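(* Consider a base station $j$ equipped with a uniform linear array. Assume that the spectral norms of the channel covariances are uniformly bounded: there is a constant $\zeta$ such that $\|\mathbf R_l\|_2<\zeta$ for all $M\in\mathbb Z^+$ and all $l\in\{1,\dots,L\}$. If the residual multipath components of the interference channels satisfy $$\|\mathbf\Xi_j\mathbf h_{l\mathrm i}\|_2<\|\mathbf\Xi_j\mathbf h_j\|_2\qquad\text{for all } l\neq j,$$ then the estimation error of $\widehat{\mathbf h}_j^{\mathrm{CA}}$ vanishes: $$\lim_{M,C\to\infty}\frac{\|\widehat{\mathbf h}_j^{\mathrm{CA}}-\mathbf h_j\|_2^2}{\|\mathbf h_j\|_2^2}=0 .$$
   Context: There are $L$ cells with one user per cell; $j\in\{1,\dots,L\}$ is the target cell, $\sigma_n^2>0$ is the noise variance, and $\mathbf s\in\mathbb C^{\tau}$ with $\mathbf s^T\mathbf s^*=\tau$ is a pilot vector shared by all users. $M$ is the number of antennas of base station $j$ and $C$ is the number of data symbols sent by each user. Write $\mathrm i$ for the imaginary unit (the subscripts $\mathrm i$, $\mathrm o$ on channels below are just labels). Uniform linear array with $M$ antennas, fixed spacing $D$, wavelength $\lambda$: the steering vector $\mathbf a(\theta)\in\mathbb C^M$, $\theta\in[0,\pi]$, has $m$-th entry $e^{-\mathrm i2\pi\frac{(m-1)D}{\lambda}\cos\theta}$. The channel from the user of cell $l$ to base station $j$ is $$\mathbf h_l=\frac{\beta_l}{\sqrt P}\sum_{p=1}^P\mathbf a(\theta_{lp})e^{\mathrm i\varphi_{lp}},$$ where $\beta_l>0$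 is a path-loss coefficient, $P$ is an arbitrary large number of i.i.d. paths, the $\theta_{lp}$ are the angles of arrival (with a probability density function depending on $l$), and the $\varphi_{lp}$ are i.i.d. random phases, independent over $l$ and $p$. The channels are constant during the transmission of the pilots and the data. Set $\mathbf R_l=\mathbb E\{\mathbf h_l\mathbf h_l^H\}\in\mathbb C^{M\times M}$. $\Phi_d$ is the angular support of the desired channel $\mathbf h_j$: the density $p_d$ of its angle of arrival satisfies $p_d(\theta)>0$ if $\theta\in\Phi_d$ and $p_d(\theta)=0$ if $\theta\notin\Phi_d$. For $l\ne j$, decompose $\mathbf h_l=\mathbf h_{l\mathrm i}+\mathbf h_{l\mathrm o}$, where $$\mathbf h_{l\mathrm i}=\frac{\beta_l}{\sqrt P}\sum_{p:\ \theta_{lp}\in\Phi_d}\mathbf a(\theta_{lp})e^{\mathrm i\varphi_{lp}},\qquad \mathbf h_{l\mathrm o}=\frac{\beta_l}{\sqrt P}\sum_{p:\ \theta_{lp}\notin\Phi_d}\mathbf a(\theta_{lp})e^{\mathrm i\varphi_{lp}},$$ i.e. $\mathbf h_{l\mathrm i}$ is the residual multipath component of the interference channel within $\Phi_d$, and $\mathbf h_{l\mathrm o}$ the component outside $\Phi_d$. Received training signal: $\mathbf Y=\sum_{l=1}^L\mathbf h_l\mathbf s^T+\mathbf N\in\mathbb C^{M\times\tau}$. Received data signal: $\mathbf W=\sum_{l=1}^L\mathbf h_l\mathbf x_l^T+\mathbf Z\in\mathbb C^{M\times C}$, where the transmitted symbols (the entries of $\mathbf x_1,\dots,\mathbf x_L\in\mathbb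 C^{C}$) are i.i.d. with zero mean and unit variance. $\mathbf N$ and $\mathbf Z$ are white additive Gaussian noise with zero mean and element-wise variance $\sigma_n^2$. Channels, data symbols and noises are mutually independent. Filters: $\mathbf\Xi_j=\big(\sum_{l=1}^L\mathbf R_l+\sigma_n^2\mathbf I_M\big)^{-1}\mathbf R_j$ and $\mathbf\Xi_j'=\mathbf R_j^{\dagger}\big(\sum_{l=1}^L\mathbf R_l+\sigma_n^2\mathbf I_M\big)$, where $\dagger$ is the Moore–Penrose pseudoinverse. Covariance-aided amplitude based (CA) estimator: $\widetilde{\mathbf W}_j=\mathbf\Xi_j\mathbf W$; $\widetilde{\mathbf u}_{j1}$ is the (unit-norm) eigenvector for the largest eigenvalue of $\frac1C\widetilde{\mathbf W}_j\widetilde{\mathbf W}_j^H$; $\overline{\mathbf u}_{j1}=\mathbf\Xi_j'\widetilde{\mathbf u}_{j1}/\|\mathbf\Xi_j'\widetilde{\mathbf u}_{j1}\|_2$; and $\widehat{\mathbf h}_j^{\mathrm{CA}}=\frac1\tau\overline{\mathbf u}_{j1}\overline{\mathbf u}_{j1}^H\mathbf Y\mathbf s^*$. $\|\cdot\|_2$ is the Euclidean norm of a vector and the spectral norm of a matrix. $\lim_{M,C\to\infty}$ is the limit as the number of antennas $M$ and the number of data symbols $C$ tend to infinity.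
   Formalization: The strict inequality is required to persist in the limit (ratio at most some ρ<1 for all large M), and no angle in Φ_d may share its steering vectors with an interference angle outside Φ_d (automatic if D ≤ λ/2); without either condition the claim fails. *)

theory Defs
  imports
    "HOL-Probability.Probability"
    "Jordan_Normal_Form.Gauss_Jordan_Elimination"
    "Jordan_Normal_Form.Schur_Decomposition"
begin

hide_const (open) Finite_Cartesian_Product.vec Finite_Cartesian_Product.row
  Finite_Cartesian_Product.mat
no_notation Finite_Cartesian_Product.vec_nth (infixl \<open>$\<close> 90)
no_notation Inner_Product.real_inner_class.inner (infix \<open>\<bullet>\<close> 70)

section \<open>Complex vectors and matrices of varying dimension\<close>

definition vnorm :: "complex vec \<Rightarrow> real" where
  "vnorm v = sqrt (Re (v \<bullet>c v))"

definition spectral_norm :: "complex mat \<Rightarrow> real" where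
  "spectral_norm A = (SUP v \<in> {v \<in> carrier_vec (dim_col A). vnorm v \<le> 1}. vnorm (A *\<^sub>v v))"

definition minv :: "complex mat \<Rightarrow> complex mat" where
  "minv A = the (mat_inverse A)"

text \<open>The Moore--Penrose pseudoinverse, as the unique matrix satisfying the four Penrose equations.\<close>

definition is_pseudoinverse :: "complex mat \<Rightarrow> complex mat \<Rightarrow> bool" where
  "is_pseudoinverse A X \<longleftrightarrow>
     X \<in> carrier_mat (dim_col A) (dim_row A) \<and>
     A * X * A = A \<and> X * A * X = X \<and>
     mat_adjoint (A * X) = A * X \<and> mat_adjoint (X * A) = X * A"

definition pseudoinverse :: "complex mat \<Rightarrow> complex mat" where
  "pseudoinverse A = (THE X. is_pseudoinverse A X)"

text \<open>Used for Hermitian matrices only, whose eigenvalues are real; comparing real parts is then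
  comparing the eigenvalues. Such a vector is determined only up to a phase (and is less unique if
  the largest eigenvalue is multiple).\<close>

definition principal_eigenvector :: "complex mat \<Rightarrow> complex vec \<Rightarrow> bool" where
  "principal_eigenvector A u \<longleftrightarrow>
     vnorm u = 1 \<and>
     (\<exists>\<mu>. eigenvector A u \<mu> \<and> (\<forall>\<nu>. eigenvalue A \<nu> \<longrightarrow> Re \<nu> \<le> Re \<mu>))"


section \<open>The uplink model\<close>

text \<open>Cells are numbered \<open>1..cells\<close> and paths \<open>1..paths\<close>, whereas antennas, pilot symbols and data
  symbols are numbered from \<open>0\<close> as the entries of vectors and matrices are. A single probability
  space carries the randomness for all numbers \<open>M\<close> of antennas and \<open>C\<close> of data symbols: angles
  and phases do not depend on \<open>M\<close> or \<open>C\<close>, and symbols and noises form infinite arrays, of which the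
  system of size \<open>(M, C)\<close> sees the initial parts.\<close>

record 'a uplink =
  pr :: "'a measure"
  cells :: nat
  target :: nat
  paths :: nat
  spacing :: real
  wavelength :: real
  path_loss :: "nat \<Rightarrow> real"
  noise_var :: real
  pilot_len :: nat
  pilot :: "complex vec"
  density :: "nat \<Rightarrow> real \<Rightarrow> real"                  \<comment> \<open>of the angles of arrival from cell \<open>l\<close>\<close>
  angle :: "nat \<Rightarrow> nat \<Rightarrow> 'a \<Rightarrow> real"               \<comment> \<open>cell, path\<close>
  phase :: "nat \<Rightarrow> nat \<Rightarrow> 'a \<Rightarrow> real"               \<comment> \<open>cell, path\<close>
  symb :: "nat \<Rightarrow> nat \<Rightarrow> 'a \<Rightarrow> complex"             \<comment> \<open>cell, symbol\<close>
  pilot_noise :: "nat \<Rightarrow> nat \<Rightarrow> 'a \<Rightarrow> complex"      \<comment> \<open>antenna, pilot symbol\<close>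
  data_noise :: "nat \<Rightarrow> nat \<Rightarrow> 'a \<Rightarrow> complex"       \<comment> \<open>antenna, data symbol\<close>

text \<open>All elementary random variables as one family, so that their joint independence can be
  stated.\<close>

datatype source =
    Angle nat nat | Phase nat nat | Symb nat nat | PNoise nat nat | DNoise nat nat

fun source_var :: "'a uplink \<Rightarrow> source \<Rightarrow> 'a \<Rightarrow> complex" where
  "source_var U (Angle l p) = (\<lambda>\<omega>. complex_of_real (angle U l p \<omega>))"
| "source_var U (Phase l p) = (\<lambda>\<omega>. complex_of_real (phase U l p \<omega>))"
| "source_var U (Symb l c) = symb U l c"
| "source_var U (PNoise m t) = pilot_noise U m t"
| "source_var U (DNoise m c) = data_noise U m c"

definition sources :: "'a uplink \<Rightarrow> source set" where
  "sources U =
     {Angle l p | l p. l \<in> {1..cells U} \<and> p \<in> {1..paths U}} \<union>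
     {Phase l p | l p. l \<in> {1..cells U} \<and> p \<in> {1..paths U}} \<union>
     {Symb l c | l c. l \<in> {1..cells U}} \<union>
     {PNoise m t | m t. t < pilot_len U} \<union>
     {DNoise m c | m c. True}"

text \<open>Circularly symmetric complex Gaussian with mean \<open>0\<close> and variance \<open>v\<close>.\<close>

definition complex_gaussian :: "'a measure \<Rightarrow> real \<Rightarrow> ('a \<Rightarrow> complex) \<Rightarrow> bool" where
  "complex_gaussian Q v X \<longleftrightarrow>
     distributed Q lborel (\<lambda>\<omega>. Re (X \<omega>)) (normal_density 0 (sqrt (v / 2))) \<and>
     distributed Q lborel (\<lambda>\<omega>. Im (X \<omega>)) (normal_density 0 (sqrt (v / 2))) \<and>
     prob_space.indep_var Q borel (\<lambda>\<omega>. Re (X \<omega>)) borel (\<lambda>\<omega>. Im (X \<omega>))"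

definition uplink_model :: "'a uplink \<Rightarrow> bool" where
  "uplink_model U \<longleftrightarrow>
     prob_space (pr U) \<and>
     target U \<in> {1..cells U} \<and>
     1 \<le> paths U \<and>
     0 < spacing U \<and> 0 < wavelength U \<and>
     0 < noise_var U \<and>
     (\<forall>l\<in>{1..cells U}. 0 < path_loss U l) \<and>
     1 \<le> pilot_len U \<and> pilot U \<in> carrier_vec (pilot_len U) \<and>
     pilot U \<bullet>c pilot U = of_nat (pilot_len U) \<and>
     prob_space.indep_vars (pr U) (\<lambda>_. borel) (source_var U) (sources U) \<and>
     (\<forall>l\<in>{1..cells U}. \<forall>t. 0 \<le> density U l t \<and> (t \<notin> {0..pi} \<longrightarrow> density U l t = 0)) \<and>
     (\<forall>l\<in>{1..cells U}. \<forall>p\<in>{1..paths U}.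
        distributed (pr U) lborel (angle U l p) (density U l)) \<and>
     (\<forall>l\<in>{1..cells U}. \<forall>p\<in>{1..paths U}.
        distr (pr U) borel (phase U l p) = distr (pr U) borel (phase U 1 1)) \<and>
     (\<forall>l\<in>{1..cells U}. \<forall>c.
        distr (pr U) borel (symb U l c) = distr (pr U) borel (symb U 1 0) \<and>
        integrable (pr U) (\<lambda>\<omega>. (cmod (symb U l c \<omega>))\<^sup>2) \<and>
        (LINT \<omega>|pr U. symb U l c \<omega>) = 0 \<and>
        (LINT \<omega>|pr U. (cmod (symb U l c \<omega>))\<^sup>2) = 1) \<and>
     (\<forall>m. \<forall>t<pilot_len U. complex_gaussian (pr U) (noise_var U) (pilot_noise U m t)) \<and>
     (\<forall>m c. complex_gaussian (pr U) (noise_var U) (data_noise U m c))"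


section \<open>Channels\<close>

definition steering :: "'a uplink \<Rightarrow> nat \<Rightarrow> real \<Rightarrow> complex vec" where
  "steering U M t =
     vec M (\<lambda>m. cis (- (2 * pi * (real m * spacing U / wavelength U) * cos t)))"

text \<open>The part of the channel from cell \<open>l\<close> carried by the paths whose angle lies in \<open>A\<close>.\<close>

definition channel_within ::
    "'a uplink \<Rightarrow> real set \<Rightarrow> nat \<Rightarrow> nat \<Rightarrow> 'a \<Rightarrow> complex vec" where
  "channel_within U A l M \<omega> =
     vec M (\<lambda>m. complex_of_real (path_loss U l / sqrt (real (paths U))) *
       (\<Sum>p | p \<in> {1..paths U} \<and> angle U l p \<omega> \<in> A.
          steering U M (angle U l p \<omega>) $ m * cis (phase U l p \<omega>)))"

definition channel :: "'a uplink \<Rightarrow> nat \<Rightarrow> nat \<Rightarrow> 'a \<Rightarrow> complex vec" where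
  "channel U = channel_within U UNIV"

definition desired_support :: "'a uplink \<Rightarrow> real set" where
  "desired_support U = {t. 0 < density U (target U) t}"

definition residual_channel :: "'a uplink \<Rightarrow> nat \<Rightarrow> nat \<Rightarrow> 'a \<Rightarrow> complex vec" where
  "residual_channel U = channel_within U (desired_support U)"

definition channel_cov :: "'a uplink \<Rightarrow> nat \<Rightarrow> nat \<Rightarrow> complex mat" where
  "channel_cov U l M =
     mat M M (\<lambda>(m, n). LINT \<omega>|pr U. channel U l M \<omega> $ m * cnj (channel U l M \<omega> $ n))"

text \<open>Steering vectors of all lengths coincide for two angles whose spatial frequencies
  \<open>spacing / wavelength * cos\<close> differ by an integer, and then no array can tell the two angles apart.
  The array is free of aliasing if this does not happen between an angle in the support of the
  desired channel and an angle outside it that occurs in an interference channel. (The end-fire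
  angles \<open>0\<close> and \<open>pi\<close>, which have probability zero, are left out, as they alias each other at
  half-wavelength spacing.)\<close>

definition aliasing_free :: "'a uplink \<Rightarrow> bool" where
  "aliasing_free U \<longleftrightarrow>
     (\<forall>t \<in> {0<..<pi} \<inter> desired_support U. \<forall>t' \<in> {0<..<pi} - desired_support U.
        (\<exists>l\<in>{1..cells U}. 0 < density U l t') \<longrightarrow>
        spacing U / wavelength U * (cos t - cos t') \<notin> \<int>)"

lemma half_wavelength_aliasing_free:
  assumes "0 < spacing U" "0 < wavelength U" "spacing U \<le> wavelength U / 2"
  shows "aliasing_free U"
  unfolding aliasing_free_def
proof (intro ballI impI notI)
  fix t t'
  assume t: "t \<in> {0<..<pi} \<inter> desired_support U"
    and t': "t' \<in> {0<..<pi} - desired_support U"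
    and int: "spacing U / wavelength U * (cos t - cos t') \<in> \<int>"
  have q: "0 < spacing U / wavelength U" "spacing U / wavelength U \<le> 1 / 2"
    using assms by (simp_all add: field_simps)
  have "cos t < cos 0" "cos pi < cos t" "cos t' < cos 0" "cos pi < cos t'"
    using t t' by (intro cos_monotone_0_pi; simp)+
  then have d: "\<bar>cos t - cos t'\<bar> < 2"
    by auto
  have "\<bar>spacing U / wavelength U * (cos t - cos t')\<bar> = spacing U / wavelength U * \<bar>cos t - cos t'\<bar>"
    using assms by (simp add: abs_mult)
  also have "\<dots> \<le> 1 / 2 * \<bar>cos t - cos t'\<bar>"
    using q by (intro mult_right_mono) auto
  also have "\<dots> < 1"
    using d by simp
  finally have "spacing U / wavelength U * (cos t - cos t') = 0"
    using Ints_nonzero_abs_less1[OF int] by blast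
  then have "cos t = cos t'"
    using assms by simp
  then have "t = t'"
    using t t' cos_inj_pi[of t t'] by simp
  with t t' show False
    by auto
qed


section \<open>The covariance-aided estimator\<close>

definition received_cov :: "'a uplink \<Rightarrow> nat \<Rightarrow> complex mat" where
  "received_cov U M =
     mat M M (\<lambda>(m, n). \<Sum>l\<in>{1..cells U}. channel_cov U l M $$ (m, n))
       + complex_of_real (noise_var U) \<cdot>\<^sub>m 1\<^sub>m M"

definition Xi :: "'a uplink \<Rightarrow> nat \<Rightarrow> complex mat" where
  "Xi U M = minv (received_cov U M) * channel_cov U (target U) M"

definition Xi' :: "'a uplink \<Rightarrow> nat \<Rightarrow> complex mat" where
  "Xi' U M = pseudoinverse (channel_cov U (target U) M) * received_cov U M"

definition training_signal :: "'a uplink \<Rightarrow> nat \<Rightarrow> 'a \<Rightarrow> complex mat" where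
  "training_signal U M \<omega> = mat M (pilot_len U) (\<lambda>(m, t).
     (\<Sum>l\<in>{1..cells U}. channel U l M \<omega> $ m * pilot U $ t) + pilot_noise U m t \<omega>)"

definition data_signal :: "'a uplink \<Rightarrow> nat \<Rightarrow> nat \<Rightarrow> 'a \<Rightarrow> complex mat" where
  "data_signal U M C \<omega> = mat M C (\<lambda>(m, c).
     (\<Sum>l\<in>{1..cells U}. channel U l M \<omega> $ m * symb U l c \<omega>) + data_noise U m c \<omega>)"

definition filtered_sample_cov :: "'a uplink \<Rightarrow> nat \<Rightarrow> nat \<Rightarrow> 'a \<Rightarrow> complex mat" where
  "filtered_sample_cov U M C \<omega> =
     (let W = Xi U M * data_signal U M C \<omega> in (1 / of_nat C) \<cdot>\<^sub>m (W * mat_adjoint W))"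

text \<open>The estimate obtained from the principal eigenvector \<open>u\<close> of the filtered sample covariance.\<close>

definition CA_estimate :: "'a uplink \<Rightarrow> nat \<Rightarrow> 'a \<Rightarrow> complex vec \<Rightarrow> complex vec" where
  "CA_estimate U M \<omega> u =
     (let v = Xi' U M *\<^sub>v u;
          b = complex_of_real (1 / vnorm v) \<cdot>\<^sub>v v;
          y = training_signal U M \<omega> *\<^sub>v conjugate (pilot U)
      in (1 / of_nat (pilot_len U)) \<cdot>\<^sub>v ((y \<bullet>c b) \<cdot>\<^sub>v b))"

end

theory Submission
  imports Defs "Jordan_Normal_Form.Spectral_Radius" "HOL-Real_Asymp.Real_Asymp"
begin

text \<open>Up to a rank-one term, the covariance of a channel is the Toeplitz matrix of the law of the
  spatial frequency \<open>x = frac (D / wavelength * cos \<theta>)\<close> of a path. The uniform bound on the spectral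
  norms forces this law to have a bounded density. At a Lebesgue point \<open>x\<close> of the densities the
  steering vector of frequency \<open>x\<close> is asymptotically an eigenvector of all the covariances, because the
  rank-one terms consist of square summable Fourier coefficients; hence the filter \<open>Xi\<close> asymptotically
  multiplies it by a gain. Steering vectors of distinct frequencies are asymptotically orthogonal, and
  so are the filtered channels. In the absence of aliasing the gain vanishes on the paths outside the
  desired support, so that the hypothesis on the residual channels makes the filtered desired channel
  dominate all the others.

  The noise is negligible in operator norm, so the filtered sample covariance is a small perturbation
  of a sum of rank-one operators with asymptotically orthogonal directions, and its principal
  eigenvector aligns with the filtered desired channel. As \<open>Xi' Xi\<close> is the projection onto the range of
  the covariance of the desired channel, \<open>Xi'\<close> turns this eigenvector into the direction of the desired
  channel itself. Interference and noise in the training signal are asymptotically orthogonal to it.\<close>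

section \<open>Linear algebra in coordinates\<close>

text \<open>The number of paths is fixed while \<open>M\<close> grows, so a channel is a finite
  random combination of steering vectors whose coefficients do not change with \<open>M\<close>. The
  difficulty lies in the deterministic covariances, about which only a norm bound is known. The
  phases need not be centred: the rank-one terms stem from pairs of distinct paths. The norm bound
  yields a bounded density because testing a covariance at a steering vector integrates the squared
  Dirichlet kernel, which has size M^2 on a window of length about 1 / M. Absolute continuity then
  puts every path frequency, almost surely, at a Lebesgue point and apart from all the others.
  \<open>M\<close> and \<open>C\<close> tend to infinity without any relation between them, so the
  noise must be small in operator norm for tall and for wide data matrices alike. The symbols have
  two moments only, so the average of their squared moduli calls for the law of large numbers for
  integrable variables. A strict inequality for each \<open>M\<close> would not survive the limit; a
  factor \<rho> < 1, the same for all large \<open>M\<close>, does.\<close>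

definition ip :: "nat \<Rightarrow> (nat \<Rightarrow> complex) \<Rightarrow> (nat \<Rightarrow> complex) \<Rightarrow> complex" where
  "ip n x y = (\<Sum>i<n. x i * cnj (y i))"

definition nrm :: "nat \<Rightarrow> (nat \<Rightarrow> complex) \<Rightarrow> real" where
  "nrm n x = L2_set (\<lambda>i. cmod (x i)) {..<n}"

text \<open>Vectors are functions on all natural numbers of which only the first \<open>n\<close>
  values count. One function then describes a channel or a steering vector for every number of
  antennas, at the price of the congruence lemmas below.\<close>

definition app :: "nat \<Rightarrow> complex mat \<Rightarrow> (nat \<Rightarrow> complex) \<Rightarrow> nat \<Rightarrow> complex" where
  "app n A x = (\<lambda>i. \<Sum>k<n. A $$ (i, k) * x k)"

lemma ip_cong: "(\<And>i. i < n \<Longrightarrow> x i = x' i) \<Longrightarrow> (\<And>i. i < n \<Longrightarrow> y i = y' i) \<Longrightarrow> ip n x y = ip n x' y'"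
  by (simp add: ip_def)

lemma nrm_cong: "(\<And>i. i < n \<Longrightarrow> x i = x' i) \<Longrightarrow> nrm n x = nrm n x'"
  by (simp add: nrm_def L2_set_def)

lemma app_cong: "(\<And>i. i < n \<Longrightarrow> x i = x' i) \<Longrightarrow> app n A x = app n A x'"
  by (simp add: app_def)

lemma ip_commute: "ip n y x = cnj (ip n x y)"
  by (simp add: ip_def mult.commute)

lemma ip_add_left: "ip n (\<lambda>i. x i + y i) z = ip n x z + ip n y z"
  by (simp add: ip_def sum.distrib distrib_right)

lemma ip_add_right: "ip n z (\<lambda>i. x i + y i) = ip n z x + ip n z y"
  by (simp add: ip_def sum.distrib distrib_left)

lemma ip_diff_left: "ip n (\<lambda>i. x i - y i) z = ip n x z - ip n y z"
  by (simp add: ip_def sum_subtractf left_diff_distrib)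

lemma ip_diff_right: "ip n z (\<lambda>i. x i - y i) = ip n z x - ip n z y"
  by (simp add: ip_def sum_subtractf right_diff_distrib)

lemma ip_scale_left: "ip n (\<lambda>i. c * x i) z = c * ip n x z"
  by (simp add: ip_def sum_distrib_left mult.assoc)

lemma ip_scale_right: "ip n z (\<lambda>i. c * x i) = cnj c * ip n z x"
  by (simp add: ip_def sum_distrib_left mult_ac)

lemma ip_sum_left: "ip n (\<lambda>i. \<Sum>l\<in>S. f l i) z = (\<Sum>l\<in>S. ip n (f l) z)"
  by (simp add: ip_def sum_distrib_right sum.swap[of _ S])

lemma ip_sum_right: "ip n z (\<lambda>i. \<Sum>l\<in>S. f l i) = (\<Sum>l\<in>S. ip n z (f l))"
  by (simp add: ip_def sum_distrib_left sum.swap[of _ S])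

lemma nrm_nonneg [simp]: "0 \<le> nrm n x"
  by (simp add: nrm_def)

lemma nrm_sq_sum: "(nrm n x)\<^sup>2 = (\<Sum>i<n. (cmod (x i))\<^sup>2)"
  by (simp add: nrm_def L2_set_def sum_nonneg)

lemma ip_self: "ip n x x = complex_of_real ((nrm n x)\<^sup>2)"
  by (simp only: ip_def nrm_sq_sum of_real_sum complex_norm_square)

lemma nrm_sq: "(nrm n x)\<^sup>2 = Re (ip n x x)"
  by (simp add: ip_self)

lemma nrm_scale: "nrm n (\<lambda>i. c * x i) = cmod c * nrm n x"
  by (simp add: nrm_def L2_set_right_distrib norm_mult)

lemma nrm_minus [simp]: "nrm n (\<lambda>i. - x i) = nrm n x"
  by (simp add: nrm_def)

lemma nrm_add: "nrm n (\<lambda>i. x i + y i) \<le> nrm n x + nrm n y"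
proof -
  have "nrm n (\<lambda>i. x i + y i) \<le> L2_set (\<lambda>i. cmod (x i) + cmod (y i)) {..<n}"
    unfolding nrm_def by (intro L2_set_mono) (auto simp: norm_triangle_ineq)
  also have "\<dots> \<le> nrm n x + nrm n y"
    unfolding nrm_def by (rule L2_set_triangle_ineq)
  finally show ?thesis .
qed

lemma nrm_diff: "nrm n (\<lambda>i. x i - y i) \<le> nrm n x + nrm n y"
  using nrm_add[of n x "\<lambda>i. - y i"] by simp

lemma nrm_zero [simp]: "nrm n (\<lambda>i. 0) = 0"
  by (simp add: nrm_def L2_set_def)

lemma nrm_sum: "finite S \<Longrightarrow> nrm n (\<lambda>i. \<Sum>l\<in>S. f l i) \<le> (\<Sum>l\<in>S. nrm n (f l))"
proof (induction S rule: finite_induct)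
  case (insert s S)
  then show ?case
    using nrm_add[of n "f s" "\<lambda>i. \<Sum>l\<in>S. f l i"] by simp
qed simp

lemma ip_bound: "cmod (ip n x y) \<le> nrm n x * nrm n y"
proof -
  have "cmod (ip n x y) \<le> (\<Sum>i<n. \<bar>cmod (x i)\<bar> * \<bar>cmod (y i)\<bar>)"
    unfolding ip_def by (rule order.trans[OF norm_sum]) (simp add: norm_mult)
  also have "\<dots> \<le> nrm n x * nrm n y"
    unfolding nrm_def by (rule L2_set_mult_ineq)
  finally show ?thesis .
qed

lemma app_add: "app n A (\<lambda>i. x i + y i) = (\<lambda>i. app n A x i + app n A y i)"
  by (simp add: app_def sum.distrib distrib_left)

lemma app_diff: "app n A (\<lambda>i. x i - y i) = (\<lambda>i. app n A x i - app n A y i)"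
  by (simp add: app_def sum_subtractf right_diff_distrib)

lemma app_scale: "app n A (\<lambda>i. c * x i) = (\<lambda>i. c * app n A x i)"
  by (simp add: app_def sum_distrib_left mult_ac)

lemma app_sum: "app n A (\<lambda>i. \<Sum>l\<in>S. f l i) = (\<lambda>i. \<Sum>l\<in>S. app n A (f l) i)"
  by (rule ext) (simp add: app_def sum_distrib_left sum.swap[of _ S])

section \<open>Adjoints, and matrices as operators on coordinate functions\<close>

lemma mat_adjoint_dim [simp]:
  "dim_row (mat_adjoint A) = dim_col A" "dim_col (mat_adjoint A) = dim_row A"
  by (simp_all add: mat_adjoint_def)

lemma mat_adjoint_carrier [simp]: "A \<in> carrier_mat m n \<Longrightarrow> mat_adjoint A \<in> carrier_mat n m"
  by (auto intro: carrier_matI)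

lemma mat_adjoint_index [simp]:
  "i < dim_col A \<Longrightarrow> j < dim_row A \<Longrightarrow> mat_adjoint A $$ (i, j) = cnj (A $$ (j, i))"
  by (simp add: mat_adjoint_def mat_of_rows_def)

lemma mat_adjoint_adjoint [simp]: "mat_adjoint (mat_adjoint (A :: complex mat)) = A"
  by (rule eq_matI) auto

lemma mat_adjoint_mult:
  fixes A B :: "complex mat"
  assumes "A \<in> carrier_mat m n" "B \<in> carrier_mat n k"
  shows "mat_adjoint (A * B) = mat_adjoint B * mat_adjoint A"
  using assms by (intro eq_matI) (auto simp: scalar_prod_def mult.commute intro!: sum.cong)

lemma app_mult:
  assumes "A \<in> carrier_mat m n" "B \<in> carrier_mat n k" "i < m"
  shows "app k (A * B) x i = app n A (app k B x) i"
proof -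
  have "app k (A * B) x i = (\<Sum>j<k. \<Sum>l<n. A $$ (i, l) * B $$ (l, j) * x j)"
    using assms by (auto simp: app_def scalar_prod_def sum_distrib_right lessThan_atLeast0 intro!: sum.cong)
  also have "\<dots> = app n A (app k B x) i"
    by (subst sum.swap) (simp add: app_def sum_distrib_left mult.assoc)
  finally show ?thesis .
qed

lemma app_one: "i < n \<Longrightarrow> app n (1\<^sub>m n) x i = x i"
  by (simp add: app_def if_distrib[of "\<lambda>a. a * _"] cong: if_cong)

lemma mult_mat_vec_app:
  "i < dim_row A \<Longrightarrow> dim_vec v = dim_col A \<Longrightarrow> (A *\<^sub>v v) $ i = app (dim_col A) A (vec_index v) i"
  by (simp add: app_def scalar_prod_def lessThan_atLeast0)

lemma scalar_prod_ip: "dim_vec v = n \<Longrightarrow> dim_vec w = n \<Longrightarrow> v \<bullet>c w = ip n (vec_index v) (vec_index w)"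
  by (simp add: ip_def scalar_prod_def lessThan_atLeast0)

lemma vnorm_nrm: "dim_vec v = n \<Longrightarrow> vnorm v = nrm n (vec_index v)"
  unfolding vnorm_def by (subst scalar_prod_ip[of _ n]) (auto simp: ip_self)

lemma ip_app:
  assumes "A \<in> carrier_mat m n"
  shows "ip m (app n A x) y = ip n x (app m (mat_adjoint A) y)"
proof -
  have "ip m (app n A x) y = (\<Sum>i<m. \<Sum>k<n. A $$ (i, k) * x k * cnj (y i))"
    by (simp add: ip_def app_def sum_distrib_right)
  also have "\<dots> = (\<Sum>k<n. \<Sum>i<m. A $$ (i, k) * x k * cnj (y i))"
    by (rule sum.swap)
  also have "\<dots> = ip n x (app m (mat_adjoint A) y)"
    using assms by (simp add: ip_def app_def sum_distrib_left mult_ac)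
  finally show ?thesis .
qed

text \<open>For z = A* y the squared norm of z equals <A z, y>, which is at most K |z| |y|; one
  factor |z| cancels unless it vanishes.\<close>

lemma nrm_app_adjoint:
  assumes A: "A \<in> carrier_mat m n" and "0 \<le> K" and K: "\<And>x. nrm m (app n A x) \<le> K * nrm n x"
  shows "nrm n (app m (mat_adjoint A) y) \<le> K * nrm m y"
proof -
  let ?z = "app m (mat_adjoint A) y"
  have "(nrm n ?z)\<^sup>2 = Re (ip m (app n A ?z) y)"
    by (simp add: ip_app[OF A] ip_self)
  also have "\<dots> \<le> nrm m (app n A ?z) * nrm m y"
    using ip_bound complex_Re_le_cmod order.trans by blast
  also have "\<dots> \<le> (K * nrm n ?z) * nrm m y"
    by (intro mult_right_mono K) simp
  finally have "nrm n ?z * nrm n ?z \<le> (K * nrm m y) * nrm n ?z"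
    by (simp add: power2_eq_square mult_ac)
  moreover have "0 \<le> K * nrm m y"
    using \<open>0 \<le> K\<close> by simp
  ultimately show ?thesis
    by (cases "nrm n ?z = 0") (auto simp: mult_le_cancel_right less_le)
qed

section \<open>Orthonormal bases\<close>

definition orthonormal :: "nat \<Rightarrow> (nat \<Rightarrow> nat \<Rightarrow> complex) \<Rightarrow> bool" where
  "orthonormal n f \<longleftrightarrow> (\<forall>i<n. \<forall>j<n. ip n (f i) (f j) = (if i = j then 1 else 0))"

text \<open>There are as many vectors as dimensions: the matrix with columns \<open>f j\<close>
  satisfies U* U = 1, and for square matrices this gives U U* = 1, which is the expansion.\<close>

lemma orthonormal_expansion:
  assumes f: "orthonormal n f" and k: "k < n"
  shows "x k = (\<Sum>j<n. ip n x (f j) * f j k)"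
proof -
  define U where "U = mat n n (\<lambda>(i, j). f j i)"
  have U: "U \<in> carrier_mat n n"
    by (simp add: U_def)
  have "mat_adjoint U * U = 1\<^sub>m n"
  proof (rule eq_matI)
    fix i j assume "i < dim_row (1\<^sub>m n)" "j < dim_col (1\<^sub>m n)"
    then have ij: "i < n" "j < n" by auto
    then have "(mat_adjoint U * U) $$ (i, j) = ip n (f j) (f i)"
      by (auto simp: U_def scalar_prod_def ip_def lessThan_atLeast0 mult.commute intro!: sum.cong)
    then show "(mat_adjoint U * U) $$ (i, j) = 1\<^sub>m n $$ (i, j)"
      using f ij by (auto simp: orthonormal_def)
  qed (simp_all add: U_def)
  then have "U * mat_adjoint U = 1\<^sub>m n"
    using mat_mult_left_right_inverse[of "mat_adjoint U" n U] U by simp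
  then have "x k = app n (U * mat_adjoint U) x k"
    using k by (simp add: app_one)
  also have "\<dots> = app n U (app n (mat_adjoint U) x) k"
    using U k by (intro app_mult) auto
  also have "\<dots> = (\<Sum>j<n. f j k * app n (mat_adjoint U) x j)"
    using k by (simp add: app_def U_def)
  also have "\<dots> = (\<Sum>j<n. ip n x (f j) * f j k)"
    using k by (intro sum.cong) (auto simp: app_def U_def ip_def mult.commute)
  finally show ?thesis .
qed

lemma parseval:
  assumes "orthonormal n f"
  shows "ip n x y = (\<Sum>j<n. ip n x (f j) * cnj (ip n y (f j)))"
proof -
  have "ip n x y = ip n (\<lambda>k. \<Sum>j<n. ip n x (f j) * f j k) y"
    by (intro ip_cong orthonormal_expansion assms) auto
  also have "\<dots> = (\<Sum>j<n. ip n x (f j) * cnj (ip n y (f j)))"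
    by (simp add: ip_sum_left ip_scale_left ip_commute[of n y])
  finally show ?thesis .
qed

text \<open>A Householder reflection maps the first unit vector to a multiple of \<open>v\<close>.\<close>

lemma orthonormal_extend:
  assumes v: "nrm n v = 1" and n: "0 < n"
  shows "\<exists>f c. orthonormal n f \<and> (\<forall>i<n. f 0 i = c * v i)"
proof -
  \<comment> \<open>Giving the added unit vector the phase of \<open>v 0\<close> prevents
    cancellation in \<open>w\<close>: its squared norm \<open>q\<close> is 2 (1 + |v 0|), hence
    positive even if \<open>v 0\<close> vanishes.\<close>
  define s where "s = cis (Arg (v 0))"
  define w where "w = (\<lambda>i. v i + (if i = 0 then s else 0))"
  define q where "q = ip n w w"
  \<comment> \<open>Column \<open>j\<close> of the reflection 1 - 2 w w* / q.\<close>
  define f where "f = (\<lambda>j i. (if i = j then 1 else 0) - 2 * cnj (w j) / q * w i)"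
  have v0: "v 0 = cmod (v 0) * s"
    unfolding s_def using rcis_cmod_Arg[of "v 0"] by (simp add: rcis_def)
  have ss: "s * cnj s = 1"
    by (simp add: s_def cis_cnj cis_mult)
  have vv: "ip n v v = 1"
    by (simp add: ip_self v)
  have dl: "ip n x (\<lambda>i. if i = 0 then s else 0) = x 0 * cnj s" for x
    using n by (simp add: ip_def if_distrib[of cnj] if_distrib[of "\<lambda>a. _ * a"] cong: if_cong)
  have dl': "ip n (\<lambda>i. if i = 0 then s else 0) x = s * cnj (x 0)" for x
    using dl[of x] by (subst ip_commute) simp
  have q: "q = 2 * (1 + cmod (v 0))"
  proof -
    have "q = 1 + v 0 * cnj s + (s * cnj (v 0) + s * cnj s)"
      unfolding q_def w_def by (simp add: ip_add_left ip_add_right dl dl' vv)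
    also have "\<dots> = 2 * (1 + cmod (v 0))"
      apply (subst v0, subst (2) v0)
      using ss by (simp add: mult_ac ring_distribs)
    finally show ?thesis .
  qed
  have "1 + cmod (v 0) > 0"
    by (simp add: add_pos_nonneg)
  then have q0: "q \<noteq> 0"
    unfolding q by (metis mult_eq_0_iff of_real_1 of_real_add of_real_eq_0_iff less_irrefl zero_neq_numeral)
  have rq: "cnj q = q"
    by (simp add: q)
  have unit: "ip n (\<lambda>i. if i = j then 1 else 0) x = cnj (x j)" if "j < n" for j x
    using that by (simp add: ip_def if_distrib[of "\<lambda>a. a * _"] cong: if_cong)
  have unit': "ip n x (\<lambda>i. if i = j then 1 else 0) = x j" if "j < n" for j x
    using unit[OF that, of x] by (subst ip_commute) simp
  have "orthonormal n f"
    unfolding orthonormal_def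
  proof (intro allI impI)
    fix i j assume ij: "i < n" "j < n"
    have "ip n (f i) (f j) = (if i = j then 1 else 0) - cnj (2 * cnj (w j) / q) * cnj (w i)
       - 2 * cnj (w i) / q * w j + 2 * cnj (w i) / q * cnj (2 * cnj (w j) / q) * q"
      unfolding f_def using ij
      by (simp only: ip_diff_left ip_diff_right ip_scale_left ip_scale_right unit unit' q_def[symmetric])
         (auto simp: algebra_simps)
    also have "\<dots> = (if i = j then 1 else 0)"
      using q0 rq by (simp add: field_simps)
    finally show "ip n (f i) (f j) = (if i = j then 1 else 0)" .
  qed
  moreover have "f 0 i = - cnj s * v i" if "i < n" for i
  proof -
    have "cnj (w 0) = (1 + cmod (v 0)) * cnj s"
      unfolding w_def by (subst v0) (simp add: algebra_simps)
    then have "2 * cnj (w 0) = q * cnj s"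
      by (simp add: q mult_ac)
    then have "2 * cnj (w 0) / q = cnj s"
      using q0 by (simp add: field_simps)
    then have "f 0 i = (if i = 0 then 1 else 0) - cnj s * w i"
      unfolding f_def by presburger
    then show ?thesis
      using ss by (cases "i = 0") (simp_all add: w_def algebra_simps)
  qed
  ultimately show ?thesis
    by blast
qed

section \<open>The spectral theorem for Hermitian matrices\<close>

definition hermitian :: "complex mat \<Rightarrow> bool" where
  "hermitian A \<longleftrightarrow> mat_adjoint A = A"

lemma hermitian_ip:
  assumes "A \<in> carrier_mat n n" "hermitian A"
  shows "ip n (app n A x) y = ip n x (app n A y)"
  using ip_app[OF assms(1), of x y] assms(2) by (simp add: hermitian_def)

lemma hermitian_eigenvalue_real:
  assumes "A \<in> carrier_mat n n" "hermitian A" "nrm n x \<noteq> 0"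
    and "\<And>i. i < n \<Longrightarrow> app n A x i = \<mu> * x i"
  shows "\<mu> = Re \<mu>"
proof -
  have 1: "ip n (app n A x) x = \<mu> * ip n x x"
    unfolding ip_scale_left[symmetric] by (intro ip_cong assms) auto
  have 2: "ip n x (app n A x) = cnj \<mu> * ip n x x"
    unfolding ip_scale_right[symmetric] by (intro ip_cong assms) auto
  have "\<mu> * ip n x x = cnj \<mu> * ip n x x"
    using 1 2 hermitian_ip[OF assms(1,2), of x x] by metis
  moreover have "ip n x x \<noteq> 0"
    using assms(3) by (simp add: ip_self)
  ultimately have "\<mu> = cnj \<mu>"
    by simp
  then show ?thesis
    by (simp add: complex_eq_iff)
qed

lemma exists_eigenfunction:
  assumes A: "A \<in> carrier_mat n n" and n: "0 < n"
  shows "\<exists>v \<mu>. nrm n v = 1 \<and> (\<forall>i<n. app n A v i = \<mu> * v i)"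
proof -
  from spectrum_non_empty[OF A] n obtain \<mu> where "eigenvalue A \<mu>"
    by (auto simp: spectrum_def)
  then obtain v where v: "v \<in> carrier_vec n" "v \<noteq> 0\<^sub>v n" "A *\<^sub>v v = \<mu> \<cdot>\<^sub>v v"
    using A by (auto simp: eigenvalue_def eigenvector_def)
  define r where "r = nrm n (vec_index v)"
  have "r \<noteq> 0"
  proof
    assume "r = 0"
    then have "(\<Sum>i<n. (cmod (v $ i))\<^sup>2) = 0"
      by (simp add: r_def nrm_sq_sum[symmetric])
    then have "\<forall>i<n. v $ i = 0"
      by (subst (asm) sum_nonneg_eq_0_iff) auto
    with v show False
      by (auto intro: eq_vecI)
  qed
  define x where "x = (\<lambda>i. complex_of_real (1 / r) * v $ i)"
  have "nrm n x = 1"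
    using \<open>r \<noteq> 0\<close> nrm_nonneg[of n "vec_index v"] unfolding x_def nrm_scale norm_of_real r_def by simp
  moreover have "app n A x i = \<mu> * x i" if "i < n" for i
  proof -
    have "app n A (vec_index v) i = \<mu> * v $ i"
      using mult_mat_vec_app[of i A v] that A v by auto
    then show ?thesis
      unfolding x_def app_scale by simp
  qed
  ultimately show ?thesis
    by blast
qed

text \<open>Induction on the dimension: an eigenvector is completed to an orthonormal basis, and a
  Hermitian matrix maps the orthogonal complement of its eigenvector into itself, where the
  induction hypothesis applies.\<close>

theorem hermitian_eigenbasis:
  assumes "A \<in> carrier_mat n n" "hermitian A"
  shows "\<exists>e d. orthonormal n e \<and> (\<forall>j<n. \<forall>i<n. app n A (e j) i = complex_of_real (d j) * e j i)"
  using assms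
proof (induction n arbitrary: A)
  case 0
  then show ?case by (auto simp: orthonormal_def)
next
  case (Suc m)
  let ?n = "Suc m"
  note A = Suc.prems(1) and herm = Suc.prems(2)
  obtain v \<mu> where v: "nrm ?n v = 1" "\<And>i. i < ?n \<Longrightarrow> app ?n A v i = \<mu> * v i"
    using exists_eigenfunction[OF A] by auto
  obtain f c where f: "orthonormal ?n f" and f0: "\<And>i. i < ?n \<Longrightarrow> f 0 i = c * v i"
    using orthonormal_extend[OF v(1)] by auto
  have Af0: "app ?n A (f 0) i = \<mu> * f 0 i" if "i < ?n" for i
  proof -
    have "app ?n A (f 0) i = app ?n A (\<lambda>i. c * v i) i"
      by (rule fun_cong[OF app_cong]) (auto simp: f0)
    then show ?thesis
      using that by (simp add: app_scale v f0)
  qed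
  have ff: "ip ?n (f i) (f j) = (if i = j then 1 else 0)" if "i < ?n" "j < ?n" for i j
    using f that by (auto simp: orthonormal_def)
  \<comment> \<open>Matrix of the restriction of \<open>A\<close> to the span of \<open>f 1\<close>,
    ..., \<open>f m\<close>; the index shift skips the eigenvector \<open>f 0\<close>.\<close>
  define B where "B = mat m m (\<lambda>(i, j). ip ?n (app ?n A (f (Suc j))) (f (Suc i)))"
  have B: "B \<in> carrier_mat m m"
    by (simp add: B_def)
  have "hermitian B"
    unfolding hermitian_def
  proof (rule eq_matI)
    fix i j assume "i < dim_row B" "j < dim_col B"
    then show "mat_adjoint B $$ (i, j) = B $$ (i, j)"
      using hermitian_ip[OF A herm, of "f (Suc j)" "f (Suc i)"] ip_commute[of ?n "f (Suc j)"]
      by (simp add: B_def)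
  qed (use B in auto)
  from Suc.IH[OF B this] obtain e d where e: "orthonormal m e"
    and d: "\<And>i j. j < m \<Longrightarrow> i < m \<Longrightarrow> app m B (e j) i = complex_of_real (d j) * e j i"
    by blast
  have Af: "app ?n A (f (Suc j)) i = (\<Sum>k<m. B $$ (k, j) * f (Suc k) i)" if "j < m" "i < ?n" for i j
  proof -
    have "ip ?n (app ?n A (f (Suc j))) (f 0) = ip ?n (f (Suc j)) (app ?n A (f 0))"
      by (rule hermitian_ip[OF A herm])
    also have "\<dots> = ip ?n (f (Suc j)) (\<lambda>i. \<mu> * f 0 i)"
      by (intro ip_cong) (auto simp: Af0)
    also have "\<dots> = 0"
      using that by (simp add: ip_scale_right ff)
    finally have 0: "ip ?n (app ?n A (f (Suc j))) (f 0) = 0" .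
    have "app ?n A (f (Suc j)) i = (\<Sum>k<?n. ip ?n (app ?n A (f (Suc j))) (f k) * f k i)"
      by (rule orthonormal_expansion[OF f that(2)])
    also have "\<dots> = (\<Sum>k<m. B $$ (k, j) * f (Suc k) i)"
      using that by (subst sum.lessThan_Suc_shift) (simp add: 0 B_def)
    finally show ?thesis .
  qed
  \<comment> \<open>Eigenvectors of \<open>B\<close> are coordinates with respect to the
    \<open>f (Suc k)\<close>; index 0 is kept for the eigenvector that was split off.\<close>
  define g where "g = (\<lambda>j i. case j of 0 \<Rightarrow> f 0 i | Suc j \<Rightarrow> \<Sum>k<m. e j k * f (Suc k) i)"
  define d' where "d' = (\<lambda>j. case j of 0 \<Rightarrow> Re \<mu> | Suc j \<Rightarrow> d j)"
  have "nrm ?n (f 0) \<noteq> 0"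
    using ff[of 0 0] by (auto simp: ip_self)
  from hermitian_eigenvalue_real[OF A herm this] Af0 have \<mu>: "complex_of_real (Re \<mu>) = \<mu>"
    by auto
  have g0: "g 0 = f 0" and gS: "g (Suc j) = (\<lambda>i. \<Sum>k<m. e j k * f (Suc k) i)" for j
    by (auto simp: g_def)
  have fsum: "ip ?n (\<lambda>i. \<Sum>k<m. a k * f (Suc k) i) (f (Suc l)) = a l" if "l < m" for a l
    using that by (simp add: ip_sum_left ip_scale_left ff if_distrib[of "\<lambda>x. _ * x"] cong: if_cong)
  have fsum0: "ip ?n (\<lambda>i. \<Sum>k<m. a k * f (Suc k) i) (f 0) = 0" for a
    by (simp add: ip_sum_left ip_scale_left ff)
  have "orthonormal ?n g"
    unfolding orthonormal_def
  proof (intro allI impI)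
    fix i j assume ij: "i < ?n" "j < ?n"
    have 1: "ip ?n (g (Suc i)) (g (Suc j)) = ip m (e i) (e j)" for i j
    proof -
      have "ip ?n (g (Suc i)) (g (Suc j)) = (\<Sum>k<m. cnj (e j k) * ip ?n (g (Suc i)) (f (Suc k)))"
        by (simp only: gS[of j] ip_sum_right ip_scale_right)
      also have "\<dots> = (\<Sum>k<m. cnj (e j k) * e i k)"
        unfolding gS by (intro sum.cong refl) (simp add: fsum)
      finally show ?thesis
        by (simp add: ip_def[of m] mult.commute)
    qed
    have 2: "ip ?n (g (Suc i)) (g 0) = 0" for i
      by (simp add: g0 gS fsum0)
    have 3: "ip ?n (g 0) (g (Suc i)) = 0" for i
      by (subst ip_commute) (simp add: 2)
    show "ip ?n (g i) (g j) = (if i = j then 1 else 0)"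
      using ij e by (cases i; cases j) (simp_all add: 1 2[unfolded g0] 3[unfolded g0] g0 ff orthonormal_def)
  qed
  moreover have "app ?n A (g j) i = complex_of_real (d' j) * g j i" if "j < ?n" "i < ?n" for i j
  proof (cases j)
    case 0
    then show ?thesis
      using that by (simp add: g0 d'_def Af0 \<mu>)
  next
    case (Suc j')
    then have j': "j' < m" using that by auto
    have "app ?n A (g j) i = (\<Sum>k<m. e j' k * app ?n A (f (Suc k)) i)"
      unfolding Suc gS by (simp add: app_sum app_scale)
    also have "\<dots> = (\<Sum>k<m. \<Sum>l<m. e j' k * (B $$ (l, k) * f (Suc l) i))"
      using that by (simp add: Af sum_distrib_left)
    also have "\<dots> = (\<Sum>l<m. app m B (e j') l * f (Suc l) i)"
      by (subst sum.swap) (simp add: app_def sum_distrib_right sum_distrib_left mult_ac)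
    also have "\<dots> = (\<Sum>l<m. complex_of_real (d j') * e j' l * f (Suc l) i)"
      using d j' by simp
    also have "\<dots> = complex_of_real (d' j) * g j i"
      unfolding Suc gS by (simp add: d'_def sum_distrib_left mult_ac)
    finally show ?thesis .
  qed
  ultimately show ?case
    by blast
qed

text \<open>In an eigenbasis the quadratic form is the sum of the eigenvalues times the squared
  coordinates. This turns the maximality in \<open>principal_eigenvector\<close>, a statement on
  eigenvalues, into an inequality that can be tested at any vector.\<close>

lemma hermitian_rayleigh:
  assumes A: "A \<in> carrier_mat n n" "hermitian A"
    and le: "\<And>\<nu>. eigenvalue A \<nu> \<Longrightarrow> Re \<nu> \<le> \<mu>"
  shows "Re (ip n (app n A x) x) \<le> \<mu> * (nrm n x)\<^sup>2"
proof -
  from hermitian_eigenbasis[OF A] obtain e d where e: "orthonormal n e"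
    and d: "\<And>i j. j < n \<Longrightarrow> i < n \<Longrightarrow> app n A (e j) i = complex_of_real (d j) * e j i"
    by blast
  have d_le: "d j \<le> \<mu>" if "j < n" for j
  proof -
    have "eigenvector A (vec n (e j)) (complex_of_real (d j))"
      unfolding eigenvector_def
    proof (intro conjI)
      show "vec n (e j) \<noteq> 0\<^sub>v (dim_row A)"
      proof
        assume "vec n (e j) = 0\<^sub>v (dim_row A)"
        then have "e j i = 0" if "i < n" for i
          using A that by (metis carrier_matD(1) index_vec index_zero_vec(1))
        then have "ip n (e j) (e j) = 0"
          by (simp add: ip_def)
        then show False
          using e that by (simp add: orthonormal_def)
      qed
      show "A *\<^sub>v vec n (e j) = complex_of_real (d j) \<cdot>\<^sub>v vec n (e j)"
      proof (rule eq_vecI)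
        fix i assume "i < dim_vec (complex_of_real (d j) \<cdot>\<^sub>v vec n (e j))"
        then have i: "i < n" by simp
        have "(A *\<^sub>v vec n (e j)) $ i = app n A (vec_index (vec n (e j))) i"
          using A i by (subst mult_mat_vec_app) auto
        also have "\<dots> = app n A (e j) i"
          by (rule fun_cong[OF app_cong]) simp
        finally show "(A *\<^sub>v vec n (e j)) $ i = (complex_of_real (d j) \<cdot>\<^sub>v vec n (e j)) $ i"
          using i that by (simp add: d)
      qed (use A in auto)
    qed (use A in auto)
    from le[of "complex_of_real (d j)"] this show ?thesis
      by (auto simp: eigenvalue_def)
  qed
  have "ip n (app n A x) (e j) = complex_of_real (d j) * ip n x (e j)" if "j < n" for j
  proof -
    have "ip n (app n A x) (e j) = ip n x (\<lambda>i. complex_of_real (d j) * e j i)"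
      using that by (subst hermitian_ip[OF A]) (auto intro!: ip_cong simp: d)
    then show ?thesis
      by (simp add: ip_scale_right)
  qed
  then have "ip n (app n A x) x = (\<Sum>j<n. complex_of_real (d j * (cmod (ip n x (e j)))\<^sup>2))"
    by (subst parseval[OF e]) (auto intro!: sum.cong simp: complex_norm_square mult.assoc simp del: of_real_power)
  then have "Re (ip n (app n A x) x) = (\<Sum>j<n. d j * (cmod (ip n x (e j)))\<^sup>2)"
    by simp
  also have "\<dots> \<le> (\<Sum>j<n. \<mu> * (cmod (ip n x (e j)))\<^sup>2)"
    by (intro sum_mono mult_right_mono d_le) auto
  also have "\<dots> = \<mu> * (nrm n x)\<^sup>2"
  proof -
    have "ip n x x = (\<Sum>j<n. complex_of_real ((cmod (ip n x (e j)))\<^sup>2))"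
      by (subst parseval[OF e]) (simp add: complex_norm_square del: of_real_power)
    then have "(nrm n x)\<^sup>2 = (\<Sum>j<n. (cmod (ip n x (e j)))\<^sup>2)"
      by (simp add: nrm_sq)
    then show ?thesis
      by (simp add: sum_distrib_left)
  qed
  finally show ?thesis .
qed

section \<open>The Moore-Penrose pseudoinverse of a Hermitian matrix\<close>

lemma is_pseudoinverse_unique:
  assumes "is_pseudoinverse A X" "is_pseudoinverse A Y"
  shows "X = Y"
proof -
  define m where "m = dim_row A"
  define n where "n = dim_col A"
  have A: "A \<in> carrier_mat m n" by (simp add: m_def n_def)
  have X: "X \<in> carrier_mat n m" and Y: "Y \<in> carrier_mat n m"
    using assms by (auto simp: is_pseudoinverse_def m_def n_def)
  have eqs: "A * X * A = A" "X * A * X = X" "A * Y * A = A" "Y * A * Y = Y"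
    "mat_adjoint (A * X) = A * X" "mat_adjoint (X * A) = X * A"
    "mat_adjoint (A * Y) = A * Y" "mat_adjoint (Y * A) = Y * A"
    using assms by (auto simp: is_pseudoinverse_def)
  \<comment> \<open>Both products are self-adjoint, and A X = (A Y)(A X) because A Y A = A. Taking
    adjoints gives A X = (A X)(A Y) = A Y. The same on the other side gives X A = Y A, and then X =
    X A X = Y A X = Y A Y = Y.\<close>
  have "A * X = A * Y"
  proof -
    have "A * X = mat_adjoint (A * Y * A * X)"
      using eqs by simp
    also have "A * Y * A * X = (A * Y) * (A * X)"
      using A X Y by (intro assoc_mult_mat[of _ m m _ n _ m]) auto
    also have "mat_adjoint \<dots> = (A * X) * (A * Y)"
      using A X Y eqs by (subst mat_adjoint_mult[of _ m m _ m]) auto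
    also have "\<dots> = A * X * A * Y"
      using A X Y by (intro assoc_mult_mat[symmetric, of _ m m _ n _ m]) auto
    finally show ?thesis using eqs by simp
  qed
  moreover have "X * A = Y * A"
  proof -
    have "X * A = mat_adjoint (X * (A * Y * A))"
      using eqs by simp
    also have "X * (A * Y * A) = (X * A) * (Y * A)"
      using A X Y by (simp add: assoc_mult_mat[of _ m n _ m _ n] assoc_mult_mat[of _ n m _ n _ n])
    also have "mat_adjoint \<dots> = (Y * A) * (X * A)"
      using A X Y eqs by (subst mat_adjoint_mult[of _ n n _ n]) auto
    also have "\<dots> = Y * (A * X * A)"
      using A X Y by (simp add: assoc_mult_mat[of _ m n _ m _ n] assoc_mult_mat[of _ n m _ n _ n])
    finally show ?thesis using eqs by simp
  qed
  moreover have "X = X * A * X" "Y = Y * A * Y" using eqs by auto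
  moreover have "Y * A * X = Y * (A * X)" "Y * (A * Y) = Y * A * Y"
    using A X Y by (simp_all add: assoc_mult_mat[of _ n m _ n _ m])
  ultimately show ?thesis
    by metis
qed

text \<open>The sum of the d_j e_j e_j*: a functional calculus over a fixed basis, in which matrix
  products become pointwise products of the coefficient functions.\<close>

definition spectral_mat :: "nat \<Rightarrow> (nat \<Rightarrow> nat \<Rightarrow> complex) \<Rightarrow> (nat \<Rightarrow> real) \<Rightarrow> complex mat" where
  "spectral_mat n e d = mat n n (\<lambda>(i, k). \<Sum>j<n. complex_of_real (d j) * e j i * cnj (e j k))"

lemma spectral_mat_carrier [simp]: "spectral_mat n e d \<in> carrier_mat n n"
  "dim_row (spectral_mat n e d) = n" "dim_col (spectral_mat n e d) = n"
  by (simp_all add: spectral_mat_def)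

lemma spectral_mat_mult:
  assumes "orthonormal n e"
  shows "spectral_mat n e c * spectral_mat n e d = spectral_mat n e (\<lambda>j. c j * d j)"
proof (rule eq_matI)
  fix i k assume "i < dim_row (spectral_mat n e (\<lambda>j. c j * d j))" "k < dim_col (spectral_mat n e (\<lambda>j. c j * d j))"
  then have ik: "i < n" "k < n" by auto
  have "(spectral_mat n e c * spectral_mat n e d) $$ (i, k) =
      (\<Sum>l<n. (\<Sum>j<n. complex_of_real (c j) * e j i * cnj (e j l)) * (\<Sum>j'<n. complex_of_real (d j') * e j' l * cnj (e j' k)))"
    using ik by (simp add: spectral_mat_def scalar_prod_def lessThan_atLeast0)
  also have "\<dots> = (\<Sum>l<n. \<Sum>j<n. \<Sum>j'<n. complex_of_real (c j * d j') * e j i * cnj (e j' k) * (e j' l * cnj (e j l)))"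
    by (simp add: sum_product mult_ac)
  also have "\<dots> = (\<Sum>j<n. \<Sum>l<n. \<Sum>j'<n. complex_of_real (c j * d j') * e j i * cnj (e j' k) * (e j' l * cnj (e j l)))"
    by (rule sum.swap)
  also have "\<dots> = (\<Sum>j<n. \<Sum>j'<n. \<Sum>l<n. complex_of_real (c j * d j') * e j i * cnj (e j' k) * (e j' l * cnj (e j l)))"
    by (rule sum.cong[OF refl], rule sum.swap)
  also have "\<dots> = (\<Sum>j<n. \<Sum>j'<n. complex_of_real (c j * d j') * e j i * cnj (e j' k) * ip n (e j') (e j))"
    by (simp add: ip_def sum_distrib_left)
  also have "\<dots> = (\<Sum>j<n. complex_of_real (c j * d j) * e j i * cnj (e j k))"
    using assms by (intro sum.cong refl)
      (simp add: orthonormal_def if_distrib[of "\<lambda>a. _ * a"] cong: if_cong)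
  finally show "(spectral_mat n e c * spectral_mat n e d) $$ (i, k) = spectral_mat n e (\<lambda>j. c j * d j) $$ (i, k)"
    using ik by (simp add: spectral_mat_def)
qed auto

lemma spectral_mat_adjoint: "mat_adjoint (spectral_mat n e d) = spectral_mat n e d"
  by (rule eq_matI) (auto simp: spectral_mat_def intro!: sum.cong)

lemma hermitian_spectral_mat:
  assumes A: "A \<in> carrier_mat n n" "hermitian A"
  shows "\<exists>e d. orthonormal n e \<and> A = spectral_mat n e d"
proof -
  from hermitian_eigenbasis[OF A] obtain e d where e: "orthonormal n e"
    and d: "\<And>i j. j < n \<Longrightarrow> i < n \<Longrightarrow> app n A (e j) i = complex_of_real (d j) * e j i"
    by blast
  have "A = spectral_mat n e d"
  proof (rule eq_matI)
    fix i k assume "i < dim_row (spectral_mat n e d)" "k < dim_col (spectral_mat n e d)"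
    then have ik: "i < n" "k < n" by auto
    define x :: "nat \<Rightarrow> complex" where "x = (\<lambda>i. if i = k then 1 else 0)"
    have ipx: "ip n x y = cnj (y k)" for y
      using ik by (simp add: ip_def x_def if_distrib[of "\<lambda>a. a * _"] cong: if_cong)
    have "A $$ (i, k) = app n A x i"
      using ik by (simp add: app_def x_def if_distrib[of "\<lambda>a. _ * a"] cong: if_cong)
    also have "\<dots> = app n A (\<lambda>i. \<Sum>j<n. ip n x (e j) * e j i) i"
      by (rule fun_cong[OF app_cong]) (rule orthonormal_expansion[OF e])
    also have "\<dots> = (\<Sum>j<n. cnj (e j k) * (complex_of_real (d j) * e j i))"
      using ik by (simp add: app_sum app_scale d ipx)
    also have "\<dots> = spectral_mat n e d $$ (i, k)"
      using ik by (simp add: spectral_mat_def mult_ac)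
    finally show "A $$ (i, k) = spectral_mat n e d $$ (i, k)" .
  qed (use A in auto)
  with e show ?thesis by blast
qed

text \<open>Invert the eigenvalues; since \<open>inverse 0 = 0\<close>, the null space needs no case
  distinction. Existence together with uniqueness gives meaning to the \<open>THE\<close> in
  \<open>pseudoinverse\<close>.\<close>

lemma hermitian_pseudoinverse:
  assumes A: "A \<in> carrier_mat n n" "hermitian A"
  shows "is_pseudoinverse A (pseudoinverse A)"
proof -
  obtain e d where e: "orthonormal n e" and Ae: "A = spectral_mat n e d"
    using hermitian_spectral_mat[OF A] by blast
  define X where "X = spectral_mat n e (\<lambda>j. inverse (d j))"
  have eqs: "(\<lambda>j. d j * inverse (d j) * d j) = d"
    "(\<lambda>j. inverse (d j) * d j * inverse (d j)) = (\<lambda>j. inverse (d j))"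
    by (auto simp: field_simps)
  have "is_pseudoinverse A X"
    unfolding is_pseudoinverse_def Ae X_def
    by (simp add: spectral_mat_mult[OF e] spectral_mat_adjoint eqs)
  then show ?thesis
    unfolding pseudoinverse_def by (rule theI) (rule is_pseudoinverse_unique[OF _ \<open>is_pseudoinverse A X\<close>])
qed

section \<open>Operator norms, and inverses of coercive matrices\<close>

lemma nrm_app_frobenius:
  "nrm m (app n A x) \<le> sqrt (\<Sum>i<m. \<Sum>k<n. (cmod (A $$ (i, k)))\<^sup>2) * nrm n x"
proof (rule power2_le_imp_le)
  have "(nrm m (app n A x))\<^sup>2 = (\<Sum>i<m. (cmod (app n A x i))\<^sup>2)"
    by (simp add: nrm_sq_sum)
  also have "\<dots> \<le> (\<Sum>i<m. (\<Sum>k<n. (cmod (A $$ (i, k)))\<^sup>2) * (nrm n x)\<^sup>2)"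
  proof (rule sum_mono)
    fix i
    have "app n A x i = ip n x (\<lambda>k. cnj (A $$ (i, k)))"
      by (simp add: app_def ip_def mult.commute)
    then have "cmod (app n A x i) \<le> nrm n x * nrm n (\<lambda>k. cnj (A $$ (i, k)))"
      by (simp add: ip_bound)
    then have "(cmod (app n A x i))\<^sup>2 \<le> (nrm n x * nrm n (\<lambda>k. cnj (A $$ (i, k))))\<^sup>2"
      by (simp add: power_mono)
    then show "(cmod (app n A x i))\<^sup>2 \<le> (\<Sum>k<n. (cmod (A $$ (i, k)))\<^sup>2) * (nrm n x)\<^sup>2"
      by (simp add: power_mult_distrib nrm_sq_sum[of _ "\<lambda>k. cnj (A $$ (i, k))"] mult.commute)
  qed
  also have "\<dots> = (sqrt (\<Sum>i<m. \<Sum>k<n. (cmod (A $$ (i, k)))\<^sup>2) * nrm n x)\<^sup>2"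
    by (simp add: power_mult_distrib sum_nonneg sum_distrib_right)
  finally show "(nrm m (app n A x))\<^sup>2 \<le> \<dots>" .
qed (simp add: sum_nonneg)

text \<open>A supremum of reals bounds its elements only if the set is bounded above, which the
  Frobenius norm ensures. A vector of norm zero cannot be normalised; the Frobenius bound settles
  this case as well.\<close>

lemma spectral_norm_bound:
  assumes A: "A \<in> carrier_mat m n"
  shows "nrm m (app n A x) \<le> spectral_norm A * nrm n x"
proof (cases "nrm n x = 0")
  case True
  then show ?thesis
    using nrm_app_frobenius[of m n A x] by simp
next
  case False
  define r where "r = nrm n x"
  have r: "r > 0" using False nrm_nonneg[of n x] unfolding r_def by linarith
  define v where "v = vec n (\<lambda>i. complex_of_real (1 / r) * x i)"
  let ?S = "{v \<in> carrier_vec (dim_col A). vnorm v \<le> 1}"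
  have val: "vnorm (A *\<^sub>v w) = nrm m (app n A (vec_index w))" if "w \<in> carrier_vec n" for w
  proof -
    have "(A *\<^sub>v w) $ i = app n A (vec_index w) i" if "i < m" for i
      using mult_mat_vec_app[of i A w] A \<open>w \<in> carrier_vec n\<close> that by auto
    then show ?thesis
      using A by (subst vnorm_nrm[of _ m]) (auto intro!: nrm_cong)
  qed
  have "bdd_above ((\<lambda>v. vnorm (A *\<^sub>v v)) ` ?S)"
  proof (rule bdd_aboveI2)
    fix w assume w: "w \<in> ?S"
    let ?F = "sqrt (\<Sum>i<m. \<Sum>k<n. (cmod (A $$ (i, k)))\<^sup>2)"
    have "vnorm (A *\<^sub>v w) \<le> ?F * nrm n (vec_index w)"
      using w A nrm_app_frobenius[of m n A "vec_index w"] val[of w] by auto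
    also have "\<dots> \<le> ?F * 1"
      using w A by (intro mult_left_mono) (auto simp: vnorm_nrm[of w n] sum_nonneg)
    finally show "vnorm (A *\<^sub>v w) \<le> ?F" by simp
  qed
  moreover have "vnorm v = 1"
  proof -
    have "vnorm v = nrm n (\<lambda>i. complex_of_real (1 / r) * x i)"
      by (subst vnorm_nrm[of _ n]) (auto simp: v_def intro!: nrm_cong)
    then show ?thesis
      using r unfolding nrm_scale norm_of_real by (simp add: r_def)
  qed
  ultimately have "vnorm (A *\<^sub>v v) \<le> spectral_norm A"
    unfolding spectral_norm_def using A by (intro cSUP_upper) (auto simp: v_def)
  moreover have "vnorm (A *\<^sub>v v) = nrm m (app n A (\<lambda>i. complex_of_real (1 / r) * x i))"
    by (subst val) (auto simp: v_def intro!: arg_cong[of _ _ "nrm m"] app_cong)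
  moreover have "\<dots> = 1 / r * nrm m (app n A x)"
    using r unfolding app_scale nrm_scale norm_of_real by simp
  ultimately show ?thesis
    using r by (simp add: r_def field_simps)
qed

text \<open>By Cauchy-Schwarz, coercivity gives s |x| <= |S x|. Hence \<open>S\<close> is injective,
  its determinant is nonzero and \<open>mat_inverse\<close> succeeds; the same inequality, applied
  to the image under the inverse, bounds the inverse.\<close>

lemma coercive_minv:
  assumes S: "S \<in> carrier_mat n n" and s: "0 < s"
    and coercive: "\<And>x. s * (nrm n x)\<^sup>2 \<le> Re (ip n (app n S x) x)"
  shows "minv S \<in> carrier_mat n n" "minv S * S = 1\<^sub>m n" "S * minv S = 1\<^sub>m n"
    "nrm n (app n (minv S) x) \<le> 1 / s * nrm n x"
proof -
  have lower: "s * nrm n x \<le> nrm n (app n S x)" for x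
  proof -
    have "s * (nrm n x)\<^sup>2 \<le> nrm n (app n S x) * nrm n x"
      using coercive[of x] ip_bound[of n "app n S x" x] complex_Re_le_cmod[of "ip n (app n S x) x"] by linarith
    then show ?thesis
      using nrm_nonneg[of n x] by (cases "nrm n x = 0") (auto simp: power2_eq_square)
  qed
  have "det S \<noteq> 0"
  proof
    assume "det S = 0"
    then obtain v where v: "v \<in> carrier_vec n" "v \<noteq> 0\<^sub>v n" "S *\<^sub>v v = 0\<^sub>v n"
      using det_0_iff_vec_prod_zero[OF S] by auto
    have "app n S (vec_index v) i = 0" if "i < n" for i
      using mult_mat_vec_app[of i S v] S v that by auto
    then have "nrm n (app n S (vec_index v)) = nrm n (\<lambda>i. 0)"
      by (rule nrm_cong)
    then have "s * nrm n (vec_index v) \<le> 0"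
      using lower[of "vec_index v"] by simp
    then have "(nrm n (vec_index v))\<^sup>2 = 0"
      using s nrm_nonneg[of n "vec_index v"] by (auto simp: mult_le_0_iff)
    then have "\<forall>i<n. v $ i = 0"
      unfolding nrm_sq_sum by (subst (asm) sum_nonneg_eq_0_iff) auto
    with v show False
      by (auto intro: eq_vecI)
  qed
  then have "S \<in> Units (ring_mat TYPE(complex) n ())"
    by (rule det_non_zero_imp_unit[OF S])
  then obtain B where B: "mat_inverse S = Some B"
    using mat_inverse(1)[OF S, where b = "()"] by (cases "mat_inverse S") auto
  from mat_inverse(2)[OF S this] B
  show *: "minv S \<in> carrier_mat n n" "minv S * S = 1\<^sub>m n" "S * minv S = 1\<^sub>m n"
    by (auto simp: minv_def)
  have "nrm n (app n S (app n (minv S) x)) = nrm n x"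
    using * S by (intro nrm_cong) (subst app_mult[symmetric], auto simp: app_one)
  with lower[of "app n (minv S) x"] s show "nrm n (app n (minv S) x) \<le> 1 / s * nrm n x"
    by (simp add: field_simps)
qed

section \<open>Lebesgue points\<close>

text \<open>The values are the measures of the sections of a planar Borel set. The lemma makes the
  exceptional set of the density theorem a Borel set.\<close>

lemma borel_measurable_ball_diff:
  fixes E :: "real set"
  assumes E: "E \<in> sets borel"
  shows "(\<lambda>x. emeasure lborel (ball x r - E)) \<in> borel_measurable borel"
proof -
  have "Pair x -` {p. dist (fst p) (snd p) < r \<and> snd p \<notin> E} = ball x r - E" for x :: real
    by auto
  moreover have "{p. dist (fst p) (snd p) < r \<and> snd p \<notin> E} \<in> sets (borel \<Otimes>\<^sub>M lborel)"
  proof -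
    have "Measurable.pred (borel \<Otimes>\<^sub>M lborel) (\<lambda>p::real\<times>real. dist (fst p) (snd p) < r \<and> snd p \<notin> E)"
      using E by measurable
    then show ?thesis
      by (simp add: pred_def space_pair_measure)
  qed
  ultimately show ?thesis
    using lborel.measurable_emeasure_Pair[of "{p. dist (fst p) (snd p) < r \<and> snd p \<notin> E}" borel]
    by simp
qed

text \<open>Lebesgue's density theorem along the radii 1 / (n + 1). Let B be the points of
  \<open>E\<close> where the estimate fails for infinitely many n, and U an open superset with |U -
  B| < \<delta>. Vitali's theorem covers B, up to a null set, by disjoint failing balls inside U.
  Each is at most 2 / \<epsilon> times as long as its part outside \<open>E\<close>, hence outside
  B, so |B| <= 2 \<delta> / \<epsilon> for every \<delta>.\<close>

lemma lebesgue_density_aux: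
  fixes E :: "real set"
  assumes E: "E \<in> sets borel" and \<epsilon>: "0 < \<epsilon>"
  shows "AE x in lborel. x \<in> E \<longrightarrow>
    (\<forall>\<^sub>F n in sequentially. emeasure lborel (ball x (1 / Suc n) - E) \<le> ennreal (\<epsilon> / Suc n))"
proof -
  define B where "B = {x \<in> E. \<exists>\<^sub>F n in sequentially. ennreal (\<epsilon> / Suc n) < emeasure lborel (ball x (1 / Suc n) - E)}"
  have B: "B \<in> sets borel"
  proof -
    have [measurable]: "(\<lambda>x. emeasure lborel (ball x r - E)) \<in> borel_measurable borel" for r :: real
      by (rule borel_measurable_ball_diff[OF E])
    have [measurable]: "E \<in> sets borel" by fact
    have "Measurable.pred borel (\<lambda>x. x \<in> E \<and> (\<forall>m. \<exists>n\<ge>m. ennreal (\<epsilon> / Suc n) < emeasure lborel (ball x (1 / Suc n) - E)))"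
      by measurable
    then show ?thesis
      by (simp add: B_def frequently_sequentially pred_def)
  qed
  have bound: "emeasure lborel B \<le> ennreal (2 / \<epsilon>) * ennreal \<delta>" if \<delta>: "0 < \<delta>" for \<delta>
  proof -
    obtain U where U: "open U" "B \<subseteq> U" and UB: "emeasure lborel (U - B) < \<delta>"
      using outer_regular_lborel[OF B \<delta>] .
    \<comment> \<open>Centre and index of the radius of a failing ball inside \<open>U\<close>.
      Around each point of \<open>B\<close> there are arbitrarily small ones, as the Vitali theorem
      requires, because failure is frequent and \<open>U\<close> is open.\<close>
    define K where "K = {(x, n). ball x (1 / Suc n) \<subseteq> U \<and> ennreal (\<epsilon> / Suc n) < emeasure lborel (ball x (1 / Suc n) - E)}"
    define a where "a = (fst :: real \<times> nat \<Rightarrow> real)"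
    define r where "r = (\<lambda>p :: real \<times> nat. 1 / real (Suc (snd p)))"
    have "\<exists>i. i \<in> K \<and> x \<in> ball (a i) (r i) \<and> r i < d" if x: "x \<in> B" and d: "0 < d" for x d
    proof -
      obtain e where e: "0 < e" "ball x e \<subseteq> U"
        using U x openE by blast
      have "(\<lambda>n. 1 / real (Suc n)) \<longlonglongrightarrow> 0"
        by real_asymp
      then have "\<forall>\<^sub>F n in sequentially. 1 / real (Suc n) < min d e"
        using d e by (intro order_tendstoD) auto
      moreover have "\<exists>\<^sub>F n in sequentially. ennreal (\<epsilon> / Suc n) < emeasure lborel (ball x (1 / Suc n) - E)"
        using x by (simp add: B_def)
      ultimately obtain n where "1 / real (Suc n) < min d e"
          "ennreal (\<epsilon> / Suc n) < emeasure lborel (ball x (1 / Suc n) - E)"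
        by (metis (mono_tags, lifting) eventually_mono frequently_def)
      moreover from this have "ball x (1 / real (Suc n)) \<subseteq> U"
        using e subset_ball[of "1 / real (Suc n)" e x] by auto
      ultimately show ?thesis
        by (intro exI[of _ "(x, n)"]) (auto simp: K_def a_def r_def)
    qed
    then obtain C where C: "countable C" "C \<subseteq> K"
      and disj: "pairwise (\<lambda>i j. disjnt (ball (a i) (r i)) (ball (a j) (r j))) C"
      and neg: "negligible (B - (\<Union>i\<in>C. ball (a i) (r i)))"
      by (rule Vitali_covering_theorem_balls)
    have dfam: "disjoint_family_on (\<lambda>i. ball (a i) (r i)) C"
      using disj by (auto simp: disjoint_family_on_def pairwise_def disjnt_def)
    have dfam': "disjoint_family_on (\<lambda>i. ball (a i) (r i) - B) C"
      using dfam unfolding disjoint_family_on_def by blast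
    have UN: "(\<Union>i\<in>C. ball (a i) (r i)) \<in> sets lborel"
      unfolding sets_lborel by (intro borel_open open_UN) auto
    have "emeasure lborel B = emeasure lebesgue B"
      using B by simp
    also have "\<dots> \<le> emeasure lebesgue (\<Union>i\<in>C. ball (a i) (r i))"
    proof (rule emeasure_mono_AE)
      show "AE x in lebesgue. x \<in> B \<longrightarrow> x \<in> (\<Union>i\<in>C. ball (a i) (r i))"
        using neg by (intro AE_I'[of "B - (\<Union>i\<in>C. ball (a i) (r i))"]) (auto simp: negligible_iff_null_sets)
    qed (use UN in \<open>auto simp: sets_completionI_sets\<close>)
    also have "\<dots> = emeasure lborel (\<Union>i\<in>C. ball (a i) (r i))"
      using UN by simp
    also have "\<dots> = (\<integral>\<^sup>+i. emeasure lborel (ball (a i) (r i)) \<partial>count_space C)"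
      using C dfam by (intro emeasure_UN_countable) auto
    also have "\<dots> \<le> (\<integral>\<^sup>+i. ennreal (2 / \<epsilon>) * emeasure lborel (ball (a i) (r i) - B) \<partial>count_space C)"
    proof (rule nn_integral_mono)
      fix i assume "i \<in> space (count_space C)"
      then have i: "i \<in> K" using C by auto
      have "emeasure lborel (ball (a i) (r i)) = ennreal (2 * r i)"
        by (subst ball_eq_greaterThanLessThan, subst emeasure_lborel_Ioo) (auto simp: r_def)
      also have "\<dots> = ennreal (2 / \<epsilon>) * ennreal (\<epsilon> * r i)"
        using \<epsilon> by (simp add: ennreal_mult'[symmetric] r_def)
      also have "\<dots> \<le> ennreal (2 / \<epsilon>) * emeasure lborel (ball (a i) (r i) - E)"
        using i by (intro mult_left_mono) (auto simp: K_def a_def r_def)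
      also have "\<dots> \<le> ennreal (2 / \<epsilon>) * emeasure lborel (ball (a i) (r i) - B)"
        using B by (intro mult_left_mono emeasure_mono) (auto simp: B_def)
      finally show "emeasure lborel (ball (a i) (r i)) \<le> ennreal (2 / \<epsilon>) * emeasure lborel (ball (a i) (r i) - B)" .
    qed
    also have "\<dots> = ennreal (2 / \<epsilon>) * (\<integral>\<^sup>+i. emeasure lborel (ball (a i) (r i) - B) \<partial>count_space C)"
      by (rule nn_integral_cmult) auto
    also have "(\<integral>\<^sup>+i. emeasure lborel (ball (a i) (r i) - B) \<partial>count_space C) = emeasure lborel (\<Union>i\<in>C. ball (a i) (r i) - B)"
      using C dfam' B by (intro emeasure_UN_countable[symmetric]) auto
    also have "\<dots> \<le> emeasure lborel (U - B)"
    proof -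
      have "ball (a i) (r i) \<subseteq> U" if "i \<in> C" for i
      proof -
        have "i \<in> K" using that C(2) by blast
        then show ?thesis by (simp add: K_def a_def r_def split_beta)
      qed
      then show ?thesis
        using U B by (intro emeasure_mono) auto
    qed
    also have "\<dots> \<le> ennreal \<delta>"
      using UB by simp
    finally show ?thesis
      by (simp add: mult_left_mono)
  qed
  have "emeasure lborel B \<le> 0"
  proof (rule ennreal_le_epsilon)
    fix e :: real assume e: "0 < e"
    have "emeasure lborel B \<le> ennreal (2 / \<epsilon>) * ennreal (\<epsilon> * e / 2)"
      using e \<epsilon> by (intro bound) simp
    also have "\<dots> = ennreal e"
      using \<epsilon> by (simp add: ennreal_mult'[symmetric])
    finally show "emeasure lborel B \<le> 0 + ennreal e" by simp
  qed
  then have "B \<in> null_sets lborel"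
    using B by auto
  then have "AE x in lborel. x \<notin> B"
    by (rule AE_not_in)
  then show ?thesis
    by (rule AE_mp) (auto simp: B_def not_frequently not_less)
qed

text \<open>Approximating \<open>f\<close> uniformly by step functions reduces the statement for bounded functions to
  density points of level sets.\<close>

theorem lebesgue_points_bounded:
  fixes f :: "real \<Rightarrow> real"
  assumes f[measurable]: "f \<in> borel_measurable borel" and K: "\<And>x. \<bar>f x\<bar> \<le> K"
  shows "AE x in lborel. \<forall>\<epsilon>>0. \<exists>\<delta>>0. \<forall>r. 0 < r \<and> r < \<delta> \<longrightarrow>
    (\<integral>\<^sup>+y\<in>ball x r. ennreal \<bar>f y - f x\<bar> \<partial>lborel) \<le> ennreal (\<epsilon> * r)"
proof -
  have K0: "0 \<le> K" using K[of 0] by linarith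
  \<comment> \<open>Level sets of mesh 1 / (k + 1); on each of them \<open>f\<close> varies by at
    most the mesh.\<close>
  define E where "E = (\<lambda>(k::nat) (i::int). {x. \<lfloor>f x * real (Suc k)\<rfloor> = i})"
  have E[measurable]: "E k i \<in> sets borel" for k i
    unfolding E_def by measurable
  have "AE x in lborel. \<forall>k i l. x \<in> E k i \<longrightarrow>
    (\<forall>\<^sub>F n in sequentially. emeasure lborel (ball x (1 / Suc n) - E k i) \<le> ennreal ((1 / Suc l) / Suc n))"
    unfolding AE_all_countable by (intro allI lebesgue_density_aux E) simp
  then show ?thesis
  proof (rule AE_mp, intro AE_I2 impI allI)
    fix x \<epsilon> :: real
    assume dens: "\<forall>k i l. x \<in> E k i \<longrightarrow>
      (\<forall>\<^sub>F n in sequentially. emeasure lborel (ball x (1 / Suc n) - E k i) \<le> ennreal ((1 / Suc l) / Suc n))"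
    assume \<epsilon>: "0 < \<epsilon>"
    \<comment> \<open>\<open>k\<close> limits the oscillation inside the level set of
      \<open>x\<close>. The next choice, \<open>l\<close>, limits how much of a small ball lies
      outside it, where the difference can be as large as 2 \<open>K\<close>; its denominator
      contains \<open>K\<close> + 1 so that it cannot vanish.\<close>
    obtain k where k: "1 / real (Suc k) < \<epsilon> / 8"
      using \<epsilon> by (metis nat_approx_posE divide_pos_pos zero_less_numeral)
    obtain l where l: "1 / real (Suc l) < \<epsilon> / (8 * (K + 1))"
      using \<epsilon> K0 nat_approx_posE[of "\<epsilon> / (8 * (K + 1))"] by auto
    define i where "i = \<lfloor>f x * real (Suc k)\<rfloor>"
    have x: "x \<in> E k i" by (simp add: E_def i_def)
    from dens x have "\<forall>\<^sub>F n in sequentially. emeasure lborel (ball x (1 / Suc n) - E k i) \<le> ennreal ((1 / Suc l) / Suc n)"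
      by blast
    then obtain n0 where n0: "\<And>n. n0 \<le> n \<Longrightarrow> emeasure lborel (ball x (1 / Suc n) - E k i) \<le> ennreal ((1 / Suc l) / Suc n)"
      by (auto simp: eventually_sequentially)
    have main: "(\<integral>\<^sup>+y\<in>ball x (1 / Suc n). ennreal \<bar>f y - f x\<bar> \<partial>lborel) \<le> ennreal (\<epsilon> / 2 / Suc n)"
      if n: "n0 \<le> n" for n
    proof -
      let ?I = "ball x (1 / Suc n)"
      have "(\<integral>\<^sup>+y\<in>?I. ennreal \<bar>f y - f x\<bar> \<partial>lborel) \<le>
        (\<integral>\<^sup>+y. ennreal (1 / Suc k) * indicator ?I y + ennreal (2 * K) * indicator (?I - E k i) y \<partial>lborel)"
      proof (rule nn_integral_mono)
        fix y
        have "\<bar>f y - f x\<bar> \<le> 1 / Suc k" if "y \<in> E k i"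
        proof -
          have "\<lfloor>f y * real (Suc k)\<rfloor> = \<lfloor>f x * real (Suc k)\<rfloor>"
            using that x by (simp add: E_def)
          then have "\<bar>f y * real (Suc k) - f x * real (Suc k)\<bar> \<le> 1"
            by linarith
          then have "\<bar>f y - f x\<bar> * real (Suc k) \<le> 1"
            by (simp add: left_diff_distrib[symmetric] abs_mult)
          then show ?thesis
            by (simp add: field_simps)
        qed
        moreover have "\<bar>f y - f x\<bar> \<le> 2 * K"
          using K[of x] K[of y] by linarith
        ultimately show "ennreal \<bar>f y - f x\<bar> * indicator ?I y \<le>
          ennreal (1 / Suc k) * indicator ?I y + ennreal (2 * K) * indicator (?I - E k i) y"
          by (auto simp: indicator_def intro: ennreal_leI add_increasing)
      qed
      also have "\<dots> = ennreal (1 / Suc k) * emeasure lborel ?I + ennreal (2 * K) * emeasure lborel (?I - E k i)"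
      proof -
        have sI: "?I \<in> sets lborel" and sD: "?I - E k i \<in> sets lborel"
          using E by auto
        show ?thesis
          by (subst nn_integral_add)
            (intro borel_measurable_times_ennreal borel_measurable_const borel_measurable_indicator sI sD
             | simp only: nn_integral_cmult_indicator[OF sI] nn_integral_cmult_indicator[OF sD])+
      qed
      also have "emeasure lborel ?I = ennreal (2 / Suc n)"
        by (subst ball_eq_greaterThanLessThan, subst emeasure_lborel_Ioo) auto
      also have "ennreal (1 / Suc k) * ennreal (2 / Suc n) + ennreal (2 * K) * emeasure lborel (?I - E k i)
          \<le> ennreal (\<epsilon> / 8) * ennreal (2 / Suc n) + ennreal (2 * K) * ennreal ((1 / Suc l) / Suc n)"
        using k n0[OF n] by (intro add_mono mult_right_mono mult_left_mono ennreal_leI) auto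
      also have "\<dots> = ennreal (\<epsilon> / 8 * (2 / Suc n)) + ennreal (2 * K * ((1 / Suc l) / Suc n))"
        using \<epsilon> K0 by (intro arg_cong2[of _ _ _ _ "(+)"] ennreal_mult[symmetric]) auto
      also have "\<dots> = ennreal (\<epsilon> / 8 * (2 / Suc n) + 2 * K * ((1 / Suc l) / Suc n))"
        using \<epsilon> K0 by (intro ennreal_plus[symmetric]) auto
      also have "\<dots> \<le> ennreal (\<epsilon> / 2 / Suc n)"
      proof (rule ennreal_leI)
        have "2 * K * (1 / Suc l) \<le> 2 * (K + 1) * (\<epsilon> / (8 * (K + 1)))"
          using l K0 by (intro mult_mono) auto
        also have "\<dots> = \<epsilon> / 4"
          using K0 by (simp add: field_simps)
        finally have "\<epsilon> / 8 * 2 + 2 * K * (1 / Suc l) \<le> \<epsilon> / 2"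
          by simp
        then have "(\<epsilon> / 8 * 2 + 2 * K * (1 / Suc l)) / Suc n \<le> \<epsilon> / 2 / Suc n"
          by (rule divide_right_mono) simp
        then show "\<epsilon> / 8 * (2 / Suc n) + 2 * K * ((1 / Suc l) / Suc n) \<le> \<epsilon> / 2 / Suc n"
          by (simp add: add_divide_distrib)
      qed
      finally show ?thesis .
    qed
    show "\<exists>\<delta>>0. \<forall>r. 0 < r \<and> r < \<delta> \<longrightarrow>
       (\<integral>\<^sup>+y\<in>ball x r. ennreal \<bar>f y - f x\<bar> \<partial>lborel) \<le> ennreal (\<epsilon> * r)"
    proof (intro exI[of _ "1 / real (n0 + 1)"] conjI allI impI)
      fix r :: real assume r: "0 < r \<and> r < 1 / real (n0 + 1)"
      \<comment> \<open>So 1 / (n + 2) < r <= 1 / (n + 1), which carries the estimate from the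
        special radii to all small ones: the enclosing ball has radius at most 2 r, paid for by the
        factor 1 / 2 in \<open>main\<close>.\<close>
      define n where "n = nat \<lfloor>1 / r\<rfloor> - 1"
      have inv: "real (n0 + 1) < 1 / r"
        using r by (simp add: field_simps)
      then have fl: "int (n0 + 1) \<le> \<lfloor>1 / r\<rfloor>"
        by (simp add: le_floor_iff)
      then have n: "n0 \<le> n" "real (Suc n) = \<lfloor>1 / r\<rfloor>"
        by (auto simp: n_def)
      have Sn: "real (Suc n) \<le> 1 / r" "1 / r < real (Suc n) + 1"
        using n by linarith+
      have "r \<le> 1 / Suc n"
        using Sn r by (simp add: field_simps)
      moreover have "1 / Suc n \<le> 2 * r"
      proof -
        have "1 / r \<le> 2 * real (Suc n)"
          using Sn(2) by simp
        then show ?thesis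
          using r by (simp add: field_simps)
      qed
      ultimately have "(\<integral>\<^sup>+y\<in>ball x r. ennreal \<bar>f y - f x\<bar> \<partial>lborel) \<le> (\<integral>\<^sup>+y\<in>ball x (1 / Suc n). ennreal \<bar>f y - f x\<bar> \<partial>lborel)"
        by (intro nn_integral_mono) (auto simp: indicator_def)
      also have "\<dots> \<le> ennreal (\<epsilon> / 2 / Suc n)"
        by (rule main[OF n(1)])
      also have "\<dots> \<le> ennreal (\<epsilon> * r)"
        using mult_left_mono[OF \<open>1 / Suc n \<le> 2 * r\<close>, of "\<epsilon> / 2"] \<epsilon> by (intro ennreal_leI) simp
      finally show "(\<integral>\<^sup>+y\<in>ball x r. ennreal \<bar>f y - f x\<bar> \<partial>lborel) \<le> ennreal (\<epsilon> * r)" .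
    qed simp
  qed
qed

lemma borel_measurable_cnj [measurable (raw)]:
  "f \<in> borel_measurable M \<Longrightarrow> (\<lambda>x. cnj (f x)) \<in> borel_measurable M"
  by (rule borel_measurable_continuous_on[where f = cnj]) (auto intro: continuous_intros)

lemma borel_measurable_cis [measurable (raw)]:
  "f \<in> borel_measurable M \<Longrightarrow> (\<lambda>x. cis (f x)) \<in> borel_measurable M"
  by (rule borel_measurable_continuous_on[where f = cis]) (auto intro: continuous_intros)

section \<open>Toeplitz matrices and their symbols\<close>

text \<open>The record field \<open>density\<close> of the model shadows the measure-theoretic
  constant of that name.\<close>

abbreviation "mdensity \<equiv> Nonnegative_Lebesgue_Integration.density"

text \<open>A density on the whole line rather than a restricted space, so that the measurable sets
  are simply those of \<open>borel\<close>.\<close>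

definition unit_lborel :: "real measure" where
  "unit_lborel = mdensity lborel (indicator {0..1})"

text \<open>As a function of m these are the entries of the steering vector of spatial frequency y;
  as functions of y they are orthonormal characters of the circle. Both readings are used.\<close>

definition wave :: "nat \<Rightarrow> real \<Rightarrow> complex" where
  "wave m y = cis (- (2 * pi * (real m * y)))"

lemma sets_unit_lborel [simp, measurable_cong]: "sets unit_lborel = sets borel"
  by (simp add: unit_lborel_def)

lemma space_unit_lborel [simp]: "space unit_lborel = UNIV"
  by (simp add: unit_lborel_def)

lemma nn_integral_unit_lborel:
  "f \<in> borel_measurable borel \<Longrightarrow> (\<integral>\<^sup>+y. f y \<partial>unit_lborel) = (\<integral>\<^sup>+y\<in>{0..1}. f y \<partial>lborel)"
  unfolding unit_lborel_def by (subst nn_integral_density) (auto simp: mult.commute)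

lemma integral_unit_lborel:
  fixes f :: "real \<Rightarrow> 'b :: {banach, second_countable_topology}"
  shows "f \<in> borel_measurable borel \<Longrightarrow> integral\<^sup>L unit_lborel f = (LINT y|lborel. indicator {0..1} y *\<^sub>R f y)"
proof -
  assume f: "f \<in> borel_measurable borel"
  have eq: "unit_lborel = mdensity lborel (\<lambda>y. ennreal (indicator {0..1} y))"
    unfolding unit_lborel_def by (intro density_cong) (auto simp: indicator_def)
  show ?thesis
    unfolding eq by (subst integral_density) (use f in auto)
qed

interpretation unit_lborel: prob_space unit_lborel
proof
  have "emeasure unit_lborel (space unit_lborel) = (\<integral>\<^sup>+y. 1 \<partial>unit_lborel)"
    by simp
  also have "\<dots> = emeasure lborel {0..1::real}"
    by (subst nn_integral_unit_lborel) auto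
  also have "\<dots> = 1"
    by simp
  finally show "emeasure unit_lborel (space unit_lborel) = 1" .
qed

lemma wave_measurable [measurable]: "wave m \<in> borel_measurable borel"
proof -
  have "continuous_on UNIV (wave m)"
    unfolding wave_def by (intro continuous_intros)
  then show ?thesis
    by (rule borel_measurable_continuous_onI)
qed

lemma cmod_wave [simp]: "cmod (wave m y) = 1"
  by (simp add: wave_def)

lemma wave_mult_cnj: "wave m x * cnj (wave n y) = cis (2 * pi * (real n * y - real m * x))"
  by (simp add: wave_def cis_cnj cis_mult algebra_simps)

lemma wave_orthonormal: "(LINT y|unit_lborel. wave m y * cnj (wave n y)) = (if m = n then 1 else 0)"
proof (cases "m = n")
  case False
  define k :: int where "k = int n - int m"
  have k: "k \<noteq> 0" using False by (simp add: k_def)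
  have "wave m y * cnj (wave n y) = cis (2 * pi * k * y)" for y
    by (simp add: wave_mult_cnj k_def algebra_simps)
  then have "(LINT y|unit_lborel. wave m y * cnj (wave n y)) = (LINT y|lborel. indicator {0..1} y *\<^sub>R cis (2 * pi * k * y))"
    by (subst integral_unit_lborel) auto
  also have "\<dots> = cis (2 * pi * k * 1) / (2 * pi * k * \<i>) - cis (2 * pi * k * 0) / (2 * pi * k * \<i>)"
  proof (rule integral_FTC_Icc)
    fix x :: real
    have "((\<lambda>y. 2 * pi * k * y) has_derivative (\<lambda>t. 2 * pi * k * t)) (at x)"
      by (rule has_derivative_mult_right) (rule has_derivative_ident)
    then have "((\<lambda>y. cis (2 * pi * k * y)) has_derivative (\<lambda>t. (2 * pi * k * t) *\<^sub>R (\<i> * cis (2 * pi * k * x)))) (at x)"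
      by (rule has_derivative_cis)
    then have "((\<lambda>y. cis (2 * pi * k * y) / (2 * pi * k * \<i>)) has_derivative
        (\<lambda>t. (2 * pi * k * t) *\<^sub>R (\<i> * cis (2 * pi * k * x)) / (2 * pi * k * \<i>))) (at x)"
      by (rule bounded_linear.has_derivative[OF bounded_linear_divide])
    moreover have "(2 * pi * k * t) *\<^sub>R (\<i> * cis (2 * pi * k * x)) / (2 * pi * k * \<i>) = t *\<^sub>R cis (2 * pi * k * x)" for t
      using k by (simp add: scaleR_conv_of_real complex_eq_iff)
    ultimately show "((\<lambda>y. cis (2 * pi * k * y) / (2 * pi * k * \<i>)) has_vector_derivative cis (2 * pi * k * x)) (at x within {0..1})"
      unfolding has_vector_derivative_def by (simp add: has_derivative_at_withinI)
  next
    show "continuous_on {0..1} (\<lambda>x. cis (2 * pi * k * x))"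
      by (intro continuous_intros)
  qed simp
  also have "cis (2 * pi * k * 1) = 1"
    by (simp add: cis_multiple_2pi)
  finally show ?thesis
    using False by simp
next
  case True
  have "wave n y * cnj (wave n y) = 1" for y
    by (simp add: complex_norm_square[symmetric])
  with True show ?thesis
    using unit_lborel.prob_space by simp
qed

lemma unit_lborel_integrable:
  fixes f :: "real \<Rightarrow> 'b :: {banach, second_countable_topology}"
  assumes "f \<in> borel_measurable borel" "\<And>y. norm (f y) \<le> B"
  shows "integrable unit_lborel f"
proof (rule unit_lborel.integrable_const_bound[of _ B])
  show "f \<in> borel_measurable unit_lborel"
    using assms(1) measurable_cong_sets[OF sets_unit_lborel refl] by blast
qed (use assms(2) in simp)

text \<open>The partial Fourier sum \<open>s\<close> of \<open>h\<close> satisfies <h, s> = <s, s>,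
  the sum of the squared coefficients, so the claim says that |h - s|^2 has a nonnegative integral.
  It converts an estimate in the frequency domain into one for vectors of every length
  \<open>M\<close>.\<close>

lemma bessel:
  fixes h :: "real \<Rightarrow> complex"
  assumes h[measurable]: "h \<in> borel_measurable borel" and B: "\<And>y. cmod (h y) \<le> B"
  shows "(\<Sum>m<M. (cmod (LINT y|unit_lborel. wave m y * h y))\<^sup>2) \<le> (LINT y|unit_lborel. (cmod (h y))\<^sup>2)"
proof -
  define c where "c = (\<lambda>m. LINT y|unit_lborel. wave m y * h y)"
  define s where "s = (\<lambda>y. \<Sum>m<M. c m * cnj (wave m y))"
  have s_meas[measurable]: "s \<in> borel_measurable borel"
    unfolding s_def by measurable
  have s_bd: "cmod (s y) \<le> (\<Sum>m<M. cmod (c m))" for y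
    unfolding s_def by (rule order.trans[OF norm_sum]) (simp add: norm_mult)
  have B0: "0 \<le> B" using B[of 0] norm_ge_zero order.trans by blast
  have S0: "0 \<le> (\<Sum>m<M. cmod (c m))" by (simp add: sum_nonneg)
  have iwh: "integrable unit_lborel (\<lambda>y. wave m y * h y)" for m
    by (rule unit_lborel_integrable[of _ B]) (auto simp: norm_mult B)
  have iww: "integrable unit_lborel (\<lambda>y. wave m y * cnj (wave n y))" for m n
    by (rule unit_lborel_integrable[of _ 1]) (auto simp: norm_mult)
  have ihh: "integrable unit_lborel (\<lambda>y. h y * cnj (h y))"
    by (rule unit_lborel_integrable[of _ "B * B"]) (auto simp: norm_mult intro!: mult_mono B B0)
  have ihs: "integrable unit_lborel (\<lambda>y. h y * cnj (s y))"
    by (rule unit_lborel_integrable[of _ "B * (\<Sum>m<M. cmod (c m))"]) (auto simp: norm_mult intro!: mult_mono B s_bd B0)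
  have iss: "integrable unit_lborel (\<lambda>y. s y * cnj (s y))"
    by (rule unit_lborel_integrable[of _ "(\<Sum>m<M. cmod (c m)) * (\<Sum>m<M. cmod (c m))"])
      (auto simp: norm_mult intro!: mult_mono s_bd S0)
  have hs: "(LINT y|unit_lborel. h y * cnj (s y)) = (\<Sum>m<M. c m * cnj (c m))"
  proof -
    have "(LINT y|unit_lborel. h y * cnj (s y)) = (LINT y|unit_lborel. (\<Sum>m<M. cnj (c m) * (wave m y * h y)))"
      by (simp add: s_def sum_distrib_left mult_ac)
    also have "\<dots> = (\<Sum>m<M. LINT y|unit_lborel. cnj (c m) * (wave m y * h y))"
      by (rule Bochner_Integration.integral_sum) (rule integrable_mult_right, rule iwh)
    also have "\<dots> = (\<Sum>m<M. cnj (c m) * c m)"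
      by (simp only: integral_mult_right_zero c_def)
    finally show ?thesis
      by (simp add: mult.commute)
  qed
  have ws: "(LINT y|unit_lborel. wave m y * s y) = c m" if "m < M" for m
  proof -
    have "(LINT y|unit_lborel. wave m y * s y) = (LINT y|unit_lborel. (\<Sum>n<M. c n * (wave m y * cnj (wave n y))))"
      by (simp add: s_def sum_distrib_left mult_ac)
    also have "\<dots> = (\<Sum>n<M. LINT y|unit_lborel. c n * (wave m y * cnj (wave n y)))"
      by (rule Bochner_Integration.integral_sum) (rule integrable_mult_right, rule iww)
    also have "\<dots> = (\<Sum>n<M. c n * (if m = n then 1 else 0))"
      by (simp only: integral_mult_right_zero wave_orthonormal)
    also have "\<dots> = c m"
      using that by (simp add: if_distrib[of "\<lambda>x. _ * x"] cong: if_cong)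
    finally show ?thesis .
  qed
  have iws: "integrable unit_lborel (\<lambda>y. wave m y * s y)" for m
    by (rule unit_lborel_integrable[of _ "\<Sum>m<M. cmod (c m)"]) (auto simp: norm_mult s_bd)
  have ss: "(LINT y|unit_lborel. s y * cnj (s y)) = (\<Sum>m<M. c m * cnj (c m))"
  proof -
    have "(LINT y|unit_lborel. s y * cnj (s y)) = (LINT y|unit_lborel. (\<Sum>m<M. cnj (c m) * (wave m y * s y)))"
    proof (rule Bochner_Integration.integral_cong)
      fix y
      have "cnj (s y) = (\<Sum>m<M. cnj (c m) * wave m y)"
        by (simp add: s_def)
      then show "s y * cnj (s y) = (\<Sum>m<M. cnj (c m) * (wave m y * s y))"
        by (simp add: sum_distrib_left mult_ac)
    qed simp
    also have "\<dots> = (\<Sum>m<M. LINT y|unit_lborel. cnj (c m) * (wave m y * s y))"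
      by (rule Bochner_Integration.integral_sum) (rule integrable_mult_right, rule iws)
    also have "\<dots> = (\<Sum>m<M. cnj (c m) * c m)"
      using ws by (simp only: integral_mult_right_zero) simp
    finally show ?thesis
      by (simp only: mult.commute)
  qed
  have "complex_of_real (LINT y|unit_lborel. (cmod (h y - s y))\<^sup>2) = (LINT y|unit_lborel. (h y - s y) * cnj (h y - s y))"
    by (simp add: integral_complex_of_real[symmetric] complex_norm_square del: of_real_power)
  also have "\<dots> = (LINT y|unit_lborel. h y * cnj (h y) - h y * cnj (s y) - cnj (h y * cnj (s y)) + s y * cnj (s y))"
    by (simp add: algebra_simps)
  also have "\<dots> = (LINT y|unit_lborel. h y * cnj (h y)) - (\<Sum>m<M. c m * cnj (c m)) - cnj (\<Sum>m<M. c m * cnj (c m)) + (\<Sum>m<M. c m * cnj (c m))"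
  proof -
    have ihs': "integrable unit_lborel (\<lambda>y. cnj (h y * cnj (s y)))"
      using ihs by (simp only: complex_integrable_cnj)
    have "(LINT y|unit_lborel. cnj (h y * cnj (s y))) = cnj (\<Sum>m<M. c m * cnj (c m))"
      unfolding hs[symmetric] by (rule Bochner_Integration.integral_cnj)
    then show ?thesis
      using ihh ihs iss ihs'
      by (simp only: Bochner_Integration.integral_add Bochner_Integration.integral_diff
          Bochner_Integration.integrable_diff hs ss)
  qed
  also have "\<dots> = (LINT y|unit_lborel. h y * cnj (h y)) - (\<Sum>m<M. c m * cnj (c m))"
    by (simp add: mult.commute)
  also have "\<dots> = complex_of_real ((LINT y|unit_lborel. (cmod (h y))\<^sup>2) - (\<Sum>m<M. (cmod (c m))\<^sup>2))"
    by (simp add: integral_complex_of_real[symmetric] complex_norm_square del: of_real_power)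
  finally have "(LINT y|unit_lborel. (cmod (h y - s y))\<^sup>2) = (LINT y|unit_lborel. (cmod (h y))\<^sup>2) - (\<Sum>m<M. (cmod (c m))\<^sup>2)"
    by (simp only: of_real_eq_iff)
  moreover have "0 \<le> (LINT y|unit_lborel. (cmod (h y - s y))\<^sup>2)"
    by simp
  ultimately show ?thesis
    by (simp add: c_def)
qed

section \<open>The Dirichlet kernel and Fejer averages at Lebesgue points\<close>

definition dirichlet :: "nat \<Rightarrow> real \<Rightarrow> real \<Rightarrow> complex" where
  "dirichlet M x y = (\<Sum>n<M. wave n x * cnj (wave n y))"

lemma dirichlet_measurable [measurable]: "dirichlet M x \<in> borel_measurable borel"
  unfolding dirichlet_def by measurable

lemma cmod_dirichlet_le: "cmod (dirichlet M x y) \<le> real M"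
  unfolding dirichlet_def by (rule order.trans[OF norm_sum]) (simp add: norm_mult)

text \<open>On [0, 1/2] one has sin (pi v) >= v. Beyond 1/2, reflection leads to 1 - |u|, the
  distance to the next zero of the sine, which is at least \<delta>.\<close>

lemma abs_sin_pi_lower:
  fixes u \<delta> :: real
  assumes "\<bar>u\<bar> \<le> 1 - \<delta>" "0 < \<delta>" "\<delta> \<le> 1"
  shows "\<delta> * \<bar>u\<bar> \<le> \<bar>sin (pi * u)\<bar>"
proof -
  \<comment> \<open>The cubic Taylor estimate suffices: for t = pi v <= 8/5 it gives sin t >= t / 2,
    and t / 2 >= v.\<close>
  have half: "v \<le> sin (pi * v)" if v: "0 \<le> v" "v \<le> 1 / 2" for v :: real
  proof -
    define t where "t = pi * v"
    have pi: "3 < pi" "pi < 3.2" using pi_approx by auto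
    have t: "0 \<le> t" "t \<le> 8 / 5"
      using v pi mult_mono[of pi "16 / 5" v "1 / 2"] by (auto simp: t_def)
    have "\<bar>sin t - (\<Sum>m<3. sin_coeff m * t ^ m)\<bar> \<le> inverse (fact 3) * \<bar>t\<bar> ^ 3"
      by (rule Maclaurin_sin_bound)
    then have "\<bar>sin t - t\<bar> \<le> t ^ 3 / 6"
      using t by (simp add: numeral_3_eq_3 sin_coeff_def field_simps)
    then have 1: "t - t ^ 3 / 6 \<le> sin t"
      by linarith
    have "t ^ 3 = t * t\<^sup>2"
      by (simp add: power3_eq_cube power2_eq_square)
    also have "\<dots> \<le> t * (8 / 5)\<^sup>2"
      using t by (intro mult_left_mono power_mono) auto
    finally have "t ^ 3 \<le> t * (64 / 25)" by (simp add: power2_eq_square)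
    with 1 have "t / 2 \<le> sin t"
      using t by linarith
    moreover have "v \<le> t / 2"
      using v pi mult_right_mono[of 3 pi v] by (simp add: t_def)
    ultimately show ?thesis by (simp add: t_def)
  qed
  define a where "a = \<bar>u\<bar>"
  have a: "0 \<le> a" "a \<le> 1 - \<delta>" using assms by (auto simp: a_def)
  have "\<bar>sin (pi * u)\<bar> = \<bar>sin (pi * a)\<bar>"
    by (cases "0 \<le> u") (auto simp: a_def)
  moreover have "\<delta> * a \<le> sin (pi * a)"
  proof (cases "a \<le> 1 / 2")
    case True
    have "\<delta> * a \<le> 1 * a"
      using a assms by (intro mult_right_mono) auto
    then show ?thesis
      using half[of a] a True by simp
  next
    case False
    have "\<delta> * a \<le> \<delta> * 1"
      using a assms by (intro mult_left_mono) auto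
    also have "\<dots> \<le> 1 - a" using a by simp
    also have "\<dots> \<le> sin (pi * (1 - a))"
      using half[of "1 - a"] a False assms by simp
    also have "\<dots> = sin (pi * a)"
      by (simp add: right_diff_distrib)
    finally show ?thesis .
  qed
  ultimately show ?thesis by (simp add: a_def)
qed

lemma cmod_cis_minus_1: "cmod (cis (2 * t) - 1) = 2 * \<bar>sin t\<bar>"
proof -
  have "cis (2 * t) - 1 = cis t * (cis t - cis (- t))"
    by (simp add: right_diff_distrib cis_mult)
  also have "cis t - cis (- t) = 2 * \<i> * sin t"
    by (simp add: complex_eq_iff)
  finally show ?thesis
    by (simp add: norm_mult)
qed

lemma cmod_geometric_cis:
  assumes "sin t \<noteq> 0"
  shows "cmod (\<Sum>n<M. cis (2 * t) ^ n) \<le> 1 / \<bar>sin t\<bar>"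
proof -
  have "cmod ((cis (2 * t) - 1) * (\<Sum>n<M. cis (2 * t) ^ n)) = cmod (cis (2 * t) ^ M - 1)"
    by (simp add: power_diff_1_eq)
  also have "\<dots> \<le> 2"
    by (rule order.trans[OF norm_triangle_ineq4]) (simp add: norm_power)
  finally have "2 * \<bar>sin t\<bar> * cmod (\<Sum>n<M. cis (2 * t) ^ n) \<le> 2"
    by (simp add: norm_mult cmod_cis_minus_1)
  then show ?thesis
    using assms by (simp add: field_simps)
qed

lemma dirichlet_geometric: "dirichlet M x y = (\<Sum>n<M. cis (2 * (pi * (y - x))) ^ n)"
proof -
  have "wave n x * cnj (wave n y) = cis (2 * (pi * (y - x))) ^ n" for n
    unfolding wave_mult_cnj by (subst Complex.DeMoivre) (simp add: algebra_simps)
  then show ?thesis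
    by (simp add: dirichlet_def)
qed

text \<open>Frequencies live on a circle, so \<open>x\<close> and \<open>y\<close> near opposite
  ends of the unit interval are neighbours. The first hypothesis keeps them \<delta> away from this
  wrap-around; then the geometric sum is bounded independently of \<open>M\<close>.\<close>

lemma cmod_dirichlet_far:
  assumes "\<bar>y - x\<bar> \<le> 1 - \<delta>" "0 < \<delta>" "\<delta> \<le> 1" "x \<noteq> y"
  shows "cmod (dirichlet M x y) \<le> 1 / (\<delta> * \<bar>y - x\<bar>)"
proof -
  have low: "\<delta> * \<bar>y - x\<bar> \<le> \<bar>sin (pi * (y - x))\<bar>"
    by (rule abs_sin_pi_lower) (use assms in auto)
  moreover have pos: "0 < \<delta> * \<bar>y - x\<bar>" using assms by simp
  ultimately have "sin (pi * (y - x)) \<noteq> 0" by auto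
  then have "cmod (dirichlet M x y) \<le> 1 / \<bar>sin (pi * (y - x))\<bar>"
    unfolding dirichlet_geometric by (rule cmod_geometric_cis)
  also have "\<dots> \<le> 1 / (\<delta> * \<bar>y - x\<bar>)"
    using low pos by (intro divide_left_mono) auto
  finally show ?thesis .
qed

text \<open>Within 1 / (6 M) every phase difference is at most pi / 3, so each summand has real part
  at least 1 / 2 and no cancellation occurs.\<close>

lemma cmod_dirichlet_near:
  assumes "\<bar>y - x\<bar> \<le> 1 / (6 * real M)" "0 < M"
  shows "real M / 2 \<le> cmod (dirichlet M x y)"
proof -
  have "1 / 2 \<le> Re (wave n x * cnj (wave n y))" if n: "n < M" for n
  proof -
    have "\<bar>2 * pi * (real n * y - real n * x)\<bar> = 2 * pi * (real n * \<bar>y - x\<bar>)"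
      by (simp add: right_diff_distrib[symmetric] abs_mult)
    also have "\<dots> \<le> 2 * pi * (real M * (1 / (6 * real M)))"
      using assms n by (intro mult_left_mono mult_mono) auto
    also have "\<dots> = pi / 3" using assms by simp
    finally have "cos (pi / 3) \<le> cos \<bar>2 * pi * (real n * y - real n * x)\<bar>"
      by (intro cos_monotone_0_pi_le) auto
    then show ?thesis
      by (simp add: wave_mult_cnj cos_60)
  qed
  then have "(\<Sum>n<M. 1 / 2) \<le> (\<Sum>n<M. Re (wave n x * cnj (wave n y)))"
    by (intro sum_mono) auto
  also have "\<dots> = Re (dirichlet M x y)"
    by (simp add: dirichlet_def)
  also have "\<dots> \<le> cmod (dirichlet M x y)"
    by (rule complex_Re_le_cmod)
  finally show ?thesis by simp
qed

lemma nn_integral_inverse_square_tail: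
  fixes s x :: real
  assumes s: "0 < s"
  shows "(\<integral>\<^sup>+y. ennreal (1 / (y - x)\<^sup>2) * indicator {y. s \<le> \<bar>y - x\<bar>} y \<partial>lborel) \<le> ennreal (2 / s)"
proof -
  have 1: "(\<integral>\<^sup>+y\<in>{s..}. ennreal (1 / y\<^sup>2) \<partial>lborel) = ennreal (0 - (- 1 / s))"
  proof (rule nn_integral_FTC_atLeast[where F = "\<lambda>y. - 1 / y"])
    show "DERIV (\<lambda>y. - 1 / y) y :> 1 / y\<^sup>2" if "s \<le> y" for y
      using s that by (auto intro!: derivative_eq_intros simp: power2_eq_square)
    show "((\<lambda>y. - 1 / y :: real) \<longlongrightarrow> 0) at_top"
      by real_asymp
  qed auto
  have "(\<integral>\<^sup>+y. ennreal (1 / (y - x)\<^sup>2) * indicator {x + s..} y \<partial>lborel) =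
      ennreal \<bar>1\<bar> * (\<integral>\<^sup>+y. ennreal (1 / ((x + 1 * y) - x)\<^sup>2) * indicator {x + s..} (x + 1 * y) \<partial>lborel)"
    by (rule nn_integral_real_affine) auto
  also have "\<dots> = (\<integral>\<^sup>+y\<in>{s..}. ennreal (1 / y\<^sup>2) \<partial>lborel)"
    by (auto intro!: nn_integral_cong simp: indicator_def)
  finally have 2: "(\<integral>\<^sup>+y. ennreal (1 / (y - x)\<^sup>2) * indicator {x + s..} y \<partial>lborel) = ennreal (1 / s)"
    by (simp add: 1)
  have "(\<integral>\<^sup>+y. ennreal (1 / (y - x)\<^sup>2) * indicator {..x - s} y \<partial>lborel) =
      ennreal \<bar>-1\<bar> * (\<integral>\<^sup>+y. ennreal (1 / ((x + (-1) * y) - x)\<^sup>2) * indicator {..x - s} (x + (-1) * y) \<partial>lborel)"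
    by (rule nn_integral_real_affine) auto
  also have "\<dots> = (\<integral>\<^sup>+y\<in>{s..}. ennreal (1 / y\<^sup>2) \<partial>lborel)"
    by (auto intro!: nn_integral_cong simp: indicator_def)
  finally have 3: "(\<integral>\<^sup>+y. ennreal (1 / (y - x)\<^sup>2) * indicator {..x - s} y \<partial>lborel) = ennreal (1 / s)"
    by (simp add: 1)
  have "(\<integral>\<^sup>+y. ennreal (1 / (y - x)\<^sup>2) * indicator {y. s \<le> \<bar>y - x\<bar>} y \<partial>lborel) \<le>
    (\<integral>\<^sup>+y. ennreal (1 / (y - x)\<^sup>2) * indicator {x + s..} y + ennreal (1 / (y - x)\<^sup>2) * indicator {..x - s} y \<partial>lborel)"
    by (intro nn_integral_mono) (auto simp: indicator_def)
  also have "\<dots> = ennreal (1 / s) + ennreal (1 / s)"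
    by (subst nn_integral_add) (auto simp: 2 3)
  also have "\<dots> = ennreal (2 / s)"
    using s by (simp add: ennreal_plus[symmetric] del: ennreal_plus)
  finally show ?thesis .
qed

text \<open>The squared kernel divided by M is the Fejer kernel. On the window |y - x| < N / M it is
  enough to bound the squared kernel by M^2 and to use the Lebesgue point, which contributes 2 K N
  \<epsilon>; outside, the decay of the kernel contributes 8 K^2 / (\<delta>^2 N). Hence
  \<open>N\<close> is chosen before \<open>\<epsilon>\<close>.\<close>

lemma fejer_tendsto:
  fixes f :: "real \<Rightarrow> real"
  assumes f[measurable]: "f \<in> borel_measurable borel" and K: "\<And>y. \<bar>f y\<bar> \<le> K"
    and x: "x \<in> {0<..<1}"
    and point: "\<forall>\<epsilon>>0. \<exists>\<delta>>0. \<forall>r. 0 < r \<and> r < \<delta> \<longrightarrow>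
      (\<integral>\<^sup>+y\<in>ball x r. ennreal \<bar>f y - f x\<bar> \<partial>lborel) \<le> ennreal (\<epsilon> * r)"
  shows "(\<lambda>M. (LINT y|unit_lborel. (cmod (dirichlet M x y))\<^sup>2 * (f y - f x)\<^sup>2) / real M) \<longlonglongrightarrow> 0"
proof -
  have K0: "0 \<le> K" using K[of 0] by linarith
  have fd: "\<bar>f y - f x\<bar> \<le> 2 * K" for y
    using K[of x] K[of y] by linarith
  \<comment> \<open>Distance of \<open>x\<close> from the ends: every y in the unit interval then
    satisfies |y - x| <= 1 - \<delta>, as \<open>cmod_dirichlet_far\<close> demands.\<close>
  define \<delta> where "\<delta> = min x (1 - x)"
  have \<delta>: "0 < \<delta>" "\<delta> \<le> 1" using x by (auto simp: \<delta>_def)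
  define g where "g = (\<lambda>M y. (cmod (dirichlet M x y))\<^sup>2 * (f y - f x)\<^sup>2)"
  have g_meas[measurable]: "g M \<in> borel_measurable borel" for M
    unfolding g_def by measurable
  have dir2: "(cmod (dirichlet M x y))\<^sup>2 \<le> (real M)\<^sup>2" for M y
    by (intro power_mono cmod_dirichlet_le) auto
  have fd2: "(f y - f x)\<^sup>2 \<le> 2 * K * \<bar>f y - f x\<bar>" for y
  proof -
    have "(f y - f x)\<^sup>2 = \<bar>f y - f x\<bar> * \<bar>f y - f x\<bar>"
      by (simp add: power2_eq_square)
    also have "\<dots> \<le> 2 * K * \<bar>f y - f x\<bar>"
      by (intro mult_right_mono fd) auto
    finally show ?thesis .
  qed
  have fd4: "(f y - f x)\<^sup>2 \<le> 4 * K\<^sup>2" for y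
    using power_mono[OF fd[of y], of 2] by (simp add: power_mult_distrib)
  have g_int: "integrable unit_lborel (g M)" for M
    unfolding g_def
    by (rule unit_lborel_integrable[of _ "(real M)\<^sup>2 * (4 * K\<^sup>2)"])
      (auto simp: abs_mult intro!: mult_mono dir2 fd4)
  have bound: "(LINT y|unit_lborel. g M y) \<le> 2 * K * real N * \<epsilon> * real M + 8 * K\<^sup>2 / \<delta>\<^sup>2 / real N * real M"
    if N: "0 < N" and M: "0 < M" and \<epsilon>: "0 < \<epsilon>"
      and near: "(\<integral>\<^sup>+y\<in>ball x (real N / real M). ennreal \<bar>f y - f x\<bar> \<partial>lborel) \<le> ennreal (\<epsilon> * (real N / real M))"
    for N M :: nat and \<epsilon> :: real
  proof -
    let ?s = "real N / real M"
    have s: "0 < ?s" using N M by simp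
    let ?A = "\<lambda>y. ennreal \<bar>f y - f x\<bar> * indicator (ball x ?s) y"
    let ?B = "\<lambda>y. ennreal (1 / (y - x)\<^sup>2) * indicator {y. ?s \<le> \<bar>y - x\<bar>} y"
    have "(\<integral>\<^sup>+y. ennreal (g M y) \<partial>unit_lborel) = (\<integral>\<^sup>+y\<in>{0..1}. ennreal (g M y) \<partial>lborel)"
      by (rule nn_integral_unit_lborel) measurable
    also have "\<dots> \<le> (\<integral>\<^sup>+y. ennreal ((real M)\<^sup>2 * (2 * K)) * ?A y + ennreal (4 * K\<^sup>2 / \<delta>\<^sup>2) * ?B y \<partial>lborel)"
    proof (rule nn_integral_mono)
      fix y
      show "ennreal (g M y) * indicator {0..1} y \<le> ennreal ((real M)\<^sup>2 * (2 * K)) * ?A y + ennreal (4 * K\<^sup>2 / \<delta>\<^sup>2) * ?B y"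
      proof (cases "y \<in> {0..1}")
        case y: True
        show ?thesis
        proof (cases "\<bar>y - x\<bar> < ?s")
          case True
          have "g M y \<le> (real M)\<^sup>2 * (2 * K * \<bar>f y - f x\<bar>)"
            unfolding g_def using K0 by (intro mult_mono dir2 fd2) auto
          then have "ennreal (g M y) \<le> ennreal ((real M)\<^sup>2 * (2 * K)) * ennreal \<bar>f y - f x\<bar>"
            using K0 by (subst ennreal_mult[symmetric]) (auto simp: mult.assoc intro: ennreal_leI)
          moreover have "y \<in> ball x ?s"
            using True by (simp add: dist_real_def abs_minus_commute)
          ultimately show ?thesis
            using y True by (simp add: add_increasing2)
        next
          case False
          then have xy: "x \<noteq> y" using s by auto
          have "cmod (dirichlet M x y) \<le> 1 / (\<delta> * \<bar>y - x\<bar>)"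
            using y \<delta> xy by (intro cmod_dirichlet_far) (auto simp: \<delta>_def)
          then have "(cmod (dirichlet M x y))\<^sup>2 \<le> (1 / (\<delta> * \<bar>y - x\<bar>))\<^sup>2"
            by (intro power_mono) auto
          then have "g M y \<le> (1 / (\<delta> * \<bar>y - x\<bar>))\<^sup>2 * (4 * K\<^sup>2)"
            unfolding g_def by (intro mult_mono fd4) auto
          also have "\<dots> = (4 * K\<^sup>2 / \<delta>\<^sup>2) * (1 / (y - x)\<^sup>2)"
            by (simp add: power_divide power_mult_distrib)
          finally have "ennreal (g M y) \<le> ennreal (4 * K\<^sup>2 / \<delta>\<^sup>2) * ennreal (1 / (y - x)\<^sup>2)"
            by (subst ennreal_mult[symmetric]) (auto intro: ennreal_leI)
          then show ?thesis
            using y False by (simp add: add_increasing)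
        qed
      qed simp
    qed
    also have "\<dots> = ennreal ((real M)\<^sup>2 * (2 * K)) * (\<integral>\<^sup>+y. ?A y \<partial>lborel) + ennreal (4 * K\<^sup>2 / \<delta>\<^sup>2) * (\<integral>\<^sup>+y. ?B y \<partial>lborel)"
    proof -
      have [measurable]: "ball x ?s \<in> sets borel"
        by simp
      have "{y. ?s \<le> \<bar>y - x\<bar>} \<in> sets borel"
        by measurable
      note [measurable] = this
      have [measurable]: "?A \<in> borel_measurable lborel" "?B \<in> borel_measurable lborel"
        by measurable
      show ?thesis
        by (subst nn_integral_add) (auto simp: nn_integral_cmult)
    qed
    also have "\<dots> \<le> ennreal ((real M)\<^sup>2 * (2 * K)) * ennreal (\<epsilon> * ?s) + ennreal (4 * K\<^sup>2 / \<delta>\<^sup>2) * ennreal (2 / ?s)"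
      by (intro add_mono mult_left_mono near nn_integral_inverse_square_tail s) auto
    also have "\<dots> = ennreal ((real M)\<^sup>2 * (2 * K) * (\<epsilon> * ?s) + (4 * K\<^sup>2 / \<delta>\<^sup>2) * (2 / ?s))"
      using K0 \<epsilon> s by (subst ennreal_plus, simp, simp, subst ennreal_mult, simp, simp, subst ennreal_mult, simp, simp) simp
    also have "(real M)\<^sup>2 * (2 * K) * (\<epsilon> * ?s) + (4 * K\<^sup>2 / \<delta>\<^sup>2) * (2 / ?s)
        = 2 * K * real N * \<epsilon> * real M + 8 * K\<^sup>2 / \<delta>\<^sup>2 / real N * real M"
      using M N \<delta> by (simp add: field_simps power2_eq_square)
    finally have "ennreal (LINT y|unit_lborel. g M y) \<le> ennreal (2 * K * real N * \<epsilon> * real M + 8 * K\<^sup>2 / \<delta>\<^sup>2 / real N * real M)"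
      by (subst (asm) nn_integral_eq_integral[OF g_int]) (auto simp: g_def)
    then show ?thesis
      using K0 \<epsilon> by (subst (asm) ennreal_le_iff) auto
  qed
  have "(\<lambda>M. (LINT y|unit_lborel. g M y) / real M) \<longlonglongrightarrow> 0"
  proof (rule tendstoI)
    fix \<eta> :: real assume \<eta>: "0 < \<eta>"
    define c where "c = 8 * K\<^sup>2 / \<delta>\<^sup>2"
    have c: "0 \<le> c" by (simp add: c_def)
    obtain N where N: "0 < N" "c / real N < \<eta> / 2"
    proof -
      obtain N :: nat where "2 * c / \<eta> < real N"
        using reals_Archimedean2 by blast
      then have "c / real (Suc N) < \<eta> / 2"
        using \<eta> c by (simp add: field_simps)
      then show ?thesis using that by blast
    qed
    define \<epsilon> where "\<epsilon> = \<eta> / (4 * (K + 1) * real N)"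
    have \<epsilon>: "0 < \<epsilon>" using \<eta> K0 N by (simp add: \<epsilon>_def)
    have "2 * K * real N * \<epsilon> \<le> 2 * (K + 1) * real N * \<epsilon>"
      using \<epsilon> N by (intro mult_right_mono) auto
    also have "\<dots> = \<eta> / 2"
    proof -
      define D where "D = (K + 1) * real N"
      have "0 < D" using K0 N by (simp add: D_def)
      moreover have "2 * (K + 1) * real N * \<epsilon> = 2 * D * (\<eta> / (4 * D))"
        by (simp only: \<epsilon>_def D_def mult.assoc)
      ultimately show ?thesis by simp
    qed
    finally have small: "2 * K * real N * \<epsilon> + c / real N < \<eta>"
      using N by linarith
    from point \<epsilon> obtain d where d: "0 < d" "\<And>r. 0 < r \<Longrightarrow> r < d \<Longrightarrow>
      (\<integral>\<^sup>+y\<in>ball x r. ennreal \<bar>f y - f x\<bar> \<partial>lborel) \<le> ennreal (\<epsilon> * r)"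
      by blast
    have "(\<lambda>M. real N / real M) \<longlonglongrightarrow> 0"
      by real_asymp
    then have "\<forall>\<^sub>F M in sequentially. real N / real M < d"
      using d(1) by (rule order_tendstoD)
    then show "\<forall>\<^sub>F M in sequentially. dist ((LINT y|unit_lborel. g M y) / real M) 0 < \<eta>"
      using eventually_gt_at_top[of 0]
    proof eventually_elim
      case (elim M)
      have "(LINT y|unit_lborel. g M y) \<le> 2 * K * real N * \<epsilon> * real M + c / real N * real M"
        unfolding c_def by (intro bound d(2)) (use elim N \<epsilon> in auto)
      also have "\<dots> = (2 * K * real N * \<epsilon> + c / real N) * real M"
        by (simp add: algebra_simps)
      finally have "(LINT y|unit_lborel. g M y) / real M \<le> 2 * K * real N * \<epsilon> + c / real N"
        using elim by (simp add: field_simps)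
      moreover have "0 \<le> (LINT y|unit_lborel. g M y)"
        by (simp add: g_def)
      ultimately show ?case
        using small by simp
    qed
  qed
  then show ?thesis
    by (simp add: g_def)
qed

section \<open>Toeplitz matrices acting on steering vectors\<close>

definition toeplitz :: "(real \<Rightarrow> real) \<Rightarrow> nat \<Rightarrow> nat \<Rightarrow> complex" where
  "toeplitz f m n = (LINT y|unit_lborel. wave m y * cnj (wave n y) * complex_of_real (f y))"

definition fourier :: "(real \<Rightarrow> real) \<Rightarrow> nat \<Rightarrow> complex" where
  "fourier f m = (LINT y|unit_lborel. wave m y * complex_of_real (f y))"

text \<open>The m-th entry of the defect is the m-th Fourier coefficient of the function y -> D_M(x,
  y) (f(y) - f(x)); Bessel's inequality bounds all \<open>M\<close> of them together.\<close>

lemma toeplitz_wave_defect: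
  fixes f :: "real \<Rightarrow> real"
  assumes f[measurable]: "f \<in> borel_measurable borel" and K: "\<And>y. \<bar>f y\<bar> \<le> K"
  shows "(nrm M (\<lambda>m. (\<Sum>n<M. toeplitz f m n * wave n x) - complex_of_real (f x) * wave m x))\<^sup>2
    \<le> (LINT y|unit_lborel. (cmod (dirichlet M x y))\<^sup>2 * (f y - f x)\<^sup>2)"
proof -
  define h where "h = (\<lambda>y. dirichlet M x y * complex_of_real (f y - f x))"
  have [measurable]: "h \<in> borel_measurable borel"
    unfolding h_def by measurable
  have fd: "\<bar>f y - f x\<bar> \<le> 2 * K" for y
    using K[of x] K[of y] by linarith
  have h_bd: "cmod (h y) \<le> real M * (2 * K)" for y
    unfolding h_def norm_mult norm_of_real by (intro mult_mono cmod_dirichlet_le fd) auto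
  have i1: "integrable unit_lborel (\<lambda>y. wave m y * cnj (wave n y) * complex_of_real (f y))" for m n
    by (rule unit_lborel_integrable[of _ K]) (auto simp: norm_mult K)
  have i2: "integrable unit_lborel (\<lambda>y. wave m y * cnj (wave n y))" for m n
    by (rule unit_lborel_integrable[of _ 1]) (auto simp: norm_mult)
  have coord: "(\<Sum>n<M. toeplitz f m n * wave n x) - complex_of_real (f x) * wave m x = (LINT y|unit_lborel. wave m y * h y)"
    if "m < M" for m
  proof -
    have "wave m y * h y = (\<Sum>n<M. (wave m y * cnj (wave n y) * complex_of_real (f y)) * wave n x
        - complex_of_real (f x) * wave n x * (wave m y * cnj (wave n y)))" for y
      by (simp add: h_def dirichlet_def sum_distrib_left sum_distrib_right sum_subtractf algebra_simps)
    then have "(LINT y|unit_lborel. wave m y * h y) = (LINT y|unit_lborel. (\<Sum>n<M. (wave m y * cnj (wave n y) * complex_of_real (f y)) * wave n x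
        - complex_of_real (f x) * wave n x * (wave m y * cnj (wave n y))))"
      by simp
    also have "\<dots> = (\<Sum>n<M. LINT y|unit_lborel. (wave m y * cnj (wave n y) * complex_of_real (f y)) * wave n x
        - complex_of_real (f x) * wave n x * (wave m y * cnj (wave n y)))"
      by (rule Bochner_Integration.integral_sum, rule Bochner_Integration.integrable_diff, rule integrable_mult_left, rule i1, rule integrable_mult_right, rule i2)
    also have "\<dots> = (\<Sum>n<M. toeplitz f m n * wave n x - complex_of_real (f x) * wave n x * (if m = n then 1 else 0))"
    proof (rule sum.cong[OF refl])
      fix n
      have "(LINT y|unit_lborel. (wave m y * cnj (wave n y) * complex_of_real (f y)) * wave n x
          - complex_of_real (f x) * wave n x * (wave m y * cnj (wave n y))) =
         (LINT y|unit_lborel. (wave m y * cnj (wave n y) * complex_of_real (f y)) * wave n x)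
          - (LINT y|unit_lborel. complex_of_real (f x) * wave n x * (wave m y * cnj (wave n y)))"
        by (rule Bochner_Integration.integral_diff, rule integrable_mult_left, rule i1, rule integrable_mult_right, rule i2)
      then show "(LINT y|unit_lborel. (wave m y * cnj (wave n y) * complex_of_real (f y)) * wave n x
          - complex_of_real (f x) * wave n x * (wave m y * cnj (wave n y))) =
          toeplitz f m n * wave n x - complex_of_real (f x) * wave n x * (if m = n then 1 else 0)"
        by (simp only: integral_mult_left_zero integral_mult_right_zero wave_orthonormal toeplitz_def)
    qed
    also have "\<dots> = (\<Sum>n<M. toeplitz f m n * wave n x) - complex_of_real (f x) * wave m x"
      using that by (simp add: sum_subtractf if_distrib[of "\<lambda>a. _ * a"] cong: if_cong)
    finally show ?thesis by simp
  qed
  have "(nrm M (\<lambda>m. (\<Sum>n<M. toeplitz f m n * wave n x) - complex_of_real (f x) * wave m x))\<^sup>2 = (\<Sum>m<M. (cmod (LINT y|unit_lborel. wave m y * h y))\<^sup>2)"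
    unfolding nrm_sq_sum by (intro sum.cong refl) (simp add: coord)
  also have "\<dots> \<le> (LINT y|unit_lborel. (cmod (h y))\<^sup>2)"
    by (rule bessel[OF _ h_bd]) measurable
  also have "\<dots> = (LINT y|unit_lborel. (cmod (dirichlet M x y))\<^sup>2 * (f y - f x)\<^sup>2)"
    by (simp add: h_def norm_mult power_mult_distrib del: of_real_diff)
  finally show ?thesis .
qed

text \<open>The steering vector has squared norm \<open>M\<close>, so the limit makes it an
  approximate eigenvector whose relative error tends to zero.\<close>

theorem toeplitz_wave_approx:
  fixes f :: "real \<Rightarrow> real"
  assumes f: "f \<in> borel_measurable borel" and K: "\<And>y. \<bar>f y\<bar> \<le> K"
  shows "AE x in lborel. x \<in> {0<..<1} \<longrightarrow>
    (\<lambda>M. (nrm M (\<lambda>m. (\<Sum>n<M. toeplitz f m n * wave n x) - complex_of_real (f x) * wave m x))\<^sup>2 / real M) \<longlonglongrightarrow> 0"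
  using lebesgue_points_bounded[OF f K]
proof (rule AE_mp, intro AE_I2 impI)
  fix x assume "\<forall>\<epsilon>>0. \<exists>\<delta>>0. \<forall>r. 0 < r \<and> r < \<delta> \<longrightarrow>
      (\<integral>\<^sup>+y\<in>ball x r. ennreal \<bar>f y - f x\<bar> \<partial>lborel) \<le> ennreal (\<epsilon> * r)" "x \<in> {0<..<1}"
  from fejer_tendsto[OF f K this(2,1)]
  show "(\<lambda>M. (nrm M (\<lambda>m. (\<Sum>n<M. toeplitz f m n * wave n x) - complex_of_real (f x) * wave m x))\<^sup>2 / real M) \<longlonglongrightarrow> 0"
    by (rule tendsto_sandwich[rotated 2, OF tendsto_const])
      (auto intro!: always_eventually divide_right_mono toeplitz_wave_defect[OF f K])
qed

text \<open>By Bessel's inequality the bound does not depend on \<open>M\<close>, whereas steering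
  vectors have norm sqrt M. This is why a rank-one matrix built from these coefficients is
  negligible on steering vectors.\<close>

lemma nrm_fourier:
  fixes f :: "real \<Rightarrow> real"
  assumes f[measurable]: "f \<in> borel_measurable borel" and K: "\<And>y. \<bar>f y\<bar> \<le> K"
  shows "nrm M (fourier f) \<le> K"
proof -
  have K0: "0 \<le> K" using K[of 0] by linarith
  have "(nrm M (fourier f))\<^sup>2 \<le> (LINT y|unit_lborel. (cmod (complex_of_real (f y)))\<^sup>2)"
    unfolding nrm_sq_sum fourier_def using K by (intro bessel) auto
  also have "\<dots> \<le> (LINT y|unit_lborel. K\<^sup>2)"
  proof (rule integral_mono)
    have 2: "(f y)\<^sup>2 \<le> K\<^sup>2" for y
      using power_mono[OF K[of y], of 2] by simp
    then show "integrable unit_lborel (\<lambda>y. (cmod (complex_of_real (f y)))\<^sup>2)"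
      by (intro unit_lborel_integrable[of _ "K\<^sup>2"]) auto
    show "(cmod (complex_of_real (f y)))\<^sup>2 \<le> K\<^sup>2" for y
      using 2 by simp
  qed simp
  also have "\<dots> = K\<^sup>2"
    using unit_lborel.prob_space by simp
  finally show ?thesis
    using K0 by (rule power2_le_imp_le)
qed

text \<open>Cut the sum where the tail of \<open>c\<close> has l2-norm at most \<epsilon> / 2. The
  head is bounded by a constant, lost after division by sqrt M, and Cauchy-Schwarz bounds the tail
  by sqrt M \<epsilon> / 2.\<close>

lemma ip_square_summable:
  assumes c: "\<And>M. nrm M c \<le> K" and w: "\<And>m. cmod (w m) \<le> 1"
  shows "(\<lambda>M. cmod (ip M w c) / sqrt (real M)) \<longlonglongrightarrow> 0"
proof (rule tendstoI)
  fix \<epsilon> :: real assume \<epsilon>: "0 < \<epsilon>"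
  have "summable (\<lambda>m. (cmod (c m))\<^sup>2)"
  proof (rule bounded_imp_summable)
    fix n
    have "(nrm (Suc n) c)\<^sup>2 \<le> K\<^sup>2"
      by (intro power_mono c) simp
    then show "(\<Sum>k\<le>n. (cmod (c k))\<^sup>2) \<le> K\<^sup>2"
      by (simp only: nrm_sq_sum lessThan_Suc_atMost)
  qed auto
  from summable_partial_sum_bound[OF this, of "(\<epsilon> / 2)\<^sup>2"] \<epsilon>
  obtain m0 where m0: "\<And>a b. a \<ge> m0 \<Longrightarrow> norm (\<Sum>k=a..b. (cmod (c k))\<^sup>2) < (\<epsilon> / 2)\<^sup>2"
    by (auto simp: zero_less_power)
  define A where "A = (\<Sum>m<m0. cmod (c m))"
  have bound: "cmod (ip M w c) \<le> A + sqrt (real M) * (\<epsilon> / 2)" if M: "m0 < M" for M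
  proof -
    have "cmod (ip M w c) \<le> (\<Sum>m<M. cmod (c m))"
      unfolding ip_def
      by (rule order.trans[OF norm_sum], intro sum_mono) (simp add: norm_mult mult_left_le_one_le w)
    also have "\<dots> = A + (\<Sum>m=m0..<M. cmod (c m))"
      unfolding A_def using M by (simp add: sum.atLeastLessThan_concat lessThan_atLeast0)
    also have "(\<Sum>m=m0..<M. cmod (c m)) = (\<Sum>m=m0..<M. \<bar>1\<bar> * \<bar>cmod (c m)\<bar>)"
      by simp
    also have "\<dots> \<le> L2_set (\<lambda>_. 1) {m0..<M} * L2_set (\<lambda>m. cmod (c m)) {m0..<M}"
      by (rule L2_set_mult_ineq)
    also have "\<dots> \<le> sqrt (real M) * (\<epsilon> / 2)"
    proof (rule mult_mono)
      show "L2_set (\<lambda>_. 1) {m0..<M} \<le> sqrt (real M)"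
        by (simp add: L2_set_def)
      have "{m0..<M} = {m0..M - 1}"
        using M by auto
      then have "(\<Sum>k=m0..<M. (cmod (c k))\<^sup>2) \<le> (\<epsilon> / 2)\<^sup>2"
        using m0[of m0 "M - 1"] by (simp add: sum_nonneg)
      then show "L2_set (\<lambda>m. cmod (c m)) {m0..<M} \<le> \<epsilon> / 2"
        unfolding L2_set_def using \<epsilon> by (intro real_le_lsqrt) auto
    qed auto
    finally show ?thesis by simp
  qed
  have "(\<lambda>M. A / sqrt (real M)) \<longlonglongrightarrow> 0"
    by real_asymp
  then have "\<forall>\<^sub>F M in sequentially. A / sqrt (real M) < \<epsilon> / 2"
    using \<epsilon> by (intro order_tendstoD) auto
  then show "\<forall>\<^sub>F M in sequentially. dist (cmod (ip M w c) / sqrt (real M)) 0 < \<epsilon>"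
    using eventually_gt_at_top[of m0]
  proof eventually_elim
    case (elim M)
    then have "0 < sqrt (real M)" by simp
    then have "cmod (ip M w c) / sqrt (real M) \<le> A / sqrt (real M) + \<epsilon> / 2"
      using bound[OF elim(2)] by (simp add: field_simps)
    moreover have "0 \<le> cmod (ip M w c) / sqrt (real M)"
      by simp
    ultimately show ?case
      unfolding dist_real_def using elim(1) by linarith
  qed
qed

text \<open>At distance at most 1 / (6 M) from x the kernel has modulus at least M / 2, so such a
  ball has mass at most 4 C / M: the mass of short intervals is bounded by a multiple of their
  length. Vitali's covering lemma extends this to open sets and outer regularity to Borel sets. The
  Radon-Nikodym theorem then gives a density, essentially bounded by 120 C.\<close>

lemma density_of_dirichlet_bound:
  fixes \<nu> :: "real measure"
  assumes "prob_space \<nu>" and sets_\<nu>: "sets \<nu> = sets borel" and supp: "emeasure \<nu> (- {0..1}) = 0"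
    and C: "\<And>M x. 0 < M \<Longrightarrow> (LINT y|\<nu>. (cmod (dirichlet M x y))\<^sup>2) \<le> C * real M"
  shows "\<exists>f K. f \<in> borel_measurable borel \<and> (\<forall>y. 0 \<le> f y \<and> f y \<le> K) \<and> \<nu> = mdensity unit_lborel (\<lambda>y. ennreal (f y))"
proof -
  interpret prob_space \<nu> by fact
  have space_\<nu>: "space \<nu> = UNIV"
    using sets_eq_imp_space_eq[OF sets_\<nu>] by simp
  note [measurable_cong] = sets_\<nu>
  have [measurable]: "ball y s \<in> sets borel" for y s :: real
    by simp
  have C0: "0 \<le> C"
  proof -
    have "0 \<le> (LINT y|\<nu>. (cmod (dirichlet 1 0 y))\<^sup>2)"
      by (rule Bochner_Integration.integral_nonneg) simp
    also have "\<dots> \<le> C * real 1"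
      by (rule C) simp
    finally show ?thesis by simp
  qed
  have ball1: "measure \<nu> (cball x (1 / (6 * real M))) \<le> 4 * C / real M" if M: "0 < M" for x M
  proof -
    let ?B = "cball x (1 / (6 * real M))"
    have "(real M / 2)\<^sup>2 * measure \<nu> ?B = (LINT y|\<nu>. (real M / 2)\<^sup>2 * indicator ?B y)"
      by (simp add: space_\<nu>)
    also have "\<dots> \<le> (LINT y|\<nu>. (cmod (dirichlet M x y))\<^sup>2)"
    proof (rule integral_mono)
      show "integrable \<nu> (\<lambda>y. (real M / 2)\<^sup>2 * indicator ?B y)"
        by (rule integrable_const_bound[of _ "(real M / 2)\<^sup>2"]) (auto simp: indicator_def)
      show "integrable \<nu> (\<lambda>y. (cmod (dirichlet M x y))\<^sup>2)"
        by (rule integrable_const_bound[of _ "(real M)\<^sup>2"]) (auto intro!: power_mono cmod_dirichlet_le)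
      fix y
      show "(real M / 2)\<^sup>2 * indicator ?B y \<le> (cmod (dirichlet M x y))\<^sup>2"
      proof (cases "y \<in> ?B")
        case True
        then have "real M / 2 \<le> cmod (dirichlet M x y)"
          using M by (intro cmod_dirichlet_near) (auto simp: dist_real_def abs_minus_commute)
        then have "(real M / 2)\<^sup>2 \<le> (cmod (dirichlet M x y))\<^sup>2"
          by (intro power_mono) auto
        then show ?thesis using True by simp
      qed simp
    qed
    also have "\<dots> \<le> C * real M"
      by (rule C[OF M])
    finally have "real M * (real M * measure \<nu> ?B) \<le> real M * (4 * C)"
      by (simp add: power2_eq_square field_simps)
    then show ?thesis
      using M by (simp add: field_simps)
  qed
  have ball2: "emeasure \<nu> (ball x (5 * r)) \<le> ennreal (120 * C) * emeasure lborel (ball x r)" if r: "0 < r" "r \<le> 1 / 30" for x r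
  proof -
    \<comment> \<open>The largest \<open>M\<close> with 5 r <= 1 / (6 M). It exceeds 1 / (60 r),
      whence 4 C / M <= 120 C * 2 r, and r <= 1 / 30 keeps it positive. The factor 5 anticipates the
      covering lemma, which enlarges balls five times.\<close>
    define M where "M = nat \<lfloor>1 / (30 * r)\<rfloor>"
    have "1 \<le> 1 / (30 * r)" using r by (simp add: field_simps)
    then have fl: "1 \<le> \<lfloor>1 / (30 * r)\<rfloor>" by simp
    then have "int M = \<lfloor>1 / (30 * r)\<rfloor>" unfolding M_def by linarith
    with fl have M: "0 < M" "real M = \<lfloor>1 / (30 * r)\<rfloor>" by linarith+
    have M1: "real M \<le> 1 / (30 * r)" using M by simp
    have "1 / (30 * r) < real M + 1" unfolding M(2) by linarith
    also have "\<dots> \<le> 2 * real M" using M(1) by simp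
    finally have M2: "1 / (30 * r) < 2 * real M" .
    have "5 * r \<le> 1 / (6 * real M)"
      using M1 M(1) r by (simp add: field_simps)
    then have "measure \<nu> (ball x (5 * r)) \<le> measure \<nu> (cball x (1 / (6 * real M)))"
      by (intro finite_measure_mono) (auto simp: sets_\<nu>)
    also have "\<dots> \<le> 4 * C * (1 / real M)"
      using ball1[OF M(1), of x] by simp
    also have "\<dots> \<le> 4 * C * (60 * r)"
      using M2 M(1) r C0 by (intro mult_left_mono) (auto simp: field_simps)
    finally have "measure \<nu> (ball x (5 * r)) \<le> 120 * C * (2 * r)" by simp
    then have "emeasure \<nu> (ball x (5 * r)) \<le> ennreal (120 * C * (2 * r))"
      by (simp add: emeasure_eq_measure ennreal_leI)
    also have "\<dots> = ennreal (120 * C) * emeasure lborel (ball x r)"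
    proof -
      have "emeasure lborel (ball x r) = ennreal (2 * r)"
        using r by (subst ball_eq_greaterThanLessThan, subst emeasure_lborel_Ioo) auto
      then show ?thesis
        using r C0 by (simp only:) (rule ennreal_mult, auto)
    qed
    finally show ?thesis .
  qed
  have open_bound: "emeasure \<nu> U \<le> ennreal (120 * C) * emeasure lborel U" if U: "open U" for U
  proof -
    have "\<exists>r. 0 < r \<and> r \<le> 1 / 30 \<and> ball x r \<subseteq> U" if "x \<in> U" for x
    proof -
      obtain e where "0 < e" "ball x e \<subseteq> U" using U \<open>x \<in> U\<close> openE by blast
      then show ?thesis
        by (intro exI[of _ "min e (1 / 30)"]) auto
    qed
    then obtain r where r: "\<And>x. x \<in> U \<Longrightarrow> 0 < r x \<and> r x \<le> 1 / 30" and rU: "\<And>x. x \<in> U \<Longrightarrow> ball x (r x) \<subseteq> U"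
      by metis
    have "U \<subseteq> (\<Union>x\<in>U. ball x (r x))"
      using r by force
    from Vitali_covering_lemma_balls[OF this r]
    obtain I where I: "countable I" "I \<subseteq> U" "pairwise (\<lambda>i j. disjnt (ball i (r i)) (ball j (r j))) I"
      and UI: "U \<subseteq> (\<Union>i\<in>I. ball i (5 * r i))"
      by blast
    have "emeasure \<nu> U \<le> emeasure \<nu> (\<Union>i\<in>I. ball i (5 * r i))"
      using UI by (intro emeasure_mono) (auto simp: sets_\<nu> intro!: borel_open open_UN)
    also have "\<dots> = (\<integral>\<^sup>+y. indicator (\<Union>i\<in>I. ball i (5 * r i)) y \<partial>\<nu>)"
      by (rule nn_integral_indicator[symmetric]) (auto simp: sets_\<nu> intro!: borel_open open_UN)
    also have "\<dots> \<le> (\<integral>\<^sup>+y. (\<integral>\<^sup>+i. indicator (ball i (5 * r i)) y \<partial>count_space I) \<partial>\<nu>)"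
    proof (rule nn_integral_mono)
      fix y
      show "indicator (\<Union>i\<in>I. ball i (5 * r i)) y \<le> (\<integral>\<^sup>+i. indicator (ball i (5 * r i)) y \<partial>count_space I)"
      proof (cases "y \<in> (\<Union>i\<in>I. ball i (5 * r i))")
        case True
        then obtain i where i: "i \<in> I" "y \<in> ball i (5 * r i)" by blast
        have "(1::ennreal) = indicator (ball i (5 * r i)) y" using i by simp
        also have "\<dots> \<le> (\<integral>\<^sup>+i. indicator (ball i (5 * r i)) y \<partial>count_space I)"
          using i(1) by (rule nn_integral_ge_point)
        finally show ?thesis using True by simp
      qed simp
    qed
    also have "\<dots> = (\<integral>\<^sup>+i. (\<integral>\<^sup>+y. indicator (ball i (5 * r i)) y \<partial>\<nu>) \<partial>count_space I)"
      using I(1) by (rule nn_integral_count_space_nn_integral) measurable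
    also have "\<dots> = (\<integral>\<^sup>+i. emeasure \<nu> (ball i (5 * r i)) \<partial>count_space I)"
      by (simp add: sets_\<nu>)
    also have "\<dots> \<le> (\<integral>\<^sup>+i. ennreal (120 * C) * emeasure lborel (ball i (r i)) \<partial>count_space I)"
      using I(2) r by (intro nn_integral_mono ball2) auto
    also have "\<dots> = ennreal (120 * C) * (\<integral>\<^sup>+i. emeasure lborel (ball i (r i)) \<partial>count_space I)"
      by (rule nn_integral_cmult) auto
    also have "(\<integral>\<^sup>+i. emeasure lborel (ball i (r i)) \<partial>count_space I) = emeasure lborel (\<Union>i\<in>I. ball i (r i))"
      using I by (intro emeasure_UN_countable[symmetric]) (auto simp: disjoint_family_on_def pairwise_def disjnt_def)
    also have "\<dots> \<le> emeasure lborel U"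
    proof (rule emeasure_mono)
      show "(\<Union>i\<in>I. ball i (r i)) \<subseteq> U"
        using rU I(2) by blast
    qed (use U in simp)
    finally show ?thesis
      by (simp add: mult_left_mono)
  qed
  have bound: "emeasure \<nu> B \<le> ennreal (120 * C) * emeasure unit_lborel B" if B: "B \<in> sets borel" for B
  proof -
    have unitB: "emeasure unit_lborel B = emeasure lborel (B \<inter> {0..1})"
      using B unfolding unit_lborel_def by (subst emeasure_density) (auto simp: mult.commute intro!: arg_cong2[of _ _ _ _ emeasure] simp flip: indicator_inter_arith)
    have "emeasure \<nu> B \<le> emeasure \<nu> ((B \<inter> {0..1}) \<union> - {0..1})"
      using B by (intro emeasure_mono) (auto simp: sets_\<nu>)
    also have "\<dots> \<le> emeasure \<nu> (B \<inter> {0..1}) + emeasure \<nu> (- {0..1})"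
      using B by (intro emeasure_subadditive) (auto simp: sets_\<nu>)
    finally have 1: "emeasure \<nu> B \<le> emeasure \<nu> (B \<inter> {0..1})"
      using supp by simp
    have 2: "emeasure \<nu> (B \<inter> {0..1}) \<le> ennreal (120 * C) * emeasure lborel (B \<inter> {0..1}) + ennreal e" if e: "0 < e" for e
    proof -
      define e' where "e' = e / (120 * C + 1)"
      have e': "0 < e'" using e C0 by (simp add: e'_def)
      obtain U where U: "open U" "B \<inter> {0..1} \<subseteq> U" "emeasure lborel (U - B \<inter> {0..1}) < e'"
        using outer_regular_lborel[of "B \<inter> {0..1}" e'] B e' by auto
      have "emeasure \<nu> (B \<inter> {0..1}) \<le> emeasure \<nu> U"
        using U by (intro emeasure_mono) (auto simp: sets_\<nu>)
      also have "\<dots> \<le> ennreal (120 * C) * emeasure lborel U"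
        by (rule open_bound[OF U(1)])
      also have "emeasure lborel U \<le> emeasure lborel ((B \<inter> {0..1}) \<union> (U - B \<inter> {0..1}))"
        using B U(1) by (intro emeasure_mono) auto
      also have "\<dots> \<le> emeasure lborel (B \<inter> {0..1}) + emeasure lborel (U - B \<inter> {0..1})"
        using B U(1) by (intro emeasure_subadditive) auto
      also have "\<dots> \<le> emeasure lborel (B \<inter> {0..1}) + ennreal e'"
        using U(3) by (intro add_left_mono) simp
      finally have "emeasure \<nu> (B \<inter> {0..1}) \<le> ennreal (120 * C) * (emeasure lborel (B \<inter> {0..1}) + ennreal e')"
        by (simp add: mult_left_mono)
      also have "\<dots> = ennreal (120 * C) * emeasure lborel (B \<inter> {0..1}) + ennreal (120 * C * e')"
        using C0 e' by (simp add: distrib_left ennreal_mult')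
      also have "120 * C * e' \<le> e"
        using C0 e by (simp add: e'_def field_simps)
      finally show ?thesis
        using e by (simp add: add_left_mono ennreal_leI)
    qed
    have "emeasure \<nu> (B \<inter> {0..1}) \<le> ennreal (120 * C) * emeasure lborel (B \<inter> {0..1})"
      by (rule ennreal_le_epsilon) (rule 2)
    with 1 unitB show ?thesis by simp
  qed
  have "absolutely_continuous unit_lborel \<nu>"
    unfolding absolutely_continuous_def
  proof
    fix B assume "B \<in> null_sets unit_lborel"
    then show "B \<in> null_sets \<nu>"
      using bound[of B] by (auto simp: null_sets_def sets_\<nu>)
  qed
  then obtain g where g[measurable]: "g \<in> borel_measurable unit_lborel" and \<nu>: "mdensity unit_lborel g = \<nu>"
    using unit_lborel.Radon_Nikodym[of \<nu>] by (auto simp: sets_\<nu>)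
  define K where "K = 120 * C"
  have K0: "0 \<le> K" using C0 by (simp add: K_def)
  \<comment> \<open>A level set B on which the density is at least K + e satisfies (K + e) |B| <= K
    |B|, so it is null; the countably many values e = 1 / (n + 1) suffice.\<close>
  have "AE y in unit_lborel. \<forall>n::nat. g y < ennreal (K + 1 / Suc n)"
    unfolding AE_all_countable
  proof
    fix n :: nat
    define e where "e = 1 / real (Suc n)"
    have e: "0 < e" by (simp add: e_def)
    define B where "B = {y. ennreal (K + e) \<le> g y}"
    have B: "B \<in> sets borel"
    proof -
      have "g \<in> borel_measurable borel" using g by simp
      then show ?thesis unfolding B_def by measurable
    qed
    have "ennreal (K + e) * emeasure unit_lborel B = (\<integral>\<^sup>+y. ennreal (K + e) * indicator B y \<partial>unit_lborel)"
      by (rule nn_integral_cmult_indicator[symmetric]) (use B in simp)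
    also have "\<dots> \<le> (\<integral>\<^sup>+y. g y * indicator B y \<partial>unit_lborel)"
      by (intro nn_integral_mono) (auto simp: B_def indicator_def)
    also have "\<dots> = emeasure (mdensity unit_lborel g) B"
      by (rule emeasure_density[symmetric]) (use B in simp_all)
    also have "\<dots> = emeasure \<nu> B"
      by (simp only: \<nu>)
    also have "\<dots> \<le> ennreal K * emeasure unit_lborel B"
      unfolding K_def by (rule bound[OF B])
    finally have "ennreal ((K + e) * measure unit_lborel B) \<le> ennreal (K * measure unit_lborel B)"
      using K0 e by (simp add: unit_lborel.emeasure_eq_measure ennreal_mult)
    then have "measure unit_lborel B \<le> 0"
      using K0 e by (subst (asm) ennreal_le_iff) (auto simp: distrib_right mult_le_0_iff less_le)
    then have "measure unit_lborel B = 0"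
      using measure_nonneg[of unit_lborel B] by linarith
    then have "B \<in> null_sets unit_lborel"
      using B by (auto simp: null_sets_def unit_lborel.emeasure_eq_measure)
    then have "AE y in unit_lborel. y \<notin> B"
      by (rule AE_not_in)
    then show "AE y in unit_lborel. g y < ennreal (K + 1 / Suc n)"
      by (rule AE_mp) (auto simp: B_def e_def not_le)
  qed
  then have AE_K: "AE y in unit_lborel. g y \<le> ennreal K"
  proof (rule AE_mp, intro AE_I2 impI)
    fix y assume *: "\<forall>n::nat. g y < ennreal (K + 1 / Suc n)"
    show "g y \<le> ennreal K"
    proof (rule ennreal_le_epsilon)
      fix e :: real assume "0 < e"
      then obtain n where "1 / real (Suc n) < e"
        by (rule nat_approx_posE)
      have "g y \<le> ennreal (K + 1 / Suc n)"
        using * by (simp add: less_imp_le)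
      also have "\<dots> \<le> ennreal (K + e)"
        using \<open>1 / real (Suc n) < e\<close> by (intro ennreal_leI) simp
      also have "\<dots> = ennreal K + ennreal e"
        using K0 \<open>0 < e\<close> by (intro ennreal_plus) auto
      finally show "g y \<le> ennreal K + ennreal e" .
    qed
  qed
  \<comment> \<open>Truncation makes the bound hold everywhere and changes the density on a null set
    only.\<close>
  define f where "f = (\<lambda>y. enn2real (min (g y) (ennreal K)))"
  have "f \<in> borel_measurable borel"
  proof -
    have "g \<in> borel_measurable borel" using g by simp
    then show ?thesis unfolding f_def by measurable
  qed
  moreover have "0 \<le> f y \<and> f y \<le> K" for y
    unfolding f_def using K0 by (auto intro: enn2real_leI)
  moreover have "\<nu> = mdensity unit_lborel (\<lambda>y. ennreal (f y))"
    unfolding \<nu>[symmetric]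
  proof (rule density_cong)
    show "AE y in unit_lborel. g y = ennreal (f y)"
      using AE_K by (rule AE_mp) (auto intro!: AE_I2 simp: f_def min_def ennreal_enn2real top.not_eq_extremum order.strict_trans1)
  qed (use g \<open>f \<in> _\<close> in auto)
  ultimately show ?thesis
    by blast
qed

section \<open>Laws of large numbers\<close>

context prob_space
begin

text \<open>By monotone convergence the sum has finite expectation, hence is almost surely finite.
  It plays the role of the Borel-Cantelli lemma in the limit theorems below.\<close>

lemma AE_summable:
  fixes Y :: "nat \<Rightarrow> 'a \<Rightarrow> real"
  assumes int: "\<And>n. integrable M (Y n)" and nn: "\<And>n \<omega>. 0 \<le> Y n \<omega>"
    and sum: "summable (\<lambda>n. expectation (Y n))"
  shows "AE \<omega> in M. summable (\<lambda>n. Y n \<omega>)"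
proof -
  have [measurable]: "Y n \<in> borel_measurable M" for n
    using int by auto
  have "(\<integral>\<^sup>+\<omega>. (\<Sum>n. ennreal (Y n \<omega>)) \<partial>M) = (\<Sum>n. \<integral>\<^sup>+\<omega>. ennreal (Y n \<omega>) \<partial>M)"
    by (rule nn_integral_suminf) measurable
  also have "\<dots> = (\<Sum>n. ennreal (expectation (Y n)))"
    by (subst nn_integral_eq_integral[OF int]) (auto simp: nn)
  also have "\<dots> = ennreal (\<Sum>n. expectation (Y n))"
    by (rule suminf_ennreal2) (auto simp: sum nn)
  also have "\<dots> \<noteq> \<infinity>"
    by simp
  finally have "AE \<omega> in M. (\<Sum>n. ennreal (Y n \<omega>)) \<noteq> \<infinity>"
    by (intro nn_integral_PInf_AE) auto
  then show ?thesis
    by (rule AE_mp) (auto intro!: AE_I2 summable_suminf_not_top nn)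
qed

lemma integrable_mult_cnj:
  fixes X Y :: "'a \<Rightarrow> complex"
  assumes [measurable]: "X \<in> borel_measurable M" "Y \<in> borel_measurable M"
    and "integrable M (\<lambda>\<omega>. (cmod (X \<omega>))\<^sup>2)" "integrable M (\<lambda>\<omega>. (cmod (Y \<omega>))\<^sup>2)"
  shows "integrable M (\<lambda>\<omega>. X \<omega> * cnj (Y \<omega>))"
proof (rule Bochner_Integration.integrable_bound)
  show "integrable M (\<lambda>\<omega>. (cmod (X \<omega>))\<^sup>2 + (cmod (Y \<omega>))\<^sup>2)"
    using assms by simp
  have "cmod (X \<omega>) * cmod (Y \<omega>) \<le> (cmod (X \<omega>))\<^sup>2 + (cmod (Y \<omega>))\<^sup>2" for \<omega>
  proof -
    have "2 * (cmod (X \<omega>) * cmod (Y \<omega>)) \<le> (cmod (X \<omega>))\<^sup>2 + (cmod (Y \<omega>))\<^sup>2"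
      using sum_squares_bound[of "cmod (X \<omega>)" "cmod (Y \<omega>)"] by (simp add: mult.assoc)
    moreover have "0 \<le> cmod (X \<omega>) * cmod (Y \<omega>)" by simp
    ultimately show ?thesis by linarith
  qed
  then show "AE \<omega> in M. norm (X \<omega> * cnj (Y \<omega>)) \<le> norm ((cmod (X \<omega>))\<^sup>2 + (cmod (Y \<omega>))\<^sup>2)"
    by (simp add: norm_mult)
qed measurable

lemma second_moment_uncorrelated:
  fixes X :: "'i \<Rightarrow> 'a \<Rightarrow> complex"
  assumes I: "finite I" and X: "\<And>i. i \<in> I \<Longrightarrow> X i \<in> borel_measurable M"
    and sq: "\<And>i. i \<in> I \<Longrightarrow> integrable M (\<lambda>\<omega>. (cmod (X i \<omega>))\<^sup>2)"
    and unc: "\<And>i j. i \<in> I \<Longrightarrow> j \<in> I \<Longrightarrow> i \<noteq> j \<Longrightarrow> expectation (\<lambda>\<omega>. X i \<omega> * cnj (X j \<omega>)) = 0"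
  shows "integrable M (\<lambda>\<omega>. (cmod (\<Sum>i\<in>I. X i \<omega>))\<^sup>2)"
    "expectation (\<lambda>\<omega>. (cmod (\<Sum>i\<in>I. X i \<omega>))\<^sup>2) = (\<Sum>i\<in>I. expectation (\<lambda>\<omega>. (cmod (X i \<omega>))\<^sup>2))"
proof -
  have int: "integrable M (\<lambda>\<omega>. X i \<omega> * cnj (X j \<omega>))" if "i \<in> I" "j \<in> I" for i j
    using that by (intro integrable_mult_cnj X sq)
  have eq: "complex_of_real ((cmod (\<Sum>i\<in>I. X i \<omega>))\<^sup>2) = (\<Sum>i\<in>I. \<Sum>j\<in>I. X i \<omega> * cnj (X j \<omega>))" for \<omega>
    by (simp only: complex_norm_square cnj_sum sum_product)
  have intc: "integrable M (\<lambda>\<omega>. complex_of_real ((cmod (\<Sum>i\<in>I. X i \<omega>))\<^sup>2))"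
    unfolding eq by (intro Bochner_Integration.integrable_sum int)
  then show "integrable M (\<lambda>\<omega>. (cmod (\<Sum>i\<in>I. X i \<omega>))\<^sup>2)"
    using integrable_Re[OF intc] by simp
  have "complex_of_real (expectation (\<lambda>\<omega>. (cmod (\<Sum>i\<in>I. X i \<omega>))\<^sup>2)) = expectation (\<lambda>\<omega>. \<Sum>i\<in>I. \<Sum>j\<in>I. X i \<omega> * cnj (X j \<omega>))"
    by (simp only: integral_complex_of_real[symmetric] eq)
  also have "\<dots> = (\<Sum>i\<in>I. \<Sum>j\<in>I. expectation (\<lambda>\<omega>. X i \<omega> * cnj (X j \<omega>)))"
    by (subst Bochner_Integration.integral_sum, intro Bochner_Integration.integrable_sum int, assumption+,
        intro sum.cong refl, subst Bochner_Integration.integral_sum, intro int, assumption+, rule refl)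
  also have "\<dots> = (\<Sum>i\<in>I. \<Sum>j\<in>I. if i = j then complex_of_real (expectation (\<lambda>\<omega>. (cmod (X i \<omega>))\<^sup>2)) else 0)"
    by (intro sum.cong refl) (auto simp: unc integral_complex_of_real[symmetric] complex_norm_square simp del: of_real_power integral_complex_of_real)
  also have "\<dots> = complex_of_real (\<Sum>i\<in>I. expectation (\<lambda>\<omega>. (cmod (X i \<omega>))\<^sup>2))"
    using I by simp
  finally show "expectation (\<lambda>\<omega>. (cmod (\<Sum>i\<in>I. X i \<omega>))\<^sup>2) = (\<Sum>i\<in>I. expectation (\<lambda>\<omega>. (cmod (X i \<omega>))\<^sup>2))"
    by (simp only: of_real_eq_iff)
qed

end

text \<open>Between consecutive squares the partial sums are controlled by the sum of the moduli.\<close>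

lemma average_tendsto_zero_squares:
  fixes x :: "nat \<Rightarrow> complex"
  assumes 1: "(\<lambda>k. cmod (\<Sum>m<(Suc k)\<^sup>2. x m) / real ((Suc k)\<^sup>2)) \<longlonglongrightarrow> 0"
    and 2: "(\<lambda>k. (\<Sum>m=(Suc k)\<^sup>2..<(Suc (Suc k))\<^sup>2. cmod (x m)) / real ((Suc k)\<^sup>2)) \<longlonglongrightarrow> 0"
  shows "(\<lambda>M. (\<Sum>m<M. x m) / of_nat M) \<longlonglongrightarrow> 0"
proof (rule tendstoI)
  fix e :: real assume e: "0 < e"
  have "\<forall>\<^sub>F k in sequentially. cmod (\<Sum>m<(Suc k)\<^sup>2. x m) / real ((Suc k)\<^sup>2) < e / 2 \<and>
      (\<Sum>m=(Suc k)\<^sup>2..<(Suc (Suc k))\<^sup>2. cmod (x m)) / real ((Suc k)\<^sup>2) < e / 2"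
    using e by (intro eventually_conj order_tendstoD[OF 1] order_tendstoD[OF 2]) auto
  then obtain k0 where k0: "\<And>k. k0 \<le> k \<Longrightarrow> cmod (\<Sum>m<(Suc k)\<^sup>2. x m) / real ((Suc k)\<^sup>2) < e / 2 \<and>
      (\<Sum>m=(Suc k)\<^sup>2..<(Suc (Suc k))\<^sup>2. cmod (x m)) / real ((Suc k)\<^sup>2) < e / 2"
    by (auto simp: eventually_sequentially)
  show "\<forall>\<^sub>F M in sequentially. dist ((\<Sum>m<M. x m) / of_nat M) 0 < e"
    unfolding eventually_sequentially
  proof (intro exI[of _ "(Suc k0)\<^sup>2"] allI impI)
    fix M :: nat assume M: "(Suc k0)\<^sup>2 \<le> M"
    obtain k where k: "k0 \<le> k" "(Suc k)\<^sup>2 \<le> M" "M < (Suc (Suc k))\<^sup>2"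
    proof -
      have ex: "\<exists>r. M < r\<^sup>2"
        by (intro exI[of _ "Suc M"]) (simp add: power2_eq_square)
      define r where "r = (LEAST r. M < r\<^sup>2)"
      have r: "M < r\<^sup>2" unfolding r_def using ex by (rule LeastI_ex)
      have "Suc k0 < r"
        using M r by (metis leD linorder_not_le order.trans power_mono zero_le not_less)
      then obtain k where rk: "r = Suc (Suc k)" "k0 \<le> k"
        by (metis Suc_le_eq Suc_le_D Suc_less_eq less_eq_Suc_le Suc_le_mono)
      have "\<not> M < (Suc k)\<^sup>2"
        using not_less_Least[of "Suc k" "\<lambda>r. M < r\<^sup>2"] rk unfolding r_def[symmetric] by simp
      then show ?thesis using that[of k] rk r by auto
    qed
    have "(\<Sum>m<M. x m) = (\<Sum>m<(Suc k)\<^sup>2. x m) + (\<Sum>m=(Suc k)\<^sup>2..<M. x m)"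
      using k(2) by (simp add: lessThan_atLeast0 sum.atLeastLessThan_concat)
    then have "cmod (\<Sum>m<M. x m) \<le> cmod (\<Sum>m<(Suc k)\<^sup>2. x m) + cmod (\<Sum>m=(Suc k)\<^sup>2..<M. x m)"
      by (simp add: norm_triangle_ineq)
    also have "cmod (\<Sum>m=(Suc k)\<^sup>2..<M. x m) \<le> (\<Sum>m=(Suc k)\<^sup>2..<M. cmod (x m))"
      by (rule norm_sum)
    also have "\<dots> \<le> (\<Sum>m=(Suc k)\<^sup>2..<(Suc (Suc k))\<^sup>2. cmod (x m))"
      using k(3) by (intro sum_mono2) auto
    finally have "cmod (\<Sum>m<M. x m) / real M \<le> (cmod (\<Sum>m<(Suc k)\<^sup>2. x m) + (\<Sum>m=(Suc k)\<^sup>2..<(Suc (Suc k))\<^sup>2. cmod (x m))) / real M"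
      by (simp add: divide_right_mono)
    also have "\<dots> \<le> (cmod (\<Sum>m<(Suc k)\<^sup>2. x m) + (\<Sum>m=(Suc k)\<^sup>2..<(Suc (Suc k))\<^sup>2. cmod (x m))) / real ((Suc k)\<^sup>2)"
    proof (rule divide_left_mono)
      show "real ((Suc k)\<^sup>2) \<le> real M" using k(2) of_nat_le_iff by blast
      have "0 < (Suc k)\<^sup>2" by simp
      then have "0 < M" using k(2) by linarith
      then show "0 < real M * real ((Suc k)\<^sup>2)" by simp
    qed (simp add: sum_nonneg add_nonneg_nonneg)
    also have "\<dots> < e"
      using k0[OF k(1)] by (simp only: add_divide_distrib) linarith
    finally show "dist ((\<Sum>m<M. x m) / of_nat M) 0 < e"
      by (simp add: norm_divide)
  qed
qed

context prob_space
begin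

text \<open>Along the squares (k + 1)^2 the averages have second moment at most K / (k + 1)^2, which
  is summable. Up to the next square there are at most 3 (k + 1) further terms, whose moduli
  contribute at most 9 K / (k + 1)^2. The argument rests on vanishing correlations alone, which
  admits summands sharing a common random factor.\<close>

theorem slln_uncorrelated:
  fixes X :: "nat \<Rightarrow> 'a \<Rightarrow> complex"
  assumes X[measurable]: "\<And>n. X n \<in> borel_measurable M"
    and sq: "\<And>n. integrable M (\<lambda>\<omega>. (cmod (X n \<omega>))\<^sup>2)"
    and K: "\<And>n. expectation (\<lambda>\<omega>. (cmod (X n \<omega>))\<^sup>2) \<le> K"
    and unc: "\<And>m n. m \<noteq> n \<Longrightarrow> expectation (\<lambda>\<omega>. X m \<omega> * cnj (X n \<omega>)) = 0"
  shows "AE \<omega> in M. (\<lambda>n. (\<Sum>m<n. X m \<omega>) / of_nat n) \<longlonglongrightarrow> 0"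
proof -
  define A where "A = (\<lambda>k \<omega>. (cmod (\<Sum>m<(Suc k)\<^sup>2. X m \<omega>))\<^sup>2 / real (Suc k) ^ 4)"
  define J where "J = (\<lambda>k. {(Suc k)\<^sup>2..<(Suc (Suc k))\<^sup>2})"
  define B where "B = (\<lambda>k \<omega>. (\<Sum>m\<in>J k. cmod (X m \<omega>))\<^sup>2 / real (Suc k) ^ 4)"
  have K0: "0 \<le> K"
    using K[of 0] by (rule order.trans[rotated]) simp
  have cardJ: "real (card (J k)) \<le> 3 * real (Suc k)" for k
    by (simp add: J_def power2_eq_square)
  have pow4: "n\<^sup>2 * c / n ^ 4 = c * (1 / n\<^sup>2)" if "n \<noteq> 0" for n c :: real
    using that by (simp add: power2_eq_square power4_eq_xxxx)
  have sum_inv: "summable (\<lambda>k. c * (1 / (real (Suc k))\<^sup>2))" for c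
  proof (rule summable_mult)
    have "summable (\<lambda>k. 1 / (real k)\<^sup>2)"
      using inverse_power_summable[of 2, where 'a = real] by (simp add: inverse_eq_divide)
    then show "summable (\<lambda>k. 1 / (real (Suc k))\<^sup>2)"
      by (subst summable_Suc_iff)
  qed
  have "AE \<omega> in M. summable (\<lambda>k. A k \<omega>)"
  proof (rule AE_summable)
    fix k
    have i: "integrable M (\<lambda>\<omega>. (cmod (\<Sum>m<(Suc k)\<^sup>2. X m \<omega>))\<^sup>2)"
      and e: "expectation (\<lambda>\<omega>. (cmod (\<Sum>m<(Suc k)\<^sup>2. X m \<omega>))\<^sup>2) = (\<Sum>m<(Suc k)\<^sup>2. expectation (\<lambda>\<omega>. (cmod (X m \<omega>))\<^sup>2))"
      by (rule second_moment_uncorrelated; simp add: sq unc)+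
    show "integrable M (A k)"
      unfolding A_def using i by simp
  next
    show "summable (\<lambda>k. expectation (A k))"
    proof (rule summable_comparison_test'[OF sum_inv[of K], of 0])
      fix k
      have e: "expectation (\<lambda>\<omega>. (cmod (\<Sum>m<(Suc k)\<^sup>2. X m \<omega>))\<^sup>2) = (\<Sum>m<(Suc k)\<^sup>2. expectation (\<lambda>\<omega>. (cmod (X m \<omega>))\<^sup>2))"
        by (rule second_moment_uncorrelated; simp add: sq unc)
      have "expectation (A k) = (\<Sum>m<(Suc k)\<^sup>2. expectation (\<lambda>\<omega>. (cmod (X m \<omega>))\<^sup>2)) / real (Suc k) ^ 4"
        unfolding A_def by (simp only: e integral_divide_zero)
      also have "\<dots> \<le> (real ((Suc k)\<^sup>2) * K) / real (Suc k) ^ 4"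
        using sum_bounded_above[of "{..<(Suc k)\<^sup>2}" "\<lambda>m. expectation (\<lambda>\<omega>. (cmod (X m \<omega>))\<^sup>2)" K] K
        by (intro divide_right_mono) auto
      also have "\<dots> = K * (1 / (real (Suc k))\<^sup>2)"
        unfolding of_nat_power by (rule pow4) simp
      finally show "norm (expectation (A k)) \<le> K * (1 / (real (Suc k))\<^sup>2)"
        by (simp add: A_def)
    qed
  qed (simp add: A_def)
  moreover have "AE \<omega> in M. summable (\<lambda>k. B k \<omega>)"
  proof -
    \<comment> \<open>Cauchy-Schwarz over the gap trades the square of the sum for the sum of the
      squares, at the cost of the number of terms.\<close>
    define B' where "B' = (\<lambda>k \<omega>. real (card (J k)) * (\<Sum>m\<in>J k. (cmod (X m \<omega>))\<^sup>2) / real (Suc k) ^ 4)"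
    have "AE \<omega> in M. summable (\<lambda>k. B' k \<omega>)"
    proof (rule AE_summable)
      show "integrable M (B' k)" for k
        unfolding B'_def using sq by simp
      show "summable (\<lambda>k. expectation (B' k))"
      proof (rule summable_comparison_test'[OF sum_inv[of "9 * K"], of 0])
        fix k
        have "expectation (B' k) = real (card (J k)) * (\<Sum>m\<in>J k. expectation (\<lambda>\<omega>. (cmod (X m \<omega>))\<^sup>2)) / real (Suc k) ^ 4"
          unfolding B'_def using sq by (simp add: Bochner_Integration.integral_sum)
        also have "\<dots> \<le> real (card (J k)) * (real (card (J k)) * K) / real (Suc k) ^ 4"
          using sum_bounded_above[of "J k" "\<lambda>m. expectation (\<lambda>\<omega>. (cmod (X m \<omega>))\<^sup>2)" K] K
          by (intro divide_right_mono mult_left_mono) auto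
        also have "\<dots> \<le> (3 * real (Suc k)) * ((3 * real (Suc k)) * K) / real (Suc k) ^ 4"
          using K0 cardJ[of k] by (intro divide_right_mono mult_mono) auto
        also have "\<dots> = (real (Suc k))\<^sup>2 * (9 * K) / real (Suc k) ^ 4"
          by (simp only: power2_eq_square mult_ac)
        also have "\<dots> = 9 * K * (1 / (real (Suc k))\<^sup>2)"
          by (rule pow4) simp
        finally show "norm (expectation (B' k)) \<le> 9 * K * (1 / (real (Suc k))\<^sup>2)"
          by (simp add: B'_def sum_nonneg)
      qed
    qed (simp add: B'_def sum_nonneg)
    then show ?thesis
    proof (rule AE_mp, intro AE_I2 impI)
      fix \<omega> assume "summable (\<lambda>k. B' k \<omega>)"
      then show "summable (\<lambda>k. B k \<omega>)"
      proof (rule summable_comparison_test'[of _ 0])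
        fix k
        have "(\<Sum>m\<in>J k. cmod (X m \<omega>))\<^sup>2 \<le> real (card (J k)) * (\<Sum>m\<in>J k. (cmod (X m \<omega>))\<^sup>2)"
        proof -
          have "(\<Sum>m\<in>J k. cmod (X m \<omega>)) \<le> sqrt (real (card (J k)) * (\<Sum>m\<in>J k. (cmod (X m \<omega>))\<^sup>2))"
            using L2_set_mult_ineq[of "\<lambda>m. 1" "\<lambda>m. cmod (X m \<omega>)" "J k"]
            by (simp add: L2_set_def real_sqrt_mult)
          from power_mono[OF this, of 2] show ?thesis
            by (simp add: sum_nonneg)
        qed
        then show "norm (B k \<omega>) \<le> B' k \<omega>"
          by (simp add: B_def B'_def divide_right_mono)
      qed
    qed
  qed
  ultimately show ?thesis
  proof eventually_elim
    fix \<omega> assume s: "summable (\<lambda>k. A k \<omega>)" "summable (\<lambda>k. B k \<omega>)"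
    have eq: "sqrt (y\<^sup>2 / real (Suc k) ^ 4) = y / real ((Suc k)\<^sup>2)" if "0 \<le> y" for y k
    proof -
      have "y\<^sup>2 / real (Suc k) ^ 4 = (y / real ((Suc k)\<^sup>2))\<^sup>2"
        by (simp only: of_nat_power power_divide power_mult[symmetric]) simp
      then show ?thesis using that by simp
    qed
    show "(\<lambda>n. (\<Sum>m<n. X m \<omega>) / of_nat n) \<longlonglongrightarrow> 0"
    proof (rule average_tendsto_zero_squares)
      have "(\<lambda>k. sqrt (A k \<omega>)) \<longlonglongrightarrow> sqrt 0"
        by (intro tendsto_real_sqrt summable_LIMSEQ_zero s)
      then show "(\<lambda>k. cmod (\<Sum>m<(Suc k)\<^sup>2. X m \<omega>) / real ((Suc k)\<^sup>2)) \<longlonglongrightarrow> 0"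
        unfolding A_def by (subst (asm) eq) auto
      have "(\<lambda>k. sqrt (B k \<omega>)) \<longlonglongrightarrow> sqrt 0"
        by (intro tendsto_real_sqrt summable_LIMSEQ_zero s)
      then show "(\<lambda>k. (\<Sum>m=(Suc k)\<^sup>2..<(Suc (Suc k))\<^sup>2. cmod (X m \<omega>)) / real ((Suc k)\<^sup>2)) \<longlonglongrightarrow> 0"
        unfolding B_def J_def by (subst (asm) eq) (auto simp: sum_nonneg)
    qed
  qed
qed

end

context prob_space
begin

lemma indep_prod_expectation:
  fixes X :: "'i \<Rightarrow> 'a \<Rightarrow> complex" and g :: "'i \<Rightarrow> complex \<Rightarrow> complex"
  assumes X: "indep_vars (\<lambda>_. borel) X I" and J: "finite J" "J \<subseteq> I"
    and g: "\<And>i. i \<in> J \<Longrightarrow> g i \<in> borel_measurable borel"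
    and int: "\<And>i. i \<in> J \<Longrightarrow> integrable M (\<lambda>\<omega>. g i (X i \<omega>))"
  shows "expectation (\<lambda>\<omega>. \<Prod>i\<in>J. g i (X i \<omega>)) = (\<Prod>i\<in>J. expectation (\<lambda>\<omega>. g i (X i \<omega>)))"
    and "integrable M (\<lambda>\<omega>. \<Prod>i\<in>J. g i (X i \<omega>))"
proof -
  have "indep_vars (\<lambda>_. borel) (\<lambda>i \<omega>. g i (X i \<omega>)) J"
    using indep_vars_subset[OF X J(2)] g by (rule indep_vars_compose2)
  with J(1) int show "expectation (\<lambda>\<omega>. \<Prod>i\<in>J. g i (X i \<omega>)) = (\<Prod>i\<in>J. expectation (\<lambda>\<omega>. g i (X i \<omega>)))"
    "integrable M (\<lambda>\<omega>. \<Prod>i\<in>J. g i (X i \<omega>))"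
    by (auto intro: indep_vars_lebesgue_integral indep_vars_integrable)
qed

lemma indep_expectation_mult:
  fixes X :: "'i \<Rightarrow> 'a \<Rightarrow> complex" and g h :: "complex \<Rightarrow> complex"
  assumes X: "indep_vars (\<lambda>_. borel) X I" and ij: "i \<in> I" "j \<in> I" "i \<noteq> j"
    and g: "g \<in> borel_measurable borel" "integrable M (\<lambda>\<omega>. g (X i \<omega>))"
    and h: "h \<in> borel_measurable borel" "integrable M (\<lambda>\<omega>. h (X j \<omega>))"
  shows "expectation (\<lambda>\<omega>. g (X i \<omega>) * h (X j \<omega>)) = expectation (\<lambda>\<omega>. g (X i \<omega>)) * expectation (\<lambda>\<omega>. h (X j \<omega>))"
    and "integrable M (\<lambda>\<omega>. g (X i \<omega>) * h (X j \<omega>))"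
proof -
  have J: "finite {i, j}" "{i, j} \<subseteq> I"
    and f: "\<And>k. k \<in> {i, j} \<Longrightarrow> (if k = i then g else h) \<in> borel_measurable borel"
    and int: "\<And>k. k \<in> {i, j} \<Longrightarrow> integrable M (\<lambda>\<omega>. (if k = i then g else h) (X k \<omega>))"
    using assms by auto
  show "expectation (\<lambda>\<omega>. g (X i \<omega>) * h (X j \<omega>)) = expectation (\<lambda>\<omega>. g (X i \<omega>)) * expectation (\<lambda>\<omega>. h (X j \<omega>))"
    "integrable M (\<lambda>\<omega>. g (X i \<omega>) * h (X j \<omega>))"
    using indep_prod_expectation[OF X J f int] ij by auto
qed

lemma indep_measurable:
  "indep_vars (\<lambda>_. borel) X I \<Longrightarrow> i \<in> I \<Longrightarrow> X i \<in> borel_measurable M"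
  by (auto simp: indep_vars_def)

lemma expectation_identical:
  fixes X Y :: "'a \<Rightarrow> complex" and g :: "complex \<Rightarrow> 'b :: {banach, second_countable_topology}"
  assumes "X \<in> borel_measurable M" "Y \<in> borel_measurable M" "distr M borel X = distr M borel Y"
    and "g \<in> borel_measurable borel"
  shows "expectation (\<lambda>\<omega>. g (X \<omega>)) = expectation (\<lambda>\<omega>. g (Y \<omega>))"
    and "integrable M (\<lambda>\<omega>. g (X \<omega>)) \<longleftrightarrow> integrable M (\<lambda>\<omega>. g (Y \<omega>))"
  using integral_distr[OF assms(1) assms(4)] integral_distr[OF assms(2) assms(4)]
    integrable_distr_eq[OF assms(1) assms(4)] integrable_distr_eq[OF assms(2) assms(4)] assms(3)
  by auto

end

section \<open>The strong law for integrable variables, by dyadic truncation\<close>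

lemma sum_powers_below:
  fixes v :: real
  assumes "0 \<le> v"
  shows "(\<Sum>k<n. if 2 ^ k < v then 2 ^ k else 0) \<le> 2 * v"
proof -
  \<comment> \<open>The second entry of the minimum makes the induction work: a further term 2^n is
    added only while 2^n < v. In expectation the lemma says that the sum of the 2^k P(g > 2^k) is at
    most 2 E g.\<close>
  have "(\<Sum>k<n. if (2::real) ^ k < v then 2 ^ k else 0) \<le> min (2 * v) (2 ^ n)"
    by (induction n) (use assms in \<open>auto simp: min_def split: if_splits\<close>)
  then show ?thesis by simp
qed

text \<open>From the first k with v <= 2^k on, the terms decrease geometrically. In expectation the
  lemma bounds the sum of the E[g^2; g <= 2^k] / 2^k, and with it the variances of the truncated
  averages, by 2 E g.\<close>

lemma sum_inverse_powers_above:
  fixes v :: real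
  assumes "0 \<le> v"
  shows "(\<Sum>k<n. if v \<le> 2 ^ k then v\<^sup>2 / 2 ^ k else 0) \<le> 2 * v"
proof -
  \<comment> \<open>The geometric series from level \<open>n\<close> on amounts to 2 v / 2^n;
    subtracting this remainder gives a bound that passes through the induction. The maximum with 0
    covers the levels below \<open>v\<close>.\<close>
  have "(\<Sum>k<n. if v \<le> 2 ^ k then v / 2 ^ k else 0) \<le> max 0 (2 - 2 * (v / 2 ^ n))"
  proof (induction n)
    case (Suc n)
    define q where "q = v / 2 ^ n"
    define t where "t = (\<Sum>k<n. if v \<le> 2 ^ k then v / 2 ^ k else 0)"
    have "v \<le> 2 ^ n \<longleftrightarrow> q \<le> 1"
      by (simp add: q_def field_simps)
    then have "(\<Sum>k<Suc n. if v \<le> 2 ^ k then v / 2 ^ k else 0) = t + (if q \<le> 1 then q else 0)"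
      by (simp add: t_def q_def)
    moreover have "2 * (v / 2 ^ Suc n) = q"
      by (simp add: q_def)
    moreover have "t \<le> max 0 (2 - 2 * q)"
      using Suc by (simp only: t_def q_def)
    ultimately show ?case
      by (simp only:) (simp add: max_def split: if_splits)
  qed (use assms in simp)
  also have "\<dots> \<le> 2"
    using assms by simp
  finally have "v * (\<Sum>k<n. if v \<le> 2 ^ k then v / 2 ^ k else 0) \<le> v * 2"
    by (rule mult_left_mono) (rule assms)
  moreover have "v * (\<Sum>k<n. if v \<le> 2 ^ k then v / 2 ^ k else 0) = (\<Sum>k<n. if v \<le> 2 ^ k then v\<^sup>2 / 2 ^ k else 0)"
    by (simp add: sum_distrib_left power2_eq_square if_distrib[of "\<lambda>x. v * x"] cong: if_cong)
  ultimately show ?thesis by simp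
qed

context prob_space
begin

text \<open>Only a first moment is available. Among the first 2^k variables the values are truncated
  at 2^k: by the two dyadic sums above, both the expected numbers of exceedances and the variances
  of the truncated averages are summable. This controls the averages at powers of two; monotonicity
  of the sums in n costs the factor 2 in between.\<close>

lemma iid_nonneg_average_upper:
  fixes X :: "nat \<Rightarrow> 'a \<Rightarrow> complex" and g :: "complex \<Rightarrow> real"
  assumes X: "indep_vars (\<lambda>_. borel) X UNIV" and id: "\<And>n. distr M borel (X n) = distr M borel (X 0)"
    and g[measurable]: "g \<in> borel_measurable borel" and g0: "\<And>x. 0 \<le> g x"
    and int: "integrable M (\<lambda>\<omega>. g (X 0 \<omega>))"
  shows "AE \<omega> in M. \<forall>e>0. \<forall>\<^sub>F n in sequentially. (\<Sum>c<n. g (X c \<omega>)) \<le> 2 * (expectation (\<lambda>\<omega>. g (X 0 \<omega>)) + e) * real n"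
proof -
  define \<mu> where "\<mu> = expectation (\<lambda>\<omega>. g (X 0 \<omega>))"
  have X_meas[measurable]: "X n \<in> borel_measurable M" for n
    using indep_measurable[OF X] by simp
  have idE: "expectation (\<lambda>\<omega>. f (X c \<omega>)) = expectation (\<lambda>\<omega>. f (X 0 \<omega>))"
    if "f \<in> borel_measurable borel" for f :: "complex \<Rightarrow> real" and c
    by (rule expectation_identical(1)[OF X_meas X_meas id that])
  define u where "u = (\<lambda>k x. if g x \<le> 2 ^ k then g x else 0)"
  have u_meas[measurable]: "u k \<in> borel_measurable borel" for k
    unfolding u_def by measurable
  have u_bd: "0 \<le> u k x" "u k x \<le> g x" "u k x \<le> 2 ^ k" for k x
    by (auto simp: u_def g0)
  have u_int: "integrable M (\<lambda>\<omega>. u k (X c \<omega>))" for k c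
    by (rule integrable_const_bound[of _ "2 ^ k"]) (auto simp: u_bd)
  define T where "T = (\<lambda>k. expectation (\<lambda>\<omega>. u k (X 0 \<omega>)))"
  have T: "0 \<le> T k" "T k \<le> \<mu>" "T k \<le> 2 ^ k" for k
  proof -
    show "T k \<le> \<mu>"
      unfolding T_def \<mu>_def using u_int int by (intro integral_mono) (auto simp: u_bd)
    show "T k \<le> 2 ^ k"
      unfolding T_def using integral_mono[OF u_int[of k 0] integrable_const[of "2 ^ k"]] u_bd prob_space by simp
  qed (simp add: T_def u_bd)
  define D where "D = (\<lambda>k c \<omega>. complex_of_real (u k (X c \<omega>) - T k))"
  have D_meas[measurable]: "D k c \<in> borel_measurable M" for k c
    unfolding D_def by measurable
  have D_bd: "(cmod (D k c \<omega>))\<^sup>2 \<le> (2 ^ k)\<^sup>2" for k c \<omega>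
  proof (rule power_mono)
    show "cmod (D k c \<omega>) \<le> 2 ^ k"
      unfolding D_def norm_of_real using u_bd[of k "X c \<omega>"] T[of k] by (simp only: abs_le_iff) linarith
  qed simp
  have D_sq: "integrable M (\<lambda>\<omega>. (cmod (D k c \<omega>))\<^sup>2)" for k c
    by (rule integrable_const_bound[of _ "(2 ^ k)\<^sup>2"]) (use D_bd in auto)
  have D_unc: "expectation (\<lambda>\<omega>. D k c \<omega> * cnj (D k d \<omega>)) = 0" if "c \<noteq> d" for k c d
  proof -
    let ?g = "\<lambda>x. complex_of_real (u k x - T k)"
    have gi: "integrable M (\<lambda>\<omega>. ?g (X c \<omega>))" for c
      using u_int[of k c] by (intro integrable_of_real Bochner_Integration.integrable_diff) auto
    have "expectation (\<lambda>\<omega>. ?g (X c \<omega>)) = complex_of_real (expectation (\<lambda>\<omega>. u k (X c \<omega>) - T k))"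
      by (rule integral_complex_of_real)
    also have "expectation (\<lambda>\<omega>. u k (X c \<omega>) - T k) = expectation (\<lambda>\<omega>. u k (X c \<omega>)) - T k"
      using u_int[of k c] prob_space by simp
    also have "\<dots> = 0"
      unfolding T_def using idE[of "u k" c] by simp
    finally have z: "expectation (\<lambda>\<omega>. ?g (X c \<omega>)) = 0" by simp
    have "expectation (\<lambda>\<omega>. ?g (X c \<omega>) * ?g (X d \<omega>)) = expectation (\<lambda>\<omega>. ?g (X c \<omega>)) * expectation (\<lambda>\<omega>. ?g (X d \<omega>))"
      by (rule indep_expectation_mult(1)[OF X]) (use that gi in auto)
    then show ?thesis
      using z by (simp add: D_def)
  qed
  define A where "A = (\<lambda>k \<omega>. (cmod (\<Sum>c<2^k. D k c \<omega>))\<^sup>2 / (2 ^ k)\<^sup>2)"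
  have EA: "integrable M (A k)" "expectation (A k) \<le> expectation (\<lambda>\<omega>. (u k (X 0 \<omega>))\<^sup>2 / 2 ^ k)" for k
  proof -
    have i: "integrable M (\<lambda>\<omega>. (cmod (\<Sum>c<2^k. D k c \<omega>))\<^sup>2)"
      and e: "expectation (\<lambda>\<omega>. (cmod (\<Sum>c<2^k. D k c \<omega>))\<^sup>2) = (\<Sum>c<2^k. expectation (\<lambda>\<omega>. (cmod (D k c \<omega>))\<^sup>2))"
      by (rule second_moment_uncorrelated; simp add: D_sq D_unc)+
    show "integrable M (A k)" unfolding A_def using i by simp
    have u2i: "integrable M (\<lambda>\<omega>. (u k (X c \<omega>))\<^sup>2)" for c
      by (rule integrable_const_bound[of _ "(2 ^ k)\<^sup>2"]) (auto simp: u_bd intro!: power_mono)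
    have "expectation (\<lambda>\<omega>. (cmod (D k c \<omega>))\<^sup>2) \<le> expectation (\<lambda>\<omega>. (u k (X 0 \<omega>))\<^sup>2)" for c
    proof -
      have "expectation (\<lambda>\<omega>. (cmod (D k c \<omega>))\<^sup>2) = expectation (\<lambda>\<omega>. (u k (X c \<omega>))\<^sup>2 - 2 * T k * u k (X c \<omega>) + (T k)\<^sup>2)"
        unfolding D_def norm_of_real power2_abs by (simp add: power2_diff algebra_simps)
      also have "\<dots> = expectation (\<lambda>\<omega>. (u k (X c \<omega>))\<^sup>2) - 2 * T k * expectation (\<lambda>\<omega>. u k (X c \<omega>)) + (T k)\<^sup>2"
        using u2i u_int prob_space by simp
      also have "expectation (\<lambda>\<omega>. u k (X c \<omega>)) = T k"
        unfolding T_def using idE[of "u k" c] by simp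
      also have "expectation (\<lambda>\<omega>. (u k (X c \<omega>))\<^sup>2) = expectation (\<lambda>\<omega>. (u k (X 0 \<omega>))\<^sup>2)"
        by (rule idE[of "\<lambda>x. (u k x)\<^sup>2"]) simp
      finally show ?thesis by (simp add: power2_eq_square)
    qed
    then have "(\<Sum>c<2^k. expectation (\<lambda>\<omega>. (cmod (D k c \<omega>))\<^sup>2)) \<le> 2 ^ k * expectation (\<lambda>\<omega>. (u k (X 0 \<omega>))\<^sup>2)"
      using sum_bounded_above[of "{..<2^k::nat}" "\<lambda>c. expectation (\<lambda>\<omega>. (cmod (D k c \<omega>))\<^sup>2)"] by simp
    then have "expectation (A k) \<le> (2 ^ k * expectation (\<lambda>\<omega>. (u k (X 0 \<omega>))\<^sup>2)) / (2 ^ k)\<^sup>2"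
      unfolding A_def by (simp only: integral_divide_zero e) (rule divide_right_mono, auto)
    then show "expectation (A k) \<le> expectation (\<lambda>\<omega>. (u k (X 0 \<omega>))\<^sup>2 / 2 ^ k)"
      by (simp add: power2_eq_square)
  qed
  have A0: "0 \<le> A k \<omega>" for k \<omega> by (simp add: A_def)
  have "AE \<omega> in M. summable (\<lambda>k. A k \<omega>)"
  proof (rule AE_summable[OF EA(1) A0])
    show "summable (\<lambda>k. expectation (A k))"
    proof (rule bounded_imp_summable)
      fix n
      have ui: "integrable M (\<lambda>\<omega>. (u k (X 0 \<omega>))\<^sup>2 / 2 ^ k)" for k
        by (intro integrable_const_bound[of _ "(2 ^ k)\<^sup>2 / 2 ^ k"]) (auto simp: u_bd intro!: power_mono divide_right_mono)
      have "(\<Sum>k\<le>n. expectation (A k)) \<le> (\<Sum>k\<le>n. expectation (\<lambda>\<omega>. (u k (X 0 \<omega>))\<^sup>2 / 2 ^ k))"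
        by (intro sum_mono EA)
      also have "\<dots> = expectation (\<lambda>\<omega>. \<Sum>k\<le>n. (u k (X 0 \<omega>))\<^sup>2 / 2 ^ k)"
        by (rule Bochner_Integration.integral_sum[symmetric]) (rule ui)
      also have "\<dots> \<le> expectation (\<lambda>\<omega>. 2 * g (X 0 \<omega>))"
      proof (rule integral_mono)
        fix \<omega>
        have "(\<Sum>k\<le>n. (u k (X 0 \<omega>))\<^sup>2 / 2 ^ k) = (\<Sum>k<Suc n. if g (X 0 \<omega>) \<le> 2 ^ k then (g (X 0 \<omega>))\<^sup>2 / 2 ^ k else 0)"
          unfolding lessThan_Suc_atMost by (intro sum.cong) (auto simp: u_def)
        also have "\<dots> \<le> 2 * g (X 0 \<omega>)"
          by (rule sum_inverse_powers_above[OF g0])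
        finally show "(\<Sum>k\<le>n. (u k (X 0 \<omega>))\<^sup>2 / 2 ^ k) \<le> 2 * g (X 0 \<omega>)" .
      qed (use ui int in auto)
      also have "\<dots> = 2 * \<mu>"
        by (simp add: \<mu>_def)
      finally show "(\<Sum>k\<le>n. expectation (A k)) \<le> 2 * \<mu>" .
    qed (simp add: A0)
  qed
  moreover
  define w where "w = (\<lambda>k x. if 2 ^ k < g x then 1 else 0 :: real)"
  have w_meas[measurable]: "w k \<in> borel_measurable borel" for k
    unfolding w_def by measurable
  have w_int: "integrable M (\<lambda>\<omega>. w k (X c \<omega>))" for k c
    by (rule integrable_const_bound[of _ 1]) (auto simp: w_def)
  \<comment> \<open>The number of variables among the first 2^k that exceed the level 2^k; a value
    below 1 means that the truncation changed none of them.\<close>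
  define Z where "Z = (\<lambda>k \<omega>. \<Sum>c<2^k. w k (X c \<omega>))"
  have EZ: "integrable M (Z k)" "expectation (Z k) = expectation (\<lambda>\<omega>. 2 ^ k * w k (X 0 \<omega>))" for k
  proof -
    show "integrable M (Z k)" unfolding Z_def using w_int by simp
    have "expectation (Z k) = (\<Sum>c<2^k. expectation (\<lambda>\<omega>. w k (X c \<omega>)))"
      unfolding Z_def by (rule Bochner_Integration.integral_sum) (rule w_int)
    also have "\<dots> = (\<Sum>c<(2::nat)^k. expectation (\<lambda>\<omega>. w k (X 0 \<omega>)))"
      by (intro sum.cong refl idE) simp
    finally show "expectation (Z k) = expectation (\<lambda>\<omega>. 2 ^ k * w k (X 0 \<omega>))" by simp
  qed
  have Z0: "0 \<le> Z k \<omega>" for k \<omega> by (simp add: Z_def w_def sum_nonneg)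
  have "AE \<omega> in M. summable (\<lambda>k. Z k \<omega>)"
  proof (rule AE_summable[OF EZ(1) Z0])
    show "summable (\<lambda>k. expectation (Z k))"
    proof (rule bounded_imp_summable)
      fix n
      have "(\<Sum>k\<le>n. expectation (Z k)) = expectation (\<lambda>\<omega>. \<Sum>k\<le>n. 2 ^ k * w k (X 0 \<omega>))"
        unfolding EZ(2) by (rule Bochner_Integration.integral_sum[symmetric]) (use w_int in auto)
      also have "\<dots> \<le> expectation (\<lambda>\<omega>. 2 * g (X 0 \<omega>))"
      proof (rule integral_mono)
        fix \<omega>
        have "(\<Sum>k\<le>n. 2 ^ k * w k (X 0 \<omega>)) = (\<Sum>k<Suc n. if 2 ^ k < g (X 0 \<omega>) then 2 ^ k else 0)"
          unfolding lessThan_Suc_atMost by (intro sum.cong) (auto simp: w_def)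
        also have "\<dots> \<le> 2 * g (X 0 \<omega>)"
          by (rule sum_powers_below[OF g0])
        finally show "(\<Sum>k\<le>n. 2 ^ k * w k (X 0 \<omega>)) \<le> 2 * g (X 0 \<omega>)" .
      qed (use w_int int in auto)
      finally show "(\<Sum>k\<le>n. expectation (Z k)) \<le> 2 * \<mu>"
        by (simp add: \<mu>_def)
    qed (simp add: Z0)
  qed
  ultimately show ?thesis
  proof eventually_elim
    fix \<omega> assume sA: "summable (\<lambda>k. A k \<omega>)" and sZ: "summable (\<lambda>k. Z k \<omega>)"
    show "\<forall>e>0. \<forall>\<^sub>F n in sequentially. (\<Sum>c<n. g (X c \<omega>)) \<le> 2 * (expectation (\<lambda>\<omega>. g (X 0 \<omega>)) + e) * real n"
    proof (intro allI impI)
      fix e :: real assume e: "0 < e"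
      have "(\<lambda>k. sqrt (A k \<omega>)) \<longlonglongrightarrow> sqrt 0"
        by (intro tendsto_real_sqrt summable_LIMSEQ_zero sA)
      then have "\<forall>\<^sub>F k in sequentially. sqrt (A k \<omega>) < e"
        using e by (intro order_tendstoD(2)[of _ "sqrt 0"]) auto
      moreover have "\<forall>\<^sub>F k in sequentially. Z k \<omega> < 1"
        using summable_LIMSEQ_zero[OF sZ] by (rule order_tendstoD) simp
      ultimately have "\<forall>\<^sub>F k in sequentially. (\<Sum>c<2^k. g (X c \<omega>)) \<le> (\<mu> + e) * 2 ^ k"
      proof eventually_elim
        case (elim k)
        have "g (X c \<omega>) \<le> 2 ^ k" if "c < 2 ^ k" for c
        proof (rule ccontr)
          assume "\<not> g (X c \<omega>) \<le> 2 ^ k"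
          then have "1 = w k (X c \<omega>)" by (simp add: w_def)
          also have "\<dots> \<le> Z k \<omega>"
            unfolding Z_def using that by (intro member_le_sum) (auto simp: w_def)
          finally show False using elim by simp
        qed
        then have "(\<Sum>c<2^k. g (X c \<omega>)) = (\<Sum>c<2^k. u k (X c \<omega>))"
          by (intro sum.cong) (auto simp: u_def)
        also have "\<dots> = 2 ^ k * T k + (\<Sum>c<2^k. u k (X c \<omega>) - T k)"
          by (simp add: sum_subtractf)
        also have "(\<Sum>c<2^k. u k (X c \<omega>) - T k) \<le> cmod (\<Sum>c<2^k. D k c \<omega>)"
          unfolding D_def of_real_sum[symmetric] norm_of_real by (rule abs_ge_self)
        also have "cmod (\<Sum>c<2^k. D k c \<omega>) = sqrt (A k \<omega>) * 2 ^ k"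
          by (simp add: A_def real_sqrt_divide)
        also have "\<dots> \<le> e * 2 ^ k"
          using elim by (intro mult_right_mono) auto
        also have "2 ^ k * T k \<le> 2 ^ k * \<mu>"
          by (intro mult_left_mono T) simp
        finally show ?case by (simp add: algebra_simps)
      qed
      then obtain k0 where k0: "\<And>k. k0 \<le> k \<Longrightarrow> (\<Sum>c<2^k. g (X c \<omega>)) \<le> (\<mu> + e) * 2 ^ k"
        by (auto simp: eventually_sequentially)
      show "\<forall>\<^sub>F n in sequentially. (\<Sum>c<n. g (X c \<omega>)) \<le> 2 * (expectation (\<lambda>\<omega>. g (X 0 \<omega>)) + e) * real n"
        unfolding eventually_sequentially
      proof (intro exI[of _ "2 ^ Suc k0"] allI impI)
        fix n :: nat assume n: "2 ^ Suc k0 \<le> n"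
        have ex: "\<exists>k. n \<le> 2 ^ k"
          using less_exp[of n] by (intro exI[of _ n]) simp
        define r where "r = (LEAST k. n \<le> 2 ^ k)"
        have r: "n \<le> 2 ^ r" unfolding r_def using ex by (rule LeastI_ex)
        have "(2::nat) ^ Suc k0 \<le> 2 ^ r" using n r by linarith
        then have "Suc k0 \<le> r" by (rule power_le_imp_le_exp[rotated]) simp
        then obtain k where k: "r = Suc k" "k0 \<le> k" by (metis Suc_le_D Suc_le_mono)
        have "\<not> n \<le> 2 ^ k"
          using not_less_Least[of k "\<lambda>k. n \<le> 2 ^ k"] k unfolding r_def[symmetric] by simp
        then have "(2::nat) ^ r \<le> 2 * n" using k by simp
        then have rn: "(2::real) ^ r \<le> 2 * real n"
          by (metis of_nat_le_iff of_nat_mult of_nat_numeral of_nat_power)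
        have "(\<Sum>c<n. g (X c \<omega>)) \<le> (\<Sum>c<2^r. g (X c \<omega>))"
          using r by (intro sum_mono2) (auto simp: g0)
        also have "\<dots> \<le> (\<mu> + e) * 2 ^ r"
          using k by (intro k0) simp
        also have "\<dots> \<le> (\<mu> + e) * (2 * real n)"
          using rn e T(1,2)[of 0] by (intro mult_left_mono) auto
        finally show "(\<Sum>c<n. g (X c \<omega>)) \<le> 2 * (expectation (\<lambda>\<omega>. g (X 0 \<omega>)) + e) * real n"
          by (simp add: \<mu>_def mult_ac)
      qed
    qed
  qed
qed

text \<open>The truncation at a constant K is bounded and obeys \<open>slln_uncorrelated\<close>.
  The mean of the remainder tends to 0 as K grows, so the crude upper bound with its factor 2 is
  good enough for the remainder.\<close>

theorem slln_iid_nonneg: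
  fixes X :: "nat \<Rightarrow> 'a \<Rightarrow> complex" and g :: "complex \<Rightarrow> real"
  assumes X: "indep_vars (\<lambda>_. borel) X UNIV" and id: "\<And>n. distr M borel (X n) = distr M borel (X 0)"
    and g[measurable]: "g \<in> borel_measurable borel" and g0: "\<And>x. 0 \<le> g x"
    and int: "integrable M (\<lambda>\<omega>. g (X 0 \<omega>))"
  shows "AE \<omega> in M. (\<lambda>n. (\<Sum>c<n. g (X c \<omega>)) / real n) \<longlonglongrightarrow> expectation (\<lambda>\<omega>. g (X 0 \<omega>))"
proof -
  define \<mu> where "\<mu> = expectation (\<lambda>\<omega>. g (X 0 \<omega>))"
  have X_meas[measurable]: "X n \<in> borel_measurable M" for n
    using indep_measurable[OF X] by simp
  have idE: "expectation (\<lambda>\<omega>. f (X c \<omega>)) = expectation (\<lambda>\<omega>. f (X 0 \<omega>))"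
    if "f \<in> borel_measurable borel" for f :: "complex \<Rightarrow> real" and c
    by (rule expectation_identical(1)[OF X_meas X_meas id that])
  define u where "u = (\<lambda>(K::nat) x. min (g x) (real K))"
  have u_meas[measurable]: "u K \<in> borel_measurable borel" for K
    unfolding u_def by measurable
  have u_bd: "0 \<le> u K x" "u K x \<le> real K" "u K x \<le> g x" for K x
    by (auto simp: u_def g0)
  have u_int: "integrable M (\<lambda>\<omega>. u K (X c \<omega>))" for K c
    by (rule integrable_const_bound[of _ "real K"]) (auto simp: u_bd)
  define m where "m = (\<lambda>K. expectation (\<lambda>\<omega>. u K (X 0 \<omega>)))"
  have m_bd: "0 \<le> m K" "m K \<le> real K" for K
  proof -
    show "m K \<le> real K"
      unfolding m_def using integral_mono[OF u_int[of K 0] integrable_const[of "real K"]] u_bd prob_space by simp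
  qed (simp add: m_def u_bd)
  have m_lim: "m \<longlonglongrightarrow> \<mu>"
    unfolding m_def \<mu>_def
  proof (rule integral_dominated_convergence[where w = "\<lambda>\<omega>. g (X 0 \<omega>)"])
    show "AE \<omega> in M. (\<lambda>K. u K (X 0 \<omega>)) \<longlonglongrightarrow> g (X 0 \<omega>)"
    proof (intro AE_I2 tendsto_eventually)
      fix \<omega>
      obtain K :: nat where K: "g (X 0 \<omega>) \<le> real K" using real_arch_simple by blast
      show "\<forall>\<^sub>F K in sequentially. u K (X 0 \<omega>) = g (X 0 \<omega>)"
        using eventually_ge_at_top[of K] by eventually_elim (use K in \<open>auto simp: u_def min_def\<close>)
    qed
  qed (use int in \<open>auto simp: u_bd\<close>)
  have lower: "AE \<omega> in M. \<forall>K. (\<lambda>n. (\<Sum>c<n. complex_of_real (u K (X c \<omega>) - m K)) / of_nat n) \<longlonglongrightarrow> 0"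
    unfolding AE_all_countable
  proof
    fix K
    let ?D = "\<lambda>c \<omega>. complex_of_real (u K (X c \<omega>) - m K)"
    have D_bd: "(cmod (?D c \<omega>))\<^sup>2 \<le> (real K)\<^sup>2" for c \<omega>
    proof (rule power_mono)
      show "cmod (?D c \<omega>) \<le> real K"
        unfolding norm_of_real using u_bd[of K "X c \<omega>"] m_bd[of K] by (simp only: abs_le_iff) linarith
    qed simp
    have D_sq: "integrable M (\<lambda>\<omega>. (cmod (?D c \<omega>))\<^sup>2)" for c
      by (rule integrable_const_bound[of _ "(real K)\<^sup>2"]) (use D_bd in \<open>auto simp del: of_real_diff\<close>)
    show "AE \<omega> in M. (\<lambda>n. (\<Sum>c<n. ?D c \<omega>) / of_nat n) \<longlonglongrightarrow> 0"
    proof (rule slln_uncorrelated[OF _ D_sq])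
      fix c
      have "expectation (\<lambda>\<omega>. (cmod (?D c \<omega>))\<^sup>2) \<le> expectation (\<lambda>\<omega>. (real K)\<^sup>2)"
        by (rule integral_mono[OF D_sq]) (use D_bd in auto)
      then show "expectation (\<lambda>\<omega>. (cmod (?D c \<omega>))\<^sup>2) \<le> (real K)\<^sup>2"
        using prob_space by simp
    next
      fix c d :: nat assume "c \<noteq> d"
      let ?g = "\<lambda>x. complex_of_real (u K x - m K)"
      have gi: "integrable M (\<lambda>\<omega>. ?g (X c \<omega>))" for c
        using u_int[of K c] by (intro integrable_of_real Bochner_Integration.integrable_diff) auto
      have "expectation (\<lambda>\<omega>. ?g (X c \<omega>)) = complex_of_real (expectation (\<lambda>\<omega>. u K (X c \<omega>) - m K))"
        by (rule integral_complex_of_real)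
      also have "expectation (\<lambda>\<omega>. u K (X c \<omega>) - m K) = expectation (\<lambda>\<omega>. u K (X c \<omega>)) - m K"
        using u_int[of K c] prob_space by simp
      also have "\<dots> = 0"
        unfolding m_def using idE[of "u K" c] by simp
      finally have z: "expectation (\<lambda>\<omega>. ?g (X c \<omega>)) = 0" by simp
      have "expectation (\<lambda>\<omega>. ?g (X c \<omega>) * ?g (X d \<omega>)) = expectation (\<lambda>\<omega>. ?g (X c \<omega>)) * expectation (\<lambda>\<omega>. ?g (X d \<omega>))"
        by (rule indep_expectation_mult(1)[OF X]) (use \<open>c \<noteq> d\<close> gi in auto)
      then show "expectation (\<lambda>\<omega>. ?D c \<omega> * cnj (?D d \<omega>)) = 0"
        using z by simp
    qed measurable
  qed
  have upper: "AE \<omega> in M. \<forall>K. \<forall>e>0. \<forall>\<^sub>F n in sequentially.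
      (\<Sum>c<n. g (X c \<omega>) - u K (X c \<omega>)) \<le> 2 * (\<mu> - m K + e) * real n"
    unfolding AE_all_countable
  proof
    fix K
    have "AE \<omega> in M. \<forall>e>0. \<forall>\<^sub>F n in sequentially.
      (\<Sum>c<n. g (X c \<omega>) - u K (X c \<omega>)) \<le> 2 * (expectation (\<lambda>\<omega>. g (X 0 \<omega>) - u K (X 0 \<omega>)) + e) * real n"
      by (rule iid_nonneg_average_upper[OF X id, where g = "\<lambda>x. g x - u K x"]) (use int u_int in \<open>auto simp: u_bd\<close>)
    then show "AE \<omega> in M. \<forall>e>0. \<forall>\<^sub>F n in sequentially.
      (\<Sum>c<n. g (X c \<omega>) - u K (X c \<omega>)) \<le> 2 * (\<mu> - m K + e) * real n"
      using int u_int by (simp add: \<mu>_def m_def)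
  qed
  from lower upper show ?thesis
  proof eventually_elim
    fix \<omega> assume L: "\<forall>K. (\<lambda>n. (\<Sum>c<n. complex_of_real (u K (X c \<omega>) - m K)) / of_nat n) \<longlonglongrightarrow> 0"
      and U: "\<forall>K. \<forall>e>0. \<forall>\<^sub>F n in sequentially. (\<Sum>c<n. g (X c \<omega>) - u K (X c \<omega>)) \<le> 2 * (\<mu> - m K + e) * real n"
    show "(\<lambda>n. (\<Sum>c<n. g (X c \<omega>)) / real n) \<longlonglongrightarrow> expectation (\<lambda>\<omega>. g (X 0 \<omega>))"
      unfolding \<mu>_def[symmetric]
    proof (rule tendstoI)
      fix e :: real assume e: "0 < e"
      from m_lim have "\<forall>\<^sub>F K in sequentially. dist (m K) \<mu> < e / 8"
        using e by (intro tendstoD) auto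
      then obtain K where K: "dist (m K) \<mu> < e / 8"
        by (auto simp: eventually_sequentially)
      from L have "\<forall>\<^sub>F n in sequentially. dist ((\<Sum>c<n. complex_of_real (u K (X c \<omega>) - m K)) / of_nat n) 0 < e / 8"
        using e by (intro tendstoD) auto
      moreover have "\<forall>\<^sub>F n in sequentially. (\<Sum>c<n. g (X c \<omega>) - u K (X c \<omega>)) \<le> 2 * (\<mu> - m K + e / 8) * real n"
        by (rule mp[OF spec[OF spec[OF U, of K], of "e / 8"]]) (use e in simp)
      ultimately show "\<forall>\<^sub>F n in sequentially. dist ((\<Sum>c<n. g (X c \<omega>)) / real n) \<mu> < e"
        using eventually_gt_at_top[of 0]
      proof eventually_elim
        case (elim n)
        define a where "a = (\<Sum>c<n. u K (X c \<omega>) - m K) / real n"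
        define t where "t = (\<Sum>c<n. g (X c \<omega>) - u K (X c \<omega>)) / real n"
        have "(\<Sum>c<n. complex_of_real (u K (X c \<omega>) - m K)) / of_nat n = complex_of_real a"
          unfolding a_def by (simp only: of_real_sum of_real_divide of_real_of_nat_eq)
        with elim(1) have a: "\<bar>a\<bar> < e / 8"
          by (simp add: dist_complex_def)
        have t: "t \<le> 2 * (\<mu> - m K + e / 8)" "0 \<le> t"
          using elim(2,3) by (auto simp: t_def u_bd field_simps intro!: divide_nonneg_nonneg sum_nonneg)
        have "(\<Sum>c<n. g (X c \<omega>)) / real n = a + m K + t"
          using elim(3) by (simp add: a_def t_def sum_subtractf diff_divide_distrib)
        moreover have "\<bar>a + m K + t - \<mu>\<bar> < e"
          using a t K unfolding dist_real_def abs_less_iff by argo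
        ultimately show ?case
          by (simp add: dist_real_def)
      qed
    qed
  qed
qed

end

lemma tendsto_zero_mult_bounded:
  fixes f g :: "'p \<Rightarrow> 'b :: real_normed_algebra"
  assumes "\<forall>\<^sub>F p in F. norm (f p) \<le> B" "(g \<longlongrightarrow> 0) F"
  shows "((\<lambda>p. f p * g p) \<longlongrightarrow> 0) F" "((\<lambda>p. g p * f p) \<longlongrightarrow> 0) F"
proof -
  have z: "((\<lambda>p. B * norm (g p)) \<longlongrightarrow> 0) F"
    using tendsto_mult_right_zero[OF tendsto_norm_zero[OF assms(2)]] .
  have 1: "\<forall>\<^sub>F p in F. norm (f p * g p) \<le> B * norm (g p)"
    using assms(1) by eventually_elim (rule order.trans[OF norm_mult_ineq], auto intro: mult_right_mono)
  show "((\<lambda>p. f p * g p) \<longlongrightarrow> 0) F"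
    by (rule Lim_null_comparison[OF 1 z])
  have 2: "\<forall>\<^sub>F p in F. norm (g p * f p) \<le> B * norm (g p)"
    using assms(1)
    by eventually_elim (rule order.trans[OF norm_mult_ineq], subst mult.commute, auto intro: mult_right_mono)
  show "((\<lambda>p. g p * f p) \<longlongrightarrow> 0) F"
    by (rule Lim_null_comparison[OF 2 z])
qed

section \<open>Principal eigenvectors of perturbed rank-one sums\<close>

text \<open>A perturbed sum of rank-one operators: if the images \<open>v l\<close> of the signal directions \<open>h l\<close>
  become orthogonal and \<open>v j\<close> dominates, then the principal eigenvector aligns with \<open>v j\<close>, and
  undoing the filter recovers the direction \<open>h j\<close>.\<close>

locale dominant_direction =
  fixes F :: "'p filter" and d :: "'p \<Rightarrow> nat" and I :: "nat set" and j :: nat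
    and A Q :: "'p \<Rightarrow> complex mat" and T :: "'p \<Rightarrow> (nat \<Rightarrow> complex) \<Rightarrow> nat \<Rightarrow> complex"
    and h :: "nat \<Rightarrow> 'p \<Rightarrow> nat \<Rightarrow> complex" and u w :: "'p \<Rightarrow> nat \<Rightarrow> complex"
    and \<mu> :: "'p \<Rightarrow> complex" and \<epsilon> :: "'p \<Rightarrow> real" and K B \<alpha> :: real and v
  defines "v \<equiv> \<lambda>l p. app (d p) (A p) (h l p)"
  assumes I: "finite I" "j \<in> I"
    and A: "\<And>p. A p \<in> carrier_mat (d p) (d p)" and K: "0 < K" "\<And>p x. nrm (d p) (app (d p) (A p) x) \<le> K * nrm (d p) x"
    and Q: "\<And>p x. nrm (d p) (app (d p) (Q p) x) \<le> nrm (d p) x"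
    and Qh: "\<And>p i. i < d p \<Longrightarrow> app (d p) (Q p) (h j p) i = h j p i"
    and T: "\<forall>\<^sub>F p in F. \<forall>x. nrm (d p) (\<lambda>i. T p x i - (\<Sum>l\<in>I. ip (d p) x (h l p) * h l p i)) \<le> \<epsilon> p * nrm (d p) x"
    and \<epsilon>: "(\<epsilon> \<longlongrightarrow> 0) F"
    and eig: "\<forall>\<^sub>F p in F. \<forall>i<d p. app (d p) (A p) (T p (app (d p) (mat_adjoint (A p)) (u p))) i = \<mu> p * u p i"
    and u: "\<forall>\<^sub>F p in F. nrm (d p) (u p) = 1"
    and ray: "\<forall>\<^sub>F p in F. \<forall>x. Re (ip (d p) (app (d p) (A p) (T p (app (d p) (mat_adjoint (A p)) x))) x) \<le> Re (\<mu> p) * (nrm (d p) x)\<^sup>2"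
    and orth: "\<And>k l. k \<in> I \<Longrightarrow> l \<in> I \<Longrightarrow> k \<noteq> l \<Longrightarrow> ((\<lambda>p. ip (d p) (v k p) (v l p)) \<longlongrightarrow> 0) F"
    and \<alpha>: "0 < \<alpha>" "\<forall>\<^sub>F p in F. \<alpha> \<le> (nrm (d p) (v j p))\<^sup>2"
    and dom: "\<And>l. l \<in> I \<Longrightarrow> l \<noteq> j \<Longrightarrow> \<exists>\<delta>>0. \<forall>\<^sub>F p in F. (nrm (d p) (v l p))\<^sup>2 + \<delta> \<le> (nrm (d p) (v j p))\<^sup>2"
    and B: "\<forall>\<^sub>F p in F. \<forall>l\<in>I. nrm (d p) (h l p) \<le> B" and B0: "0 \<le> B"
    and orth_h: "\<And>l. l \<in> I \<Longrightarrow> l \<noteq> j \<Longrightarrow> ((\<lambda>p. ip (d p) (h l p) (h j p)) \<longlongrightarrow> 0) F"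
    and wB: "\<forall>\<^sub>F p in F. nrm (d p) (w p) \<le> B" and wh: "((\<lambda>p. ip (d p) (w p) (h j p)) \<longlongrightarrow> 0) F"
begin

definition "c l p = ip (d p) (u p) (v l p)"
text \<open>The eigenvalue equation says A s = \<mu> u. So a matrix whose product with
  \<open>A\<close> is \<open>Q\<close> carries \<open>u\<close> to t / \<mu>, and \<open>t\<close>
  below spans the direction that the estimator uses.\<close>

definition "s p = T p (app (d p) (mat_adjoint (A p)) (u p))"
definition "e p = (\<lambda>i. s p i - (\<Sum>l\<in>I. c l p * h l p i))"
definition "t p = app (d p) (Q p) (s p)"
text \<open>Models the training signal after correlation with the pilot: all channels superposed,
  plus noise. Its projection on \<open>t\<close> is the estimate.\<close>

definition "y p = (\<lambda>i. (\<Sum>l\<in>I. h l p i) + w p i)"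

lemma adjoint_bound: "nrm (d p) (app (d p) (mat_adjoint (A p)) x) \<le> K * nrm (d p) x"
  using nrm_app_adjoint[OF A _ K(2)] K(1) by simp

lemma ip_adjoint: "ip (d p) (app (d p) (mat_adjoint (A p)) x) z = ip (d p) x (app (d p) (A p) z)"
  using ip_app[OF mat_adjoint_carrier[OF A], of p x z] by simp

lemma v_bound: "\<forall>\<^sub>F p in F. \<forall>l\<in>I. nrm (d p) (v l p) \<le> K * B"
  using B
proof eventually_elim
  case (elim p)
  show ?case
  proof
    fix l assume "l \<in> I"
    then have "K * nrm (d p) (h l p) \<le> K * B"
      using elim K(1) by (intro mult_left_mono) auto
    then show "nrm (d p) (v l p) \<le> K * B"
      using K(2)[of p "h l p"] by (simp add: v_def)
  qed
qed

lemma c_bound: "\<forall>\<^sub>F p in F. \<forall>l\<in>I. cmod (c l p) \<le> K * B"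
  using v_bound u
proof eventually_elim
  case (elim p)
  show ?case
  proof
    fix l assume "l \<in> I"
    have "cmod (c l p) \<le> nrm (d p) (u p) * nrm (d p) (v l p)"
      unfolding c_def by (rule ip_bound)
    then show "cmod (c l p) \<le> K * B"
      using elim \<open>l \<in> I\<close> by force
  qed
qed

text \<open>As a sesquilinear form A T A* differs from the sum of the v_l v_l* by at most \<epsilon>
  K^2, with one factor \<open>K\<close> for \<open>A\<close> and one for its adjoint.\<close>

lemma ip_T: "\<forall>\<^sub>F p in F. \<forall>x z. cmod (ip (d p) (app (d p) (A p) (T p (app (d p) (mat_adjoint (A p)) x))) z
    - (\<Sum>l\<in>I. ip (d p) x (v l p) * ip (d p) (v l p) z)) \<le> \<epsilon> p * K\<^sup>2 * nrm (d p) x * nrm (d p) z"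
  using T
proof eventually_elim
  case (elim p)
  show ?case
  proof (intro allI)
    fix x z
    define q where "q = app (d p) (mat_adjoint (A p)) x"
    define r where "r = (\<lambda>i. T p q i - (\<Sum>l\<in>I. ip (d p) q (h l p) * h l p i))"
    have q: "nrm (d p) q \<le> K * nrm (d p) x"
      unfolding q_def by (rule adjoint_bound)
    have r: "nrm (d p) r \<le> \<epsilon> p * nrm (d p) q"
      unfolding r_def using elim by blast
    have "T p q = (\<lambda>i. (\<Sum>l\<in>I. ip (d p) q (h l p) * h l p i) + r i)"
      by (simp add: r_def)
    then have "app (d p) (A p) (T p q) = (\<lambda>i. (\<Sum>l\<in>I. ip (d p) q (h l p) * v l p i) + app (d p) (A p) r i)"
      by (simp only: app_add app_sum app_scale v_def)
    then have "ip (d p) (app (d p) (A p) (T p q)) z = (\<Sum>l\<in>I. ip (d p) q (h l p) * ip (d p) (v l p) z) + ip (d p) (app (d p) (A p) r) z"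
      by (simp only: ip_add_left ip_sum_left ip_scale_left)
    moreover have "ip (d p) q (h l p) = ip (d p) x (v l p)" for l
      unfolding q_def v_def by (rule ip_adjoint)
    ultimately have eq: "ip (d p) (app (d p) (A p) (T p q)) z - (\<Sum>l\<in>I. ip (d p) x (v l p) * ip (d p) (v l p) z) = ip (d p) (app (d p) (A p) r) z"
      by simp
    \<comment> \<open>The sign of \<open>\<epsilon> p\<close> is not assumed. If it is negative, the
      approximation hypothesis forces all norms in this dimension to vanish.\<close>
    have "\<epsilon> p * nrm (d p) q \<le> \<epsilon> p * (K * nrm (d p) x)"
    proof (cases "0 \<le> \<epsilon> p")
      case False
      then have "\<epsilon> p * nrm (d p) q \<le> 0" by (simp add: mult_nonpos_nonneg)
      then have "nrm (d p) r = 0" using r nrm_nonneg[of "d p" r] by linarith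
      have "nrm (d p) q = 0"
        using r False \<open>nrm (d p) r = 0\<close> nrm_nonneg[of "d p" q] by (simp add: zero_le_mult_iff)
      have "nrm (d p) x = 0 \<or> 0 \<le> \<epsilon> p"
      proof -
        have "nrm (d p) (\<lambda>i. T p x i - (\<Sum>l\<in>I. ip (d p) x (h l p) * h l p i)) \<le> \<epsilon> p * nrm (d p) x"
          using elim by blast
        then have "0 \<le> \<epsilon> p * nrm (d p) x"
          using nrm_nonneg order.trans by blast
        then show ?thesis using nrm_nonneg[of "d p" x] by (auto simp: zero_le_mult_iff)
      qed
      then show ?thesis using False \<open>nrm (d p) q = 0\<close> by simp
    qed (use q in \<open>auto intro: mult_left_mono\<close>)
    with r have "nrm (d p) r \<le> \<epsilon> p * (K * nrm (d p) x)" by linarith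
    then have "K * nrm (d p) r \<le> K * (\<epsilon> p * (K * nrm (d p) x))"
      using K(1) by (intro mult_left_mono) auto
    then have "nrm (d p) (app (d p) (A p) r) \<le> \<epsilon> p * K\<^sup>2 * nrm (d p) x"
      using K(2)[of p r] by (simp add: power2_eq_square mult_ac)
    then have "nrm (d p) (app (d p) (A p) r) * nrm (d p) z \<le> \<epsilon> p * K\<^sup>2 * nrm (d p) x * nrm (d p) z"
      by (rule mult_right_mono) simp
    with ip_bound[of "d p" "app (d p) (A p) r" z]
    show "cmod (ip (d p) (app (d p) (A p) (T p (app (d p) (mat_adjoint (A p)) x))) z
      - (\<Sum>l\<in>I. ip (d p) x (v l p) * ip (d p) (v l p) z)) \<le> \<epsilon> p * K\<^sup>2 * nrm (d p) x * nrm (d p) z"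
      unfolding q_def[symmetric] eq by linarith
  qed
qed

text \<open>The Rayleigh inequality with \<open>v j p\<close> as test vector: of the sum of the
  |<v_j, v_l>|^2 only the term l = j, the fourth power of |v_j|, is kept, and the positive factor
  |v_j|^2 is cancelled.\<close>

lemma mu_lower: "\<forall>\<^sub>F p in F. (nrm (d p) (v j p))\<^sup>2 - \<epsilon> p * K\<^sup>2 \<le> Re (\<mu> p)"
  using ip_T ray \<alpha>(2)
proof eventually_elim
  case (elim p)
  let ?n = "(nrm (d p) (v j p))\<^sup>2"
  let ?z = "ip (d p) (app (d p) (A p) (T p (app (d p) (mat_adjoint (A p)) (v j p)))) (v j p)"
  let ?S = "\<Sum>l\<in>I. ip (d p) (v j p) (v l p) * ip (d p) (v l p) (v j p)"
  have "cmod (?z - ?S) \<le> \<epsilon> p * K\<^sup>2 * nrm (d p) (v j p) * nrm (d p) (v j p)"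
    using elim(1) by blast
  then have 1: "Re ?S - \<epsilon> p * K\<^sup>2 * ?n \<le> Re ?z"
    using abs_Re_le_cmod[of "?z - ?S"] by (simp add: power2_eq_square mult.assoc)
  have "Re ?S = (\<Sum>l\<in>I. (cmod (ip (d p) (v j p) (v l p)))\<^sup>2)"
  proof -
    have "ip (d p) (v j p) (v l p) * ip (d p) (v l p) (v j p) = complex_of_real ((cmod (ip (d p) (v j p) (v l p)))\<^sup>2)" for l
      by (subst (2) ip_commute) (rule complex_norm_square[symmetric])
    then show ?thesis by simp
  qed
  also have "(cmod (ip (d p) (v j p) (v j p)))\<^sup>2 \<le> \<dots>"
    using I by (intro member_le_sum) auto
  also have "(cmod (ip (d p) (v j p) (v j p)))\<^sup>2 = ?n * ?n"
    unfolding ip_self norm_of_real by (simp add: power2_eq_square)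
  finally have "?n * ?n - \<epsilon> p * K\<^sup>2 * ?n \<le> Re ?z"
    using 1 by linarith
  also have "\<dots> \<le> Re (\<mu> p) * ?n"
    using elim(2) by blast
  finally have "(?n - \<epsilon> p * K\<^sup>2) * ?n \<le> Re (\<mu> p) * ?n"
    by (simp add: left_diff_distrib)
  moreover have "0 < ?n" using elim(3) \<alpha>(1) by linarith
  ultimately show ?case by (simp add: mult_le_cancel_right)
qed

lemma err_tendsto:
  assumes "\<forall>\<^sub>F p in F. norm (f p :: complex) \<le> \<epsilon> p * b"
  shows "(f \<longlongrightarrow> 0) F"
  by (rule Lim_null_comparison[OF assms]) (rule tendsto_mult_left_zero[OF \<epsilon>])

lemma eps_nonneg: "\<forall>\<^sub>F p in F. 0 \<le> \<epsilon> p"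
  using T u
proof eventually_elim
  case (elim p)
  have "nrm (d p) (\<lambda>i. T p (u p) i - (\<Sum>l\<in>I. ip (d p) (u p) (h l p) * h l p i)) \<le> \<epsilon> p * nrm (d p) (u p)"
    using elim(1) by blast
  from order.trans[OF nrm_nonneg this] show ?case
    using elim(2) by simp
qed

lemma ip_As: "\<forall>\<^sub>F p in F. \<forall>z. \<mu> p * ip (d p) (u p) z = ip (d p) (app (d p) (A p) (s p)) z"
  using eig
proof eventually_elim
  case (elim p)
  show ?case
    unfolding ip_scale_left[symmetric] s_def using elim by (auto intro!: ip_cong)
qed

text \<open>Pair the eigenvalue equation with v_k. Asymptotic orthogonality removes the other
  directions, so that \<mu> c_k and |v_k|^2 c_k agree in the limit.\<close>

lemma c_eq_tendsto:
  assumes k: "k \<in> I"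
  shows "((\<lambda>p. (\<mu> p - (nrm (d p) (v k p))\<^sup>2) * c k p) \<longlongrightarrow> 0) F"
proof -
  have 1: "((\<lambda>p. \<mu> p * c k p - (\<Sum>l\<in>I. c l p * ip (d p) (v l p) (v k p))) \<longlongrightarrow> 0) F"
  proof (rule err_tendsto)
    show "\<forall>\<^sub>F p in F. norm (\<mu> p * c k p - (\<Sum>l\<in>I. c l p * ip (d p) (v l p) (v k p))) \<le> \<epsilon> p * (K\<^sup>2 * (K * B))"
      using ip_T ip_As u v_bound eps_nonneg
    proof eventually_elim
      case (elim p)
      have "norm (\<mu> p * c k p - (\<Sum>l\<in>I. c l p * ip (d p) (v l p) (v k p))) \<le> \<epsilon> p * K\<^sup>2 * nrm (d p) (u p) * nrm (d p) (v k p)"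
        using elim(1,2) by (auto simp: c_def s_def)
      also have "\<dots> \<le> \<epsilon> p * K\<^sup>2 * nrm (d p) (u p) * (K * B)"
        using elim k by (intro mult_left_mono) auto
      finally show ?case using elim by (simp add: mult.assoc)
    qed
  qed
  have 2: "((\<lambda>p. \<Sum>l\<in>I-{k}. c l p * ip (d p) (v l p) (v k p)) \<longlongrightarrow> 0) F"
  proof (rule tendsto_null_sum)
    fix l assume l: "l \<in> I - {k}"
    have "\<forall>\<^sub>F p in F. norm (c l p) \<le> K * B"
      using c_bound by eventually_elim (use l in auto)
    then show "((\<lambda>p. c l p * ip (d p) (v l p) (v k p)) \<longlongrightarrow> 0) F"
      by (rule tendsto_zero_mult_bounded) (use l k orth in auto)
  qed
  have "(\<lambda>p. (\<mu> p - (nrm (d p) (v k p))\<^sup>2) * c k p) =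
    (\<lambda>p. (\<mu> p * c k p - (\<Sum>l\<in>I. c l p * ip (d p) (v l p) (v k p))) + (\<Sum>l\<in>I-{k}. c l p * ip (d p) (v l p) (v k p)))"
  proof
    fix p
    have "(\<Sum>l\<in>I. c l p * ip (d p) (v l p) (v k p)) = c k p * ip (d p) (v k p) (v k p) + (\<Sum>l\<in>I-{k}. c l p * ip (d p) (v l p) (v k p))"
      using I k by (simp add: sum.remove[of I k])
    then show "(\<mu> p - (nrm (d p) (v k p))\<^sup>2) * c k p =
      (\<mu> p * c k p - (\<Sum>l\<in>I. c l p * ip (d p) (v l p) (v k p))) + (\<Sum>l\<in>I-{k}. c l p * ip (d p) (v l p) (v k p))"
      by (simp add: ip_self algebra_simps)
  qed
  then show ?thesis
    using tendsto_add[OF 1 2] by simp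
qed

text \<open>Asymptotically \<mu> is at least |v_j|^2, which exceeds |v_k|^2 by \<delta>. The first
  factor in \<open>c_eq_tendsto\<close> thus stays away from zero, and c_k must vanish.\<close>

lemma c_tendsto:
  assumes k: "k \<in> I" "k \<noteq> j"
  shows "(c k \<longlongrightarrow> 0) F"
proof -
  obtain \<delta> where \<delta>: "0 < \<delta>" "\<forall>\<^sub>F p in F. (nrm (d p) (v k p))\<^sup>2 + \<delta> \<le> (nrm (d p) (v j p))\<^sup>2"
    using dom[OF k] by blast
  have "((\<lambda>p. \<epsilon> p * K\<^sup>2) \<longlongrightarrow> 0) F"
    by (rule tendsto_mult_left_zero[OF \<epsilon>])
  then have "\<forall>\<^sub>F p in F. \<epsilon> p * K\<^sup>2 < \<delta> / 2"
    using \<delta> by (intro order_tendstoD) auto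
  with \<delta>(2) mu_lower have "\<forall>\<^sub>F p in F. norm (c k p) \<le> (2 / \<delta>) * norm ((\<mu> p - (nrm (d p) (v k p))\<^sup>2) * c k p)"
  proof eventually_elim
    case (elim p)
    have "\<delta> / 2 \<le> Re (\<mu> p - (nrm (d p) (v k p))\<^sup>2)"
      using elim by simp
    also have "\<dots> \<le> cmod (\<mu> p - (nrm (d p) (v k p))\<^sup>2)"
      by (rule complex_Re_le_cmod)
    finally have *: "\<delta> / 2 * cmod (c k p) \<le> cmod (\<mu> p - (nrm (d p) (v k p))\<^sup>2) * cmod (c k p)"
      by (rule mult_right_mono) simp
    have "cmod (c k p) = (2 / \<delta>) * (\<delta> / 2 * cmod (c k p))"
      using \<delta>(1) by simp
    also have "\<dots> \<le> (2 / \<delta>) * (cmod (\<mu> p - (nrm (d p) (v k p))\<^sup>2) * cmod (c k p))"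
      using * \<delta>(1) by (intro mult_left_mono) auto
    finally show ?case
      by (simp only: norm_mult)
  qed
  then show ?thesis
    by (rule Lim_null_comparison) (intro tendsto_mult_right_zero tendsto_norm_zero c_eq_tendsto k)
qed

text \<open>Pair the eigenvalue equation with \<open>u\<close> itself: \<mu> is asymptotically the
  sum of the |c_l|^2, of which only |c_j|^2 survives. The loss from \<alpha> to \<alpha> / 4 absorbs
  the error of \<open>mu_lower\<close> and that of this approximation.\<close>

lemma c_j_lower: "\<forall>\<^sub>F p in F. \<alpha> / 4 \<le> (cmod (c j p))\<^sup>2"
proof -
  have 1: "((\<lambda>p. \<mu> p - (\<Sum>l\<in>I. complex_of_real ((cmod (c l p))\<^sup>2))) \<longlongrightarrow> 0) F"
  proof (rule err_tendsto)
    show "\<forall>\<^sub>F p in F. norm (\<mu> p - (\<Sum>l\<in>I. complex_of_real ((cmod (c l p))\<^sup>2))) \<le> \<epsilon> p * K\<^sup>2"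
      using ip_T ip_As u
    proof eventually_elim
      case (elim p)
      have "complex_of_real ((cmod (c l p))\<^sup>2) = ip (d p) (u p) (v l p) * ip (d p) (v l p) (u p)" for l
        unfolding c_def by (subst (3) ip_commute) (rule complex_norm_square)
      then have "norm (\<mu> p * ip (d p) (u p) (u p) - (\<Sum>l\<in>I. complex_of_real ((cmod (c l p))\<^sup>2))) \<le> \<epsilon> p * K\<^sup>2 * nrm (d p) (u p) * nrm (d p) (u p)"
        using elim(1,2) unfolding s_def by presburger
      then show ?case
        using elim(3) by (simp add: ip_self)
    qed
  qed
  have 2: "((\<lambda>p. \<Sum>l\<in>I-{j}. complex_of_real ((cmod (c l p))\<^sup>2)) \<longlongrightarrow> 0) F"
  proof (rule tendsto_null_sum)
    fix l assume "l \<in> I - {j}"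
    then have "((\<lambda>p. complex_of_real ((cmod (c l p))\<^sup>2)) \<longlongrightarrow> complex_of_real (0\<^sup>2)) F"
      by (intro tendsto_of_real tendsto_power tendsto_norm_zero c_tendsto) auto
    then show "((\<lambda>p. complex_of_real ((cmod (c l p))\<^sup>2)) \<longlongrightarrow> 0) F" by simp
  qed
  have "((\<lambda>p. (\<mu> p - (\<Sum>l\<in>I. complex_of_real ((cmod (c l p))\<^sup>2))) + (\<Sum>l\<in>I-{j}. complex_of_real ((cmod (c l p))\<^sup>2))) \<longlongrightarrow> 0 + 0) F"
    by (rule tendsto_add[OF 1 2])
  then have "((\<lambda>p. Re ((\<mu> p - (\<Sum>l\<in>I. complex_of_real ((cmod (c l p))\<^sup>2))) + (\<Sum>l\<in>I-{j}. complex_of_real ((cmod (c l p))\<^sup>2)))) \<longlongrightarrow> Re 0) F"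
    by (intro tendsto_Re) simp
  moreover have "(\<lambda>p. Re ((\<mu> p - (\<Sum>l\<in>I. complex_of_real ((cmod (c l p))\<^sup>2))) + (\<Sum>l\<in>I-{j}. complex_of_real ((cmod (c l p))\<^sup>2)))) = (\<lambda>p. Re (\<mu> p) - (cmod (c j p))\<^sup>2)"
    using I by (simp add: sum.remove[of I j])
  ultimately have 3: "((\<lambda>p. Re (\<mu> p) - (cmod (c j p))\<^sup>2) \<longlongrightarrow> 0) F"
    by (simp only: zero_complex.sel)
  have "((\<lambda>p. \<epsilon> p * K\<^sup>2) \<longlongrightarrow> 0) F"
    by (rule tendsto_mult_left_zero[OF \<epsilon>])
  then have "\<forall>\<^sub>F p in F. \<epsilon> p * K\<^sup>2 < \<alpha> / 2"
    using \<alpha>(1) by (intro order_tendstoD) auto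
  moreover have "\<forall>\<^sub>F p in F. Re (\<mu> p) - (cmod (c j p))\<^sup>2 < \<alpha> / 4"
    using 3 \<alpha>(1) by (intro order_tendstoD) auto
  ultimately show ?thesis
    using mu_lower \<alpha>(2) by eventually_elim linarith
qed

definition "r p = (\<lambda>i. t p i - c j p * h j p i)"

text \<open>\<open>Q\<close> fixes \<open>h j\<close> and does not increase norms, so
  \<open>t\<close> is c_j h_j up to bounded vectors with vanishing coefficients and the operator
  error.\<close>

lemma r_tendsto: "((\<lambda>p. nrm (d p) (r p)) \<longlongrightarrow> 0) F"
proof (rule Lim_null_comparison)
  show "\<forall>\<^sub>F p in F. norm (nrm (d p) (r p)) \<le> (\<Sum>l\<in>I-{j}. cmod (c l p) * B) + \<epsilon> p * K"
    using T u B eps_nonneg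
  proof eventually_elim
    case (elim p)
    define q where "q = app (d p) (mat_adjoint (A p)) (u p)"
    have cq: "ip (d p) q (h l p) = c l p" for l
      unfolding q_def c_def v_def by (rule ip_adjoint)
    have "nrm (d p) (e p) \<le> \<epsilon> p * nrm (d p) q"
      unfolding e_def s_def q_def[symmetric] cq[symmetric] using elim(1) by blast
    also have "\<dots> \<le> \<epsilon> p * K"
      using adjoint_bound[of p "u p"] elim unfolding q_def by (intro mult_left_mono) auto
    finally have e: "nrm (d p) (e p) \<le> \<epsilon> p * K" .
    have "s p = (\<lambda>i. (\<Sum>l\<in>I. c l p * h l p i) + e p i)"
      by (simp add: e_def)
    then have "t p = (\<lambda>i. (\<Sum>l\<in>I. c l p * app (d p) (Q p) (h l p) i) + app (d p) (Q p) (e p) i)"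
      unfolding t_def by (simp only: app_add app_sum app_scale)
    then have t: "t p i = c j p * app (d p) (Q p) (h j p) i + (\<Sum>l\<in>I-{j}. c l p * app (d p) (Q p) (h l p) i) + app (d p) (Q p) (e p) i" for i
      using I by (simp add: sum.remove[of I j])
    have "nrm (d p) (r p) = nrm (d p) (\<lambda>i. (\<Sum>l\<in>I-{j}. c l p * app (d p) (Q p) (h l p) i) + app (d p) (Q p) (e p) i)"
      by (rule nrm_cong) (simp add: r_def t Qh)
    also have "\<dots> \<le> nrm (d p) (\<lambda>i. \<Sum>l\<in>I-{j}. c l p * app (d p) (Q p) (h l p) i) + nrm (d p) (app (d p) (Q p) (e p))"
      by (rule nrm_add)
    also have "\<dots> \<le> (\<Sum>l\<in>I-{j}. cmod (c l p) * B) + \<epsilon> p * K"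
    proof (rule add_mono)
      have "nrm (d p) (\<lambda>i. \<Sum>l\<in>I-{j}. c l p * app (d p) (Q p) (h l p) i) \<le> (\<Sum>l\<in>I-{j}. nrm (d p) (\<lambda>i. c l p * app (d p) (Q p) (h l p) i))"
        using I by (intro nrm_sum) auto
      also have "\<dots> \<le> (\<Sum>l\<in>I-{j}. cmod (c l p) * B)"
        unfolding nrm_scale using Q elim(3) by (intro sum_mono mult_left_mono) (auto intro: order.trans)
      finally show "nrm (d p) (\<lambda>i. \<Sum>l\<in>I-{j}. c l p * app (d p) (Q p) (h l p) i) \<le> (\<Sum>l\<in>I-{j}. cmod (c l p) * B)" .
      show "nrm (d p) (app (d p) (Q p) (e p)) \<le> \<epsilon> p * K"
        using Q[of p "e p"] e by linarith
    qed
    finally show ?case by simp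
  qed
  have "((\<lambda>p. (\<Sum>l\<in>I-{j}. cmod (c l p) * B) + \<epsilon> p * K) \<longlongrightarrow> 0 + 0) F"
    by (intro tendsto_add tendsto_null_sum tendsto_mult_left_zero tendsto_norm_zero c_tendsto \<epsilon>) auto
  then show "((\<lambda>p. (\<Sum>l\<in>I-{j}. cmod (c l p) * B) + \<epsilon> p * K) \<longlongrightarrow> 0) F" by simp
qed

text \<open>The projection of \<open>y\<close> on the line of \<open>t\<close> does not see the
  scale of \<open>t\<close>, so the unknown coefficient c_j drops out; what matters is that it stays
  away from zero.\<close>

theorem estimate_tendsto:
  "((\<lambda>p. nrm (d p) (\<lambda>i. ip (d p) (y p) (t p) / complex_of_real ((nrm (d p) (t p))\<^sup>2) * t p i - h j p i)) \<longlongrightarrow> 0) F"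
proof -
  define n where "n p = nrm (d p)" for p
  define B2 where "B2 = real (card I) * B + B"
  have h_bd: "\<forall>\<^sub>F p in F. n p (h j p) \<le> B"
    using B by eventually_elim (use I in \<open>auto simp: n_def\<close>)
  have c_bd: "\<forall>\<^sub>F p in F. cmod (c j p) \<le> K * B"
    using c_bound by eventually_elim (use I in auto)
  have r_bd: "\<forall>\<^sub>F p in F. n p (r p) < 1"
    unfolding n_def by (rule order_tendstoD[OF r_tendsto]) simp
  have y_bd: "\<forall>\<^sub>F p in F. n p (y p) \<le> B2"
    using B wB
  proof eventually_elim
    case (elim p)
    have "n p (y p) \<le> n p (\<lambda>i. \<Sum>l\<in>I. h l p i) + n p (w p)"
      unfolding y_def n_def by (rule nrm_add)
    also have "n p (\<lambda>i. \<Sum>l\<in>I. h l p i) \<le> (\<Sum>l\<in>I. n p (h l p))"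
      unfolding n_def using I by (intro nrm_sum) auto
    also have "\<dots> \<le> real (card I) * B"
      using sum_bounded_above[of I "\<lambda>l. n p (h l p)" B] elim(1) by (simp add: n_def)
    finally show ?case using elim(2) by (simp add: B2_def n_def)
  qed
  have ip_r: "((\<lambda>p. ip (d p) (x p) (r p)) \<longlongrightarrow> 0) F" if x: "\<forall>\<^sub>F p in F. n p (x p) \<le> b" for x b
  proof (rule Lim_null_comparison)
    show "\<forall>\<^sub>F p in F. norm (ip (d p) (x p) (r p)) \<le> b * n p (r p)"
      using x
    proof eventually_elim
      case (elim p)
      have "n p (x p) * n p (r p) \<le> b * n p (r p)"
        using elim by (intro mult_right_mono) (auto simp: n_def)
      then show ?case
        using ip_bound[of "d p" "x p" "r p"] unfolding n_def by linarith
    qed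
    show "((\<lambda>p. b * n p (r p)) \<longlongrightarrow> 0) F"
      unfolding n_def by (rule tendsto_mult_right_zero[OF r_tendsto])
  qed
  define N where "N p = complex_of_real ((n p (h j p))\<^sup>2)" for p
  have N: "ip (d p) (h j p) (h j p) = N p" for p
    by (simp add: N_def n_def ip_self)
  \<comment> \<open>With N = |h_j|^2, these are the errors of the two leading-order formulas <y, t>
    = conj(c_j) N and |t|^2 = |c_j|^2 N.\<close>
  define \<eta>1 where "\<eta>1 p = ip (d p) (y p) (t p) - cnj (c j p) * N p" for p
  define \<eta>2 where "\<eta>2 p = complex_of_real ((n p (t p))\<^sup>2) - c j p * cnj (c j p) * N p" for p
  have t_eq: "t p = (\<lambda>i. c j p * h j p i + r p i)" for p
    by (simp add: r_def)
  have \<eta>1: "(\<eta>1 \<longlongrightarrow> 0) F"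
  proof -
    have "\<eta>1 p = cnj (c j p) * ((\<Sum>l\<in>I-{j}. ip (d p) (h l p) (h j p)) + ip (d p) (w p) (h j p)) + ip (d p) (y p) (r p)" for p
    proof -
      have "ip (d p) (y p) (h j p) = N p + (\<Sum>l\<in>I-{j}. ip (d p) (h l p) (h j p)) + ip (d p) (w p) (h j p)"
        unfolding y_def using I by (simp add: ip_add_left ip_sum_left sum.remove[of I j] N)
      then show ?thesis
        unfolding \<eta>1_def t_eq ip_add_right ip_scale_right by (simp add: algebra_simps)
    qed
    then have "\<eta>1 = (\<lambda>p. cnj (c j p) * ((\<Sum>l\<in>I-{j}. ip (d p) (h l p) (h j p)) + ip (d p) (w p) (h j p)) + ip (d p) (y p) (r p))"
      by (rule ext)
    moreover have "((\<lambda>p. cnj (c j p) * ((\<Sum>l\<in>I-{j}. ip (d p) (h l p) (h j p)) + ip (d p) (w p) (h j p)) + ip (d p) (y p) (r p)) \<longlongrightarrow> 0 + 0) F"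
    proof (intro tendsto_add ip_r[OF y_bd])
      have "((\<lambda>p. (\<Sum>l\<in>I-{j}. ip (d p) (h l p) (h j p)) + ip (d p) (w p) (h j p)) \<longlongrightarrow> 0 + 0) F"
        by (intro tendsto_add tendsto_null_sum orth_h wh) auto
      then show "((\<lambda>p. cnj (c j p) * ((\<Sum>l\<in>I-{j}. ip (d p) (h l p) (h j p)) + ip (d p) (w p) (h j p))) \<longlongrightarrow> 0) F"
        using c_bd by (intro tendsto_zero_mult_bounded[of _ "K * B"]) auto
    qed
    ultimately show ?thesis by simp
  qed
  have \<eta>2: "(\<eta>2 \<longlongrightarrow> 0) F"
  proof -
    have "\<eta>2 p = c j p * ip (d p) (h j p) (r p) + cnj (c j p) * cnj (ip (d p) (h j p) (r p)) + ip (d p) (r p) (r p)" for p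
    proof -
      have "complex_of_real ((n p (t p))\<^sup>2) = ip (d p) (t p) (t p)"
        by (simp add: n_def ip_self)
      also have "\<dots> = c j p * cnj (c j p) * N p + c j p * ip (d p) (h j p) (r p) + cnj (c j p) * ip (d p) (r p) (h j p) + ip (d p) (r p) (r p)"
        unfolding t_eq ip_add_left ip_add_right ip_scale_left ip_scale_right N by (simp add: algebra_simps)
      finally show ?thesis
        unfolding \<eta>2_def by (subst (asm) (2) ip_commute) simp
    qed
    then have "\<eta>2 = (\<lambda>p. c j p * ip (d p) (h j p) (r p) + cnj (c j p) * cnj (ip (d p) (h j p) (r p)) + ip (d p) (r p) (r p))"
      by (rule ext)
    moreover have "((\<lambda>p. c j p * ip (d p) (h j p) (r p) + cnj (c j p) * cnj (ip (d p) (h j p) (r p)) + ip (d p) (r p) (r p)) \<longlongrightarrow> 0 + 0 + 0) F"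
    proof (intro tendsto_add)
      have z: "((\<lambda>p. ip (d p) (h j p) (r p)) \<longlongrightarrow> 0) F"
        by (rule ip_r[OF h_bd])
      show "((\<lambda>p. c j p * ip (d p) (h j p) (r p)) \<longlongrightarrow> 0) F"
        by (rule tendsto_zero_mult_bounded[OF c_bd z])
      have "((\<lambda>p. cnj (ip (d p) (h j p) (r p))) \<longlongrightarrow> 0) F"
        using tendsto_cnj[OF z] by simp
      then show "((\<lambda>p. cnj (c j p) * cnj (ip (d p) (h j p) (r p))) \<longlongrightarrow> 0) F"
        using c_bd by (intro tendsto_zero_mult_bounded[of _ "K * B"]) auto
      show "((\<lambda>p. ip (d p) (r p) (r p)) \<longlongrightarrow> 0) F"
        by (rule ip_r[of _ 1]) (use r_bd in \<open>auto elim: eventually_mono\<close>)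
    qed
    ultimately show ?thesis by simp
  qed
  \<comment> \<open>Lower bound for |c_j|^2 |h_j|^2: the first factor is at least \<alpha> / 4, the
    second at least \<alpha> / K^2 because |v_j| <= K |h_j|.\<close>
  define \<kappa> where "\<kappa> = \<alpha> / 4 * (\<alpha> / K\<^sup>2)"
  have \<kappa>: "0 < \<kappa>" using \<alpha>(1) K(1) by (simp add: \<kappa>_def)
  have t_low: "\<forall>\<^sub>F p in F. \<kappa> / 2 \<le> (n p (t p))\<^sup>2"
  proof -
    have "\<forall>\<^sub>F p in F. norm (\<eta>2 p) < \<kappa> / 2"
      using tendsto_norm_zero[OF \<eta>2] \<kappa> by (intro order_tendstoD) auto
    with c_j_lower \<alpha>(2) show ?thesis
    proof eventually_elim
      case (elim p)
      have "\<alpha> \<le> (K * n p (h j p))\<^sup>2"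
        using elim(2) K(2)[of p "h j p"] power_mono[of "nrm (d p) (v j p)" "K * n p (h j p)" 2]
        unfolding v_def n_def by simp
      then have "\<alpha> / K\<^sup>2 \<le> (n p (h j p))\<^sup>2"
        using K(1) by (simp add: power_mult_distrib field_simps)
      then have "\<kappa> \<le> (cmod (c j p))\<^sup>2 * (n p (h j p))\<^sup>2"
        unfolding \<kappa>_def using elim(1) \<alpha>(1) K(1) by (intro mult_mono) auto
      moreover have "(n p (t p))\<^sup>2 = (cmod (c j p))\<^sup>2 * (n p (h j p))\<^sup>2 + Re (\<eta>2 p)"
      proof -
        have "complex_of_real ((n p (t p))\<^sup>2) = complex_of_real ((cmod (c j p))\<^sup>2 * (n p (h j p))\<^sup>2) + \<eta>2 p"
          unfolding \<eta>2_def N_def by (simp add: complex_norm_square del: of_real_power)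
        then show ?thesis
          by (metis Re_complex_of_real plus_complex.sel(1))
      qed
      moreover have "\<bar>Re (\<eta>2 p)\<bar> < \<kappa> / 2"
        using elim(3) abs_Re_le_cmod[of "\<eta>2 p"] by linarith
      ultimately show ?case by linarith
    qed
  qed
  \<comment> \<open>Norm of the error multiplied by |t|^2, which keeps divisions out of the
    estimate. The leading terms |c_j|^2 N h_j cancel, and every remaining term contains
    \<open>\<eta>1\<close>, \<open>\<eta>2\<close> or \<open>r\<close>.\<close>
  define num where "num p = n p (\<lambda>i. ip (d p) (y p) (t p) * t p i - complex_of_real ((n p (t p))\<^sup>2) * h j p i)" for p
  have "(num \<longlongrightarrow> 0) F"
  proof (rule Lim_null_comparison)
    show "\<forall>\<^sub>F p in F. norm (num p) \<le> cmod (\<eta>1 p) * (K * B * B) + (K * B * B\<^sup>2 + cmod (\<eta>1 p)) * n p (r p) + cmod (\<eta>2 p) * B"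
      using c_bd h_bd
    proof eventually_elim
      case (elim p)
      have Np: "cmod (N p) \<le> B\<^sup>2"
        unfolding N_def norm_of_real using elim(2) by (simp add: power_mono n_def)
      have "num p = n p (\<lambda>i. (\<eta>1 p * c j p) * h j p i + ((cnj (c j p) * N p + \<eta>1 p) * r p i + (- \<eta>2 p) * h j p i))"
        unfolding num_def n_def
      proof (rule nrm_cong)
        fix i
        have 1: "ip (d p) (y p) (t p) = cnj (c j p) * N p + \<eta>1 p"
          by (simp add: \<eta>1_def)
        have ti: "t p i = c j p * h j p i + r p i"
          by (simp add: r_def)
        have 2: "complex_of_real ((nrm (d p) (t p))\<^sup>2) = c j p * cnj (c j p) * N p + \<eta>2 p"
          by (simp add: \<eta>2_def n_def)
        show "ip (d p) (y p) (t p) * t p i - complex_of_real ((nrm (d p) (t p))\<^sup>2) * h j p i =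
          (\<eta>1 p * c j p) * h j p i + ((cnj (c j p) * N p + \<eta>1 p) * r p i + (- \<eta>2 p) * h j p i)"
          unfolding 1 2 ti by (simp add: algebra_simps)
      qed
      also have "\<dots> \<le> n p (\<lambda>i. (\<eta>1 p * c j p) * h j p i) + (n p (\<lambda>i. (cnj (c j p) * N p + \<eta>1 p) * r p i) + n p (\<lambda>i. (- \<eta>2 p) * h j p i))"
        unfolding n_def by (rule order.trans[OF nrm_add]) (intro add_left_mono nrm_add)
      also have "\<dots> = cmod (\<eta>1 p) * (cmod (c j p) * n p (h j p)) + (cmod (cnj (c j p) * N p + \<eta>1 p) * n p (r p) + cmod (\<eta>2 p) * n p (h j p))"
        unfolding n_def nrm_scale by (simp add: norm_mult mult.assoc)
      also have "\<dots> \<le> cmod (\<eta>1 p) * (K * B * B) + ((K * B * B\<^sup>2 + cmod (\<eta>1 p)) * n p (r p) + cmod (\<eta>2 p) * B)"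
      proof (intro add_mono)
        show "cmod (\<eta>1 p) * (cmod (c j p) * n p (h j p)) \<le> cmod (\<eta>1 p) * (K * B * B)"
          using elim K(1) B0 by (intro mult_left_mono mult_mono) (auto simp: n_def)
        have "cmod (cnj (c j p) * N p) \<le> K * B * B\<^sup>2"
          unfolding norm_mult using elim Np K(1) B0 by (intro mult_mono) auto
        then have "cmod (cnj (c j p) * N p + \<eta>1 p) \<le> K * B * B\<^sup>2 + cmod (\<eta>1 p)"
          using norm_triangle_ineq[of "cnj (c j p) * N p" "\<eta>1 p"] by linarith
        then show "cmod (cnj (c j p) * N p + \<eta>1 p) * n p (r p) \<le> (K * B * B\<^sup>2 + cmod (\<eta>1 p)) * n p (r p)"
          by (rule mult_right_mono) (simp add: n_def)
        show "cmod (\<eta>2 p) * n p (h j p) \<le> cmod (\<eta>2 p) * B"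
          using elim by (intro mult_left_mono) auto
      qed
      finally show ?case by (simp add: num_def n_def)
    qed
    have "((\<lambda>p. cmod (\<eta>1 p) * (K * B * B) + (K * B * B\<^sup>2 + cmod (\<eta>1 p)) * n p (r p) + cmod (\<eta>2 p) * B) \<longlongrightarrow> 0 * (K * B * B) + (K * B * B\<^sup>2 + 0) * 0 + 0 * B) F"
      unfolding n_def by (intro tendsto_intros tendsto_norm_zero \<eta>1 \<eta>2 r_tendsto)
    then show "((\<lambda>p. cmod (\<eta>1 p) * (K * B * B) + (K * B * B\<^sup>2 + cmod (\<eta>1 p)) * n p (r p) + cmod (\<eta>2 p) * B) \<longlongrightarrow> 0) F"
      by simp
  qed
  show ?thesis
  proof (rule Lim_null_comparison)
    show "\<forall>\<^sub>F p in F. norm (nrm (d p) (\<lambda>i. ip (d p) (y p) (t p) / complex_of_real ((nrm (d p) (t p))\<^sup>2) * t p i - h j p i)) \<le> (2 / \<kappa>) * num p"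
      using t_low
    proof eventually_elim
      case (elim p)
      define m where "m = (n p (t p))\<^sup>2"
      have m: "\<kappa> / 2 \<le> m" "0 < m" using elim \<kappa> by (auto simp: m_def)
      have "nrm (d p) (\<lambda>i. ip (d p) (y p) (t p) / complex_of_real ((nrm (d p) (t p))\<^sup>2) * t p i - h j p i)
        = nrm (d p) (\<lambda>i. complex_of_real (1 / m) * (ip (d p) (y p) (t p) * t p i - complex_of_real m * h j p i))"
        using m(2) by (intro nrm_cong) (simp add: m_def n_def field_simps)
      also have "\<dots> = (1 / m) * num p"
        unfolding nrm_scale norm_of_real num_def m_def[symmetric] using m(2) by (simp add: n_def)
      also have "\<dots> \<le> (2 / \<kappa>) * num p"
        using m \<kappa> by (intro mult_right_mono) (auto simp: num_def n_def field_simps)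
      finally show ?case by simp
    qed
    show "((\<lambda>p. (2 / \<kappa>) * num p) \<longlongrightarrow> 0) F"
      by (rule tendsto_mult_right_zero[OF \<open>(num \<longlongrightarrow> 0) F\<close>])
  qed
qed

end

section \<open>The operator norm of a noise matrix\<close>

text \<open>Entry of Z Z* - C v 1: the Gram matrix of the rows minus its expectation for independent
  centred entries of variance \<open>v\<close>.\<close>

definition gram_dev :: "(nat \<Rightarrow> nat \<Rightarrow> complex) \<Rightarrow> real \<Rightarrow> nat \<Rightarrow> nat \<Rightarrow> nat \<Rightarrow> complex" where
  "gram_dev z v C m m' = (\<Sum>c<C. z m c * cnj (z m' c) - (if m = m' then complex_of_real v else 0))"

definition gram_frob :: "(nat \<Rightarrow> nat \<Rightarrow> complex) \<Rightarrow> real \<Rightarrow> nat \<Rightarrow> nat \<Rightarrow> real" where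
  "gram_frob z v M C = (\<Sum>m<M. \<Sum>m'<M. (cmod (gram_dev z v C m m'))\<^sup>2)"

text \<open>\<open>N\<close> bounds the square of the operator norm of the upper left
  \<open>M\<close> by \<open>C\<close> block of \<open>z\<close>, expressed through the adjoint of
  the block.\<close>

definition op_bound :: "(nat \<Rightarrow> nat \<Rightarrow> complex) \<Rightarrow> nat \<Rightarrow> nat \<Rightarrow> real \<Rightarrow> bool" where
  "op_bound z M C N \<longleftrightarrow> (\<forall>y. (nrm C (\<lambda>c. \<Sum>m<M. cnj (z m c) * y m))\<^sup>2 \<le> N * (nrm M y)\<^sup>2)"

text \<open>|Z* y|^2 is the quadratic form of Z Z*: the mean contributes C v |y|^2, and the
  deviation at most its Frobenius norm times |y|^2.\<close>

lemma op_bound_gram: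
  "op_bound z M C (sqrt (gram_frob z v M C) + real C * v)"
  unfolding op_bound_def
proof
  fix y
  define G where "G = mat M M (\<lambda>(m', m). gram_dev z v C m' m)"
  have "complex_of_real ((nrm C (\<lambda>c. \<Sum>m<M. cnj (z m c) * y m))\<^sup>2) =
      (\<Sum>c<C. (\<Sum>m<M. cnj (z m c) * y m) * cnj (\<Sum>m'<M. cnj (z m' c) * y m'))"
    unfolding nrm_sq_sum of_real_sum by (simp only: complex_norm_square)
  also have "\<dots> = (\<Sum>c<C. \<Sum>m<M. \<Sum>m'<M. (y m * cnj (y m')) * (z m' c * cnj (z m c)))"
    by (simp add: sum_product mult_ac)
  also have "\<dots> = (\<Sum>m<M. \<Sum>c<C. \<Sum>m'<M. (y m * cnj (y m')) * (z m' c * cnj (z m c)))"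
    by (rule sum.swap)
  also have "\<dots> = (\<Sum>m<M. \<Sum>m'<M. \<Sum>c<C. (y m * cnj (y m')) * (z m' c * cnj (z m c)))"
    by (rule sum.cong[OF refl], rule sum.swap)
  also have "\<dots> = (\<Sum>m<M. \<Sum>m'<M. (y m * cnj (y m')) * (gram_dev z v C m' m + (if m' = m then complex_of_real (real C * v) else 0)))"
    by (intro sum.cong refl) (simp add: gram_dev_def sum_subtractf sum_distrib_left[symmetric])
  also have "\<dots> = (\<Sum>m<M. \<Sum>m'<M. (y m * cnj (y m')) * gram_dev z v C m' m) + (\<Sum>m<M. complex_of_real (real C * v) * (y m * cnj (y m)))"
    by (simp add: distrib_left sum.distrib if_distrib[of "\<lambda>x. _ * x"] mult_ac cong: if_cong)
  also have "(\<Sum>m<M. \<Sum>m'<M. (y m * cnj (y m')) * gram_dev z v C m' m) = ip M (app M G y) y"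
    by (subst sum.swap) (simp add: ip_def app_def G_def sum_distrib_left sum_distrib_right mult_ac)
  also have "(\<Sum>m<M. complex_of_real (real C * v) * (y m * cnj (y m))) = complex_of_real (real C * v * (nrm M y)\<^sup>2)"
    by (simp only: of_real_mult[of _ "(nrm M y)\<^sup>2"] ip_self[symmetric] ip_def sum_distrib_left)
  finally have "Re (complex_of_real ((nrm C (\<lambda>c. \<Sum>m<M. cnj (z m c) * y m))\<^sup>2)) = Re (ip M (app M G y) y + complex_of_real (real C * v * (nrm M y)\<^sup>2))"
    by (rule arg_cong[of _ _ Re])
  then have "(nrm C (\<lambda>c. \<Sum>m<M. cnj (z m c) * y m))\<^sup>2 = Re (ip M (app M G y) y) + real C * v * (nrm M y)\<^sup>2"
    by (simp only: Re_complex_of_real plus_complex.sel)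
  moreover have "Re (ip M (app M G y) y) \<le> sqrt (gram_frob z v M C) * (nrm M y)\<^sup>2"
  proof -
    have "nrm M (app M G y) \<le> sqrt (gram_frob z v M C) * nrm M y"
      using nrm_app_frobenius[of M M G y] by (simp add: G_def gram_frob_def)
    then have "nrm M (app M G y) * nrm M y \<le> sqrt (gram_frob z v M C) * nrm M y * nrm M y"
      by (rule mult_right_mono) simp
    then show ?thesis
      using ip_bound[of M "app M G y" y] complex_Re_le_cmod[of "ip M (app M G y) y"]
      by (simp add: power2_eq_square mult.assoc)
  qed
  ultimately show "(nrm C (\<lambda>c. \<Sum>m<M. cnj (z m c) * y m))\<^sup>2 \<le> (sqrt (gram_frob z v M C) + real C * v) * (nrm M y)\<^sup>2"
    by (simp add: distrib_right)
qed

text \<open>The smaller block acts like the larger one on vectors padded by zeros, with fewer output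
  coordinates.\<close>

lemma op_bound_mono:
  assumes "op_bound z M' C' N" "M \<le> M'" "C \<le> C'"
  shows "op_bound z M C N"
  unfolding op_bound_def
proof
  fix y :: "nat \<Rightarrow> complex"
  define y' where "y' m = (if m < M then y m else 0)" for m
  have ext: "(\<Sum>m<M'. f m * y' m) = (\<Sum>m<M. f m * y m)" for f :: "nat \<Rightarrow> complex"
  proof -
    have "(\<Sum>m<M'. f m * y' m) = (\<Sum>m<M. f m * y' m)"
      using assms(2) by (intro sum.mono_neutral_right) (auto simp: y'_def)
    then show ?thesis by (simp add: y'_def)
  qed
  have ny: "(nrm M' y')\<^sup>2 = (nrm M y)\<^sup>2"
  proof -
    have "(\<Sum>m<M'. (cmod (y' m))\<^sup>2) = (\<Sum>m<M. (cmod (y' m))\<^sup>2)"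
      using assms(2) by (intro sum.mono_neutral_right) (auto simp: y'_def)
    then show ?thesis by (simp add: nrm_sq_sum y'_def)
  qed
  have "(nrm C (\<lambda>c. \<Sum>m<M. cnj (z m c) * y m))\<^sup>2 \<le> (nrm C' (\<lambda>c. \<Sum>m<M'. cnj (z m c) * y' m))\<^sup>2"
    unfolding nrm_sq_sum ext using assms(3) by (intro sum_mono2) auto
  also have "\<dots> \<le> N * (nrm M' y')\<^sup>2"
    using assms(1) unfolding op_bound_def by blast
  finally show "(nrm C (\<lambda>c. \<Sum>m<M. cnj (z m c) * y m))\<^sup>2 \<le> N * (nrm M y)\<^sup>2"
    by (simp add: ny)
qed

lemma op_bound_iff_nrm:
  assumes "0 \<le> N"
  shows "op_bound z M C N \<longleftrightarrow> (\<forall>y. nrm C (app M (mat_adjoint (mat M C (\<lambda>(m, c). z m c))) y) \<le> sqrt N * nrm M y)"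
proof -
  have "nrm C (app M (mat_adjoint (mat M C (\<lambda>(m, c). z m c))) y) = nrm C (\<lambda>c. \<Sum>m<M. cnj (z m c) * y m)" for y
    by (rule nrm_cong) (simp add: app_def)
  moreover have "a\<^sup>2 \<le> N * b\<^sup>2 \<longleftrightarrow> a \<le> sqrt N * b" if "0 \<le> a" "0 \<le> b" for a b :: real
  proof -
    have "a\<^sup>2 \<le> N * b\<^sup>2 \<longleftrightarrow> a\<^sup>2 \<le> (sqrt N * b)\<^sup>2"
      using assms by (simp add: power_mult_distrib)
    also have "\<dots> \<longleftrightarrow> a \<le> sqrt N * b"
      using that assms by (intro power_mono_iff) auto
    finally show ?thesis .
  qed
  ultimately show ?thesis
    by (simp add: op_bound_def)
qed

text \<open>An operator and its adjoint have the same norm; conjugating the vector accounts for the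
  difference between transpose and adjoint.\<close>

lemma op_bound_transpose:
  assumes N: "0 \<le> N" and b: "op_bound (\<lambda>c m. z m c) C M N"
  shows "op_bound z M C N"
proof -
  let ?A = "mat M C (\<lambda>(m, c). z m c)"
  have A: "?A \<in> carrier_mat M C" by simp
  have "nrm M (app C ?A x) \<le> sqrt N * nrm C x" for x
  proof -
    have "(nrm M (\<lambda>m. \<Sum>c<C. cnj (z m c) * cnj (x c)))\<^sup>2 \<le> N * (nrm C (\<lambda>c. cnj (x c)))\<^sup>2"
      using spec[OF b[unfolded op_bound_def], of "\<lambda>c. cnj (x c)"] .
    moreover have "nrm C (\<lambda>c. cnj (x c)) = nrm C x"
      by (simp add: nrm_def)
    moreover have "nrm M (\<lambda>m. \<Sum>c<C. cnj (z m c) * cnj (x c)) = nrm M (app C ?A x)"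
    proof -
      have "nrm M (\<lambda>m. \<Sum>c<C. cnj (z m c) * cnj (x c)) = nrm M (\<lambda>m. cnj (app C ?A x m))"
        by (rule nrm_cong) (simp add: app_def)
      then show ?thesis by (simp add: nrm_def)
    qed
    ultimately have "(nrm M (app C ?A x))\<^sup>2 \<le> (sqrt N * nrm C x)\<^sup>2"
      using N by (simp add: power_mult_distrib)
    then show ?thesis
      by (rule power2_le_imp_le) (simp add: N)
  qed
  from nrm_app_adjoint[OF A _ this] N show ?thesis
    by (subst op_bound_iff_nrm) auto
qed

text \<open>Logarithm to the base 4, rounded up: a positive dimension is enlarged to a power of 4 by
  a factor of at most 4.\<close>

definition lg4 :: "nat \<Rightarrow> nat" where
  "lg4 n = (LEAST a. n \<le> 4 ^ a)"

lemma lg4: "n \<le> 4 ^ lg4 n" "1 \<le> n \<Longrightarrow> 4 ^ lg4 n \<le> 4 * n"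
proof -
  have ex: "\<exists>a. n \<le> (4::nat) ^ a"
    using less_exp[of n] power_mono[of 2 "4::nat" n] by (intro exI[of _ n]) linarith
  then show "n \<le> 4 ^ lg4 n"
    unfolding lg4_def by (rule LeastI_ex)
  assume n: "1 \<le> n"
  show "4 ^ lg4 n \<le> 4 * n"
  proof (cases "lg4 n")
    case (Suc a)
    have "\<not> n \<le> 4 ^ a"
      using not_less_Least[of a "\<lambda>a. n \<le> 4 ^ a"] Suc unfolding lg4_def[symmetric] by simp
    then show ?thesis using Suc by simp
  qed (use n in simp)
qed

lemma filterlim_lg4: "filterlim lg4 at_top sequentially"
  unfolding filterlim_at_top
proof
  fix Z
  show "\<forall>\<^sub>F n in sequentially. Z \<le> lg4 n"
    using eventually_gt_at_top[of "4 ^ Z"]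
  proof eventually_elim
    case (elim n)
    then have "(4::nat) ^ Z < 4 ^ lg4 n" using lg4(1)[of n] by linarith
    then have "Z < lg4 n" by (rule power_less_imp_less_exp[rotated]) simp
    then show ?case by simp
  qed
qed

section \<open>Expected size of the Gram deviation, and the operator bound on a grid\<close>

context prob_space
begin

text \<open>For fixed rows the summands over the columns are uncorrelated: on the diagonal as
  centred functions of independent variables, off it because four distinct centred factors meet. So
  each of the R^2 entries has second moment linear in \<open>C\<close>, and the expectation relative
  to (R C)^2 is of order 1 / C.\<close>

lemma gram_frob_expectation:
  fixes X :: "'i \<Rightarrow> 'a \<Rightarrow> complex" and idx :: "nat \<Rightarrow> nat \<Rightarrow> 'i"
  assumes X: "indep_vars (\<lambda>_. borel) X J" and idx: "\<And>m c. idx m c \<in> J"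
    and inj: "\<And>m c m' c'. idx m c = idx m' c' \<Longrightarrow> m = m' \<and> c = c'"
    and mean: "\<And>m c. expectation (X (idx m c)) = 0"
    and var: "\<And>m c. expectation (\<lambda>\<omega>. (cmod (X (idx m c) \<omega>))\<^sup>2) = v"
    and fourth: "\<And>m c. integrable M (\<lambda>\<omega>. (cmod (X (idx m c) \<omega>)) ^ 4)"
    and \<kappa>: "\<And>m c. expectation (\<lambda>\<omega>. (cmod (X (idx m c) \<omega>)) ^ 4) \<le> \<kappa>"
  shows "integrable M (\<lambda>\<omega>. gram_frob (\<lambda>m c. X (idx m c) \<omega>) v R C)"
    and "expectation (\<lambda>\<omega>. gram_frob (\<lambda>m c. X (idx m c) \<omega>) v R C) \<le> (real R)\<^sup>2 * real C * (2 * \<kappa> + 2 * v\<^sup>2)"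
proof -
  define Z where "Z = (\<lambda>m c. X (idx m c))"
  have Z_meas[measurable]: "Z m c \<in> borel_measurable M" for m c
    unfolding Z_def by (rule indep_measurable[OF X idx])
  have sq: "integrable M (\<lambda>\<omega>. (cmod (Z m c \<omega>))\<^sup>2)" for m c
  proof (rule Bochner_Integration.integrable_bound)
    show "integrable M (\<lambda>\<omega>. 1 + (cmod (Z m c \<omega>)) ^ 4)"
      using fourth by (simp add: Z_def)
    have "(a::real)\<^sup>2 \<le> 1 + a ^ 4" for a
    proof -
      have "0 \<le> (a\<^sup>2 - 1)\<^sup>2" by simp
      also have "(a\<^sup>2 - 1)\<^sup>2 = a ^ 4 - 2 * a\<^sup>2 + 1"
        by (simp add: power2_eq_square power4_eq_xxxx algebra_simps)
      finally have "2 * a\<^sup>2 \<le> 1 + a ^ 4" by simp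
      moreover have "0 \<le> a\<^sup>2" by simp
      ultimately show ?thesis by linarith
    qed
    then show "AE \<omega> in M. norm ((cmod (Z m c \<omega>))\<^sup>2) \<le> norm (1 + (cmod (Z m c \<omega>)) ^ 4)"
      by (simp add: add_nonneg_nonneg)
  qed measurable
  have lin: "integrable M (Z m c)" for m c
  proof (rule Bochner_Integration.integrable_bound)
    show "integrable M (\<lambda>\<omega>. 1 + (cmod (Z m c \<omega>))\<^sup>2)"
      using sq by simp
    have "(a::real) \<le> 1 + a\<^sup>2" for a
    proof -
      have "0 \<le> (a - 1 / 2)\<^sup>2" by simp
      also have "(a - 1 / 2)\<^sup>2 = a\<^sup>2 - a + 1 / 4"
        by (simp add: power2_eq_square algebra_simps)
      finally show ?thesis by simp
    qed
    then show "AE \<omega> in M. norm (Z m c \<omega>) \<le> norm (1 + (cmod (Z m c \<omega>))\<^sup>2)"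
      by (simp add: add_nonneg_nonneg)
  qed measurable
  define W where "W = (\<lambda>m m' c \<omega>. Z m c \<omega> * cnj (Z m' c \<omega>) - (if m = m' then complex_of_real v else 0))"
  have W_meas[measurable]: "W m m' c \<in> borel_measurable M" for m m' c
    unfolding W_def by measurable
  have W_bd: "(cmod (W m m' c \<omega>))\<^sup>2 \<le> (cmod (Z m c \<omega>)) ^ 4 + (cmod (Z m' c \<omega>)) ^ 4 + 2 * v\<^sup>2" for m m' c \<omega>
  proof -
    define a where "a = cmod (Z m c \<omega>)"
    define b where "b = cmod (Z m' c \<omega>)"
    have "cmod (W m m' c \<omega>) \<le> cmod (Z m c \<omega> * cnj (Z m' c \<omega>)) + cmod (if m = m' then complex_of_real v else 0)"
      unfolding W_def by (rule norm_triangle_ineq4)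
    also have "\<dots> \<le> a * b + \<bar>v\<bar>"
      by (simp add: norm_mult a_def b_def)
    finally have "(cmod (W m m' c \<omega>))\<^sup>2 \<le> (a * b + \<bar>v\<bar>)\<^sup>2"
      by (intro power_mono) auto
    also have "\<dots> \<le> 2 * (a * b)\<^sup>2 + 2 * v\<^sup>2"
    proof -
      have "0 \<le> (a * b - \<bar>v\<bar>)\<^sup>2" by simp
      then show ?thesis by (simp add: power2_sum power2_diff)
    qed
    also have "2 * (a * b)\<^sup>2 \<le> a ^ 4 + b ^ 4"
    proof -
      have "0 \<le> (a\<^sup>2 - b\<^sup>2)\<^sup>2" by simp
      also have "(a\<^sup>2 - b\<^sup>2)\<^sup>2 = a ^ 4 + b ^ 4 - 2 * (a * b)\<^sup>2"
        by (simp add: power2_eq_square power4_eq_xxxx algebra_simps)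
      finally show ?thesis by simp
    qed
    finally show ?thesis by (simp add: a_def b_def)
  qed
  have W_sq: "integrable M (\<lambda>\<omega>. (cmod (W m m' c \<omega>))\<^sup>2)" for m m' c
  proof (rule Bochner_Integration.integrable_bound)
    show "integrable M (\<lambda>\<omega>. (cmod (Z m c \<omega>)) ^ 4 + (cmod (Z m' c \<omega>)) ^ 4 + 2 * v\<^sup>2)"
      using fourth by (simp add: Z_def)
    show "AE \<omega> in M. norm ((cmod (W m m' c \<omega>))\<^sup>2) \<le> norm ((cmod (Z m c \<omega>)) ^ 4 + (cmod (Z m' c \<omega>)) ^ 4 + 2 * v\<^sup>2)"
      using W_bd by (simp add: add_nonneg_nonneg)
  qed measurable
  have W_E: "expectation (\<lambda>\<omega>. (cmod (W m m' c \<omega>))\<^sup>2) \<le> 2 * \<kappa> + 2 * v\<^sup>2" for m m' c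
  proof -
    have "expectation (\<lambda>\<omega>. (cmod (W m m' c \<omega>))\<^sup>2) \<le> expectation (\<lambda>\<omega>. (cmod (Z m c \<omega>)) ^ 4 + (cmod (Z m' c \<omega>)) ^ 4 + 2 * v\<^sup>2)"
      using fourth by (intro integral_mono W_sq W_bd) (simp add: Z_def)
    also have "\<dots> = expectation (\<lambda>\<omega>. (cmod (Z m c \<omega>)) ^ 4) + expectation (\<lambda>\<omega>. (cmod (Z m' c \<omega>)) ^ 4) + 2 * v\<^sup>2"
      using fourth prob_space by (simp add: Z_def)
    also have "\<dots> \<le> 2 * \<kappa> + 2 * v\<^sup>2"
      using \<kappa>[of m c] \<kappa>[of m' c] by (simp add: Z_def)
    finally show ?thesis .
  qed
  have W_unc: "expectation (\<lambda>\<omega>. W m m' c \<omega> * cnj (W m m' c' \<omega>)) = 0" if cc: "c \<noteq> c'" for m m' c c'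
  proof (cases "m = m'")
    case True
    let ?g = "\<lambda>x. x * cnj x - complex_of_real v"
    have gi: "integrable M (\<lambda>\<omega>. ?g (X (idx m c) \<omega>))" for c
      using integrable_mult_cnj[OF Z_meas Z_meas sq sq, of m c m c] by (simp add: Z_def)
    have gm: "expectation (\<lambda>\<omega>. ?g (X (idx m c) \<omega>)) = 0" for c
    proof -
      have "?g (X (idx m c) \<omega>) = complex_of_real ((cmod (Z m c \<omega>))\<^sup>2 - v)" for \<omega>
        by (simp add: Z_def complex_norm_square del: of_real_power)
      then have "expectation (\<lambda>\<omega>. ?g (X (idx m c) \<omega>)) = complex_of_real (expectation (\<lambda>\<omega>. (cmod (Z m c \<omega>))\<^sup>2 - v))"
        by (simp only: integral_complex_of_real)
      also have "expectation (\<lambda>\<omega>. (cmod (Z m c \<omega>))\<^sup>2 - v) = 0"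
        using sq[of m c] var[of m c] prob_space by (simp add: Z_def)
      finally show ?thesis by simp
    qed
    have "expectation (\<lambda>\<omega>. ?g (X (idx m c) \<omega>) * ?g (X (idx m c') \<omega>)) = expectation (\<lambda>\<omega>. ?g (X (idx m c) \<omega>)) * expectation (\<lambda>\<omega>. ?g (X (idx m c') \<omega>))"
    proof (rule indep_expectation_mult(1)[OF X idx idx _ _ gi _ gi])
      show "idx m c \<noteq> idx m c'" using cc inj by blast
      show "?g \<in> borel_measurable borel" by measurable
      then show "?g \<in> borel_measurable borel" .
    qed
    moreover have "W m m' c \<omega> * cnj (W m m' c' \<omega>) = ?g (X (idx m c) \<omega>) * ?g (X (idx m c') \<omega>)" for \<omega>
      using True by (simp add: W_def Z_def mult.commute)
    ultimately show ?thesis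
      using gm by simp
  next
    case False
    let ?i = "idx m c" let ?j = "idx m' c" let ?k = "idx m c'" let ?l = "idx m' c'"
    have dist: "?i \<noteq> ?j" "?i \<noteq> ?k" "?i \<noteq> ?l" "?j \<noteq> ?k" "?j \<noteq> ?l" "?k \<noteq> ?l"
      using inj cc False by blast+
    \<comment> \<open>The product to be averaged is z_i conj(z_j) conj(z_k) z_l; \<open>g\<close>
      records which factors are conjugated.\<close>
    define g :: "'i \<Rightarrow> complex \<Rightarrow> complex" where "g = (\<lambda>i. if i = ?j \<or> i = ?k then cnj else id)"
    have "expectation (\<lambda>\<omega>. \<Prod>i\<in>{?i, ?j, ?k, ?l}. g i (X i \<omega>)) = (\<Prod>i\<in>{?i, ?j, ?k, ?l}. expectation (\<lambda>\<omega>. g i (X i \<omega>)))"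
    proof (rule indep_prod_expectation(1)[OF X])
      fix i assume i: "i \<in> {?i, ?j, ?k, ?l}"
      have "(\<lambda>x. cnj x) \<in> borel_measurable borel" by measurable
      then show "g i \<in> borel_measurable borel"
        by (auto simp: g_def id_def)
      show "integrable M (\<lambda>\<omega>. g i (X i \<omega>))"
        using i lin by (auto simp: g_def Z_def)
    qed (use idx in auto)
    moreover have "expectation (\<lambda>\<omega>. g ?i (X ?i \<omega>)) = 0"
      using dist mean[of m c] by (simp add: g_def)
    ultimately have "expectation (\<lambda>\<omega>. \<Prod>i\<in>{?i, ?j, ?k, ?l}. g i (X i \<omega>)) = 0"
      by (simp add: prod_zero_iff)
    moreover have "(\<Prod>i\<in>{?i, ?j, ?k, ?l}. g i (X i \<omega>)) = W m m' c \<omega> * cnj (W m m' c' \<omega>)" for \<omega>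
      using dist False by (simp add: W_def Z_def g_def mult_ac)
    ultimately show ?thesis by simp
  qed
  have D: "gram_dev (\<lambda>m c. X (idx m c) \<omega>) v C m m' = (\<Sum>c<C. W m m' c \<omega>)" for m m' \<omega>
    by (simp add: gram_dev_def W_def Z_def)
  have D_int: "integrable M (\<lambda>\<omega>. (cmod (\<Sum>c<C. W m m' c \<omega>))\<^sup>2)" for m m'
    by (rule second_moment_uncorrelated; simp add: W_sq W_unc)
  have D_E: "expectation (\<lambda>\<omega>. (cmod (\<Sum>c<C. W m m' c \<omega>))\<^sup>2) \<le> real C * (2 * \<kappa> + 2 * v\<^sup>2)" for m m'
  proof -
    have "expectation (\<lambda>\<omega>. (cmod (\<Sum>c<C. W m m' c \<omega>))\<^sup>2) = (\<Sum>c<C. expectation (\<lambda>\<omega>. (cmod (W m m' c \<omega>))\<^sup>2))"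
      by (rule second_moment_uncorrelated; simp add: W_sq W_unc)
    also have "\<dots> \<le> real C * (2 * \<kappa> + 2 * v\<^sup>2)"
      using sum_bounded_above[of "{..<C}" "\<lambda>c. expectation (\<lambda>\<omega>. (cmod (W m m' c \<omega>))\<^sup>2)"] W_E by simp
    finally show ?thesis .
  qed
  show "integrable M (\<lambda>\<omega>. gram_frob (\<lambda>m c. X (idx m c) \<omega>) v R C)"
    unfolding gram_frob_def D by (intro Bochner_Integration.integrable_sum D_int)
  have "expectation (\<lambda>\<omega>. gram_frob (\<lambda>m c. X (idx m c) \<omega>) v R C) = (\<Sum>m<R. \<Sum>m'<R. expectation (\<lambda>\<omega>. (cmod (\<Sum>c<C. W m m' c \<omega>))\<^sup>2))"
    unfolding gram_frob_def D using D_int by (simp add: Bochner_Integration.integral_sum Bochner_Integration.integrable_sum)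
  also have "\<dots> \<le> (\<Sum>m<R. \<Sum>m'<R. real C * (2 * \<kappa> + 2 * v\<^sup>2))"
    by (intro sum_mono D_E)
  also have "\<dots> = (real R)\<^sup>2 * real C * (2 * \<kappa> + 2 * v\<^sup>2)"
    by (simp add: power2_eq_square)
  finally show "expectation (\<lambda>\<omega>. gram_frob (\<lambda>m c. X (idx m c) \<omega>) v R C) \<le> (real R)\<^sup>2 * real C * (2 * \<kappa> + 2 * v\<^sup>2)" .
qed

text \<open>The operator norm is monotone in both dimensions, so it suffices to control it on the grid of
  dimensions \<open>(4 ^ a, 4 ^ b)\<close>, using the Gram matrix of the shorter side.\<close>

theorem noise_operator_bound:
  fixes X :: "'i \<Rightarrow> 'a \<Rightarrow> complex" and idx :: "nat \<Rightarrow> nat \<Rightarrow> 'i"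
  assumes X: "indep_vars (\<lambda>_. borel) X J" and idx: "\<And>m c. idx m c \<in> J"
    and inj: "\<And>m c m' c'. idx m c = idx m' c' \<Longrightarrow> m = m' \<and> c = c'"
    and mean: "\<And>m c. expectation (X (idx m c)) = 0"
    and var: "\<And>m c. expectation (\<lambda>\<omega>. (cmod (X (idx m c) \<omega>))\<^sup>2) = v"
    and fourth: "\<And>m c. integrable M (\<lambda>\<omega>. (cmod (X (idx m c) \<omega>)) ^ 4)"
    and \<kappa>: "\<And>m c. expectation (\<lambda>\<omega>. (cmod (X (idx m c) \<omega>)) ^ 4) \<le> \<kappa>"
  shows "AE \<omega> in M. \<exists>N. ((\<lambda>p. N (fst p) (snd p)) \<longlongrightarrow> 0) (sequentially \<times>\<^sub>F sequentially) \<and>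
    (\<forall>R C. 1 \<le> R \<longrightarrow> 1 \<le> C \<longrightarrow> 0 \<le> N R C \<and> op_bound (\<lambda>m c. X (idx m c) \<omega>) R C (N R C * (real R * real C)))"
proof -
  define k where "k = 2 * \<kappa> + 2 * v\<^sup>2"
  have v0: "0 \<le> v"
    using var[of 0 0] by (metis Bochner_Integration.integral_nonneg zero_le_power2)
  have "0 \<le> expectation (\<lambda>\<omega>. (cmod (X (idx 0 0) \<omega>)) ^ 4)"
    by simp
  then have "0 \<le> \<kappa>" using \<kappa>[of 0 0] by linarith
  then have k0: "0 \<le> k" by (simp add: k_def)
  \<comment> \<open>Squared Frobenius deviations on the grid, relative to (R C)^2, for the rows here
    and for the columns in \<open>G2\<close>. The first is small when 4^b is large, the second when
    4^a is, so the larger exponent decides which of them is used.\<close>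
  define G1 where "G1 = (\<lambda>\<omega> a b. gram_frob (\<lambda>m c. X (idx m c) \<omega>) v (4 ^ a) (4 ^ b) / (4 ^ a * 4 ^ b)\<^sup>2)"
  define G2 where "G2 = (\<lambda>\<omega> a b. gram_frob (\<lambda>c m. X (idx m c) \<omega>) v (4 ^ b) (4 ^ a) / (4 ^ a * 4 ^ b)\<^sup>2)"
  have G0: "0 \<le> G1 \<omega> a b" "0 \<le> G2 \<omega> a b" for \<omega> a b
    by (simp_all add: G1_def G2_def gram_frob_def sum_nonneg)
  have G1: "integrable M (\<lambda>\<omega>. G1 \<omega> a b)" "expectation (\<lambda>\<omega>. G1 \<omega> a b) \<le> k / 4 ^ b" for a b
  proof -
    have gf: "integrable M (\<lambda>\<omega>. gram_frob (\<lambda>m c. X (idx m c) \<omega>) v (4 ^ a) (4 ^ b))"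
      "expectation (\<lambda>\<omega>. gram_frob (\<lambda>m c. X (idx m c) \<omega>) v (4 ^ a) (4 ^ b)) \<le> (real (4 ^ a))\<^sup>2 * real (4 ^ b) * (2 * \<kappa> + 2 * v\<^sup>2)"
      by (rule gram_frob_expectation[where X = X and J = J and idx = idx and v = v and \<kappa> = \<kappa> and R = "4 ^ a" and C = "4 ^ b", OF X idx inj mean var fourth \<kappa>], assumption)+
    show "integrable M (\<lambda>\<omega>. G1 \<omega> a b)"
      unfolding G1_def using gf(1) by simp
    have "expectation (\<lambda>\<omega>. G1 \<omega> a b) \<le> ((real (4 ^ a))\<^sup>2 * real (4 ^ b) * k) / (4 ^ a * 4 ^ b)\<^sup>2"
      unfolding G1_def k_def integral_divide_zero using gf(2) by (rule divide_right_mono) (rule zero_le_power2)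
    also have "\<dots> = k / 4 ^ b"
      by (simp add: power2_eq_square)
    finally show "expectation (\<lambda>\<omega>. G1 \<omega> a b) \<le> k / 4 ^ b" .
  qed
  have G2: "integrable M (\<lambda>\<omega>. G2 \<omega> a b)" "expectation (\<lambda>\<omega>. G2 \<omega> a b) \<le> k / 4 ^ a" for a b
  proof -
    have inj': "m = m' \<and> c = c'" if "idx c m = idx c' m'" for m c m' c'
      using inj[OF that] by simp
    have gf: "integrable M (\<lambda>\<omega>. gram_frob (\<lambda>c m. X (idx m c) \<omega>) v (4 ^ b) (4 ^ a))"
      "expectation (\<lambda>\<omega>. gram_frob (\<lambda>c m. X (idx m c) \<omega>) v (4 ^ b) (4 ^ a)) \<le> (real (4 ^ b))\<^sup>2 * real (4 ^ a) * (2 * \<kappa> + 2 * v\<^sup>2)"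
      by (rule gram_frob_expectation[where X = X and J = J and idx = "\<lambda>c m. idx m c" and v = v and \<kappa> = \<kappa> and R = "4 ^ b" and C = "4 ^ a", OF X idx inj' mean var fourth \<kappa>], assumption)+
    show "integrable M (\<lambda>\<omega>. G2 \<omega> a b)"
      unfolding G2_def using gf(1) by simp
    have "expectation (\<lambda>\<omega>. gram_frob (\<lambda>c m. X (idx m c) \<omega>) v (4 ^ b) (4 ^ a)) \<le> (real (4 ^ b))\<^sup>2 * real (4 ^ a) * k"
      unfolding k_def by (rule gf(2))
    then have "expectation (\<lambda>\<omega>. G2 \<omega> a b) \<le> ((real (4 ^ b))\<^sup>2 * real (4 ^ a) * k) / (4 ^ a * 4 ^ b)\<^sup>2"
      unfolding G2_def integral_divide_zero by (rule divide_right_mono) (rule zero_le_power2)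
    also have "\<dots> = k / 4 ^ a"
      by (simp add: power2_eq_square)
    finally show "expectation (\<lambda>\<omega>. G2 \<omega> a b) \<le> k / 4 ^ a" .
  qed
  \<comment> \<open>All grid points whose larger exponent is \<open>n\<close>: 2 (n + 1) terms of
    expectation at most k / 4^n each, which is summable over \<open>n\<close>.\<close>
  define Y where "Y = (\<lambda>n \<omega>. (\<Sum>a\<le>n. G1 \<omega> a n) + (\<Sum>b\<le>n. G2 \<omega> n b))"
  have "AE \<omega> in M. summable (\<lambda>n. Y n \<omega>)"
  proof (rule AE_summable)
    show "integrable M (Y n)" for n
      unfolding Y_def by (intro Bochner_Integration.integrable_add Bochner_Integration.integrable_sum G1 G2)
    show "summable (\<lambda>n. expectation (Y n))"
    proof (rule summable_comparison_test'[of "\<lambda>n. (2 * k) * (1 / 2) ^ n" 0])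
      show "summable (\<lambda>n. (2 * k) * (1 / 2) ^ n)"
        by (intro summable_mult summable_geometric) simp
      fix n
      have "expectation (Y n) = (\<Sum>a\<le>n. expectation (\<lambda>\<omega>. G1 \<omega> a n)) + (\<Sum>b\<le>n. expectation (\<lambda>\<omega>. G2 \<omega> n b))"
        unfolding Y_def using G1(1) G2(1) by (simp add: Bochner_Integration.integral_sum Bochner_Integration.integrable_sum)
      also have "\<dots> \<le> (\<Sum>a\<le>n. k / 4 ^ n) + (\<Sum>b\<le>n. k / 4 ^ n)"
        by (intro add_mono sum_mono G1 G2)
      also have "\<dots> = 2 * (real (Suc n) * (k / 4 ^ n))"
        by simp
      also have "\<dots> \<le> 2 * (2 ^ n * (k / 4 ^ n))"
      proof -
        have "Suc n \<le> 2 ^ n" using less_exp[of n] by (simp add: Suc_le_eq)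
        then have "real (Suc n) \<le> 2 ^ n" by (metis of_nat_le_iff of_nat_numeral of_nat_power)
        then show ?thesis using k0 by (intro mult_left_mono mult_right_mono) auto
      qed
      also have "\<dots> = (2 * k) * (1 / 2) ^ n"
      proof -
        have "(4::real) ^ n = 2 ^ n * 2 ^ n" by (simp add: power_mult_distrib[symmetric])
        then show ?thesis by (simp add: power_divide)
      qed
      finally show "norm (expectation (Y n)) \<le> (2 * k) * (1 / 2) ^ n"
        by (simp add: Y_def sum_nonneg G0)
    qed
  qed (simp add: Y_def sum_nonneg G0)
  then show ?thesis
  proof (rule AE_mp, intro AE_I2 impI)
    fix \<omega> assume "summable (\<lambda>n. Y n \<omega>)"
    then have Y0: "(\<lambda>n. Y n \<omega>) \<longlonglongrightarrow> 0" by (rule summable_LIMSEQ_zero)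
    \<comment> \<open>The factor 16 comes from rounding both dimensions up to the grid, by at most 4
      each. The other two terms come from the mean of the Gram matrix, C v or R v after the same
      rounding, divided by R C.\<close>
    define N where "N R C = 16 * sqrt (Y (max (lg4 R) (lg4 C)) \<omega>) + (4 * v) / real R + (4 * v) / real C" for R C
    have Ynn: "0 \<le> Y n \<omega>" for n by (simp add: Y_def sum_nonneg G0)
    have "((\<lambda>p. N (fst p) (snd p)) \<longlongrightarrow> 16 * sqrt 0 + 0 + 0) (sequentially \<times>\<^sub>F sequentially)"
      unfolding N_def
    proof (intro tendsto_add tendsto_mult tendsto_const tendsto_real_sqrt)
      have "filterlim (\<lambda>p. max (lg4 (fst p)) (lg4 (snd p))) at_top (sequentially \<times>\<^sub>F sequentially)"
        by (rule filterlim_at_top_mono[OF filterlim_compose[OF filterlim_lg4 filterlim_fst]]) simp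
      then show "((\<lambda>p. Y (max (lg4 (fst p)) (lg4 (snd p))) \<omega>) \<longlongrightarrow> 0) (sequentially \<times>\<^sub>F sequentially)"
        by (rule filterlim_compose[OF Y0])
      have "(\<lambda>n. (4 * v) / real n) \<longlonglongrightarrow> 0" by real_asymp
      then show "((\<lambda>p. (4 * v) / real (fst p)) \<longlongrightarrow> 0) (sequentially \<times>\<^sub>F sequentially)"
        "((\<lambda>p. (4 * v) / real (snd p)) \<longlongrightarrow> 0) (sequentially \<times>\<^sub>F sequentially)"
        by (rule filterlim_compose[OF _ filterlim_fst], rule filterlim_compose[OF _ filterlim_snd])
    qed
    then have 1: "((\<lambda>p. N (fst p) (snd p)) \<longlongrightarrow> 0) (sequentially \<times>\<^sub>F sequentially)" by simp
    have "0 \<le> N R C \<and> op_bound (\<lambda>m c. X (idx m c) \<omega>) R C (N R C * (real R * real C))" if RC: "1 \<le> R" "1 \<le> C" for R C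
    proof
      let ?z = "\<lambda>m c. X (idx m c) \<omega>"
      define a where "a = lg4 R" define b where "b = lg4 C"
      have pa: "R \<le> 4 ^ a" "(4::real) ^ a \<le> 4 * real R"
      proof -
        have "real (4 ^ a) \<le> real (4 * R)"
          using lg4(2)[OF RC(1)] unfolding a_def of_nat_le_iff .
        then show "(4::real) ^ a \<le> 4 * real R" by simp
      qed (simp add: a_def lg4)
      have pb: "C \<le> 4 ^ b" "(4::real) ^ b \<le> 4 * real C"
      proof -
        have "real (4 ^ b) \<le> real (4 * C)"
          using lg4(2)[OF RC(2)] unfolding b_def of_nat_le_iff .
        then show "(4::real) ^ b \<le> 4 * real C" by simp
      qed (simp add: b_def lg4)
      let ?Y = "sqrt (Y (max a b) \<omega>)"
      have ab: "(4 ^ a * 4 ^ b) * ?Y \<le> 16 * ?Y * (real R * real C)"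
      proof -
        have "(4::real) ^ a * 4 ^ b \<le> (4 * real R) * (4 * real C)"
          using pa pb by (intro mult_mono) auto
        then have "(4 ^ a * 4 ^ b) * ?Y \<le> ((4 * real R) * (4 * real C)) * ?Y"
          by (rule mult_right_mono) (simp add: Ynn)
        then show ?thesis by (simp add: mult_ac)
      qed
      have frob: "sqrt g \<le> (4 ^ a * 4 ^ b) * ?Y" if "g / (4 ^ a * 4 ^ b)\<^sup>2 \<le> Y (max a b) \<omega>" for g
      proof -
        have "g \<le> Y (max a b) \<omega> * (4 ^ a * 4 ^ b)\<^sup>2"
          using that by (subst (asm) pos_divide_le_eq) auto
        then have "sqrt g \<le> sqrt (Y (max a b) \<omega> * (4 ^ a * 4 ^ b)\<^sup>2)"
          by (rule real_sqrt_le_mono)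
        then show ?thesis by (simp add: real_sqrt_mult mult.commute)
      qed
      show N0: "0 \<le> N R C" using v0 Ynn by (simp add: N_def)
      have vR: "4 ^ b * v \<le> (4 * v / real R) * (real R * real C)"
        using RC pb v0 mult_right_mono[OF pb(2) v0] by (simp add: mult_ac)
      have vC: "4 ^ a * v \<le> (4 * v / real C) * (real R * real C)"
        using RC pa v0 mult_right_mono[OF pa(2) v0] by (simp add: mult_ac)
      have Nsum: "N R C * (real R * real C) = 16 * ?Y * (real R * real C) + (4 * v / real R) * (real R * real C) + (4 * v / real C) * (real R * real C)"
        by (simp add: N_def a_def b_def distrib_right)
      have pos: "0 \<le> (4 * v / real R) * (real R * real C)" "0 \<le> (4 * v / real C) * (real R * real C)"
        using v0 by auto
      have weaken: "op_bound z' R' C' q" if "op_bound z' R' C' q'" "q' \<le> q" for z' R' C' q q'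
        using that unfolding op_bound_def by (meson mult_right_mono order.trans zero_le_power2)
      show "op_bound ?z R C (N R C * (real R * real C))"
      proof (cases "a \<le> b")
        case True
        have "G1 \<omega> a b \<le> (\<Sum>a\<le>b. G1 \<omega> a b)"
          using True by (intro member_le_sum) (auto simp: G0)
        also have "\<dots> \<le> Y b \<omega>" by (simp add: Y_def sum_nonneg G0)
        finally have "G1 \<omega> a b \<le> Y (max a b) \<omega>" using True by (simp add: max_def)
        from frob[OF this[unfolded G1_def]]
        have "sqrt (gram_frob ?z v (4 ^ a) (4 ^ b)) + real (4 ^ b) * v \<le> N R C * (real R * real C)"
          using ab vR pos unfolding Nsum by simp
        then have "op_bound ?z (4 ^ a) (4 ^ b) (N R C * (real R * real C))"
          by (rule weaken[OF op_bound_gram])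
        then show ?thesis by (rule op_bound_mono) (use pa pb in auto)
      next
        case False
        have "G2 \<omega> a b \<le> (\<Sum>b\<le>a. G2 \<omega> a b)"
          using False by (intro member_le_sum) (auto simp: G0)
        also have "\<dots> \<le> Y a \<omega>" by (simp add: Y_def sum_nonneg G0)
        finally have "G2 \<omega> a b \<le> Y (max a b) \<omega>" using False by (simp add: max_def)
        from frob[OF this[unfolded G2_def]]
        have "sqrt (gram_frob (\<lambda>c m. ?z m c) v (4 ^ b) (4 ^ a)) + real (4 ^ a) * v \<le> N R C * (real R * real C)"
          using ab vC pos unfolding Nsum by simp
        then have *: "op_bound (\<lambda>c m. ?z m c) (4 ^ b) (4 ^ a) (N R C * (real R * real C))"
          by (rule weaken[OF op_bound_gram])
        have nn: "0 \<le> N R C * (real R * real C)" using N0 by simp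
        from * have "op_bound ?z (4 ^ a) (4 ^ b) (N R C * (real R * real C))"
          by (rule op_bound_transpose[where z = ?z, OF nn])
        then show ?thesis by (rule op_bound_mono) (use pa pb in auto)
      qed
    qed
    with 1 show "\<exists>N. ((\<lambda>p. N (fst p) (snd p)) \<longlongrightarrow> 0) (sequentially \<times>\<^sub>F sequentially) \<and>
      (\<forall>R C. 1 \<le> R \<longrightarrow> 1 \<le> C \<longrightarrow> 0 \<le> N R C \<and> op_bound (\<lambda>m c. X (idx m c) \<omega>) R C (N R C * (real R * real C)))"
      by blast
  qed
qed

end

text \<open>The fourth moment is estimated through (x^2 + y^2)^2 <= 2 x^4 + 2 y^4, where the real
  and the imaginary part each have fourth moment 3 (v / 2)^2.\<close>

lemma (in prob_space) complex_gaussian_moments: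
  assumes g: "complex_gaussian M v X" and v: "0 < v" and [measurable]: "X \<in> borel_measurable M"
  shows "expectation X = 0" "expectation (\<lambda>\<omega>. (cmod (X \<omega>))\<^sup>2) = v"
    "integrable M (\<lambda>\<omega>. (cmod (X \<omega>)) ^ 4)" "expectation (\<lambda>\<omega>. (cmod (X \<omega>)) ^ 4) \<le> 3 * v\<^sup>2"
proof -
  define s where "s = sqrt (v / 2)"
  have s: "0 < s" "s\<^sup>2 = v / 2" using v by (auto simp: s_def)
  have re: "distributed M lborel (\<lambda>\<omega>. Re (X \<omega>)) (normal_density 0 s)"
    and im: "distributed M lborel (\<lambda>\<omega>. Im (X \<omega>)) (normal_density 0 s)"
    using g by (auto simp: complex_gaussian_def s_def)
  have moments: "expectation Y = 0 \<and> integrable M Y \<and> expectation (\<lambda>\<omega>. (Y \<omega>)\<^sup>2) = v / 2 \<and> integrable M (\<lambda>\<omega>. (Y \<omega>)\<^sup>2) \<and>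
      expectation (\<lambda>\<omega>. (Y \<omega>) ^ 4) = 3 * v\<^sup>2 / 4 \<and> integrable M (\<lambda>\<omega>. (Y \<omega>) ^ 4)"
    if Y: "distributed M lborel Y (normal_density 0 s)" for Y :: "'a \<Rightarrow> real"
  proof -
    have e: "expectation (\<lambda>\<omega>. (Y \<omega>) ^ k) = (LINT x|lborel. normal_density 0 s x * (x - 0) ^ k)" for k
      using distributed_integral[OF Y, of "\<lambda>x. x ^ k"] by simp
    have i: "integrable M (\<lambda>\<omega>. (Y \<omega>) ^ k)" for k
      using distributed_integrable[OF Y, of "\<lambda>x. x ^ k"] integrable_normal_moment[OF s(1), of 0 k] by simp
    have "expectation (\<lambda>\<omega>. (Y \<omega>) ^ 1) = 0"
      unfolding e using integral_normal_moment_odd[OF s(1), of 0 0] by simp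
    moreover have "expectation (\<lambda>\<omega>. (Y \<omega>)\<^sup>2) = v / 2"
      unfolding e using integral_normal_moment_even[OF s(1), of 0 1] s(2) by simp
    moreover have "expectation (\<lambda>\<omega>. (Y \<omega>) ^ 4) = 3 * v\<^sup>2 / 4"
      unfolding e using integral_normal_moment_even[OF s(1), of 0 2, unfolded s(2)] v
      by (simp add: fact_numeral power2_eq_square field_simps)
    ultimately show ?thesis
      using i[of 1] i[of 2] i[of 4] by simp
  qed
  note R = moments[OF re] and J = moments[OF im]
  have X_int: "integrable M X"
  proof -
    have "integrable M (\<lambda>\<omega>. complex_of_real (Re (X \<omega>)) + \<i> * complex_of_real (Im (X \<omega>)))"
      using R J by (intro Bochner_Integration.integrable_add integrable_mult_right integrable_of_real) auto
    then show ?thesis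
      by (simp only: complex_eq[symmetric])
  qed
  show "expectation X = 0"
  proof (rule complex_eqI)
    show "Re (expectation X) = Re 0"
      using R by (subst integral_Re[OF X_int, symmetric]) simp
    show "Im (expectation X) = Im 0"
      using J by (subst integral_Im[OF X_int, symmetric]) simp
  qed
  show "expectation (\<lambda>\<omega>. (cmod (X \<omega>))\<^sup>2) = v"
    using R J by (simp add: cmod_power2)
  have four: "(cmod z) ^ 4 \<le> 2 * (Re z) ^ 4 + 2 * (Im z) ^ 4" for z
  proof -
    have "(cmod z) ^ 4 = ((Re z)\<^sup>2 + (Im z)\<^sup>2)\<^sup>2"
      by (metis cmod_power2 mult_2 numeral_Bit0 power2_eq_square power_add)
    also have "\<dots> \<le> 2 * ((Re z)\<^sup>2)\<^sup>2 + 2 * ((Im z)\<^sup>2)\<^sup>2"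
    proof -
      have "0 \<le> ((Re z)\<^sup>2 - (Im z)\<^sup>2)\<^sup>2" by simp
      then show ?thesis by (simp only: power2_sum power2_diff)
    qed
    finally show ?thesis by (simp flip: power_mult)
  qed
  show i4: "integrable M (\<lambda>\<omega>. (cmod (X \<omega>)) ^ 4)"
  proof (rule Bochner_Integration.integrable_bound)
    show "integrable M (\<lambda>\<omega>. 2 * (Re (X \<omega>)) ^ 4 + 2 * (Im (X \<omega>)) ^ 4)"
      using R J by simp
    show "AE \<omega> in M. norm ((cmod (X \<omega>)) ^ 4) \<le> norm (2 * (Re (X \<omega>)) ^ 4 + 2 * (Im (X \<omega>)) ^ 4)"
      using four by (intro AE_I2) (simp add: order.trans[OF four abs_ge_self])
  qed measurable
  have "expectation (\<lambda>\<omega>. (cmod (X \<omega>)) ^ 4) \<le> expectation (\<lambda>\<omega>. 2 * (Re (X \<omega>)) ^ 4 + 2 * (Im (X \<omega>)) ^ 4)"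
    using R J by (intro integral_mono i4 four) auto
  also have "\<dots> = 3 * v\<^sup>2"
    using R J by simp
  finally show "expectation (\<lambda>\<omega>. (cmod (X \<omega>)) ^ 4) \<le> 3 * v\<^sup>2" .
qed

section \<open>Gram matrices of steering vectors and of the received data\<close>

lemma dirichlet_ip: "ip M (\<lambda>m. wave m x) (\<lambda>m. wave m y) = dirichlet M x y"
  by (simp add: ip_def dirichlet_def)

lemma nrm_wave: "nrm M (\<lambda>m. wave m x) = sqrt (real M)"
  by (simp add: nrm_def L2_set_def)

text \<open>Off the diagonal the Dirichlet kernel is bounded in \<open>M\<close>, since two points
  of the open unit interval stay clear of the wrap-around.\<close>

lemma dirichlet_average:
  assumes "x \<in> {0<..<1}" "y \<in> {0<..<1}"
  shows "(\<lambda>M. dirichlet M x y / of_nat M) \<longlonglongrightarrow> (if x = y then 1 else 0)"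
proof (cases "x = y")
  case True
  have dx: "dirichlet M x x = of_nat M" for M
    using ip_self[of M "\<lambda>m. wave m x"] by (simp add: dirichlet_ip[symmetric] nrm_wave)
  have "\<forall>\<^sub>F M in sequentially. dirichlet M x y / of_nat M = 1"
    using eventually_gt_at_top[of "0::nat"] by eventually_elim (simp add: True[symmetric] dx)
  then show ?thesis
    using True by (simp add: tendsto_eventually)
next
  case False
  define \<delta> where "\<delta> = 1 - \<bar>y - x\<bar>"
  have \<delta>: "0 < \<delta>" "\<delta> \<le> 1" using assms by (auto simp: \<delta>_def)
  define c where "c = 1 / (\<delta> * \<bar>y - x\<bar>)"
  have "(\<lambda>M. dirichlet M x y / of_nat M) \<longlonglongrightarrow> 0"
  proof (rule Lim_null_comparison)
    show "\<forall>\<^sub>F M in sequentially. norm (dirichlet M x y / of_nat M) \<le> c / real M"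
    proof (rule always_eventually, rule allI)
      fix M
      have "cmod (dirichlet M x y) \<le> c"
        unfolding c_def using False \<delta> by (intro cmod_dirichlet_far) (auto simp: \<delta>_def)
      then show "norm (dirichlet M x y / of_nat M) \<le> c / real M"
        by (simp add: norm_divide divide_right_mono)
    qed
    show "(\<lambda>M. c / real M) \<longlonglongrightarrow> 0" by real_asymp
  qed
  then show ?thesis using False by simp
qed

text \<open>After division by sqrt M, steering vectors of distinct frequencies are asymptotically
  orthonormal, so inner products of combinations tend to those of the coefficients.\<close>

lemma wave_comb_gram:
  assumes S: "finite S" and inj: "inj_on x S" and x: "\<And>s. s \<in> S \<Longrightarrow> x s \<in> {0<..<1}"
  shows "(\<lambda>M. ip M (\<lambda>m. \<Sum>s\<in>S. a s * wave m (x s)) (\<lambda>m. \<Sum>s\<in>S. b s * wave m (x s)) / of_nat M)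
    \<longlonglongrightarrow> (\<Sum>s\<in>S. a s * cnj (b s))"
proof -
  have "(\<lambda>M. \<Sum>s\<in>S. \<Sum>s'\<in>S. a s * cnj (b s') * (dirichlet M (x s) (x s') / of_nat M))
      \<longlonglongrightarrow> (\<Sum>s\<in>S. \<Sum>s'\<in>S. a s * cnj (b s') * (if x s = x s' then 1 else 0))"
    by (intro tendsto_sum tendsto_mult tendsto_const dirichlet_average x)
  moreover have "(\<Sum>s\<in>S. \<Sum>s'\<in>S. a s * cnj (b s') * (if x s = x s' then 1 else 0)) = (\<Sum>s\<in>S. a s * cnj (b s))"
  proof (rule sum.cong[OF refl])
    fix s assume s: "s \<in> S"
    have "(\<Sum>s'\<in>S. a s * cnj (b s') * (if x s = x s' then 1 else 0)) = (\<Sum>s'\<in>S. if s = s' then a s * cnj (b s) else 0)"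
      by (rule sum.cong) (use inj s in \<open>auto simp: inj_on_def\<close>)
    then show "(\<Sum>s'\<in>S. a s * cnj (b s') * (if x s = x s' then 1 else 0)) = a s * cnj (b s)"
      using S s by simp
  qed
  moreover have "ip M (\<lambda>m. \<Sum>s\<in>S. a s * wave m (x s)) (\<lambda>m. \<Sum>s\<in>S. b s * wave m (x s)) / of_nat M =
     (\<Sum>s\<in>S. \<Sum>s'\<in>S. a s * cnj (b s') * (dirichlet M (x s) (x s') / of_nat M))" for M
    by (simp add: ip_sum_left ip_sum_right ip_scale_left ip_scale_right dirichlet_ip sum_distrib_left
        sum_divide_distrib mult_ac)
  ultimately show ?thesis by simp
qed

text \<open>A deterministic comparison of W W* y / (C M) with the sum of the h_l h_l* y / M. With q
  = W* y, the error consists of the deviation of the symbol Gram matrix from the identity, the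
  correlation of symbols with noise, and the noise applied to q. Here \<open>g\<close> measures the
  first, and \<open>N\<close> is the squared noise norm relative to M C; the explicit constant
  vanishes with both.\<close>

lemma data_gram_bound:
  fixes h x z :: "nat \<Rightarrow> nat \<Rightarrow> complex" and I :: "nat set"
  defines "W \<equiv> \<lambda>m c. (\<Sum>l\<in>I. h l m * x l c) + z m c"
  assumes I: "finite I" and M: "0 < M" and C: "0 < C"
    and B: "0 \<le> B" "\<And>l. l \<in> I \<Longrightarrow> nrm M (h l) \<le> B * sqrt (real M)"
    and X: "\<And>l. l \<in> I \<Longrightarrow> nrm C (x l) \<le> X * sqrt (real C)" "0 \<le> X"
    and N: "0 \<le> N" "op_bound z M C (N * (real M * real C))"
    and g: "\<And>l k. l \<in> I \<Longrightarrow> k \<in> I \<Longrightarrow> cmod ((\<Sum>c<C. x l c * cnj (x k c)) / of_nat C - (if l = k then 1 else 0)) \<le> g"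
  shows "nrm M (\<lambda>m. (\<Sum>c<C. W m c * (\<Sum>m'<M. cnj (W m' c) * y m')) / of_nat (C * M)
      - (\<Sum>l\<in>I. ip M y (\<lambda>i. h l i / sqrt (real M)) * (h l m / sqrt (real M))))
    \<le> (real (card I) * B * (real (card I) * B * g + X * sqrt N) + sqrt N * (real (card I) * X * B + sqrt N)) * nrm M y"
proof -
  define q where "q = (\<lambda>c. \<Sum>m'<M. cnj (W m' c) * y m')"
  define \<zeta> where "\<zeta> = (\<lambda>c. \<Sum>m'<M. cnj (z m' c) * y m')"
  define r where "r = sqrt (real M)"
  define n where "n = sqrt (real C)"
  define Y where "Y = nrm M y"
  have r: "0 < r" "complex_of_real r * complex_of_real r = of_nat M" "r * r = real M" using M
    by (auto simp: r_def of_real_mult[symmetric] simp del: of_real_mult)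
  have n: "0 < n" "n * n = real C" using C by (auto simp: n_def)
  have Y0: "0 \<le> Y" by (simp add: Y_def)
  have cardI: "real (card I) \<ge> 0" by simp
  have q_eq: "q c = (\<Sum>l\<in>I. ip M y (h l) * cnj (x l c)) + \<zeta> c" for c
  proof -
    have "q c = (\<Sum>m'<M. \<Sum>l\<in>I. cnj (x l c) * (y m' * cnj (h l m'))) + \<zeta> c"
      unfolding q_def W_def \<zeta>_def
      by (simp add: distrib_right distrib_left sum.distrib sum_distrib_right sum_distrib_left mult_ac)
    also have "(\<Sum>m'<M. \<Sum>l\<in>I. cnj (x l c) * (y m' * cnj (h l m'))) = (\<Sum>l\<in>I. ip M y (h l) * cnj (x l c))"
      by (subst sum.swap) (simp add: ip_def sum_distrib_left sum_distrib_right mult_ac)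
    finally show ?thesis .
  qed
  have ipB: "cmod (ip M y (h l)) \<le> Y * (B * r)" if "l \<in> I" for l
  proof -
    have "nrm M y * nrm M (h l) \<le> nrm M y * (B * r)"
      unfolding r_def using that by (intro mult_left_mono B) auto
    then show ?thesis
      using ip_bound[of M y "h l"] by (simp add: Y_def)
  qed
  have \<zeta>_bd: "nrm C \<zeta> \<le> sqrt N * r * n * Y"
  proof (rule power2_le_imp_le)
    have "(nrm C \<zeta>)\<^sup>2 \<le> N * (real M * real C) * Y\<^sup>2"
      unfolding \<zeta>_def Y_def using N(2) unfolding op_bound_def by (rule spec)
    also have "\<dots> = (sqrt N * r * n * Y)\<^sup>2"
      using N(1) by (simp add: power_mult_distrib r_def n_def mult_ac)
    finally show "(nrm C \<zeta>)\<^sup>2 \<le> (sqrt N * r * n * Y)\<^sup>2" .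
  qed (use N r n Y0 in simp)
  have q_bd: "nrm C q \<le> r * n * ((real (card I) * X * B + sqrt N) * Y)"
  proof -
    have "nrm C q \<le> nrm C (\<lambda>c. \<Sum>l\<in>I. ip M y (h l) * cnj (x l c)) + nrm C \<zeta>"
      unfolding q_eq by (rule nrm_add)
    also have "nrm C (\<lambda>c. \<Sum>l\<in>I. ip M y (h l) * cnj (x l c)) \<le> (\<Sum>l\<in>I. cmod (ip M y (h l)) * nrm C (x l))"
      using nrm_sum[OF I, of C "\<lambda>l c. ip M y (h l) * cnj (x l c)"] by (simp add: nrm_scale) (simp add: nrm_def)
    also have "\<dots> \<le> (\<Sum>l\<in>I. (Y * (B * r)) * (X * n))"
      unfolding n_def using Y0 B r by (intro sum_mono mult_mono ipB X) auto
    finally have "nrm C q \<le> (\<Sum>l\<in>I. (Y * (B * r)) * (X * n)) + sqrt N * r * n * Y"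
      using \<zeta>_bd by linarith
    then show ?thesis by (simp add: algebra_simps)
  qed
  \<comment> \<open>Here the noise matrix itself acts, whereas \<open>op_bound\<close> speaks of its
    adjoint, so the bound is carried over by \<open>nrm_app_adjoint\<close>.\<close>
  have Zq: "nrm M (\<lambda>m. \<Sum>c<C. z m c * q c) \<le> sqrt N * r * n * nrm C q"
  proof -
    define Zm where "Zm = mat M C (\<lambda>(m, c). z m c)"
    have Zm: "Zm \<in> carrier_mat M C" by (simp add: Zm_def)
    have N': "0 \<le> N * (real M * real C)" using N by simp
    have "nrm M (app C (mat_adjoint (mat_adjoint Zm)) q) \<le> sqrt (N * (real M * real C)) * nrm C q"
    proof (rule nrm_app_adjoint[OF mat_adjoint_carrier[OF Zm]])
      show "nrm C (app M (mat_adjoint Zm) x) \<le> sqrt (N * (real M * real C)) * nrm M x" for x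
        using N(2) op_bound_iff_nrm[OF N'] by (simp add: Zm_def)
    qed (use N' in simp)
    moreover have "nrm M (app C (mat_adjoint (mat_adjoint Zm)) q) = nrm M (\<lambda>m. \<Sum>c<C. z m c * q c)"
      unfolding mat_adjoint_adjoint by (rule nrm_cong) (simp add: app_def Zm_def)
    ultimately show ?thesis
      by (simp add: real_sqrt_mult r_def n_def mult_ac)
  qed
  \<comment> \<open>The amount by which the correlation of \<open>q\<close> with the symbols of user
    l misses the amplitude <y, h_l>.\<close>
  define e where "e = (\<lambda>l. (\<Sum>c<C. x l c * q c) / of_nat C - ip M y (h l))"
  have e_bd: "cmod (e l) \<le> r * ((real (card I) * B * g + X * sqrt N) * Y)" if l: "l \<in> I" for l
  proof -
    let ?d = "\<lambda>k. (\<Sum>c<C. x l c * cnj (x k c)) / of_nat C - (if l = k then 1 else 0)"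
    have "(\<Sum>c<C. x l c * q c) = (\<Sum>k\<in>I. ip M y (h k) * (\<Sum>c<C. x l c * cnj (x k c))) + (\<Sum>c<C. x l c * \<zeta> c)"
    proof -
      have "(\<Sum>c<C. x l c * q c) = (\<Sum>c<C. \<Sum>k\<in>I. ip M y (h k) * (x l c * cnj (x k c))) + (\<Sum>c<C. x l c * \<zeta> c)"
        unfolding q_eq by (simp add: distrib_left sum.distrib sum_distrib_left mult_ac)
      also have "(\<Sum>c<C. \<Sum>k\<in>I. ip M y (h k) * (x l c * cnj (x k c))) = (\<Sum>k\<in>I. ip M y (h k) * (\<Sum>c<C. x l c * cnj (x k c)))"
        by (subst sum.swap) (simp add: sum_distrib_left)
      finally show ?thesis .
    qed
    then have "(\<Sum>c<C. x l c * q c) / of_nat C = (\<Sum>k\<in>I. ip M y (h k) * ((\<Sum>c<C. x l c * cnj (x k c)) / of_nat C)) + (\<Sum>c<C. x l c * \<zeta> c) / of_nat C"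
      by (simp add: add_divide_distrib sum_divide_distrib sum_distrib_left)
    moreover have "ip M y (h l) = (\<Sum>k\<in>I. ip M y (h k) * (if l = k then 1 else 0))"
      using I l by (simp add: if_distrib[of "\<lambda>a. _ * a"] cong: if_cong)
    ultimately have "e l = (\<Sum>k\<in>I. ip M y (h k) * ?d k) + (\<Sum>c<C. x l c * \<zeta> c) / of_nat C"
      unfolding e_def by (simp add: right_diff_distrib sum_subtractf)
    then have "cmod (e l) \<le> cmod (\<Sum>k\<in>I. ip M y (h k) * ?d k) + cmod (\<Sum>c<C. x l c * \<zeta> c) / real C"
      using norm_triangle_ineq[of "\<Sum>k\<in>I. ip M y (h k) * ?d k" "(\<Sum>c<C. x l c * \<zeta> c) / of_nat C"] by (simp add: norm_divide)
    also have "cmod (\<Sum>k\<in>I. ip M y (h k) * ?d k) \<le> (\<Sum>k\<in>I. (Y * (B * r)) * g)"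
    proof (rule order.trans[OF norm_sum], rule sum_mono)
      fix k assume k: "k \<in> I"
      show "norm (ip M y (h k) * ?d k) \<le> (Y * (B * r)) * g"
        unfolding norm_mult using Y0 B r by (intro mult_mono ipB[OF k] g[OF l k]) auto
    qed
    also have "cmod (\<Sum>c<C. x l c * \<zeta> c) \<le> (X * n) * (sqrt N * r * n * Y)"
    proof -
      have "cmod (\<Sum>c<C. x l c * \<zeta> c) = cmod (ip C (x l) (\<lambda>c. cnj (\<zeta> c)))" by (simp add: ip_def)
      also have "\<dots> \<le> nrm C (x l) * nrm C (\<lambda>c. cnj (\<zeta> c))" by (rule ip_bound)
      also have "nrm C (\<lambda>c. cnj (\<zeta> c)) = nrm C \<zeta>" by (simp add: nrm_def)
      also have "nrm C (x l) * nrm C \<zeta> \<le> (X * n) * (sqrt N * r * n * Y)"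
        unfolding n_def[symmetric] using X(1)[OF l] X(2) \<zeta>_bd n by (intro mult_mono) (auto simp: n_def)
      finally show ?thesis .
    qed
    finally have "cmod (e l) \<le> (\<Sum>k\<in>I. (Y * (B * r)) * g) + (X * n) * (sqrt N * r * n * Y) / real C"
      by (simp add: divide_right_mono)
    also have "(X * n) * (sqrt N * r * n * Y) / real C = X * sqrt N * r * Y"
      using n by (simp add: n(2)[symmetric])
    finally show ?thesis by (simp add: algebra_simps)
  qed
  have W_eq: "(\<Sum>c<C. W m c * q c) / of_nat (C * M) - (\<Sum>l\<in>I. ip M y (\<lambda>i. h l i / sqrt (real M)) * (h l m / sqrt (real M)))
      = (1 / of_nat M) * (\<Sum>l\<in>I. e l * h l m) + (1 / of_nat (C * M)) * (\<Sum>c<C. z m c * q c)" for m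
  proof -
    have a: "ip M y (\<lambda>i. h l i / sqrt (real M)) * (h l m / sqrt (real M)) = (1 / of_nat M) * (ip M y (h l) * h l m)" for l
    proof -
      have "ip M y (\<lambda>i. h l i / sqrt (real M)) = ip M y (h l) / complex_of_real r"
        using ip_scale_right[of M y "1 / complex_of_real r" "h l"] by (simp add: r_def)
      then show ?thesis
        using r by (simp add: r_def[symmetric] r(2)[symmetric])
    qed
    have "(\<Sum>c<C. W m c * q c) = (\<Sum>c<C. \<Sum>l\<in>I. h l m * (x l c * q c)) + (\<Sum>c<C. z m c * q c)"
      unfolding W_def by (simp add: distrib_right sum.distrib sum_distrib_right mult.assoc)
    also have "(\<Sum>c<C. \<Sum>l\<in>I. h l m * (x l c * q c)) = (\<Sum>l\<in>I. h l m * (\<Sum>c<C. x l c * q c))"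
      by (subst sum.swap) (simp add: sum_distrib_left)
    also have "\<dots> = (\<Sum>l\<in>I. of_nat C * ((e l + ip M y (h l)) * h l m))"
      unfolding e_def using C by (intro sum.cong refl) simp
    finally have "(\<Sum>c<C. W m c * q c) / of_nat (C * M) = (\<Sum>l\<in>I. (1 / of_nat M) * ((e l + ip M y (h l)) * h l m)) + (1 / of_nat (C * M)) * (\<Sum>c<C. z m c * q c)"
      using C M by (simp add: add_divide_distrib sum_divide_distrib)
    then show ?thesis
      unfolding a by (simp add: sum_subtractf[symmetric] sum_distrib_left algebra_simps sum.distrib)
  qed
  have "nrm M (\<lambda>m. (\<Sum>c<C. W m c * q c) / of_nat (C * M) - (\<Sum>l\<in>I. ip M y (\<lambda>i. h l i / sqrt (real M)) * (h l m / sqrt (real M))))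
    \<le> nrm M (\<lambda>m. (1 / of_nat M) * (\<Sum>l\<in>I. e l * h l m)) + nrm M (\<lambda>m. (1 / of_nat (C * M)) * (\<Sum>c<C. z m c * q c))"
    unfolding W_eq by (rule nrm_add)
  also have "nrm M (\<lambda>m. (1 / of_nat M) * (\<Sum>l\<in>I. e l * h l m)) \<le> real (card I) * B * (real (card I) * B * g + X * sqrt N) * Y"
  proof -
    have "nrm M (\<lambda>m. \<Sum>l\<in>I. e l * h l m) \<le> (\<Sum>l\<in>I. cmod (e l) * nrm M (h l))"
      using nrm_sum[OF I, of M "\<lambda>l m. e l * h l m"] by (simp add: nrm_scale)
    also have "\<dots> \<le> (\<Sum>l\<in>I. (r * ((real (card I) * B * g + X * sqrt N) * Y)) * (B * r))"
    proof (rule sum_mono)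
      fix l assume l: "l \<in> I"
      from norm_ge_zero[of "e l"] e_bd[OF l] have "0 \<le> r * ((real (card I) * B * g + X * sqrt N) * Y)" by linarith
      then show "cmod (e l) * nrm M (h l) \<le> (r * ((real (card I) * B * g + X * sqrt N) * Y)) * (B * r)"
        unfolding r_def using e_bd[OF l] B(2)[OF l] by (intro mult_mono) (auto simp: r_def)
    qed
    also have "\<dots> = real M * (real (card I) * B * (real (card I) * B * g + X * sqrt N) * Y)"
      by (simp add: r(3)[symmetric] mult_ac)
    finally show ?thesis
      unfolding nrm_scale using M by (simp add: norm_divide field_simps)
  qed
  also have "nrm M (\<lambda>m. (1 / of_nat (C * M)) * (\<Sum>c<C. z m c * q c)) \<le> sqrt N * (real (card I) * X * B + sqrt N) * Y"
  proof -
    have "nrm M (\<lambda>m. \<Sum>c<C. z m c * q c) \<le> sqrt N * r * n * (r * n * ((real (card I) * X * B + sqrt N) * Y))"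
      using Zq q_bd N r n by (meson mult_left_mono order.trans mult_nonneg_nonneg real_sqrt_ge_zero less_imp_le)
    also have "\<dots> = real (C * M) * (sqrt N * (real (card I) * X * B + sqrt N) * Y)"
      by (simp add: r(3)[symmetric] n(2)[symmetric] mult_ac)
    finally show ?thesis
      unfolding nrm_scale using M C by (simp add: norm_divide norm_mult field_simps)
  qed
  finally show ?thesis
    unfolding q_def Y_def by (simp add: distrib_right)
qed

section \<open>Covariances of the channels\<close>

locale uplink_system =
  fixes U :: "'a uplink" and \<zeta> :: real
  assumes model: "uplink_model U"
    and no_alias: "aliasing_free U"
    and bounded: "\<And>M l. 1 \<le> M \<Longrightarrow> l \<in> {1..cells U} \<Longrightarrow> spectral_norm (channel_cov U l M) < \<zeta>"
begin

abbreviation "cs \<equiv> {1..cells U}"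
abbreviation "ps \<equiv> {1..paths U}"
abbreviation "tgt \<equiv> target U"

sublocale prob_space "pr U"
  using model by (simp add: uplink_model_def)

lemma params:
  "tgt \<in> cs" "1 \<le> paths U" "0 < spacing U" "0 < wavelength U" "0 < noise_var U"
  "\<And>l. l \<in> cs \<Longrightarrow> 0 < path_loss U l" "1 \<le> pilot_len U" "pilot U \<in> carrier_vec (pilot_len U)"
  "pilot U \<bullet>c pilot U = of_nat (pilot_len U)"
  using model by (auto simp: uplink_model_def)

lemma indep: "indep_vars (\<lambda>_. borel) (source_var U) (sources U)"
  using model by (simp add: uplink_model_def)

lemma source_measurable: "s \<in> sources U \<Longrightarrow> source_var U s \<in> borel_measurable (pr U)"
  by (rule indep_measurable[OF indep])

lemma density_nonneg: "l \<in> cs \<Longrightarrow> 0 \<le> density U l t" "l \<in> cs \<Longrightarrow> t \<notin> {0..pi} \<Longrightarrow> density U l t = 0"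
  using model by (auto simp: uplink_model_def)

lemma angle_distributed: "l \<in> cs \<Longrightarrow> p \<in> ps \<Longrightarrow> distributed (pr U) lborel (angle U l p) (density U l)"
  using model by (auto simp: uplink_model_def)

lemma angle_measurable: "l \<in> cs \<Longrightarrow> p \<in> ps \<Longrightarrow> angle U l p \<in> borel_measurable (pr U)"
  using angle_distributed[of l p] by (simp add: distributed_def)

lemma path_sources: "l \<in> cs \<Longrightarrow> p \<in> ps \<Longrightarrow> Angle l p \<in> sources U" "l \<in> cs \<Longrightarrow> p \<in> ps \<Longrightarrow> Phase l p \<in> sources U"
  by (auto simp: sources_def)

lemma phase_measurable: "l \<in> cs \<Longrightarrow> p \<in> ps \<Longrightarrow> phase U l p \<in> borel_measurable (pr U)"
  using measurable_compose[OF source_measurable[OF path_sources(2)] borel_measurable_Re, of l p] by simp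

text \<open>Antennas sit at integer multiples of the spacing, so a steering vector depends on its
  frequency modulo 1 only; \<open>frac\<close> picks the representative in [0, 1).\<close>

definition freq :: "real \<Rightarrow> real" where
  "freq t = frac (spacing U / wavelength U * cos t)"

definition path_freq :: "nat \<Rightarrow> nat \<Rightarrow> 'a \<Rightarrow> real" where
  "path_freq l p \<omega> = freq (angle U l p \<omega>)"

definition path_gain :: "nat \<Rightarrow> nat \<Rightarrow> 'a \<Rightarrow> complex" where
  "path_gain l p \<omega> = cis (phase U l p \<omega>)"

text \<open>The responses of all conceivable antennas at once; the channel of an array of M antennas
  consists of the first M values.\<close>

definition chan :: "nat \<Rightarrow> 'a \<Rightarrow> nat \<Rightarrow> complex" where
  "chan l \<omega> m = (\<Sum>p\<in>ps. complex_of_real (path_loss U l / sqrt (real (paths U))) * path_gain l p \<omega> * wave m (path_freq l p \<omega>))"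

lemma freq_measurable [measurable]: "freq \<in> borel_measurable borel"
  unfolding freq_def frac_def by measurable

lemma freq_bounds: "0 \<le> freq t" "freq t < 1"
  by (auto simp: freq_def frac_lt_1)

lemma path_freq_measurable: "l \<in> cs \<Longrightarrow> p \<in> ps \<Longrightarrow> path_freq l p \<in> borel_measurable (pr U)"
  unfolding path_freq_def[abs_def] using measurable_compose[OF angle_measurable freq_measurable] .

lemma path_gain_measurable: "l \<in> cs \<Longrightarrow> p \<in> ps \<Longrightarrow> path_gain l p \<in> borel_measurable (pr U)"
  unfolding path_gain_def[abs_def] by (rule borel_measurable_cis) (rule phase_measurable)

lemma cmod_path_gain [simp]: "cmod (path_gain l p \<omega>) = 1"
  by (simp add: path_gain_def)

lemma wave_frac: "wave m (frac y) = wave m y"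
proof -
  have "wave m (frac y) = cis (- (2 * pi * (real m * y)) + 2 * pi * (real_of_int (int m * \<lfloor>y\<rfloor>)))"
    by (simp add: wave_def frac_def algebra_simps)
  also have "\<dots> = wave m y * cis (2 * pi * (real_of_int (int m * \<lfloor>y\<rfloor>)))"
    by (simp only: wave_def cis_mult)
  also have "cis (2 * pi * (real_of_int (int m * \<lfloor>y\<rfloor>))) = 1"
    by (rule cis_multiple_2pi) (rule Ints_of_int)
  finally show ?thesis by simp
qed

lemma steering_wave: "m < M \<Longrightarrow> steering U M t $ m = wave m (freq t)"
  unfolding steering_def freq_def wave_frac by (simp add: wave_def mult_ac)

text \<open>Restricting the paths amounts to setting coefficients to zero, so all parts of a channel
  are combinations of the same steering vectors.\<close>

lemma channel_within_coef:
  assumes "m < M"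
  shows "channel_within U A l M \<omega> $ m = (\<Sum>p\<in>ps. (if angle U l p \<omega> \<in> A
    then complex_of_real (path_loss U l / sqrt (real (paths U))) * path_gain l p \<omega> else 0) * wave m (path_freq l p \<omega>))"
proof -
  have "channel_within U A l M \<omega> $ m = complex_of_real (path_loss U l / sqrt (real (paths U))) *
      (\<Sum>p | p \<in> ps \<and> angle U l p \<omega> \<in> A. wave m (path_freq l p \<omega>) * path_gain l p \<omega>)"
    using assms by (simp add: channel_within_def steering_wave path_freq_def path_gain_def del: of_real_divide)
  also have "(\<Sum>p | p \<in> ps \<and> angle U l p \<omega> \<in> A. wave m (path_freq l p \<omega>) * path_gain l p \<omega>)
     = (\<Sum>p\<in>ps. if angle U l p \<omega> \<in> A then wave m (path_freq l p \<omega>) * path_gain l p \<omega> else 0)"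
    using sum.inter_filter[of ps "\<lambda>p. wave m (path_freq l p \<omega>) * path_gain l p \<omega>" "\<lambda>p. angle U l p \<omega> \<in> A"] by simp
  also have "complex_of_real (path_loss U l / sqrt (real (paths U))) * \<dots> = (\<Sum>p\<in>ps. (if angle U l p \<omega> \<in> A
    then complex_of_real (path_loss U l / sqrt (real (paths U))) * path_gain l p \<omega> else 0) * wave m (path_freq l p \<omega>))"
    unfolding sum_distrib_left by (intro sum.cong refl) (simp add: mult_ac)
  finally show ?thesis .
qed

lemma channel_chan: "m < M \<Longrightarrow> channel U l M \<omega> $ m = chan l \<omega> m"
  unfolding channel_def by (subst channel_within_coef) (simp_all add: chan_def)

lemma dim_channel_within [simp]: "dim_vec (channel_within U A l M \<omega>) = M"
  by (simp add: channel_within_def)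

lemma dim_channel [simp]: "dim_vec (channel U l M \<omega>) = M"
  by (simp add: channel_def)

section \<open>The spectral density of a channel\<close>

definition freq_law :: "nat \<Rightarrow> real measure" where
  "freq_law l = distr (pr U) borel (path_freq l 1)"

lemma freq_law_eq:
  assumes "l \<in> cs" "p \<in> ps"
  shows "distr (pr U) borel (path_freq l p) = freq_law l"
proof -
  have "distr (pr U) borel (path_freq l p) = distr (mdensity lborel (density U l)) borel freq" if "p \<in> ps" for p
  proof -
    have "distr (distr (pr U) lborel (angle U l p)) borel freq = distr (pr U) borel (freq \<circ> angle U l p)"
      using angle_measurable[OF assms(1) that] by (intro distr_distr) auto
    then show ?thesis
      using angle_distributed[OF assms(1) that]
      by (simp add: distributed_def o_def path_freq_def[abs_def])
  qed
  then show ?thesis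
    using assms params(2) by (simp add: freq_law_def)
qed

lemma freq_law_prob: "l \<in> cs \<Longrightarrow> prob_space (freq_law l)"
  unfolding freq_law_def using params(2) by (intro prob_space_distr path_freq_measurable) auto

lemma expectation_path_freq:
  fixes f :: "real \<Rightarrow> 'b :: {banach, second_countable_topology}"
  assumes "l \<in> cs" "p \<in> ps" "f \<in> borel_measurable borel"
  shows "expectation (\<lambda>\<omega>. f (path_freq l p \<omega>)) = integral\<^sup>L (freq_law l) f"
  using integral_distr[OF path_freq_measurable[OF assms(1,2)] assms(3)] freq_law_eq[OF assms(1,2)] by simp

definition mean_gain :: complex where
  "mean_gain = expectation (path_gain 1 1)"

text \<open>Of the P^2 pairs of paths, P (P - 1) consist of distinct paths, each with the factor |E
  exp(i \<phi>)|^2; the normalisation 1 / P of the squared amplitude leaves this weight.\<close>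

definition mean_weight :: real where
  "mean_weight = (real (paths U) - 1) * (cmod mean_gain)\<^sup>2"

lemma mean_weight_nonneg: "0 \<le> mean_weight"
  using params(2) by (simp add: mean_weight_def)

lemma expectation_path_gain:
  assumes "l \<in> cs" "p \<in> ps"
  shows "expectation (path_gain l p) = mean_gain"
proof -
  have eq: "distr (pr U) borel (phase U l p) = distr (pr U) borel (phase U 1 1)"
    using model assms unfolding uplink_model_def by blast
  have m: "cis \<in> borel_measurable borel"
    using borel_measurable_cis[of "\<lambda>x. x" borel] by simp
  have "1 \<in> cs" "1 \<in> ps" using params(1,2) by auto
  then have one: "phase U 1 1 \<in> borel_measurable (pr U)"
    by (rule phase_measurable)
  have "expectation (path_gain l p) = integral\<^sup>L (distr (pr U) borel (phase U l p)) cis"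
    unfolding path_gain_def[abs_def] by (rule integral_distr[symmetric, OF phase_measurable[OF assms] m])
  also have "\<dots> = integral\<^sup>L (distr (pr U) borel (phase U 1 1)) cis"
    by (simp only: eq)
  also have "\<dots> = mean_gain"
    unfolding mean_gain_def path_gain_def[abs_def] by (rule integral_distr[OF one m])
  finally show ?thesis .
qed

definition law_fourier :: "nat \<Rightarrow> nat \<Rightarrow> complex" where
  "law_fourier l m = (LINT y|freq_law l. wave m y)"

definition law_toeplitz :: "nat \<Rightarrow> nat \<Rightarrow> nat \<Rightarrow> complex" where
  "law_toeplitz l m n = (LINT y|freq_law l. wave m y * cnj (wave n y))"

text \<open>For a single path the phase factor cancels against its conjugate. For two paths the two
  phases and the two angles are independent, and the expectation factors into a rank-one
  expression.\<close>

lemma path_pair_expectation: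
  assumes l: "l \<in> cs" and p: "p \<in> ps" and q: "q \<in> ps"
  shows "expectation (\<lambda>\<omega>. (path_gain l p \<omega> * wave m (path_freq l p \<omega>)) * cnj (path_gain l q \<omega> * wave n (path_freq l q \<omega>)))
    = (if p = q then law_toeplitz l m n else (cmod mean_gain)\<^sup>2 * (law_fourier l m * cnj (law_fourier l n)))"
    (is "expectation ?f = _")
proof (cases "p = q")
  case True
  have "?f \<omega> = wave m (path_freq l p \<omega>) * cnj (wave n (path_freq l p \<omega>))" for \<omega>
  proof -
    have "path_gain l p \<omega> * cnj (path_gain l p \<omega>) = 1"
      using complex_norm_square[of "path_gain l p \<omega>"] by simp
    then show ?thesis
      using True by (simp add: mult_ac)
  qed
  then have "expectation ?f = expectation (\<lambda>\<omega>. (\<lambda>y. wave m y * cnj (wave n y)) (path_freq l p \<omega>))"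
    by (simp only:)
  also have "\<dots> = law_toeplitz l m n"
    unfolding law_toeplitz_def by (rule expectation_path_freq[OF l p]) measurable
  finally show ?thesis using True by simp
next
  case False
  define g :: "source \<Rightarrow> complex \<Rightarrow> complex" where
    "g = (\<lambda>s z. if s = Phase l p then cis (Re z) else if s = Angle l p then wave m (freq (Re z))
       else if s = Phase l q then cnj (cis (Re z)) else cnj (wave n (freq (Re z))))"
  let ?J = "{Phase l p, Angle l p, Phase l q, Angle l q}"
  have g_meas: "g s \<in> borel_measurable borel" for s
    unfolding g_def by measurable
  have g_int: "integrable (pr U) (\<lambda>\<omega>. g s (source_var U s \<omega>))" if "s \<in> ?J" for s
  proof (rule integrable_const_bound[of _ 1])
    have "s \<in> sources U" using that path_sources[OF l p] path_sources[OF l q] by auto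
    from measurable_compose[OF source_measurable[OF this] g_meas]
    show "(\<lambda>\<omega>. g s (source_var U s \<omega>)) \<in> borel_measurable (pr U)" .
  qed (simp add: g_def)
  have "expectation (\<lambda>\<omega>. \<Prod>s\<in>?J. g s (source_var U s \<omega>)) = (\<Prod>s\<in>?J. expectation (\<lambda>\<omega>. g s (source_var U s \<omega>)))"
    by (rule indep_prod_expectation(1)[OF indep _ _ g_meas g_int]) (use path_sources[OF l p] path_sources[OF l q] in auto)
  moreover have "(\<Prod>s\<in>?J. g s (source_var U s \<omega>)) = ?f \<omega>" for \<omega>
    using False by (simp add: g_def path_gain_def path_freq_def mult_ac)
  moreover have "expectation (\<lambda>\<omega>. g (Phase l p) (source_var U (Phase l p) \<omega>)) = mean_gain"
    using expectation_path_gain[OF l p] by (simp add: g_def path_gain_def[abs_def])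
  moreover have "expectation (\<lambda>\<omega>. g (Phase l q) (source_var U (Phase l q) \<omega>)) = cnj mean_gain"
    using expectation_path_gain[OF l q] False by (simp add: g_def path_gain_def[abs_def])
  moreover have "expectation (\<lambda>\<omega>. g (Angle l p) (source_var U (Angle l p) \<omega>)) = law_fourier l m"
    using expectation_path_freq[OF l p, of "wave m"] by (simp add: g_def path_freq_def[abs_def] law_fourier_def)
  moreover have "expectation (\<lambda>\<omega>. g (Angle l q) (source_var U (Angle l q) \<omega>)) = cnj (law_fourier l n)"
    using expectation_path_freq[OF l q, of "wave n"] False by (simp add: g_def path_freq_def[abs_def] law_fourier_def)
  ultimately show ?thesis
    using False by (simp add: complex_norm_square mult_ac del: of_real_power)
qed

lemma chan_measurable: "l \<in> cs \<Longrightarrow> (\<lambda>\<omega>. chan l \<omega> m) \<in> borel_measurable (pr U)"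
  unfolding chan_def
  by (intro borel_measurable_sum borel_measurable_times borel_measurable_const path_gain_measurable
      measurable_compose[OF path_freq_measurable wave_measurable])

lemma chan_bound: "cmod (chan l \<omega> m) \<le> real (paths U) * \<bar>path_loss U l / sqrt (real (paths U))\<bar>"
proof -
  have "cmod (chan l \<omega> m) \<le> (\<Sum>p\<in>ps. \<bar>path_loss U l / sqrt (real (paths U))\<bar>)"
    unfolding chan_def by (rule order.trans[OF norm_sum]) (simp add: norm_mult norm_divide)
  then show ?thesis by simp
qed

lemma path_pair_integrable:
  assumes l: "l \<in> cs" and p: "p \<in> ps" and q: "q \<in> ps"
  shows "integrable (pr U) (\<lambda>\<omega>. (path_gain l p \<omega> * wave m (path_freq l p \<omega>)) * cnj (path_gain l q \<omega> * wave n (path_freq l q \<omega>)))"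
proof (rule integrable_const_bound[of _ 1])
  note [measurable] = path_gain_measurable[OF l p] path_gain_measurable[OF l q] path_freq_measurable[OF l p] path_freq_measurable[OF l q]
  show "(\<lambda>\<omega>. (path_gain l p \<omega> * wave m (path_freq l p \<omega>)) * cnj (path_gain l q \<omega> * wave n (path_freq l q \<omega>))) \<in> borel_measurable (pr U)"
    by measurable
qed (simp add: norm_mult)

lemma sum_diag_off:
  fixes A D :: complex
  assumes "finite S"
  shows "(\<Sum>p\<in>S. \<Sum>q\<in>S. if p = q then A else D) = of_nat (card S) * A + of_nat (card S) * (of_nat (card S) - 1) * D"
proof -
  have "(\<Sum>q\<in>S. if p = q then A else D) = A + (of_nat (card S) - 1) * D" if "p \<in> S" for p
  proof -
    have "(\<Sum>q\<in>S. if p = q then A else D) = (\<Sum>q\<in>S. D + (if p = q then A - D else 0))"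
      by (intro sum.cong) auto
    then show ?thesis
      using assms that by (simp add: sum.distrib algebra_simps)
  qed
  then have "(\<Sum>p\<in>S. \<Sum>q\<in>S. if p = q then A else D) = (\<Sum>p\<in>S. A + (of_nat (card S) - 1) * D)"
    by (rule sum.cong[OF refl])
  then show ?thesis by (simp add: algebra_simps)
qed

lemma chan_covariance:
  assumes l: "l \<in> cs"
  shows "expectation (\<lambda>\<omega>. chan l \<omega> m * cnj (chan l \<omega> n)) =
    (path_loss U l)\<^sup>2 * (law_toeplitz l m n + mean_weight * (law_fourier l m * cnj (law_fourier l n)))"
proof -
  define a where "a = path_loss U l / sqrt (real (paths U))"
  define t where "t = (\<lambda>p m \<omega>. path_gain l p \<omega> * wave m (path_freq l p \<omega>))"
  have P: "0 < real (paths U)" using params(2) by simp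
  have aP: "a\<^sup>2 * real (paths U) = (path_loss U l)\<^sup>2"
    using P by (simp add: a_def power_divide)
  have "chan l \<omega> m * cnj (chan l \<omega> n) = complex_of_real (a\<^sup>2) * (\<Sum>p\<in>ps. \<Sum>q\<in>ps. t p m \<omega> * cnj (t q n \<omega>))" for \<omega>
  proof -
    have c: "chan l \<omega> m = complex_of_real a * (\<Sum>p\<in>ps. t p m \<omega>)" for m
      by (simp add: chan_def t_def a_def sum_distrib_left mult.assoc)
    show ?thesis
      unfolding c by (simp add: sum_product power2_eq_square mult_ac)
  qed
  then have "expectation (\<lambda>\<omega>. chan l \<omega> m * cnj (chan l \<omega> n)) = complex_of_real (a\<^sup>2) * expectation (\<lambda>\<omega>. \<Sum>p\<in>ps. \<Sum>q\<in>ps. t p m \<omega> * cnj (t q n \<omega>))"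
    by simp
  also have "expectation (\<lambda>\<omega>. \<Sum>p\<in>ps. \<Sum>q\<in>ps. t p m \<omega> * cnj (t q n \<omega>)) = (\<Sum>p\<in>ps. expectation (\<lambda>\<omega>. \<Sum>q\<in>ps. t p m \<omega> * cnj (t q n \<omega>)))"
    unfolding t_def by (intro Bochner_Integration.integral_sum Bochner_Integration.integrable_sum path_pair_integrable l)
  also have "\<dots> = (\<Sum>p\<in>ps. \<Sum>q\<in>ps. expectation (\<lambda>\<omega>. t p m \<omega> * cnj (t q n \<omega>)))"
    unfolding t_def by (intro sum.cong refl Bochner_Integration.integral_sum path_pair_integrable l)
  also have "\<dots> = (\<Sum>p\<in>ps. \<Sum>q\<in>ps. if p = q then law_toeplitz l m n else (cmod mean_gain)\<^sup>2 * (law_fourier l m * cnj (law_fourier l n)))"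
    unfolding t_def by (intro sum.cong refl path_pair_expectation l)
  also have "\<dots> = of_nat (paths U) * law_toeplitz l m n + of_nat (paths U) * (of_nat (paths U) - 1) * ((cmod mean_gain)\<^sup>2 * (law_fourier l m * cnj (law_fourier l n)))"
    by (subst sum_diag_off) simp_all
  also have "\<dots> = of_nat (paths U) * (law_toeplitz l m n + mean_weight * (law_fourier l m * cnj (law_fourier l n)))"
    by (simp add: mean_weight_def algebra_simps)
  also have "complex_of_real (a\<^sup>2) * \<dots> = complex_of_real (a\<^sup>2 * real (paths U)) * (law_toeplitz l m n + mean_weight * (law_fourier l m * cnj (law_fourier l n)))"
    by simp
  finally show ?thesis by (simp only: aP) 
qed

section \<open>Covariance matrices and the densities that they force\<close>

abbreviation "R l M \<equiv> channel_cov U l M"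

lemma R_carrier [simp]: "R l M \<in> carrier_mat M M" "dim_row (R l M) = M" "dim_col (R l M) = M"
  by (simp_all add: channel_cov_def)

lemma R_expectation: "m < M \<Longrightarrow> n < M \<Longrightarrow> R l M $$ (m, n) = expectation (\<lambda>\<omega>. chan l \<omega> m * cnj (chan l \<omega> n))"
  by (simp add: channel_cov_def channel_chan)

lemma R_entry: "l \<in> cs \<Longrightarrow> m < M \<Longrightarrow> n < M \<Longrightarrow> R l M $$ (m, n) =
    (path_loss U l)\<^sup>2 * (law_toeplitz l m n + mean_weight * (law_fourier l m * cnj (law_fourier l n)))"
  by (simp only: R_expectation chan_covariance)

lemma R_hermitian: "hermitian (R l M)"
  unfolding hermitian_def
proof (rule eq_matI)
  fix i k assume "i < dim_row (R l M)" "k < dim_col (R l M)"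
  then have ik: "i < M" "k < M" by auto
  have "cnj (expectation (\<lambda>\<omega>. chan l \<omega> k * cnj (chan l \<omega> i))) = expectation (\<lambda>\<omega>. cnj (chan l \<omega> k * cnj (chan l \<omega> i)))"
    by (rule Bochner_Integration.integral_cnj[symmetric])
  then show "mat_adjoint (R l M) $$ (i, k) = R l M $$ (i, k)"
    using ik by (simp add: R_expectation mult.commute)
qed auto

lemma chan_pair_integrable:
  assumes "l \<in> cs"
  shows "integrable (pr U) (\<lambda>\<omega>. chan l \<omega> m * cnj (chan l \<omega> n))"
proof -
  define b where "b = real (paths U) * \<bar>path_loss U l / sqrt (real (paths U))\<bar>"
  have bd: "cmod (chan l \<omega> k) \<le> b" for \<omega> k unfolding b_def by (rule chan_bound)
  note [measurable] = chan_measurable[OF assms]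
  show ?thesis
  proof (rule integrable_const_bound[of _ "b * b"])
    have "0 \<le> b" by (simp add: b_def)
    then show "AE \<omega> in pr U. norm (chan l \<omega> m * cnj (chan l \<omega> n)) \<le> b * b"
      by (intro AE_I2) (simp add: norm_mult mult_mono bd)
  qed measurable
qed

text \<open>The quadratic form of a covariance is the second moment of an inner product with the
  channel. Besides positivity this yields that the inner product vanishes almost surely whenever the
  form does.\<close>

lemma R_quadratic:
  assumes l: "l \<in> cs"
  shows "ip M (app M (R l M) y) y = complex_of_real (expectation (\<lambda>\<omega>. (cmod (ip M (chan l \<omega>) y))\<^sup>2))"
    and "integrable (pr U) (\<lambda>\<omega>. (cmod (ip M (chan l \<omega>) y))\<^sup>2)"
proof -
  have eq: "complex_of_real ((cmod (ip M (chan l \<omega>) y))\<^sup>2) = (\<Sum>m<M. \<Sum>n<M. (cnj (y m) * y n) * (chan l \<omega> m * cnj (chan l \<omega> n)))" for \<omega>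
    by (simp only: complex_norm_square ip_def cnj_sum sum_product) (simp add: mult_ac)
  have int: "integrable (pr U) (\<lambda>\<omega>. complex_of_real ((cmod (ip M (chan l \<omega>) y))\<^sup>2))"
    unfolding eq by (intro Bochner_Integration.integrable_sum integrable_mult_right chan_pair_integrable l)
  then show "integrable (pr U) (\<lambda>\<omega>. (cmod (ip M (chan l \<omega>) y))\<^sup>2)"
    using integrable_Re[OF int] by simp
  have "complex_of_real (expectation (\<lambda>\<omega>. (cmod (ip M (chan l \<omega>) y))\<^sup>2)) = expectation (\<lambda>\<omega>. \<Sum>m<M. \<Sum>n<M. (cnj (y m) * y n) * (chan l \<omega> m * cnj (chan l \<omega> n)))"
    unfolding integral_complex_of_real[symmetric] eq ..
  also have "\<dots> = (\<Sum>m<M. expectation (\<lambda>\<omega>. \<Sum>n<M. (cnj (y m) * y n) * (chan l \<omega> m * cnj (chan l \<omega> n))))"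
    by (intro Bochner_Integration.integral_sum Bochner_Integration.integrable_sum integrable_mult_right chan_pair_integrable l)
  also have "\<dots> = (\<Sum>m<M. \<Sum>n<M. expectation (\<lambda>\<omega>. (cnj (y m) * y n) * (chan l \<omega> m * cnj (chan l \<omega> n))))"
    by (intro sum.cong refl Bochner_Integration.integral_sum integrable_mult_right chan_pair_integrable l)
  also have "\<dots> = (\<Sum>m<M. \<Sum>n<M. (cnj (y m) * y n) * R l M $$ (m, n))"
    by (intro sum.cong refl) (simp add: R_expectation)
  also have "\<dots> = ip M (app M (R l M) y) y"
    by (simp add: ip_def app_def sum_distrib_left sum_distrib_right mult_ac)
  finally show "ip M (app M (R l M) y) y = complex_of_real (expectation (\<lambda>\<omega>. (cmod (ip M (chan l \<omega>) y))\<^sup>2))"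
    by simp
qed

lemma R_psd: "l \<in> cs \<Longrightarrow> 0 \<le> Re (ip M (app M (R l M) y) y)"
  by (simp add: R_quadratic(1))

lemma R_bound: "l \<in> cs \<Longrightarrow> nrm M (app M (R l M) y) \<le> \<bar>\<zeta>\<bar> * nrm M y"
proof (cases "M = 0")
  case False
  assume "l \<in> cs"
  then have "spectral_norm (R l M) * nrm M y \<le> \<bar>\<zeta>\<bar> * nrm M y"
    using bounded[of M l] False by (intro mult_right_mono) auto
  then show ?thesis
    using spectral_norm_bound[OF R_carrier(1)[of l M], of y] by linarith
qed (simp add: nrm_def)

text \<open>Test the covariance at the steering vector of frequency \<open>x\<close>: the Toeplitz
  part gives the integral of the squared Dirichlet kernel, the rank-one part is nonnegative and is
  dropped, and the norm bound limits the whole form by |\<zeta>| M.\<close>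

lemma law_dirichlet_bound:
  assumes l: "l \<in> cs" and M: "0 < M"
  shows "(LINT y|freq_law l. (cmod (dirichlet M x y))\<^sup>2) \<le> (\<bar>\<zeta>\<bar> / (path_loss U l)\<^sup>2) * real M"
proof -
  interpret nu: prob_space "freq_law l" by (rule freq_law_prob[OF l])
  have sets_nu [measurable_cong]: "sets (freq_law l) = sets borel" by (simp add: freq_law_def)
  define a where "a = (\<lambda>m. wave m x)"
  have i: "integrable (freq_law l) (\<lambda>y. wave m y * cnj (wave n y))" for m n
    by (rule nu.integrable_const_bound[of _ 1]) (auto simp: norm_mult)
  have "complex_of_real (LINT y|freq_law l. (cmod (dirichlet M x y))\<^sup>2) = (LINT y|freq_law l. (\<Sum>m<M. \<Sum>n<M. (a n * cnj (a m)) * (wave m y * cnj (wave n y))))"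
  proof -
    have "complex_of_real ((cmod (dirichlet M x y))\<^sup>2) = (\<Sum>m<M. \<Sum>n<M. (a n * cnj (a m)) * (wave m y * cnj (wave n y)))" for y
      unfolding complex_norm_square dirichlet_def cnj_sum sum_product
      by (subst sum.swap) (simp add: a_def mult_ac)
    then show ?thesis
      by (simp only: integral_complex_of_real[symmetric])
  qed
  also have "\<dots> = (\<Sum>m<M. LINT y|freq_law l. (\<Sum>n<M. (a n * cnj (a m)) * (wave m y * cnj (wave n y))))"
    by (intro Bochner_Integration.integral_sum Bochner_Integration.integrable_sum integrable_mult_right i)
  also have "\<dots> = (\<Sum>m<M. \<Sum>n<M. LINT y|freq_law l. (a n * cnj (a m)) * (wave m y * cnj (wave n y)))"
    by (intro sum.cong refl Bochner_Integration.integral_sum integrable_mult_right i)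
  also have "\<dots> = (\<Sum>m<M. \<Sum>n<M. (a n * cnj (a m)) * law_toeplitz l m n)"
    by (simp add: law_toeplitz_def)
  finally have D: "complex_of_real (LINT y|freq_law l. (cmod (dirichlet M x y))\<^sup>2) = (\<Sum>m<M. \<Sum>n<M. (a n * cnj (a m)) * law_toeplitz l m n)" .
  define b where "b = law_fourier l"
  have "ip M (app M (R l M) a) a = (\<Sum>m<M. \<Sum>n<M. (path_loss U l)\<^sup>2 * ((a n * cnj (a m)) * law_toeplitz l m n) + (path_loss U l)\<^sup>2 * mean_weight * ((b m * cnj (a m)) * cnj (b n * cnj (a n))))"
    unfolding ip_def app_def b_def sum_distrib_right
    by (intro sum.cong refl) (simp add: R_entry[OF l] algebra_simps)
  also have "\<dots> = (path_loss U l)\<^sup>2 * (\<Sum>m<M. \<Sum>n<M. (a n * cnj (a m)) * law_toeplitz l m n) + (path_loss U l)\<^sup>2 * mean_weight * (ip M b a * cnj (ip M b a))"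
    by (simp add: sum.distrib sum_distrib_left[symmetric] ip_def sum_product cnj_sum)
  also have "\<dots> = complex_of_real ((path_loss U l)\<^sup>2 * (LINT y|freq_law l. (cmod (dirichlet M x y))\<^sup>2) + (path_loss U l)\<^sup>2 * mean_weight * (cmod (ip M b a))\<^sup>2)"
    unfolding D[symmetric] by (simp add: complex_norm_square[symmetric])
  finally have "Re (ip M (app M (R l M) a) a) = (path_loss U l)\<^sup>2 * (LINT y|freq_law l. (cmod (dirichlet M x y))\<^sup>2) + (path_loss U l)\<^sup>2 * mean_weight * (cmod (ip M b a))\<^sup>2"
    by (simp only: Re_complex_of_real)
  then have "(path_loss U l)\<^sup>2 * (LINT y|freq_law l. (cmod (dirichlet M x y))\<^sup>2) \<le> Re (ip M (app M (R l M) a) a)"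
    using mean_weight_nonneg by simp
  also have "\<dots> \<le> nrm M (app M (R l M) a) * nrm M a"
    using ip_bound complex_Re_le_cmod order.trans by blast
  also have "\<dots> \<le> (\<bar>\<zeta>\<bar> * nrm M a) * nrm M a"
    by (intro mult_right_mono R_bound l) simp
  also have "\<dots> = \<bar>\<zeta>\<bar> * real M"
    unfolding a_def nrm_wave by simp
  finally show ?thesis
    using params(6)[OF l] by (simp add: field_simps)
qed

lemma freq_law_density: "\<exists>f K. \<forall>l\<in>cs. f l \<in> borel_measurable borel \<and> (\<forall>y. 0 \<le> f l y \<and> f l y \<le> K) \<and>
    freq_law l = mdensity unit_lborel (\<lambda>y. ennreal (f l y))"
proof -
  have "\<exists>f K. f \<in> borel_measurable borel \<and> (\<forall>y. 0 \<le> f y \<and> f y \<le> K) \<and> freq_law l = mdensity unit_lborel (\<lambda>y. ennreal (f y))"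
    if l: "l \<in> cs" for l
  proof (rule density_of_dirichlet_bound)
    show "prob_space (freq_law l)" by (rule freq_law_prob[OF l])
    show "sets (freq_law l) = sets borel" by (simp add: freq_law_def)
    have "path_freq l 1 -` (- {0..1}) \<inter> space (pr U) = {}"
      using freq_bounds by (auto simp: path_freq_def less_imp_le)
    then show "emeasure (freq_law l) (- {0..1}) = 0"
      unfolding freq_law_def using path_freq_measurable[OF l, of 1] params(2) by (subst emeasure_distr) auto
    show "(LINT y|freq_law l. (cmod (dirichlet M x y))\<^sup>2) \<le> (\<bar>\<zeta>\<bar> / (path_loss U l)\<^sup>2) * real M" if "0 < M" for M x
      by (rule law_dirichlet_bound[OF l that])
  qed
  then obtain f K where fK: "\<And>l. l \<in> cs \<Longrightarrow> f l \<in> borel_measurable borel \<and> (\<forall>y. 0 \<le> f l y \<and> f l y \<le> K l) \<and> freq_law l = mdensity unit_lborel (\<lambda>y. ennreal (f l y))"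
    by metis
  have "K l \<le> Max (K ` cs)" if "l \<in> cs" for l
    using that by (intro Max_ge) auto
  with fK have "\<forall>l\<in>cs. f l \<in> borel_measurable borel \<and> (\<forall>y. 0 \<le> f l y \<and> f l y \<le> Max (K ` cs)) \<and> freq_law l = mdensity unit_lborel (\<lambda>y. ennreal (f l y))"
    by (meson order.trans)
  then show ?thesis by blast
qed

text \<open>One version of the densities of the frequency laws, fixed once and for all. A density is
  determined only up to null sets; its values matter at path frequencies, which avoid a given null
  set almost surely.\<close>

definition spec :: "nat \<Rightarrow> real \<Rightarrow> real" where
  "spec = (SOME f. \<exists>K. \<forall>l\<in>cs. f l \<in> borel_measurable borel \<and> (\<forall>y. 0 \<le> f l y \<and> f l y \<le> K) \<and>
    freq_law l = mdensity unit_lborel (\<lambda>y. ennreal (f l y)))"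

lemma spec_ex: "\<exists>K. \<forall>l\<in>cs. spec l \<in> borel_measurable borel \<and> (\<forall>y. 0 \<le> spec l y \<and> spec l y \<le> K) \<and>
    freq_law l = mdensity unit_lborel (\<lambda>y. ennreal (spec l y))"
  unfolding spec_def using freq_law_density by (rule someI_ex)

lemma spec:
  assumes "l \<in> cs"
  shows "spec l \<in> borel_measurable borel" "0 \<le> spec l y" "freq_law l = mdensity unit_lborel (\<lambda>y. ennreal (spec l y))"
  using spec_ex assms by blast+

lemma measurable_unit_lborel: "f \<in> borel_measurable unit_lborel \<longleftrightarrow> f \<in> borel_measurable borel"
  by (simp add: measurable_def)

lemma law_toeplitz_spec: "l \<in> cs \<Longrightarrow> law_toeplitz l m n = toeplitz (spec l) m n"
  unfolding law_toeplitz_def toeplitz_def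
  by (subst spec(3), simp, subst integral_density) (auto simp: spec measurable_unit_lborel scaleR_conv_of_real mult.commute)

lemma law_fourier_spec: "l \<in> cs \<Longrightarrow> law_fourier l m = fourier (spec l) m"
  unfolding law_fourier_def fourier_def
  by (subst spec(3), simp, subst integral_density) (auto simp: spec measurable_unit_lborel scaleR_conv_of_real mult.commute)

end

section \<open>Subfamilies and pairs of independent variables\<close>

context prob_space
begin

lemma indep_vars_reindex:
  assumes X: "indep_vars M' X I" and f: "inj_on f J" "f ` J \<subseteq> I"
  shows "indep_vars (\<lambda>i. M' (f i)) (\<lambda>i. X (f i)) J"
  unfolding indep_vars_def2 indep_sets_def
proof (intro conjI ballI allI impI)
  define G where "G = (\<lambda>i. {X i -` A \<inter> space M |A. A \<in> sets (M' i)})"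
  have X': "\<And>i. i \<in> I \<Longrightarrow> random_variable (M' i) (X i)" "\<And>i. i \<in> I \<Longrightarrow> G i \<subseteq> events"
    "\<And>K A. K \<subseteq> I \<Longrightarrow> K \<noteq> {} \<Longrightarrow> finite K \<Longrightarrow> A \<in> Pi K G \<Longrightarrow> prob (\<Inter>j\<in>K. A j) = (\<Prod>j\<in>K. prob (A j))"
    using X unfolding indep_vars_def2 indep_sets_def G_def by blast+
  fix i assume "i \<in> J"
  with f have "f i \<in> I" by auto
  then show "random_variable (M' (f i)) (X (f i))" "{X (f i) -` A \<inter> space M |A. A \<in> sets (M' (f i))} \<subseteq> events"
    using X'(1,2)[of "f i"] by (auto simp: G_def)
next
  define G where "G = (\<lambda>i. {X i -` A \<inter> space M |A. A \<in> sets (M' i)})"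
  have X': "\<And>K A. K \<subseteq> I \<Longrightarrow> K \<noteq> {} \<Longrightarrow> finite K \<Longrightarrow> A \<in> Pi K G \<Longrightarrow> prob (\<Inter>j\<in>K. A j) = (\<Prod>j\<in>K. prob (A j))"
    using X unfolding indep_vars_def2 indep_sets_def G_def by blast
  fix K A assume K: "K \<subseteq> J" "K \<noteq> {}" "finite K" and "A \<in> (\<Pi> i\<in>K. {X (f i) -` A \<inter> space M |A. A \<in> sets (M' (f i))})"
  then have A: "\<And>i. i \<in> K \<Longrightarrow> A i \<in> G (f i)" by (auto simp: G_def Pi_iff)
  have inj: "inj_on f K" using f(1) K(1) by (rule inj_on_subset)
  define B where "B = (\<lambda>i. A (inv_into K f i))"
  have B: "B (f i) = A i" if "i \<in> K" for i using inj that by (simp add: B_def)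
  have "prob (\<Inter>j\<in>f ` K. B j) = (\<Prod>j\<in>f ` K. prob (B j))"
    using K f A B by (intro X') auto
  then show "prob (\<Inter>j\<in>K. A j) = (\<Prod>j\<in>K. prob (A j))"
    using inj B by (simp add: prod.reindex)
qed

lemma square_integrable_complex:
  fixes X :: "'a \<Rightarrow> complex"
  assumes "X \<in> borel_measurable M" "integrable M (\<lambda>\<omega>. (cmod (X \<omega>))\<^sup>2)"
  shows "integrable M X"
proof (rule integrable_norm_cancel)
  show "integrable M (\<lambda>\<omega>. cmod (X \<omega>))"
    by (rule square_integrable_imp_integrable[OF measurable_compose[OF assms(1) borel_measurable_norm] assms(2)])
qed (rule assms(1))

lemma indep_vars_pair:
  assumes X: "indep_vars (\<lambda>_. N) X I" and "i \<in> I" "k \<in> I" "i \<noteq> k"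
  shows "indep_var N (X i) N (X k)"
proof -
  have "indep_vars (\<lambda>_. N) (\<lambda>b. X (case_bool i k b)) UNIV"
    using assms by (intro indep_vars_reindex[OF X]) (auto simp: inj_on_def split: bool.splits)
  moreover have "(\<lambda>b. X (case_bool i k b)) = case_bool (X i) (X k)" "(\<lambda>_. N) = case_bool N N"
    by (auto split: bool.splits)
  ultimately show ?thesis
    unfolding indep_var_def by simp
qed

end

context uplink_system
begin

section \<open>Path frequencies\<close>

text \<open>The Toeplitz part is covered by \<open>toeplitz_wave_approx\<close>. The rank-one part
  maps the steering vector to a vector of bounded norm times a factor that is o(sqrt M) by
  \<open>ip_square_summable\<close>.\<close>

lemma R_wave_approx:
  assumes l: "l \<in> cs"
  shows "AE x in lborel. x \<in> {0<..<1} \<longrightarrow>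
    (\<lambda>M. nrm M (\<lambda>m. app M (R l M) (\<lambda>n. wave n x) m - complex_of_real ((path_loss U l)\<^sup>2 * spec l x) * wave m x) / sqrt (real M)) \<longlonglongrightarrow> 0"
proof -
  obtain K where K: "\<And>y. 0 \<le> spec l y \<and> spec l y \<le> K" using spec_ex l by blast
  have m: "spec l \<in> borel_measurable borel" by (rule spec(1)[OF l])
  have ab: "\<bar>spec l y\<bar> \<le> K" for y using K[of y] by linarith
  show ?thesis
    using toeplitz_wave_approx[OF m ab]
  proof eventually_elim
    case (elim x)
    show ?case
    proof
    assume x: "x \<in> {0<..<1}"
    define D where "D M m = (\<Sum>n<M. toeplitz (spec l) m n * wave n x) - complex_of_real (spec l x) * wave m x" for M m
    have "(\<lambda>M. (nrm M (D M))\<^sup>2 / real M) \<longlonglongrightarrow> 0"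
      using mp[OF elim x] unfolding D_def .
    from tendsto_real_sqrt[OF this] have D: "(\<lambda>M. nrm M (D M) / sqrt (real M)) \<longlonglongrightarrow> 0"
      by (simp add: real_sqrt_divide)
    let ?b = "(path_loss U l)\<^sup>2"
    define e where "e M = ip M (\<lambda>n. wave n x) (fourier (spec l))" for M
    have e: "(\<lambda>M. cmod (e M) / sqrt (real M)) \<longlonglongrightarrow> 0"
      unfolding e_def by (rule ip_square_summable[OF nrm_fourier[OF m ab]]) simp
    have eq: "app M (R l M) (\<lambda>n. wave n x) m - complex_of_real (?b * spec l x) * wave m x
      = complex_of_real ?b * D M m + (complex_of_real (?b * mean_weight) * e M) * fourier (spec l) m" if "m < M" for M m
    proof -
      have "app M (R l M) (\<lambda>n. wave n x) m = (\<Sum>n<M. complex_of_real ?b * (toeplitz (spec l) m n * wave n x)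
          + (complex_of_real (?b * mean_weight) * (wave n x * cnj (fourier (spec l) n))) * fourier (spec l) m)"
        unfolding app_def using that
        by (intro sum.cong refl) (simp add: R_entry[OF l] law_toeplitz_spec[OF l] law_fourier_spec[OF l] algebra_simps)
      also have "\<dots> = complex_of_real ?b * (\<Sum>n<M. toeplitz (spec l) m n * wave n x)
          + (complex_of_real (?b * mean_weight) * e M) * fourier (spec l) m"
        unfolding e_def ip_def by (simp only: sum.distrib sum_distrib_left sum_distrib_right)
      finally show ?thesis
        by (simp add: D_def algebra_simps)
    qed
    have bd: "nrm M (\<lambda>m. app M (R l M) (\<lambda>n. wave n x) m - complex_of_real (?b * spec l x) * wave m x) / sqrt (real M)
        \<le> ?b * (nrm M (D M) / sqrt (real M)) + ?b * mean_weight * K * (cmod (e M) / sqrt (real M))" for M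
    proof -
      have "nrm M (\<lambda>m. app M (R l M) (\<lambda>n. wave n x) m - complex_of_real (?b * spec l x) * wave m x)
        = nrm M (\<lambda>m. complex_of_real ?b * D M m + (complex_of_real (?b * mean_weight) * e M) * fourier (spec l) m)"
        by (rule nrm_cong) (rule eq)
      also have "\<dots> \<le> nrm M (\<lambda>m. complex_of_real ?b * D M m) + nrm M (\<lambda>m. (complex_of_real (?b * mean_weight) * e M) * fourier (spec l) m)"
        by (rule nrm_add)
      also have "\<dots> = ?b * nrm M (D M) + ?b * mean_weight * cmod (e M) * nrm M (fourier (spec l))"
        using mean_weight_nonneg by (simp only: nrm_scale norm_mult norm_of_real) (simp add: abs_mult)
      also have "\<dots> \<le> ?b * nrm M (D M) + ?b * mean_weight * cmod (e M) * K"
        using mean_weight_nonneg by (intro add_left_mono mult_left_mono nrm_fourier[OF m ab]) simp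
      finally have "nrm M (\<lambda>m. app M (R l M) (\<lambda>n. wave n x) m - complex_of_real (?b * spec l x) * wave m x) / sqrt (real M)
        \<le> (?b * nrm M (D M) + ?b * mean_weight * cmod (e M) * K) / sqrt (real M)"
        by (rule divide_right_mono) simp
      then show ?thesis
        by (simp add: add_divide_distrib mult_ac)
    qed
    have lim: "(\<lambda>M. ?b * (nrm M (D M) / sqrt (real M)) + ?b * mean_weight * K * (cmod (e M) / sqrt (real M))) \<longlonglongrightarrow> 0"
      using tendsto_add[OF tendsto_mult_left[OF D, of ?b] tendsto_mult_left[OF e, of "?b * mean_weight * K"]] by simp
    show "(\<lambda>M. nrm M (\<lambda>m. app M (R l M) (\<lambda>n. wave n x) m - complex_of_real (?b * spec l x) * wave m x) / sqrt (real M)) \<longlonglongrightarrow> 0"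
      by (rule tendsto_sandwich[OF _ _ tendsto_const lim]) (use bd in \<open>auto intro!: always_eventually divide_nonneg_nonneg\<close>)
    qed
  qed
qed

text \<open>Lebesgue points enter the rest of the proof only through this property, which holds at
  almost every frequency.\<close>

definition good :: "real \<Rightarrow> bool" where
  "good x \<longleftrightarrow> x \<in> {0<..<1} \<and> (\<forall>l\<in>cs. (\<lambda>M. nrm M (\<lambda>m. app M (R l M) (\<lambda>n. wave n x) m
     - complex_of_real ((path_loss U l)\<^sup>2 * spec l x) * wave m x) / sqrt (real M)) \<longlonglongrightarrow> 0)"

lemma AE_good: "AE x in lborel. x \<in> {0<..<1} \<longrightarrow> good x"
proof -
  have "AE x in lborel. \<forall>l\<in>cs. x \<in> {0<..<1} \<longrightarrow> (\<lambda>M. nrm M (\<lambda>m. app M (R l M) (\<lambda>n. wave n x) m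
     - complex_of_real ((path_loss U l)\<^sup>2 * spec l x) * wave m x) / sqrt (real M)) \<longlonglongrightarrow> 0"
    by (rule AE_finite_allI[OF _ R_wave_approx]) simp_all
  then show ?thesis
    unfolding good_def by eventually_elim blast
qed

text \<open>Under a law with a density, that density is positive almost surely. This is the origin
  of the positive gain on the paths of the desired channel.\<close>

lemma AE_freq_law:
  assumes l: "l \<in> cs" and Q: "AE x in lborel. x \<in> {0<..<1} \<longrightarrow> Q x"
  shows "AE x in freq_law l. x \<in> {0<..<1} \<and> 0 < spec l x \<and> Q x"
proof -
  have "AE x in lborel. 0 < (indicator {0..1} x :: ennreal) \<longrightarrow> x \<in> {0<..<1} \<and> Q x"
    using Q AE_lborel_singleton[of "0::real"] AE_lborel_singleton[of "1::real"]
    by eventually_elim (auto simp: indicator_def split: if_splits)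
  then have "AE x in unit_lborel. x \<in> {0<..<1} \<and> Q x"
    unfolding unit_lborel_def by (subst AE_density) auto
  then have "AE x in mdensity unit_lborel (\<lambda>y. ennreal (spec l y)). x \<in> {0<..<1} \<and> 0 < spec l x \<and> Q x"
    using spec(1)[OF l] by (subst AE_density) (auto simp: measurable_unit_lborel)
  then show ?thesis
    by (simp only: spec(3)[OF l])
qed

lemma AE_path_freq:
  assumes l: "l \<in> cs" and p: "p \<in> ps" and Q: "AE x in lborel. x \<in> {0<..<1} \<longrightarrow> Q x"
  shows "AE \<omega> in pr U. path_freq l p \<omega> \<in> {0<..<1} \<and> 0 < spec l (path_freq l p \<omega>) \<and> Q (path_freq l p \<omega>)"
  using AE_distrD[OF path_freq_measurable[OF l p], of "\<lambda>x. x \<in> {0<..<1} \<and> 0 < spec l x \<and> Q x"]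
    AE_freq_law[OF l Q] by (simp only: freq_law_eq[OF l p])

lemma AE_angle:
  assumes l: "l \<in> cs" and p: "p \<in> ps"
  shows "AE \<omega> in pr U. angle U l p \<omega> \<in> {0<..<pi} \<and> 0 < density U l (angle U l p \<omega>)"
proof -
  have d: "(\<lambda>t. ennreal (density U l t)) \<in> borel_measurable lborel" and a: "angle U l p \<in> measurable (pr U) lborel"
    and eq: "distr (pr U) lborel (angle U l p) = mdensity lborel (\<lambda>t. ennreal (density U l t))"
    using angle_distributed[OF l p] by (auto simp: distributed_def)
  have "AE t in lborel. 0 < ennreal (density U l t) \<longrightarrow> t \<in> {0<..<pi} \<and> 0 < density U l t"
    using AE_lborel_singleton[of 0] AE_lborel_singleton[of pi]
  proof eventually_elim
    case (elim t)
    then show ?case using density_nonneg(2)[OF l, of t] by force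
  qed
  then have "AE t in distr (pr U) lborel (angle U l p). t \<in> {0<..<pi} \<and> 0 < density U l t"
    unfolding eq by (subst AE_density[OF d])
  from AE_distrD[OF a this] show ?thesis .
qed

text \<open>By the absence of aliasing, a path outside the desired support has a frequency that the
  desired channel does not produce.\<close>

lemma AE_off_support:
  assumes l: "l \<in> cs" and p: "p \<in> ps"
  shows "AE \<omega> in pr U. angle U l p \<omega> \<notin> desired_support U \<longrightarrow> spec tgt (path_freq l p \<omega>) = 0"
proof -
  define \<kappa> where "\<kappa> = spacing U / wavelength U"
  have \<kappa>: "0 < \<kappa>" using params by (simp add: \<kappa>_def)
  \<comment> \<open>The arc cosine by way of the arc tangent: a formula on the whole line whose
    measurability is immediate. It agrees with \<open>arccos\<close> on the open interval from -1 to
    1, the range where it is used.\<close>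
  define acs where "acs y = pi / 2 - arctan (y / sqrt (1 - y\<^sup>2))" for y
  have acs: "acs y = arccos y" if "\<bar>y\<bar> < 1" for y
    using arccos_arctan[of y] that by (simp add: acs_def abs_less_iff)
  have d[measurable]: "(\<lambda>t. ennreal (density U k t)) \<in> borel_measurable borel" if "k \<in> cs" for k
    using angle_distributed[OF that, of 1] params(2) by (simp add: distributed_def)
  note [measurable] = d[OF l] d[OF params(1)]
  have [measurable]: "arctan \<in> borel_measurable borel"
    by (intro borel_measurable_continuous_onI continuous_intros)
  have [measurable]: "acs \<in> borel_measurable borel"
    unfolding acs_def[abs_def] by measurable
  define T where "T = {t. \<not> 0 < ennreal (density U tgt t) \<and> 0 < ennreal (density U l t)}"
  have [measurable]: "T \<in> sets borel" unfolding T_def by measurable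
  \<comment> \<open>The frequencies of the angles in \<open>T\<close>: the integer \<open>n\<close>
    runs through the possible integer parts that \<open>frac\<close> has removed.\<close>
  define E0 where "E0 = {x. \<exists>n::int. \<bar>(x + real_of_int n) / \<kappa>\<bar> < 1 \<and> acs ((x + real_of_int n) / \<kappa>) \<in> T}"
  have [measurable]: "E0 \<in> sets borel"
    unfolding E0_def by measurable
  have "AE \<omega> in pr U. path_freq tgt 1 \<omega> \<notin> E0"
    using AE_angle[OF params(1), of 1] params(2)
  proof -
    have "AE \<omega> in pr U. angle U tgt 1 \<omega> \<in> {0<..<pi} \<and> 0 < density U tgt (angle U tgt 1 \<omega>)"
      using params(2) by (intro AE_angle params(1)) auto
    then show ?thesis
    proof eventually_elim
      case (elim \<omega>)
      show ?case
      proof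
        assume "path_freq tgt 1 \<omega> \<in> E0"
        then obtain n :: int where n: "\<bar>(path_freq tgt 1 \<omega> + real_of_int n) / \<kappa>\<bar> < 1"
            "acs ((path_freq tgt 1 \<omega> + real_of_int n) / \<kappa>) \<in> T"
          unfolding E0_def by blast
        define y where "y = (path_freq tgt 1 \<omega> + real_of_int n) / \<kappa>"
        define t where "t = acs y"
        have y: "-1 < y" "y < 1" using n(1) unfolding y_def[symmetric] by linarith+
        have t: "t = arccos y" using acs n(1) by (simp add: t_def y_def)
        have "0 < t" "t < pi" using y arccos_lt_bounded[of y] by (auto simp: t)
        moreover have "cos t = y" using y by (simp add: t)
        moreover have tT: "t \<in> T" using n(2) by (simp add: t_def y_def)
        ultimately have "t \<in> {0<..<pi} - desired_support U" "\<exists>l\<in>cs. 0 < density U l t"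
          using l by (auto simp: T_def desired_support_def)
        moreover have "angle U tgt 1 \<omega> \<in> {0<..<pi} \<inter> desired_support U"
          using elim by (simp add: desired_support_def)
        ultimately have "\<kappa> * (cos (angle U tgt 1 \<omega>) - cos t) \<notin> \<int>"
          using no_alias unfolding aliasing_free_def \<kappa>_def by blast
        moreover have "\<kappa> * (cos (angle U tgt 1 \<omega>) - cos t) = real_of_int (\<lfloor>\<kappa> * cos (angle U tgt 1 \<omega>)\<rfloor> - n)"
          using \<kappa> \<open>cos t = y\<close> by (simp add: y_def path_freq_def freq_def frac_def field_simps \<kappa>_def[symmetric])
        ultimately show False by (metis Ints_of_int)
      qed
    qed
  qed
  \<comment> \<open>As the desired channel almost surely produces no frequency of \<open>E0\<close>,
    its law gives \<open>E0\<close> mass zero, and its density vanishes almost everywhere on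
    \<open>E0\<close>.\<close>
  then have "AE x in freq_law tgt. x \<notin> E0"
    unfolding freq_law_def using path_freq_measurable[OF params(1), of 1] params(2) by (subst AE_distr_iff) auto
  then have "AE x in unit_lborel. 0 < ennreal (spec tgt x) \<longrightarrow> x \<notin> E0"
    unfolding spec(3)[OF params(1)] using spec(1)[OF params(1)] by (subst (asm) AE_density) (auto simp: measurable_unit_lborel)
  then have "AE x in lborel. 0 < (indicator {0..1} x :: ennreal) \<longrightarrow> 0 < ennreal (spec tgt x) \<longrightarrow> x \<notin> E0"
    unfolding unit_lborel_def by (subst (asm) AE_density) auto
  then have "AE x in lborel. x \<in> {0<..<1} \<longrightarrow> x \<in> E0 \<longrightarrow> spec tgt x = 0"
  proof eventually_elim
    case (elim x)
    then show ?case using spec(2)[OF params(1), of x] by (auto simp: indicator_def)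
  qed
  from AE_path_freq[OF l p this] AE_angle[OF l p] show ?thesis
  proof eventually_elim
    case (elim \<omega>)
    show ?case
    proof
      assume off: "angle U l p \<omega> \<notin> desired_support U"
      let ?t = "angle U l p \<omega>"
      have t: "0 < ?t" "?t < pi" "0 < density U l ?t" using elim by auto
      have "cos ?t < cos 0" "cos pi < cos ?t"
        using t by (intro cos_monotone_0_pi; simp)+
      then have c: "\<bar>cos ?t\<bar> < 1" by auto
      have T: "?t \<in> T" using off t by (auto simp: T_def desired_support_def)
      have "(path_freq l p \<omega> + real_of_int \<lfloor>\<kappa> * cos ?t\<rfloor>) / \<kappa> = cos ?t"
        using \<kappa> by (simp add: path_freq_def freq_def frac_def \<kappa>_def[symmetric])
      moreover have "acs (cos ?t) = ?t"
        using acs[OF c] t by (simp add: arccos_cos)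
      ultimately have "path_freq l p \<omega> \<in> E0"
        unfolding E0_def using c T by (intro CollectI exI[of _ "\<lfloor>\<kappa> * cos ?t\<rfloor>"]) simp
      then show "spec tgt (path_freq l p \<omega>) = 0" using elim by blast
    qed
  qed
qed

lemma AE_freq_law_neq:
  assumes l: "l \<in> cs"
  shows "AE x in freq_law l. x \<noteq> y"
proof -
  have "AE x in lborel. x \<in> {0<..<1} \<longrightarrow> x \<noteq> y"
    using AE_lborel_singleton[of y] by eventually_elim simp
  from AE_freq_law[OF l this] show ?thesis by eventually_elim simp
qed

text \<open>The two frequencies are independent and the law of the second has no atoms, so by Fubini
  the diagonal has probability zero.\<close>

lemma AE_path_freq_distinct:
  assumes l: "l \<in> cs" "p \<in> ps" and k: "k \<in> cs" "q \<in> ps" and ne: "(l, p) \<noteq> (k, q)"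
  shows "AE \<omega> in pr U. path_freq l p \<omega> \<noteq> path_freq k q \<omega>"
proof -
  let ?X = "path_freq l p" and ?Y = "path_freq k q"
  have [measurable]: "?X \<in> borel_measurable (pr U)" "?Y \<in> borel_measurable (pr U)"
    using path_freq_measurable l k by auto
  have "indep_var borel (source_var U (Angle l p)) borel (source_var U (Angle k q))"
    by (rule indep_vars_pair[OF indep]) (use l k ne in \<open>auto simp: sources_def\<close>)
  then have "indep_var borel ((\<lambda>z. freq (Re z)) \<circ> source_var U (Angle l p)) borel ((\<lambda>z. freq (Re z)) \<circ> source_var U (Angle k q))"
    by (rule indep_var_compose) measurable
  then have iv: "indep_var borel ?X borel ?Y"
    by (simp add: o_def path_freq_def[abs_def])
  have eq: "distr (pr U) (borel \<Otimes>\<^sub>M borel) (\<lambda>\<omega>. (?X \<omega>, ?Y \<omega>)) = freq_law l \<Otimes>\<^sub>M freq_law k"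
    using iv freq_law_eq[OF l] freq_law_eq[OF k] by (simp add: indep_var_distribution_eq)
  interpret P: pair_sigma_finite "freq_law l" "freq_law k"
    using freq_law_prob[OF l(1)] freq_law_prob[OF k(1)]
    by (intro pair_sigma_finite.intro prob_space_imp_sigma_finite)
  have [measurable_cong]: "sets (freq_law l) = sets borel" "sets (freq_law k) = sets borel"
    by (simp_all add: freq_law_def)
  have "AE z in freq_law l \<Otimes>\<^sub>M freq_law k. fst z \<noteq> snd z"
  proof (rule P.AE_pair_measure)
    show "{z \<in> space (freq_law l \<Otimes>\<^sub>M freq_law k). fst z \<noteq> snd z} \<in> sets (freq_law l \<Otimes>\<^sub>M freq_law k)"
      by measurable
    show "AE x in freq_law l. AE y in freq_law k. fst (x, y) \<noteq> snd (x, y)"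
    proof (rule AE_I2)
      fix x
      show "AE y in freq_law k. fst (x, y) \<noteq> snd (x, y)"
        using AE_freq_law_neq[OF k(1), of x] by eventually_elim simp
    qed
  qed
  then have "AE z in distr (pr U) (borel \<Otimes>\<^sub>M borel) (\<lambda>\<omega>. (?X \<omega>, ?Y \<omega>)). fst z \<noteq> snd z"
    unfolding eq .
  from AE_distrD[OF _ this] show ?thesis by simp
qed

end

context uplink_system
begin

section \<open>The filter matrices\<close>

abbreviation "\<sigma>2 \<equiv> noise_var U"
abbreviation "S M \<equiv> received_cov U M"

lemma S_carrier [simp]: "S M \<in> carrier_mat M M" "dim_row (S M) = M" "dim_col (S M) = M"
  by (simp_all add: received_cov_def)

lemma S_app: "m < M \<Longrightarrow> app M (S M) y m = (\<Sum>l\<in>cs. app M (R l M) y m) + complex_of_real \<sigma>2 * y m"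
proof -
  assume m: "m < M"
  have "app M (S M) y m = (\<Sum>k<M. (\<Sum>l\<in>cs. R l M $$ (m, k) * y k) + (if m = k then complex_of_real \<sigma>2 * y k else 0))"
    unfolding app_def using m
    by (intro sum.cong refl) (simp add: received_cov_def distrib_right sum_distrib_right)
  also have "\<dots> = (\<Sum>k<M. \<Sum>l\<in>cs. R l M $$ (m, k) * y k) + (\<Sum>k<M. if m = k then complex_of_real \<sigma>2 * y k else 0)"
    by (rule sum.distrib)
  also have "(\<Sum>k<M. \<Sum>l\<in>cs. R l M $$ (m, k) * y k) = (\<Sum>l\<in>cs. app M (R l M) y m)"
    unfolding app_def by (rule sum.swap)
  also have "(\<Sum>k<M. if m = k then complex_of_real \<sigma>2 * y k else 0) = complex_of_real \<sigma>2 * y m"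
    using m by simp
  finally show ?thesis .
qed

text \<open>The covariances are positive semidefinite, so the noise term makes the received
  covariance coercive with a constant that does not depend on \<open>M\<close>.\<close>

lemma S_coercive: "\<sigma>2 * (nrm M x)\<^sup>2 \<le> Re (ip M (app M (S M) x) x)"
proof -
  have "ip M (app M (S M) x) x = ip M (\<lambda>m. (\<Sum>l\<in>cs. app M (R l M) x m) + complex_of_real \<sigma>2 * x m) x"
    by (rule ip_cong) (simp_all add: S_app)
  also have "\<dots> = (\<Sum>l\<in>cs. ip M (app M (R l M) x) x) + complex_of_real (\<sigma>2 * (nrm M x)\<^sup>2)"
    by (simp only: ip_add_left ip_sum_left ip_scale_left ip_self of_real_mult)
  finally have "Re (ip M (app M (S M) x) x) = (\<Sum>l\<in>cs. Re (ip M (app M (R l M) x) x)) + \<sigma>2 * (nrm M x)\<^sup>2"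
    by simp
  moreover have "0 \<le> (\<Sum>l\<in>cs. Re (ip M (app M (R l M) x) x))"
    by (intro sum_nonneg R_psd)
  ultimately show ?thesis by linarith
qed

lemmas S_inverse = coercive_minv[OF S_carrier(1) params(5) S_coercive]

lemma Xi_carrier [simp]: "Xi U M \<in> carrier_mat M M" "dim_row (Xi U M) = M" "dim_col (Xi U M) = M"
proof -
  show "Xi U M \<in> carrier_mat M M"
    unfolding Xi_def using S_inverse(1) by (rule mult_carrier_mat) simp
  then show "dim_row (Xi U M) = M" "dim_col (Xi U M) = M" by auto
qed

lemma Xi_app: "i < M \<Longrightarrow> app M (Xi U M) x i = app M (minv (S M)) (app M (R tgt M) x) i"
  unfolding Xi_def by (rule app_mult[OF S_inverse(1) R_carrier(1)])

text \<open>The added 1 keeps the constant strictly positive, as the perturbation argument divides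
  by it.\<close>

lemma Xi_bound: "nrm M (app M (Xi U M) x) \<le> (\<bar>\<zeta>\<bar> + 1) / \<sigma>2 * nrm M x"
proof -
  have "nrm M (app M (Xi U M) x) = nrm M (app M (minv (S M)) (app M (R tgt M) x))"
    by (rule nrm_cong) (rule Xi_app)
  also have "\<dots> \<le> 1 / \<sigma>2 * nrm M (app M (R tgt M) x)"
    by (rule S_inverse(4))
  also have "\<dots> \<le> 1 / \<sigma>2 * ((\<bar>\<zeta>\<bar> + 1) * nrm M x)"
  proof (rule mult_left_mono)
    have "\<bar>\<zeta>\<bar> * nrm M x \<le> (\<bar>\<zeta>\<bar> + 1) * nrm M x"
      by (rule mult_right_mono) simp_all
    with R_bound[OF params(1), of M x] show "nrm M (app M (R tgt M) x) \<le> (\<bar>\<zeta>\<bar> + 1) * nrm M x"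
      by (rule order.trans)
  qed (use params(5) in simp)
  finally show ?thesis by simp
qed

text \<open>The limiting eigenvalue of the filter \<open>Xi\<close> on the steering vector of frequency \<open>x\<close>.\<close>

definition gain :: "real \<Rightarrow> real" where
  "gain x = (path_loss U tgt)\<^sup>2 * spec tgt x / ((\<Sum>l\<in>cs. (path_loss U l)\<^sup>2 * spec l x) + \<sigma>2)"

lemma gain_denominator: "0 < (\<Sum>l\<in>cs. (path_loss U l)\<^sup>2 * spec l x) + \<sigma>2"
  using params(5) by (intro add_nonneg_pos sum_nonneg mult_nonneg_nonneg spec) auto

text \<open>Let b_l be the approximate eigenvalue of R_l. The gain satisfies b_target = gain (sum of
  the b_l + noise variance), hence R_target w - gain S w is small, and the inverse of S is bounded
  uniformly in M.\<close>

lemma Xi_wave: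
  assumes x: "good x"
  shows "(\<lambda>M. nrm M (\<lambda>m. app M (Xi U M) (\<lambda>n. wave n x) m - complex_of_real (gain x) * wave m x) / sqrt (real M)) \<longlonglongrightarrow> 0"
proof -
  define w where "w = (\<lambda>n. wave n x)"
  define b where "b = (\<lambda>l. (path_loss U l)\<^sup>2 * spec l x)"
  define D where "D = (\<lambda>l M m. app M (R l M) w m - complex_of_real (b l) * w m)"
  have D: "(\<lambda>M. nrm M (D l M) / sqrt (real M)) \<longlonglongrightarrow> 0" if "l \<in> cs" for l
    using x that unfolding good_def D_def w_def b_def by blast
  have g: "complex_of_real (gain x) * (\<Sum>l\<in>cs. complex_of_real (b l)) + complex_of_real (gain x) * complex_of_real \<sigma>2 = complex_of_real (b tgt)"
  proof -
    have "gain x * ((\<Sum>l\<in>cs. b l) + \<sigma>2) = b tgt"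
      using gain_denominator[of x] by (simp add: gain_def b_def)
    then have "complex_of_real (gain x * ((\<Sum>l\<in>cs. b l) + \<sigma>2)) = complex_of_real (b tgt)" by (simp only:)
    then show ?thesis by (simp add: algebra_simps)
  qed
  have bd: "nrm M (\<lambda>m. app M (Xi U M) w m - complex_of_real (gain x) * w m) / sqrt (real M)
      \<le> 1 / \<sigma>2 * (nrm M (D tgt M) / sqrt (real M) + \<bar>gain x\<bar> * (\<Sum>l\<in>cs. nrm M (D l M) / sqrt (real M)))" for M
  proof -
    have S: "app M (R tgt M) w m - complex_of_real (gain x) * app M (S M) w m
        = D tgt M m - complex_of_real (gain x) * (\<Sum>l\<in>cs. D l M m)" if "m < M" for m
    proof -
      have "(\<Sum>l\<in>cs. D l M m) = (\<Sum>l\<in>cs. app M (R l M) w m) - (\<Sum>l\<in>cs. complex_of_real (b l)) * w m"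
        by (simp add: D_def sum_subtractf sum_distrib_right)
      then have h1: "complex_of_real (gain x) * (\<Sum>l\<in>cs. D l M m) = complex_of_real (gain x) * (\<Sum>l\<in>cs. app M (R l M) w m)
          - complex_of_real (gain x) * (\<Sum>l\<in>cs. complex_of_real (b l)) * w m"
        by (simp only: right_diff_distrib mult.assoc)
      have h2: "complex_of_real (b tgt) * w m = complex_of_real (gain x) * (\<Sum>l\<in>cs. complex_of_real (b l)) * w m + complex_of_real (gain x) * complex_of_real \<sigma>2 * w m"
        by (simp only: g[symmetric] distrib_right)
      have h3: "complex_of_real (gain x) * app M (S M) w m = complex_of_real (gain x) * (\<Sum>l\<in>cs. app M (R l M) w m) + complex_of_real (gain x) * complex_of_real \<sigma>2 * w m"
        by (simp only: S_app[OF that] distrib_left mult.assoc)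
      have h4: "D tgt M m = app M (R tgt M) w m - complex_of_real (b tgt) * w m"
        by (simp only: D_def)
      have "x - (a + s) = x - (b + s) - (a - b)" for x a b s :: complex
        by simp
      then show ?thesis
        unfolding h1 h3 h4 h2 .
    qed
    have id: "app M (minv (S M)) (app M (S M) w) m = w m" if "m < M" for m
      using app_mult[OF S_inverse(1) S_carrier(1) that, of w] app_one[OF that, of w] by (simp add: S_inverse(2))
    have "nrm M (\<lambda>m. app M (Xi U M) w m - complex_of_real (gain x) * w m)
      = nrm M (app M (minv (S M)) (\<lambda>m. app M (R tgt M) w m - complex_of_real (gain x) * app M (S M) w m))"
      by (rule nrm_cong) (simp add: Xi_app app_diff app_scale id)
    also have "\<dots> = nrm M (app M (minv (S M)) (\<lambda>m. D tgt M m - complex_of_real (gain x) * (\<Sum>l\<in>cs. D l M m)))"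
      by (rule arg_cong[of _ _ "nrm M"], rule app_cong) (rule S)
    also have "\<dots> \<le> 1 / \<sigma>2 * nrm M (\<lambda>m. D tgt M m - complex_of_real (gain x) * (\<Sum>l\<in>cs. D l M m))"
      by (rule S_inverse(4))
    also have "\<dots> \<le> 1 / \<sigma>2 * (nrm M (D tgt M) + nrm M (\<lambda>m. complex_of_real (gain x) * (\<Sum>l\<in>cs. D l M m)))"
      using params(5) by (intro mult_left_mono nrm_diff) simp
    also have "\<dots> \<le> 1 / \<sigma>2 * (nrm M (D tgt M) + \<bar>gain x\<bar> * (\<Sum>l\<in>cs. nrm M (D l M)))"
      unfolding nrm_scale norm_of_real using params(5)
      by (intro mult_left_mono add_left_mono nrm_sum) auto
    finally have "nrm M (\<lambda>m. app M (Xi U M) w m - complex_of_real (gain x) * w m) / sqrt (real M)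
      \<le> 1 / \<sigma>2 * (nrm M (D tgt M) + \<bar>gain x\<bar> * (\<Sum>l\<in>cs. nrm M (D l M))) / sqrt (real M)"
      by (rule divide_right_mono) simp
    then show ?thesis
      by (simp add: sum_divide_distrib[symmetric] add_divide_distrib algebra_simps)
  qed
  have "(\<lambda>M. 1 / \<sigma>2 * (nrm M (D tgt M) / sqrt (real M) + \<bar>gain x\<bar> * (\<Sum>l\<in>cs. nrm M (D l M) / sqrt (real M)))) \<longlonglongrightarrow> 1 / \<sigma>2 * (0 + \<bar>gain x\<bar> * (\<Sum>l\<in>cs. 0))"
    by (intro tendsto_intros D params(1))
  then have lim: "(\<lambda>M. 1 / \<sigma>2 * (nrm M (D tgt M) / sqrt (real M) + \<bar>gain x\<bar> * (\<Sum>l\<in>cs. nrm M (D l M) / sqrt (real M)))) \<longlonglongrightarrow> 0"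
    by simp
  have "(\<lambda>M. nrm M (\<lambda>m. app M (Xi U M) w m - complex_of_real (gain x) * w m) / sqrt (real M)) \<longlonglongrightarrow> 0"
    by (rule tendsto_sandwich[OF _ always_eventually[OF allI[OF bd]] tendsto_const lim])
      (auto intro!: always_eventually divide_nonneg_nonneg)
  then show ?thesis by (simp only: w_def)
qed

section \<open>The projection that remains after undoing the filter\<close>

definition range_proj :: "nat \<Rightarrow> complex mat" where
  "range_proj M = pseudoinverse (R tgt M) * R tgt M"

text \<open>In the product of \<open>Xi'\<close> and \<open>Xi\<close> the received covariance meets
  its inverse, which leaves the pseudoinverse times the covariance. The other claims are the Penrose
  equations.\<close>

lemma range_proj:
  shows range_proj_carrier [simp]: "range_proj M \<in> carrier_mat M M"
    and range_proj_hermitian: "hermitian (range_proj M)"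
    and range_proj_idem: "range_proj M * range_proj M = range_proj M"
    and R_range_proj: "R tgt M * range_proj M = R tgt M"
    and Xi'_Xi: "Xi' U M * Xi U M = range_proj M"
    and Xi'_carrier: "Xi' U M \<in> carrier_mat M M"
proof -
  let ?R = "R tgt M" and ?P = "pseudoinverse (R tgt M)"
  have p: "is_pseudoinverse ?R ?P"
    by (rule hermitian_pseudoinverse[OF R_carrier(1) R_hermitian])
  then have P: "?P \<in> carrier_mat M M" "?R * ?P * ?R = ?R" "?P * ?R * ?P = ?P" "mat_adjoint (?P * ?R) = ?P * ?R"
    by (auto simp: is_pseudoinverse_def)
  have R: "?R \<in> carrier_mat M M" by simp
  have Si: "minv (S M) \<in> carrier_mat M M" by (rule S_inverse(1))
  show "range_proj M \<in> carrier_mat M M" unfolding range_proj_def using P(1) R by (rule mult_carrier_mat)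
  show "hermitian (range_proj M)" unfolding hermitian_def range_proj_def by (rule P(4))
  have "range_proj M * range_proj M = (?P * ?R * ?P) * ?R"
    unfolding range_proj_def using assoc_mult_mat[OF mult_carrier_mat[OF P(1) R] P(1) R] by simp
  then show "range_proj M * range_proj M = range_proj M"
    by (simp only: P(3) range_proj_def)
  show "R tgt M * range_proj M = R tgt M"
    unfolding range_proj_def using assoc_mult_mat[OF R P(1) R] P(2) by simp
  show "Xi' U M \<in> carrier_mat M M"
    unfolding Xi'_def using P(1) S_carrier(1) by (rule mult_carrier_mat)
  have "Xi' U M * Xi U M = ?P * (S M * (minv (S M) * ?R))"
    unfolding Xi'_def Xi_def by (rule assoc_mult_mat[OF P(1) S_carrier(1) mult_carrier_mat[OF Si R]])
  also have "S M * (minv (S M) * ?R) = S M * minv (S M) * ?R"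
    by (rule assoc_mult_mat[symmetric, OF S_carrier(1) Si R])
  also have "\<dots> = ?R"
    unfolding S_inverse(3) by (rule left_mult_one_mat[OF R])
  finally show "Xi' U M * Xi U M = range_proj M" by (simp only: range_proj_def)
qed

text \<open>For an orthogonal projection P one has |P x|^2 = <P x, x>, and Cauchy-Schwarz
  applies.\<close>

lemma range_proj_bound: "nrm M (app M (range_proj M) x) \<le> nrm M x"
proof -
  let ?y = "app M (range_proj M) x"
  have "complex_of_real ((nrm M ?y)\<^sup>2) = ip M ?y ?y" by (simp only: ip_self)
  also have "\<dots> = ip M (app M (range_proj M) ?y) x"
    by (rule hermitian_ip[OF range_proj_carrier range_proj_hermitian, symmetric])
  also have "\<dots> = ip M ?y x"
    by (rule ip_cong) (simp_all add: app_mult[OF range_proj_carrier range_proj_carrier, symmetric] range_proj_idem)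
  finally have "(nrm M ?y)\<^sup>2 = cmod (ip M ?y x)"
    by (metis norm_of_real abs_power2 abs_of_nonneg zero_le_power2)
  also have "\<dots> \<le> nrm M ?y * nrm M x" by (rule ip_bound)
  finally have "nrm M ?y * nrm M ?y \<le> nrm M ?y * nrm M x" by (simp add: power2_eq_square)
  then show ?thesis
    using nrm_nonneg[of M ?y] nrm_nonneg[of M x] by (cases "nrm M ?y = 0") (auto simp: mult_le_cancel_left)
qed

text \<open>The covariance annihilates the rows of \<open>1 - range_proj\<close>, so the desired channel has second moment
  zero against them.\<close>

lemma AE_range_proj_chan: "AE \<omega> in pr U. \<forall>M. \<forall>i<M. app M (range_proj M) (chan tgt \<omega>) i = chan tgt \<omega> i"
proof -
  have "AE \<omega> in pr U. app M (range_proj M) (chan tgt \<omega>) i = chan tgt \<omega> i" if i: "i < M" for M i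
  proof -
    define e :: "nat \<Rightarrow> complex" where "e = (\<lambda>k. if k = i then 1 else 0)"
    \<comment> \<open>The i-th column of 1 - P for the projection P: pairing a vector h with it
      gives the i-th entry of h - P h, and R y = 0 because R P = R.\<close>
    define y where "y = (\<lambda>k. e k - app M (range_proj M) e k)"
    have y: "ip M h y = h i - app M (range_proj M) h i" for h
    proof -
      have e: "ip M z e = z i" for z
        unfolding ip_def e_def using i by (simp add: if_distrib[of "\<lambda>x. _ * cnj x"] cong: if_cong)
      have "ip M h (app M (range_proj M) e) = ip M (app M (range_proj M) h) e"
        by (rule hermitian_ip[OF range_proj_carrier range_proj_hermitian, symmetric])
      then show ?thesis by (simp add: y_def ip_diff_right e)
    qed
    have "app M (R tgt M) y m = 0" if "m < M" for m
      using that app_mult[OF R_carrier(1)[of tgt M] range_proj_carrier that, of e]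
      by (simp add: y_def app_diff R_range_proj)
    then have "ip M (app M (R tgt M) y) y = ip M (\<lambda>m. 0) y"
      by (intro ip_cong) auto
    then have "complex_of_real (expectation (\<lambda>\<omega>. (cmod (ip M (chan tgt \<omega>) y))\<^sup>2)) = 0"
      by (simp add: R_quadratic(1)[OF params(1), symmetric]) (simp add: ip_def)
    then have "expectation (\<lambda>\<omega>. (cmod (ip M (chan tgt \<omega>) y))\<^sup>2) = 0" by (simp only: of_real_eq_0_iff)
    then have "AE \<omega> in pr U. (cmod (ip M (chan tgt \<omega>) y))\<^sup>2 = 0"
      by (subst (asm) integral_nonneg_eq_0_iff_AE[OF R_quadratic(2)[OF params(1)]]) auto
    then show ?thesis
      by eventually_elim (simp add: y)
  qed
  then show ?thesis
    by (simp add: AE_all_countable)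
qed

section \<open>Noises and symbols\<close>

lemma data_noise_measurable: "data_noise U m c \<in> borel_measurable (pr U)"
  using source_measurable[of "DNoise m c"] by (simp add: sources_def)

lemma pilot_noise_measurable: "t < pilot_len U \<Longrightarrow> pilot_noise U m t \<in> borel_measurable (pr U)"
  using source_measurable[of "PNoise m t"] by (simp add: sources_def)

lemma data_noise_gaussian: "complex_gaussian (pr U) \<sigma>2 (data_noise U m c)"
  using model unfolding uplink_model_def by blast

lemma pilot_noise_gaussian: "t < pilot_len U \<Longrightarrow> complex_gaussian (pr U) \<sigma>2 (pilot_noise U m t)"
  using model unfolding uplink_model_def by blast

lemmas data_noise_moments = complex_gaussian_moments[OF data_noise_gaussian params(5) data_noise_measurable]
lemmas pilot_noise_moments = complex_gaussian_moments[OF pilot_noise_gaussian params(5) pilot_noise_measurable]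

lemma AE_data_noise: "AE \<omega> in pr U. \<exists>N. ((\<lambda>p. N (fst p) (snd p)) \<longlongrightarrow> 0) (sequentially \<times>\<^sub>F sequentially) \<and>
    (\<forall>M C. 1 \<le> M \<longrightarrow> 1 \<le> C \<longrightarrow> 0 \<le> N M C \<and> op_bound (\<lambda>m c. data_noise U m c \<omega>) M C (N M C * (real M * real C)))"
proof -
  have "AE \<omega> in pr U. \<exists>N. ((\<lambda>p. N (fst p) (snd p)) \<longlongrightarrow> 0) (sequentially \<times>\<^sub>F sequentially) \<and>
    (\<forall>M C. 1 \<le> M \<longrightarrow> 1 \<le> C \<longrightarrow> 0 \<le> N M C \<and> op_bound (\<lambda>m c. source_var U (DNoise m c) \<omega>) M C (N M C * (real M * real C)))"
    by (rule noise_operator_bound[OF indep, where idx = DNoise and v = \<sigma>2 and \<kappa> = "3 * \<sigma>2\<^sup>2"])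
      (auto simp: sources_def data_noise_moments simp del: of_real_power)
  then show ?thesis by simp
qed

text \<open>The centred squared moduli are uncorrelated, and the fourth moments of the noise bound
  their second moments, so \<open>slln_uncorrelated\<close> applies.\<close>

lemma AE_pilot_noise_norm:
  assumes t: "t < pilot_len U"
  shows "AE \<omega> in pr U. (\<lambda>M. (\<Sum>i<M. (cmod (pilot_noise U i t \<omega>))\<^sup>2) / real M) \<longlonglongrightarrow> \<sigma>2"
proof -
  define X where "X = (\<lambda>i \<omega>. complex_of_real ((cmod (pilot_noise U i t \<omega>))\<^sup>2 - \<sigma>2))"
  note [measurable] = pilot_noise_measurable[OF t]
  have sq: "integrable (pr U) (\<lambda>\<omega>. (cmod (pilot_noise U i t \<omega>))\<^sup>2)" for i
    using pilot_noise_moments(2)[OF t t, of i] params(5) not_integrable_integral_eq by fastforce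
  have X2: "(cmod (X i \<omega>))\<^sup>2 = (cmod (pilot_noise U i t \<omega>)) ^ 4 - 2 * \<sigma>2 * (cmod (pilot_noise U i t \<omega>))\<^sup>2 + \<sigma>2\<^sup>2" for i \<omega>
    unfolding X_def norm_of_real power2_abs by (simp add: power2_eq_square power4_eq_xxxx algebra_simps)
  have iX: "integrable (pr U) (X i)" for i
    unfolding X_def by (intro integrable_of_real Bochner_Integration.integrable_diff sq) simp
  have EX: "expectation (X i) = 0" for i
  proof -
    have "expectation (\<lambda>\<omega>. (cmod (pilot_noise U i t \<omega>))\<^sup>2 - \<sigma>2) = 0"
      using sq[of i] by (simp add: pilot_noise_moments(2)[OF t t] prob_space)
    then show ?thesis unfolding X_def by (simp only: integral_complex_of_real of_real_0)
  qed
  have "AE \<omega> in pr U. (\<lambda>n. (\<Sum>m<n. X m \<omega>) / of_nat n) \<longlonglongrightarrow> 0"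
  proof (rule slln_uncorrelated)
    show "X n \<in> borel_measurable (pr U)" for n unfolding X_def by measurable
    show "integrable (pr U) (\<lambda>\<omega>. (cmod (X n \<omega>))\<^sup>2)" for n
      unfolding X2 using sq[of n] pilot_noise_moments(3)[OF t t, of n] by simp
    show "expectation (\<lambda>\<omega>. (cmod (X n \<omega>))\<^sup>2) \<le> 3 * \<sigma>2\<^sup>2" for n
    proof -
      have "expectation (\<lambda>\<omega>. (cmod (X n \<omega>))\<^sup>2) = expectation (\<lambda>\<omega>. (cmod (pilot_noise U n t \<omega>)) ^ 4) - 2 * \<sigma>2 * \<sigma>2 + \<sigma>2\<^sup>2"
        unfolding X2 using sq[of n] pilot_noise_moments(3)[OF t t, of n]
        by (simp add: pilot_noise_moments(2)[OF t t] prob_space)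
      then show ?thesis
        using pilot_noise_moments(4)[OF t t, of n] zero_le_power2[of \<sigma>2] unfolding power2_eq_square by linarith
    qed
    show "expectation (\<lambda>\<omega>. X m \<omega> * cnj (X n \<omega>)) = 0" if "m \<noteq> n" for m n
    proof -
      define g where "g = (\<lambda>z. complex_of_real ((cmod z)\<^sup>2 - \<sigma>2))"
      have g: "g \<in> borel_measurable borel" unfolding g_def by measurable
      have gX: "(\<lambda>\<omega>. g (source_var U (PNoise i t) \<omega>)) = X i" for i
        by (simp add: g_def X_def)
      have "expectation (\<lambda>\<omega>. g (source_var U (PNoise m t) \<omega>) * g (source_var U (PNoise n t) \<omega>))
        = expectation (\<lambda>\<omega>. g (source_var U (PNoise m t) \<omega>)) * expectation (\<lambda>\<omega>. g (source_var U (PNoise n t) \<omega>))"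
        by (rule indep_expectation_mult(1)[OF indep]) (use t that iX g in \<open>auto simp: gX sources_def simp del: source_var.simps\<close>)
      moreover have "X m \<omega> * cnj (X n \<omega>) = g (source_var U (PNoise m t) \<omega>) * g (source_var U (PNoise n t) \<omega>)" for \<omega>
        by (simp add: X_def g_def)
      ultimately show ?thesis
        unfolding gX by (simp add: EX)
    qed
  qed
  then show ?thesis
  proof eventually_elim
    case (elim \<omega>)
    have "(\<lambda>n. Re ((\<Sum>m<n. X m \<omega>) / of_nat n) + \<sigma>2) \<longlonglongrightarrow> Re 0 + \<sigma>2"
      by (intro tendsto_intros elim)
    moreover have "\<forall>\<^sub>F n in sequentially. Re ((\<Sum>m<n. X m \<omega>) / of_nat n) + \<sigma>2 = (\<Sum>i<n. (cmod (pilot_noise U i t \<omega>))\<^sup>2) / real n"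
      using eventually_gt_at_top[of "0::nat"]
    proof eventually_elim
      case (elim n)
      have "(\<Sum>m<n. X m \<omega>) / of_nat n = complex_of_real (((\<Sum>i<n. (cmod (pilot_noise U i t \<omega>))\<^sup>2) - real n * \<sigma>2) / real n)"
        by (simp add: X_def sum_subtractf)
      then have "Re ((\<Sum>m<n. X m \<omega>) / of_nat n) = ((\<Sum>i<n. (cmod (pilot_noise U i t \<omega>))\<^sup>2) - real n * \<sigma>2) / real n"
        by (simp only: Re_complex_of_real)
      then show ?case using elim by (simp add: field_simps)
    qed
    ultimately show ?case
      by (simp add: tendsto_cong)
  qed
qed

text \<open>All summands share the same random path frequency, so independence of the summands is
  not at hand. They are uncorrelated nevertheless: distinct noise entries are centred and
  independent of each other and of the angle.\<close>

lemma AE_pilot_noise_wave: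
  assumes t: "t < pilot_len U" and p: "p \<in> ps"
  shows "AE \<omega> in pr U. (\<lambda>M. (\<Sum>i<M. pilot_noise U i t \<omega> * cnj (wave i (path_freq tgt p \<omega>))) / of_nat M) \<longlonglongrightarrow> 0"
proof (rule slln_uncorrelated)
  let ?X = "\<lambda>i \<omega>. pilot_noise U i t \<omega> * cnj (wave i (path_freq tgt p \<omega>))"
  note [measurable] = pilot_noise_measurable[OF t] path_freq_measurable[OF params(1) p]
  have sq: "integrable (pr U) (\<lambda>\<omega>. (cmod (pilot_noise U i t \<omega>))\<^sup>2)" for i
    using pilot_noise_moments(2)[OF t t, of i] params(5) not_integrable_integral_eq by fastforce
  have int: "integrable (pr U) (pilot_noise U i t)" for i
    by (rule square_integrable_complex[OF _ sq]) measurable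
  show "?X n \<in> borel_measurable (pr U)" for n by measurable
  show "integrable (pr U) (\<lambda>\<omega>. (cmod (?X n \<omega>))\<^sup>2)" "expectation (\<lambda>\<omega>. (cmod (?X n \<omega>))\<^sup>2) \<le> \<sigma>2" for n
    using sq[of n] pilot_noise_moments(2)[OF t t, of n] by (simp_all add: norm_mult)
  show "expectation (\<lambda>\<omega>. ?X m \<omega> * cnj (?X n \<omega>)) = 0" if ne: "m \<noteq> n" for m n
  proof -
    define g :: "source \<Rightarrow> complex \<Rightarrow> complex" where
      "g = (\<lambda>s z. if s = PNoise m t then z else if s = PNoise n t then cnj z
         else cnj (wave m (freq (Re z))) * wave n (freq (Re z)))"
    let ?J = "{PNoise m t, PNoise n t, Angle tgt p}"
    have J: "?J \<subseteq> sources U" using t path_sources[OF params(1) p] by (auto simp: sources_def)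
    have g_meas: "g s \<in> borel_measurable borel" for s
      unfolding g_def by measurable
    have g_int: "integrable (pr U) (\<lambda>\<omega>. g s (source_var U s \<omega>))" if s: "s \<in> ?J" for s
    proof (cases "s = Angle tgt p")
      case True
      show ?thesis
      proof (rule integrable_const_bound[of _ 1])
        show "(\<lambda>\<omega>. g s (source_var U s \<omega>)) \<in> borel_measurable (pr U)"
          using measurable_compose[OF source_measurable g_meas] s J by blast
      qed (simp add: g_def True norm_mult)
    next
      case False
      then show ?thesis using s int ne by (auto simp: g_def)
    qed
    have "expectation (\<lambda>\<omega>. \<Prod>s\<in>?J. g s (source_var U s \<omega>)) = (\<Prod>s\<in>?J. expectation (\<lambda>\<omega>. g s (source_var U s \<omega>)))"
      by (rule indep_prod_expectation(1)[OF indep _ J g_meas g_int]) simp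
    moreover have "(\<Prod>s\<in>?J. g s (source_var U s \<omega>)) = ?X m \<omega> * cnj (?X n \<omega>)" for \<omega>
      using ne by (simp add: g_def path_freq_def mult_ac)
    moreover have "expectation (\<lambda>\<omega>. g (PNoise m t) (source_var U (PNoise m t) \<omega>)) = 0"
      using pilot_noise_moments(1)[OF t t, of m] by (simp add: g_def)
    ultimately show ?thesis by simp
  qed
qed

section \<open>Empirical correlations of the data symbols\<close>

lemma symbol_moments:
  assumes "l \<in> cs"
  shows "distr (pr U) borel (symb U l c) = distr (pr U) borel (symb U l 0)"
    "integrable (pr U) (\<lambda>\<omega>. (cmod (symb U l c \<omega>))\<^sup>2)" "expectation (symb U l c) = 0"
    "expectation (\<lambda>\<omega>. (cmod (symb U l c \<omega>))\<^sup>2) = 1"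
  using model assms unfolding uplink_model_def by metis+

lemma symbol_measurable: "l \<in> cs \<Longrightarrow> symb U l c \<in> borel_measurable (pr U)"
  using source_measurable[of "Symb l c"] by (simp add: sources_def)

text \<open>The symbols have two moments, so their squared moduli are merely integrable; their
  common distribution makes \<open>slln_iid_nonneg\<close> applicable.\<close>

lemma AE_symbol_norm:
  assumes l: "l \<in> cs"
  shows "AE \<omega> in pr U. (\<lambda>C. (\<Sum>c<C. symb U l c \<omega> * cnj (symb U l c \<omega>)) / of_nat C) \<longlonglongrightarrow> 1"
proof -
  have "indep_vars (\<lambda>_. borel) (\<lambda>c. source_var U (Symb l c)) UNIV"
    by (rule indep_vars_reindex[OF indep, of "Symb l"]) (use l in \<open>auto simp: inj_on_def sources_def\<close>)
  then have iv: "indep_vars (\<lambda>_. borel) (symb U l) UNIV" by simp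
  have "AE \<omega> in pr U. (\<lambda>n. (\<Sum>c<n. (cmod (symb U l c \<omega>))\<^sup>2) / real n) \<longlonglongrightarrow> expectation (\<lambda>\<omega>. (cmod (symb U l 0 \<omega>))\<^sup>2)"
    by (rule slln_iid_nonneg[where g = "\<lambda>z. (cmod z)\<^sup>2", OF iv symbol_moments(1)[OF l]])
      (use symbol_moments(2)[OF l] in auto)
  then show ?thesis
  proof eventually_elim
    case (elim \<omega>)
    then have "(\<lambda>n. (\<Sum>c<n. (cmod (symb U l c \<omega>))\<^sup>2) / real n) \<longlonglongrightarrow> 1"
      by (simp add: symbol_moments(4)[OF l])
    then have "(\<lambda>n. complex_of_real ((\<Sum>c<n. (cmod (symb U l c \<omega>))\<^sup>2) / real n)) \<longlonglongrightarrow> complex_of_real 1"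
      by (rule tendsto_of_real)
    then show ?case
      by (simp add: complex_norm_square[symmetric] del: of_real_power)
  qed
qed

text \<open>The products of symbols of two users are uncorrelated over time and have second moment
  1, since the two squared moduli are independent with mean 1.\<close>

lemma AE_symbol_cross:
  assumes l: "l \<in> cs" and k: "k \<in> cs" and lk: "l \<noteq> k"
  shows "AE \<omega> in pr U. (\<lambda>C. (\<Sum>c<C. symb U l c \<omega> * cnj (symb U k c \<omega>)) / of_nat C) \<longlonglongrightarrow> 0"
proof (rule slln_uncorrelated)
  let ?X = "\<lambda>c \<omega>. symb U l c \<omega> * cnj (symb U k c \<omega>)"
  note [measurable] = symbol_measurable[OF l] symbol_measurable[OF k]
  have src: "Symb l c \<in> sources U" "Symb k c \<in> sources U" for c
    using l k by (auto simp: sources_def)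
  have int: "integrable (pr U) (symb U i c)" if "i \<in> cs" for i c
    by (rule square_integrable_complex[OF symbol_measurable[OF that] symbol_moments(2)[OF that]])
  show "?X n \<in> borel_measurable (pr U)" for n by measurable
  have *: "integrable (pr U) (\<lambda>\<omega>. complex_of_real ((cmod (symb U l n \<omega>))\<^sup>2) * complex_of_real ((cmod (symb U k n \<omega>))\<^sup>2))"
    "expectation (\<lambda>\<omega>. complex_of_real ((cmod (symb U l n \<omega>))\<^sup>2) * complex_of_real ((cmod (symb U k n \<omega>))\<^sup>2)) = 1" for n
  proof -
    let ?g = "\<lambda>z. complex_of_real ((cmod z)\<^sup>2)"
    have i: "integrable (pr U) (\<lambda>\<omega>. ?g (source_var U (Symb i n) \<omega>))" if "i \<in> cs" for i
      unfolding source_var.simps by (intro integrable_of_real symbol_moments(2) that)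
    note A = indep_expectation_mult[OF indep src(1)[of n] src(2)[of n], of ?g ?g]
    have e: "expectation (\<lambda>\<omega>. ?g (symb U i n \<omega>)) = 1" if "i \<in> cs" for i
      by (simp only: integral_complex_of_real symbol_moments(4)[OF that] of_real_1)
    show "integrable (pr U) (\<lambda>\<omega>. complex_of_real ((cmod (symb U l n \<omega>))\<^sup>2) * complex_of_real ((cmod (symb U k n \<omega>))\<^sup>2))"
      using A(2) lk i[OF l] i[OF k] by simp
    show "expectation (\<lambda>\<omega>. complex_of_real ((cmod (symb U l n \<omega>))\<^sup>2) * complex_of_real ((cmod (symb U k n \<omega>))\<^sup>2)) = 1"
      using A(1) lk i[OF l] i[OF k] e[OF l] e[OF k] by (simp del: of_real_power)
  qed
  have X2: "complex_of_real ((cmod (?X n \<omega>))\<^sup>2) = complex_of_real ((cmod (symb U l n \<omega>))\<^sup>2) * complex_of_real ((cmod (symb U k n \<omega>))\<^sup>2)" for n \<omega>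
    by (simp add: norm_mult power_mult_distrib)
  show "integrable (pr U) (\<lambda>\<omega>. (cmod (?X n \<omega>))\<^sup>2)" for n
    using integrable_Re[OF *(1)[of n, folded X2]] by (simp only: Re_complex_of_real)
  show "expectation (\<lambda>\<omega>. (cmod (?X n \<omega>))\<^sup>2) \<le> 1" for n
    using *(2)[of n] unfolding X2[symmetric] integral_complex_of_real by simp
  show "expectation (\<lambda>\<omega>. ?X m \<omega> * cnj (?X n \<omega>)) = 0" if ne: "m \<noteq> n" for m n
  proof -
    define g :: "source \<Rightarrow> complex \<Rightarrow> complex" where
      "g = (\<lambda>s z. if s = Symb l m \<or> s = Symb k n then z else cnj z)"
    let ?J = "{Symb l m, Symb k m, Symb l n, Symb k n}"
    have g_meas: "g s \<in> borel_measurable borel" for s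
      unfolding g_def by measurable
    have g_int: "integrable (pr U) (\<lambda>\<omega>. g s (source_var U s \<omega>))" if s: "s \<in> ?J" for s
      using s int[OF l] int[OF k] lk ne by (auto simp: g_def)
    have "expectation (\<lambda>\<omega>. \<Prod>s\<in>?J. g s (source_var U s \<omega>)) = (\<Prod>s\<in>?J. expectation (\<lambda>\<omega>. g s (source_var U s \<omega>)))"
      by (rule indep_prod_expectation(1)[OF indep _ _ g_meas g_int]) (use src in auto)
    moreover have "(\<Prod>s\<in>?J. g s (source_var U s \<omega>)) = ?X m \<omega> * cnj (?X n \<omega>)" for \<omega>
      using ne lk by (simp add: g_def mult_ac)
    moreover have "expectation (\<lambda>\<omega>. g (Symb l m) (source_var U (Symb l m) \<omega>)) = 0"
      using symbol_moments(3)[OF l, of m] by (simp add: g_def)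
    ultimately show ?thesis by simp
  qed
qed

lemma AE_symbols: "AE \<omega> in pr U. \<forall>l\<in>cs. \<forall>k\<in>cs.
    (\<lambda>C. (\<Sum>c<C. symb U l c \<omega> * cnj (symb U k c \<omega>)) / of_nat C) \<longlonglongrightarrow> (if l = k then 1 else 0)"
  using AE_symbol_norm AE_symbol_cross by (intro AE_finite_allI) (simp_all split: if_splits)

end

section \<open>Asymptotic Gram matrices\<close>

lemma nrm_le_sqrt:
  assumes "\<And>i. i < M \<Longrightarrow> cmod (x i) \<le> b"
  shows "nrm M x \<le> b * sqrt (real M)"
proof (cases "M = 0")
  case False
  then have b: "0 \<le> b" using assms[of 0] norm_ge_zero[of "x 0"] by linarith
  have "(nrm M x)\<^sup>2 \<le> (\<Sum>i<M. b\<^sup>2)"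
    unfolding nrm_sq_sum using assms by (intro sum_mono power_mono) auto
  also have "\<dots> = (b * sqrt (real M))\<^sup>2"
    by (simp add: power_mult_distrib)
  finally show ?thesis
    by (rule power2_le_imp_le) (use b in simp)
qed (simp add: nrm_def)

lemma ip_divide: "ip n (\<lambda>i. x i / complex_of_real c) (\<lambda>i. y i / complex_of_real d) = ip n x y / complex_of_real (c * d)"
  by (simp add: ip_def sum_divide_distrib)

lemma nrm_divide: "nrm n (\<lambda>i. x i / c) = nrm n x / cmod c"
  using nrm_scale[of n "1 / c" x] by (simp add: norm_divide)

lemma Re_ip_self_divide: "Re (ip M z z / of_nat M) = (nrm M z)\<^sup>2 / real M"
  by (simp only: nrm_sq Re_divide_of_nat)

lemma app_divide: "app n A (\<lambda>i. x i / c) = (\<lambda>i. app n A x i / c)"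
  by (simp add: app_def sum_divide_distrib)

text \<open><f, g> - <f', g'> = <f - f', g> + <f', g - g'>, where the vectors have norm of order
  sqrt M and the differences are of smaller order.\<close>

lemma gram_perturb:
  assumes f: "(\<lambda>M. nrm M (\<lambda>m. f M m - f' M m) / sqrt (real M)) \<longlonglongrightarrow> 0"
    and g: "(\<lambda>M. nrm M (\<lambda>m. g M m - g' M m) / sqrt (real M)) \<longlonglongrightarrow> 0"
    and B: "\<And>M. nrm M (f' M) \<le> B * sqrt (real M)" "\<And>M. nrm M (g' M) \<le> B * sqrt (real M)"
    and lim: "(\<lambda>M. ip M (f' M) (g' M) / of_nat M) \<longlonglongrightarrow> L"
  shows "(\<lambda>M. ip M (f M) (g M) / of_nat M) \<longlonglongrightarrow> L"
proof -
  define a where "a M = nrm M (\<lambda>m. f M m - f' M m) / sqrt (real M)" for M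
  define b where "b M = nrm M (\<lambda>m. g M m - g' M m) / sqrt (real M)" for M
  have a0: "a \<longlonglongrightarrow> 0" and b0: "b \<longlonglongrightarrow> 0"
    using f g by (simp_all only: a_def[abs_def] b_def[abs_def])
  have "(\<lambda>M. a M * (B + b M) + B * b M) \<longlonglongrightarrow> 0 * (B + 0) + B * 0"
    by (intro tendsto_intros a0 b0)
  then have lim0: "(\<lambda>M. a M * (B + b M) + B * b M) \<longlonglongrightarrow> 0" by simp
  have "(\<lambda>M. ip M (f M) (g M) / of_nat M - ip M (f' M) (g' M) / of_nat M) \<longlonglongrightarrow> 0"
  proof (rule Lim_null_comparison[OF _ lim0])
    show "\<forall>\<^sub>F M in sequentially. norm (ip M (f M) (g M) / of_nat M - ip M (f' M) (g' M) / of_nat M) \<le> a M * (B + b M) + B * b M"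
      using eventually_gt_at_top[of "0::nat"]
    proof eventually_elim
      case (elim M)
      let ?r = "sqrt (real M)"
      have r: "0 < ?r" "?r * ?r = real M" using elim by auto
      have na: "nrm M (\<lambda>m. f M m - f' M m) = a M * ?r" and nb: "nrm M (\<lambda>m. g M m - g' M m) = b M * ?r"
        using elim by (simp_all add: a_def b_def)
      have pos: "0 \<le> a M" "0 \<le> b M" by (simp_all add: a_def b_def)
      have "nrm M (g M) = nrm M (\<lambda>m. (g M m - g' M m) + g' M m)" by simp
      also have "\<dots> \<le> b M * ?r + B * ?r"
        using nrm_add[of M "\<lambda>m. g M m - g' M m" "g' M"] B(2)[of M] nb by linarith
      finally have ng: "nrm M (g M) \<le> (B + b M) * ?r" by (simp add: algebra_simps)
      have e: "ip M (f M) (g M) - ip M (f' M) (g' M) = ip M (\<lambda>m. f M m - f' M m) (g M) + ip M (f' M) (\<lambda>m. g M m - g' M m)"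
        by (simp add: ip_diff_left ip_diff_right)
      have "cmod (ip M (f M) (g M) - ip M (f' M) (g' M)) \<le> cmod (ip M (\<lambda>m. f M m - f' M m) (g M)) + cmod (ip M (f' M) (\<lambda>m. g M m - g' M m))"
        unfolding e by (rule norm_triangle_ineq)
      also have "\<dots> \<le> nrm M (\<lambda>m. f M m - f' M m) * nrm M (g M) + nrm M (f' M) * nrm M (\<lambda>m. g M m - g' M m)"
        by (rule add_mono[OF ip_bound ip_bound])
      also have "\<dots> \<le> (a M * ?r) * ((B + b M) * ?r) + (B * ?r) * (b M * ?r)"
        unfolding na nb
        by (rule add_mono[OF mult_left_mono[OF ng] mult_right_mono[OF B(1)]]) (simp_all add: pos)
      also have "\<dots> = (a M * (B + b M) + B * b M) * (?r * ?r)"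
        by (simp only: algebra_simps)
      finally have "cmod (ip M (f M) (g M) - ip M (f' M) (g' M)) \<le> (a M * (B + b M) + B * b M) * real M"
        unfolding r(2) .
      then have "cmod (ip M (f M) (g M) - ip M (f' M) (g' M)) / real M \<le> a M * (B + b M) + B * b M"
        using elim by (simp add: field_simps)
      then show ?case
        by (simp only: diff_divide_distrib[symmetric] norm_divide norm_of_nat)
    qed
  qed
  from tendsto_add[OF this lim] show ?thesis by simp
qed

lemma mult_entry:
  assumes "A \<in> carrier_mat m n" "B \<in> carrier_mat n k" "i < m" "j < k"
  shows "(A * B) $$ (i, j) = app n A (\<lambda>l. B $$ (l, j)) i"
  using assms by (auto simp: app_def scalar_prod_def atLeast0LessThan intro!: sum.cong)

lemma vnorm_mult_app:
  assumes "A \<in> carrier_mat n n" "dim_vec v = n" "\<And>i. i < n \<Longrightarrow> v $ i = x i"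
  shows "vnorm (A *\<^sub>v v) = nrm n (app n A x)"
proof -
  have "vnorm (A *\<^sub>v v) = nrm n (vec_index (A *\<^sub>v v))"
    by (rule vnorm_nrm) (use assms in auto)
  also have "\<dots> = nrm n (app n A (vec_index v))"
  proof (rule nrm_cong)
    show "(A *\<^sub>v v) $ i = app n A (vec_index v) i" if "i < n" for i
      using mult_mat_vec_app[of i A v] carrier_matD[OF assms(1)] assms(2) that by (simp del: index_mult_mat_vec)
  qed
  also have "app n A (vec_index v) = app n A x"
    by (rule app_cong) (rule assms(3))
  finally show ?thesis .
qed

text \<open>Eventually along this filter means for all sufficiently large numbers of antennas and of
  symbols, in any proportion.\<close>

abbreviation (input) "MC_filter \<equiv> (sequentially \<times>\<^sub>F sequentially :: (nat \<times> nat) filter)"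

lemma MC_filter_lim:
  "(f \<longlongrightarrow> L) sequentially \<Longrightarrow> ((\<lambda>p. f (fst p)) \<longlongrightarrow> L) MC_filter"
  "(f \<longlongrightarrow> L) sequentially \<Longrightarrow> ((\<lambda>p. f (snd p)) \<longlongrightarrow> L) MC_filter"
  by (rule filterlim_compose[OF _ filterlim_fst], assumption) (rule filterlim_compose[OF _ filterlim_snd], assumption)

lemma MC_filter_eventually:
  "eventually P sequentially \<Longrightarrow> \<forall>\<^sub>F p in MC_filter. P (fst p)"
  "eventually P sequentially \<Longrightarrow> \<forall>\<^sub>F p in MC_filter. P (snd p)"
  by (erule eventually_compose_filterlim, rule filterlim_fst) (erule eventually_compose_filterlim, rule filterlim_snd)

text \<open>A single outcome, with all the almost sure properties as assumptions, so that everything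
  below is deterministic. The eigenvectors may be chosen separately for each size of the
  system.\<close>

locale uplink_sample = uplink_system U \<zeta> for U :: "'a uplink" and \<zeta> +
  fixes \<omega> :: 'a and u :: "nat \<Rightarrow> nat \<Rightarrow> complex vec"
  assumes path_good: "\<And>l p. l \<in> cs \<Longrightarrow> p \<in> ps \<Longrightarrow> good (path_freq l p \<omega>)"
    and target_pos: "\<And>p. p \<in> ps \<Longrightarrow> 0 < spec tgt (path_freq tgt p \<omega>)"
    and off_support: "\<And>l p. l \<in> cs \<Longrightarrow> p \<in> ps \<Longrightarrow> angle U l p \<omega> \<notin> desired_support U \<Longrightarrow> spec tgt (path_freq l p \<omega>) = 0"
    and distinct_freqs: "inj_on (\<lambda>(l, p). path_freq l p \<omega>) (cs \<times> ps)"
    and in_range: "\<And>M i. i < M \<Longrightarrow> app M (range_proj M) (chan tgt \<omega>) i = chan tgt \<omega> i"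
    and data_noise_bound: "\<exists>N. ((\<lambda>p. N (fst p) (snd p)) \<longlongrightarrow> 0) MC_filter \<and>
      (\<forall>M C. 1 \<le> M \<longrightarrow> 1 \<le> C \<longrightarrow> 0 \<le> N M C \<and> op_bound (\<lambda>m c. data_noise U m c \<omega>) M C (N M C * (real M * real C)))"
    and pilot_noise_norm: "\<And>t. t < pilot_len U \<Longrightarrow> (\<lambda>M. (\<Sum>i<M. (cmod (pilot_noise U i t \<omega>))\<^sup>2) / real M) \<longlonglongrightarrow> noise_var U"
    and pilot_noise_wave: "\<And>t p. t < pilot_len U \<Longrightarrow> p \<in> ps \<Longrightarrow>
      (\<lambda>M. (\<Sum>i<M. pilot_noise U i t \<omega> * cnj (wave i (path_freq tgt p \<omega>))) / of_nat M) \<longlonglongrightarrow> 0"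
    and symbols: "\<And>l k. l \<in> cs \<Longrightarrow> k \<in> cs \<Longrightarrow>
      (\<lambda>C. (\<Sum>c<C. symb U l c \<omega> * cnj (symb U k c \<omega>)) / of_nat C) \<longlonglongrightarrow> (if l = k then 1 else 0)"
    and dominance: "\<And>l. l \<in> cs \<Longrightarrow> l \<noteq> tgt \<Longrightarrow> \<exists>\<rho><1. \<forall>\<^sub>F M in sequentially.
      vnorm (Xi U M *\<^sub>v residual_channel U l M \<omega>) \<le> \<rho> * vnorm (Xi U M *\<^sub>v channel U tgt M \<omega>)"
    and principal: "\<And>M C. 1 \<le> M \<Longrightarrow> 1 \<le> C \<Longrightarrow> principal_eigenvector (filtered_sample_cov U M C \<omega>) (u M C)"
begin

section \<open>Channels as combinations of steering vectors\<close>

definition X :: "nat \<times> nat \<Rightarrow> real" where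
  "X = (\<lambda>(l, p). path_freq l p \<omega>)"

definition comb :: "(nat \<times> nat \<Rightarrow> complex) \<Rightarrow> nat \<Rightarrow> complex" where
  "comb a = (\<lambda>m. \<Sum>s\<in>cs \<times> ps. a s * wave m (X s))"

text \<open>Indexed by all paths of all cells and zero off cell \<open>l\<close>: channels of
  different cells then have coefficients with disjoint supports, which makes the channels
  asymptotically orthogonal.\<close>

definition coef :: "nat \<Rightarrow> nat \<times> nat \<Rightarrow> complex" where
  "coef l = (\<lambda>(k, p). if k = l then complex_of_real (path_loss U l / sqrt (real (paths U))) * path_gain l p \<omega> else 0)"

definition res_coef :: "nat \<Rightarrow> nat \<times> nat \<Rightarrow> complex" where
  "res_coef l = (\<lambda>(k, p). if angle U k p \<omega> \<in> desired_support U then coef l (k, p) else 0)"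

lemma sum_cell:
  assumes "l \<in> cs" and "\<And>k p. k \<noteq> l \<Longrightarrow> f (k, p) = (0::complex)"
  shows "(\<Sum>s\<in>cs \<times> ps. f s) = (\<Sum>p\<in>ps. f (l, p))"
proof -
  have "(\<Sum>s\<in>cs \<times> ps. f s) = (\<Sum>k\<in>cs. \<Sum>p\<in>ps. f (k, p))"
    by (subst sum.cartesian_product) simp
  also have "\<dots> = (\<Sum>k\<in>cs. if k = l then \<Sum>p\<in>ps. f (l, p) else 0)"
    by (intro sum.cong refl) (simp add: assms(2))
  finally show ?thesis using assms(1) by simp
qed

lemma chan_comb: "l \<in> cs \<Longrightarrow> chan l \<omega> = comb (coef l)"
  unfolding comb_def by (rule ext, subst sum_cell[of l]) (simp_all add: coef_def X_def chan_def)

lemma residual_comb: "l \<in> cs \<Longrightarrow> m < M \<Longrightarrow> residual_channel U l M \<omega> $ m = comb (res_coef l) m"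
  unfolding comb_def residual_channel_def
  by (subst sum_cell[of l]) (auto simp: res_coef_def coef_def X_def channel_within_coef intro!: sum.cong)

lemma dim_residual: "dim_vec (residual_channel U l M \<omega>) = M"
  by (simp add: residual_channel_def)

lemma X_good: "s \<in> cs \<times> ps \<Longrightarrow> good (X s)"
  using path_good by (auto simp: X_def)

lemma gram_comb: "(\<lambda>M. ip M (comb a) (comb b) / of_nat M) \<longlonglongrightarrow> (\<Sum>s\<in>cs \<times> ps. a s * cnj (b s))"
  unfolding comb_def
  by (rule wave_comb_gram) (use distinct_freqs X_good in \<open>auto simp: X_def good_def\<close>)

lemma comb_bound: "nrm M (comb a) \<le> (\<Sum>s\<in>cs \<times> ps. cmod (a s)) * sqrt (real M)"
  by (rule nrm_le_sqrt) (auto simp: comb_def norm_mult intro!: order.trans[OF norm_sum])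

lemma Xi_comb: "(\<lambda>M. nrm M (\<lambda>m. app M (Xi U M) (comb a) m - comb (\<lambda>s. complex_of_real (gain (X s)) * a s) m) / sqrt (real M)) \<longlonglongrightarrow> 0"
proof -
  define D where "D s M m = app M (Xi U M) (\<lambda>n. wave n (X s)) m - complex_of_real (gain (X s)) * wave m (X s)" for s M m
  have D: "(\<lambda>M. nrm M (D s M) / sqrt (real M)) \<longlonglongrightarrow> 0" if "s \<in> cs \<times> ps" for s
    using Xi_wave[OF X_good[OF that]] by (simp only: D_def[abs_def])
  have eq: "app M (Xi U M) (comb a) m - comb (\<lambda>s. complex_of_real (gain (X s)) * a s) m = (\<Sum>s\<in>cs \<times> ps. a s * D s M m)" for M m
    unfolding comb_def app_sum app_scale D_def by (simp add: sum_subtractf algebra_simps)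
  have bd: "nrm M (\<lambda>m. app M (Xi U M) (comb a) m - comb (\<lambda>s. complex_of_real (gain (X s)) * a s) m) / sqrt (real M)
     \<le> (\<Sum>s\<in>cs \<times> ps. cmod (a s) * (nrm M (D s M) / sqrt (real M)))" for M
  proof -
    have "nrm M (\<lambda>m. \<Sum>s\<in>cs \<times> ps. a s * D s M m) \<le> (\<Sum>s\<in>cs \<times> ps. cmod (a s) * nrm M (D s M))"
      unfolding nrm_scale[symmetric] by (rule nrm_sum) simp
    then show ?thesis
      unfolding eq by (simp add: divide_right_mono sum_divide_distrib[symmetric])
  qed
  have "(\<lambda>M. \<Sum>s\<in>cs \<times> ps. cmod (a s) * (nrm M (D s M) / sqrt (real M))) \<longlonglongrightarrow> (\<Sum>s\<in>cs \<times> ps. cmod (a s) * 0)"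
    by (intro tendsto_intros D)
  then have lim: "(\<lambda>M. \<Sum>s\<in>cs \<times> ps. cmod (a s) * (nrm M (D s M) / sqrt (real M))) \<longlonglongrightarrow> 0" by simp
  show ?thesis
    by (rule tendsto_sandwich[OF _ always_eventually[OF allI[OF bd]] tendsto_const lim])
      (auto intro!: always_eventually divide_nonneg_nonneg)
qed

text \<open>The filter multiplies each coefficient by the gain of its frequency up to o(sqrt M), so
  the limit follows from \<open>gram_comb\<close> by perturbation.\<close>

lemma gram_Xi: "(\<lambda>M. ip M (app M (Xi U M) (comb a)) (app M (Xi U M) (comb b)) / of_nat M)
    \<longlonglongrightarrow> (\<Sum>s\<in>cs \<times> ps. complex_of_real ((gain (X s))\<^sup>2) * (a s * cnj (b s)))"
proof (rule gram_perturb[where f = "\<lambda>M. app M (Xi U M) (comb a)" and g = "\<lambda>M. app M (Xi U M) (comb b)",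
      OF Xi_comb Xi_comb])
  let ?n = "\<lambda>a. \<Sum>s\<in>cs \<times> ps. cmod (complex_of_real (gain (X s)) * a s)"
  have n: "0 \<le> ?n a" for a by (intro sum_nonneg) simp
  show "nrm M (comb (\<lambda>s. complex_of_real (gain (X s)) * a s)) \<le> (?n a + ?n b) * sqrt (real M)" for M
    using comb_bound[of M "\<lambda>s. complex_of_real (gain (X s)) * a s"] n[of b] by (simp add: distrib_right add_increasing2)
  show "nrm M (comb (\<lambda>s. complex_of_real (gain (X s)) * b s)) \<le> (?n a + ?n b) * sqrt (real M)" for M
    using comb_bound[of M "\<lambda>s. complex_of_real (gain (X s)) * b s"] n[of a] by (simp add: distrib_right add_increasing)
  have "(\<lambda>M. ip M (comb (\<lambda>s. complex_of_real (gain (X s)) * a s)) (comb (\<lambda>s. complex_of_real (gain (X s)) * b s)) / of_nat M)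
      \<longlonglongrightarrow> (\<Sum>s\<in>cs \<times> ps. (complex_of_real (gain (X s)) * a s) * cnj (complex_of_real (gain (X s)) * b s))"
    by (rule gram_comb)
  then show "(\<lambda>M. ip M (comb (\<lambda>s. complex_of_real (gain (X s)) * a s)) (comb (\<lambda>s. complex_of_real (gain (X s)) * b s)) / of_nat M)
      \<longlonglongrightarrow> (\<Sum>s\<in>cs \<times> ps. complex_of_real ((gain (X s))\<^sup>2) * (a s * cnj (b s)))"
    by (simp add: power2_eq_square mult_ac)
qed

lemma coef_gram:
  assumes l: "l \<in> cs"
  shows "(\<Sum>s\<in>cs \<times> ps. g s * (coef l s * cnj (coef k s))) = (if l = k then \<Sum>p\<in>ps. g (l, p) * complex_of_real ((path_loss U l)\<^sup>2 / real (paths U)) else 0)"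
proof -
  have P: "0 < real (paths U)" using params(2) by simp
  have A: "(\<Sum>s\<in>cs \<times> ps. g s * (coef l s * cnj (coef k s))) = (\<Sum>p\<in>ps. g (l, p) * (coef l (l, p) * cnj (coef k (l, p))))"
    by (rule sum_cell[OF l]) (simp add: coef_def)
  have E: "coef l (l, p) * cnj (coef l (l, p)) = complex_of_real ((path_loss U l)\<^sup>2 / real (paths U))" for p
  proof -
    have "(cmod (coef l (l, p)))\<^sup>2 = (path_loss U l)\<^sup>2 / real (paths U)"
      using P by (simp add: coef_def norm_mult norm_divide power_divide)
    then show ?thesis by (simp only: complex_norm_square[symmetric])
  qed
  show ?thesis
  proof (cases "k = l")
    case True
    show ?thesis unfolding A unfolding True by (simp only: E simp_thms if_True)
  next
    case False
    then show ?thesis unfolding A by (simp add: coef_def[of k])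
  qed
qed

text \<open>This turns out to be the limit of |Xi h_l|^2 / M.\<close>

definition signal_power :: "nat \<Rightarrow> real" where
  "signal_power l = (\<Sum>p\<in>ps. (gain (X (l, p)))\<^sup>2 * ((path_loss U l)\<^sup>2 / real (paths U)))"

lemma signal_power_complex:
  "(\<Sum>p\<in>ps. complex_of_real ((gain (X (l, p)))\<^sup>2) * complex_of_real ((path_loss U l)\<^sup>2 / real (paths U))) = complex_of_real (signal_power l)"
  by (simp only: signal_power_def of_real_sum of_real_mult)

lemma signal_power_pos: "0 < signal_power tgt"
  unfolding signal_power_def
proof (rule sum_pos)
  show "ps \<noteq> {}" using params(2) by simp
  fix p assume p: "p \<in> ps"
  have "0 < gain (X (tgt, p))"
    unfolding gain_def using target_pos[OF p] params(6)[OF params(1)] gain_denominator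
    by (intro divide_pos_pos mult_pos_pos) (auto simp: X_def)
  then show "0 < (gain (X (tgt, p)))\<^sup>2 * ((path_loss U tgt)\<^sup>2 / real (paths U))"
    using params(2) params(6)[OF params(1)] by simp
qed simp

text \<open>A path outside the support has gain zero, so it makes no difference whether its
  coefficient is kept: the residual and the whole interference channel have the same asymptotic
  filtered power.\<close>

lemma gain_res:
  assumes "s \<in> cs \<times> ps"
  shows "gain (X s) * (res_coef l s * cnj (res_coef l s)) = gain (X s) * (coef l s * cnj (coef l s))"
proof -
  obtain k p where s: "s = (k, p)" "k \<in> cs" "p \<in> ps" using assms by blast
  have "gain (X s) = 0" if "angle U k p \<omega> \<notin> desired_support U"
    using off_support[OF s(2,3) that] by (simp add: gain_def X_def s)
  then show ?thesis by (auto simp: res_coef_def s)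
qed

text \<open>Scaled by 1 / sqrt M, the norms of the channels converge to the path losses; in this
  scaling the abstract perturbation result applies.\<close>

definition h :: "nat \<Rightarrow> nat \<times> nat \<Rightarrow> nat \<Rightarrow> complex" where
  "h l p = (\<lambda>i. chan l \<omega> i / complex_of_real (sqrt (real (fst p))))"

definition v :: "nat \<Rightarrow> nat \<times> nat \<Rightarrow> nat \<Rightarrow> complex" where
  "v = (\<lambda>l p. app (fst p) (Xi U (fst p)) (h l p))"

lemma h_gram:
  assumes "l \<in> cs" "k \<in> cs"
  shows "((\<lambda>p. ip (fst p) (h l p) (h k p)) \<longlongrightarrow> (if l = k then complex_of_real ((path_loss U l)\<^sup>2) else 0)) MC_filter"
proof -
  have "(\<lambda>M. ip M (comb (coef l)) (comb (coef k)) / of_nat M) \<longlonglongrightarrow> (\<Sum>s\<in>cs \<times> ps. 1 * (coef l s * cnj (coef k s)))"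
    using gram_comb[of "coef l" "coef k"] by simp
  also have "(\<Sum>s\<in>cs \<times> ps. 1 * (coef l s * cnj (coef k s))) = (if l = k then complex_of_real ((path_loss U l)\<^sup>2) else 0)"
    unfolding coef_gram[OF assms(1), of "\<lambda>s. 1"] using params(2) by simp
  finally have "((\<lambda>p. ip (fst p) (comb (coef l)) (comb (coef k)) / of_nat (fst p)) \<longlongrightarrow> (if l = k then complex_of_real ((path_loss U l)\<^sup>2) else 0)) MC_filter"
    by (rule MC_filter_lim(1))
  then show ?thesis
    by (simp only: h_def ip_divide chan_comb[OF assms(1)] chan_comb[OF assms(2)] real_sqrt_mult_self abs_of_nat of_real_of_nat_eq)
qed

lemma v_eq: "v l p = (\<lambda>i. app (fst p) (Xi U (fst p)) (chan l \<omega>) i / complex_of_real (sqrt (real (fst p))))"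
  by (simp only: v_def h_def app_divide)

lemma v_gram:
  assumes "l \<in> cs" "k \<in> cs"
  shows "((\<lambda>p. ip (fst p) (v l p) (v k p)) \<longlongrightarrow> (if l = k then complex_of_real (signal_power l) else 0)) MC_filter"
proof -
  have "(\<lambda>M. ip M (app M (Xi U M) (comb (coef l))) (app M (Xi U M) (comb (coef k))) / of_nat M)
      \<longlonglongrightarrow> (if l = k then complex_of_real (signal_power l) else 0)"
    using gram_Xi[of "coef l" "coef k"] unfolding coef_gram[OF assms(1), of "\<lambda>s. complex_of_real ((gain (X s))\<^sup>2)"]
    by (simp only: signal_power_complex)
  from MC_filter_lim(1)[OF this] show ?thesis
    by (simp only: v_eq ip_divide chan_comb[OF assms(1)] chan_comb[OF assms(2)] real_sqrt_mult_self abs_of_nat of_real_of_nat_eq)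
qed

lemma v_norm: "l \<in> cs \<Longrightarrow> ((\<lambda>p. (nrm (fst p) (v l p))\<^sup>2) \<longlongrightarrow> signal_power l) MC_filter"
  using tendsto_Re[OF v_gram[of l l]] by (simp add: ip_self)

lemma h_norm: "l \<in> cs \<Longrightarrow> ((\<lambda>p. (nrm (fst p) (h l p))\<^sup>2) \<longlongrightarrow> (path_loss U l)\<^sup>2) MC_filter"
  using tendsto_Re[OF h_gram[of l l]] by (simp add: ip_self del: of_real_power)

text \<open>In the limit the hypothesis on the residual channel bounds the power of the whole
  interference channel by r^2 times the desired power; strictness comes from r < 1 and the
  positivity of the desired power.\<close>

lemma signal_power_less:
  assumes l: "l \<in> cs" "l \<noteq> tgt"
  shows "signal_power l < signal_power tgt"
proof -
  obtain \<rho> where \<rho>: "\<rho> < 1" "\<forall>\<^sub>F M in sequentially.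
      vnorm (Xi U M *\<^sub>v residual_channel U l M \<omega>) \<le> \<rho> * vnorm (Xi U M *\<^sub>v channel U tgt M \<omega>)"
    using dominance[OF l] by blast
  \<comment> \<open>\<rho> is not assumed nonnegative, and squaring the inequality needs a
    nonnegative factor.\<close>
  define r where "r = max \<rho> 0"
  have r: "0 \<le> r" "r < 1" "\<rho> \<le> r" using \<rho>(1) by (auto simp: r_def)
  have res: "vnorm (Xi U M *\<^sub>v residual_channel U l M \<omega>) = nrm M (app M (Xi U M) (comb (res_coef l)))" for M
    by (rule vnorm_mult_app) (simp_all add: residual_comb[OF l(1)] dim_residual)
  have des: "vnorm (Xi U M *\<^sub>v channel U tgt M \<omega>) = nrm M (app M (Xi U M) (comb (coef tgt)))" for M
    by (rule vnorm_mult_app) (simp_all add: channel_chan chan_comb[OF params(1)])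
  have eq: "(\<Sum>s\<in>cs \<times> ps. complex_of_real ((gain (X s))\<^sup>2) * (res_coef l s * cnj (res_coef l s))) = complex_of_real (signal_power l)"
  proof -
    have "(\<Sum>s\<in>cs \<times> ps. complex_of_real ((gain (X s))\<^sup>2) * (res_coef l s * cnj (res_coef l s)))
      = (\<Sum>s\<in>cs \<times> ps. complex_of_real ((gain (X s))\<^sup>2) * (coef l s * cnj (coef l s)))"
      by (intro sum.cong refl) (simp only: power2_eq_square of_real_mult mult.assoc gain_res)
    then show ?thesis
      using coef_gram[OF l(1), of "\<lambda>s. complex_of_real ((gain (X s))\<^sup>2)" l] by (simp only: signal_power_complex simp_thms if_True)
  qed
  have lim1: "(\<lambda>M. (nrm M (app M (Xi U M) (comb (res_coef l))))\<^sup>2 / real M) \<longlonglongrightarrow> signal_power l"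
    using tendsto_Re[OF gram_Xi[of "res_coef l" "res_coef l", unfolded eq]]
    by (simp only: Re_ip_self_divide Re_complex_of_real)
  have eq2: "(\<Sum>s\<in>cs \<times> ps. complex_of_real ((gain (X s))\<^sup>2) * (coef tgt s * cnj (coef tgt s))) = complex_of_real (signal_power tgt)"
    using coef_gram[OF params(1), of "\<lambda>s. complex_of_real ((gain (X s))\<^sup>2)" tgt] by (simp only: signal_power_complex simp_thms if_True)
  have lim2: "(\<lambda>M. (nrm M (app M (Xi U M) (comb (coef tgt))))\<^sup>2 / real M) \<longlonglongrightarrow> signal_power tgt"
    using tendsto_Re[OF gram_Xi[of "coef tgt" "coef tgt", unfolded eq2]]
    by (simp only: Re_ip_self_divide Re_complex_of_real)
  have "signal_power l \<le> r\<^sup>2 * signal_power tgt"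
  proof (rule tendsto_le[OF _ tendsto_mult_left[OF lim2] lim1])
    show "\<forall>\<^sub>F M in sequentially. (nrm M (app M (Xi U M) (comb (res_coef l))))\<^sup>2 / real M
        \<le> r\<^sup>2 * ((nrm M (app M (Xi U M) (comb (coef tgt))))\<^sup>2 / real M)"
      using \<rho>(2)
    proof eventually_elim
      case (elim M)
      have "nrm M (app M (Xi U M) (comb (res_coef l))) \<le> \<rho> * nrm M (app M (Xi U M) (comb (coef tgt)))"
        using elim by (simp only: res des)
      also have "\<dots> \<le> r * nrm M (app M (Xi U M) (comb (coef tgt)))"
        using r by (intro mult_right_mono) auto
      finally have "(nrm M (app M (Xi U M) (comb (res_coef l))))\<^sup>2 \<le> (r * nrm M (app M (Xi U M) (comb (coef tgt))))\<^sup>2"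
        by (intro power_mono) auto
      then show ?case
        by (simp add: power_mult_distrib divide_right_mono)
    qed
  qed simp
  also have "\<dots> < signal_power tgt"
    using signal_power_pos r by (simp add: power_less_one_iff abs_square_less_1)
  finally show ?thesis .
qed

section \<open>The sample covariance of the data and its eigenvectors\<close>

definition W :: "nat \<Rightarrow> nat \<Rightarrow> complex" where
  "W m c = (\<Sum>l\<in>cs. chan l \<omega> m * symb U l c \<omega>) + data_noise U m c \<omega>"

text \<open>The action of the unfiltered sample covariance divided by the number of antennas; the
  filtered sample covariance is then M times Xi T Xi*.\<close>

definition T :: "nat \<times> nat \<Rightarrow> (nat \<Rightarrow> complex) \<Rightarrow> nat \<Rightarrow> complex" where
  "T p x i = (\<Sum>c<snd p. W i c * (\<Sum>m<fst p. cnj (W m c) * x m)) / of_nat (snd p * fst p)"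

lemma T_approx: "\<exists>\<epsilon>. (\<epsilon> \<longlongrightarrow> 0) MC_filter \<and> (\<forall>\<^sub>F p in MC_filter. \<forall>x.
    nrm (fst p) (\<lambda>i. T p x i - (\<Sum>l\<in>cs. ip (fst p) x (h l p) * h l p i)) \<le> \<epsilon> p * nrm (fst p) x)"
proof -
  obtain N where N: "((\<lambda>p. N (fst p) (snd p)) \<longlongrightarrow> 0) MC_filter"
    "\<And>M C. 1 \<le> M \<Longrightarrow> 1 \<le> C \<Longrightarrow> 0 \<le> N M C \<and> op_bound (\<lambda>m c. data_noise U m c \<omega>) M C (N M C * (real M * real C))"
    using data_noise_bound by blast
  define B where "B = (\<Sum>l\<in>cs. \<Sum>s\<in>cs \<times> ps. cmod (coef l s))"
  have B: "0 \<le> B" unfolding B_def by (intro sum_nonneg) simp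
  have chan_B: "nrm M (chan l \<omega>) \<le> B * sqrt (real M)" if "l \<in> cs" for l M
  proof -
    have "(\<Sum>s\<in>cs \<times> ps. cmod (coef l s)) \<le> B"
      unfolding B_def using that by (intro member_le_sum[of l cs "\<lambda>l. \<Sum>s\<in>cs \<times> ps. cmod (coef l s)"] sum_nonneg) auto
    then have "(\<Sum>s\<in>cs \<times> ps. cmod (coef l s)) * sqrt (real M) \<le> B * sqrt (real M)"
      by (rule mult_right_mono) simp
    then show ?thesis
      unfolding chan_comb[OF that] using comb_bound[of M "coef l"] by linarith
  qed
  define q where "q C l k = (\<Sum>c<C. symb U l c \<omega> * cnj (symb U k c \<omega>)) / of_nat C - (if l = k then 1 else 0)" for C l k
  define g where "g C = (\<Sum>l\<in>cs. \<Sum>k\<in>cs. cmod (q C l k))" for C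
  have q0: "(\<lambda>C. q C l k) \<longlonglongrightarrow> 0" if "l \<in> cs" "k \<in> cs" for l k
    unfolding q_def using symbols[OF that] by (rule LIM_zero)
  have "g \<longlonglongrightarrow> (\<Sum>l\<in>cs. \<Sum>k\<in>cs. cmod 0)"
    unfolding g_def by (intro tendsto_sum tendsto_norm q0)
  then have g0: "g \<longlonglongrightarrow> 0" by simp
  have q_le: "cmod (q C l k) \<le> g C" if "l \<in> cs" "k \<in> cs" for C l k
  proof -
    have "cmod (q C l k) \<le> (\<Sum>k\<in>cs. cmod (q C l k))"
      using that by (intro member_le_sum) auto
    also have "\<dots> \<le> g C"
      unfolding g_def using that by (intro member_le_sum[of l cs "\<lambda>l. \<Sum>k\<in>cs. cmod (q C l k)"] sum_nonneg) auto
    finally show ?thesis .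
  qed
  have g1: "\<forall>\<^sub>F C in sequentially. g C < 1"
    using order_tendstoD(2)[OF g0, of 1] by simp
  \<comment> \<open>The average power is within 1 of its limit 1, so it is below 4; this is the
    origin of the factor 2.\<close>
  have sym: "nrm C (\<lambda>c. symb U l c \<omega>) \<le> 2 * sqrt (real C)" if l: "l \<in> cs" and C: "1 \<le> C" and g: "g C < 1" for l C
  proof -
    have "(\<Sum>c<C. symb U l c \<omega> * cnj (symb U l c \<omega>)) / of_nat C = complex_of_real ((nrm C (\<lambda>c. symb U l c \<omega>))\<^sup>2 / real C)"
      using ip_self[of C "\<lambda>c. symb U l c \<omega>"] by (simp add: ip_def)
    then have "q C l l = complex_of_real ((nrm C (\<lambda>c. symb U l c \<omega>))\<^sup>2 / real C - 1)"
      by (simp only: q_def of_real_diff of_real_1 if_True simp_thms)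
    then have "\<bar>(nrm C (\<lambda>c. symb U l c \<omega>))\<^sup>2 / real C - 1\<bar> < 1"
      using q_le[OF l l, of C] g by (simp only: norm_of_real)
    then have "(nrm C (\<lambda>c. symb U l c \<omega>))\<^sup>2 / real C < 4" by linarith
    then have "(nrm C (\<lambda>c. symb U l c \<omega>))\<^sup>2 \<le> (2 * sqrt (real C))\<^sup>2"
      using C by (simp add: field_simps)
    then show ?thesis by (rule power2_le_imp_le) simp
  qed
  define n where "n = real (card cs)"
  \<comment> \<open>The constant of \<open>data_gram_bound\<close> for the symbol bound 2.\<close>
  define \<epsilon> where "\<epsilon> p = (n * B * (n * B * g (snd p) + 2 * sqrt (N (fst p) (snd p)))
      + sqrt (N (fst p) (snd p)) * (n * 2 * B + sqrt (N (fst p) (snd p))))" for p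
  have "(\<epsilon> \<longlongrightarrow> n * B * (n * B * 0 + 2 * sqrt 0) + sqrt 0 * (n * 2 * B + sqrt 0)) MC_filter"
    unfolding \<epsilon>_def by (intro tendsto_intros N(1) MC_filter_lim(2)[OF g0])
  then have "(\<epsilon> \<longlongrightarrow> 0) MC_filter" by simp
  moreover have "\<forall>\<^sub>F p in MC_filter. \<forall>x.
    nrm (fst p) (\<lambda>i. T p x i - (\<Sum>l\<in>cs. ip (fst p) x (h l p) * h l p i)) \<le> \<epsilon> p * nrm (fst p) x"
    using MC_filter_eventually(1)[OF eventually_ge_at_top[of 1]] MC_filter_eventually(2)[OF eventually_ge_at_top[of 1]]
      MC_filter_eventually(2)[OF g1]
  proof eventually_elim
    case (elim p)
    then have Np: "0 \<le> N (fst p) (snd p)" "op_bound (\<lambda>m c. data_noise U m c \<omega>) (fst p) (snd p) (N (fst p) (snd p) * (real (fst p) * real (snd p)))"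
      using N(2) by auto
    then have Np': "0 \<le> sqrt (N (fst p) (snd p))" "sqrt (N (fst p) (snd p)) ^ 2 = N (fst p) (snd p)" by auto
    show ?case
    proof
      fix x
      show "nrm (fst p) (\<lambda>i. T p x i - (\<Sum>l\<in>cs. ip (fst p) x (h l p) * h l p i)) \<le> \<epsilon> p * nrm (fst p) x"
        unfolding T_def W_def h_def \<epsilon>_def n_def
        by (rule data_gram_bound[where h = "\<lambda>l. chan l \<omega>" and x = "\<lambda>l c. symb U l c \<omega>" and z = "\<lambda>m c. data_noise U m c \<omega>"
              and I = cs and B = B and X = 2 and N = "N (fst p) (snd p)" and g = "g (snd p)"])
          (use elim Np B chan_B sym q_le in \<open>auto simp: q_def\<close>)
    qed
  qed
  ultimately show ?thesis by blast
qed

lemma W_filtered: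
  assumes "i < M" "c < C"
  shows "(Xi U M * data_signal U M C \<omega>) $$ (i, c) = app M (Xi U M) (\<lambda>m. W m c) i"
proof -
  have "(Xi U M * data_signal U M C \<omega>) $$ (i, c) = app M (Xi U M) (\<lambda>m. data_signal U M C \<omega> $$ (m, c)) i"
    by (rule mult_entry[OF Xi_carrier(1)]) (use assms in \<open>simp_all add: data_signal_def\<close>)
  also have "\<dots> = app M (Xi U M) (\<lambda>m. W m c) i"
    by (rule fun_cong[OF app_cong]) (use assms in \<open>simp add: data_signal_def W_def channel_chan\<close>)
  finally show ?thesis .
qed

lemma filtered_carrier: "filtered_sample_cov U M C \<omega> \<in> carrier_mat M M"
  unfolding filtered_sample_cov_def Let_def carrier_mat_def by simp

lemma filtered_entry:
  assumes "i < M" "k < M"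
  shows "filtered_sample_cov U M C \<omega> $$ (i, k) = (\<Sum>c<C. app M (Xi U M) (\<lambda>m. W m c) i * cnj (app M (Xi U M) (\<lambda>m. W m c) k)) / of_nat C"
proof -
  let ?V = "Xi U M * data_signal U M C \<omega>"
  have V: "?V \<in> carrier_mat M C" by (rule mult_carrier_mat[OF Xi_carrier(1)]) (simp add: data_signal_def)
  have "(?V * mat_adjoint ?V) $$ (i, k) = app C ?V (\<lambda>c. mat_adjoint ?V $$ (c, k)) i"
    by (rule mult_entry[OF V mat_adjoint_carrier[OF V] assms])
  also have "\<dots> = (\<Sum>c<C. app M (Xi U M) (\<lambda>m. W m c) i * cnj (app M (Xi U M) (\<lambda>m. W m c) k))"
    unfolding app_def[of C]
  proof (rule sum.cong[OF refl])
    fix c assume "c \<in> {..<C}"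
    then have c: "c < C" by simp
    have "mat_adjoint ?V $$ (c, k) = cnj (?V $$ (k, c))"
      using carrier_matD[OF V] c assms by (intro mat_adjoint_index) auto
    then show "?V $$ (i, c) * mat_adjoint ?V $$ (c, k) = app M (Xi U M) (\<lambda>m. W m c) i * cnj (app M (Xi U M) (\<lambda>m. W m c) k)"
      by (simp only: W_filtered[OF assms(1) c] W_filtered[OF assms(2) c])
  qed
  finally have e: "(?V * mat_adjoint ?V) $$ (i, k) = (\<Sum>c<C. app M (Xi U M) (\<lambda>m. W m c) i * cnj (app M (Xi U M) (\<lambda>m. W m c) k))" .
  have "i < dim_row (?V * mat_adjoint ?V)" "k < dim_col (?V * mat_adjoint ?V)" using assms V by auto
  then have "filtered_sample_cov U M C \<omega> $$ (i, k) = 1 / of_nat C * (?V * mat_adjoint ?V) $$ (i, k)"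
    unfolding filtered_sample_cov_def Let_def by (rule index_smult_mat(1))
  then show ?thesis unfolding e by simp
qed

lemma filtered_hermitian: "hermitian (filtered_sample_cov U M C \<omega>)"
  unfolding hermitian_def
proof (rule eq_matI)
  note D = carrier_matD[OF filtered_carrier[of M C]]
  fix i k assume "i < dim_row (filtered_sample_cov U M C \<omega>)" "k < dim_col (filtered_sample_cov U M C \<omega>)"
  then have "i < M" "k < M" by (simp_all add: D)
  then show "mat_adjoint (filtered_sample_cov U M C \<omega>) $$ (i, k) = filtered_sample_cov U M C \<omega> $$ (i, k)"
    by (simp add: D filtered_entry mult.commute)
qed (simp_all add: carrier_matD[OF filtered_carrier])

lemma filtered_app:
  assumes "1 \<le> M" "1 \<le> C" and i: "i < M"
  shows "app M (filtered_sample_cov U M C \<omega>) x i = of_nat M * app M (Xi U M) (T (M, C) (app M (mat_adjoint (Xi U M)) x)) i"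
proof -
  define a where "a c = app M (Xi U M) (\<lambda>m. W m c)" for c
  define b where "b = app M (mat_adjoint (Xi U M)) x"
  have M: "of_nat M \<noteq> (0::complex)" using assms by simp
  have b: "(\<Sum>m<M. cnj (W m c) * b m) = (\<Sum>k<M. cnj (a c k) * x k)" for c
  proof -
    have "ip M b (\<lambda>m. W m c) = ip M x (a c)"
      unfolding b_def a_def using ip_app[OF mat_adjoint_carrier[OF Xi_carrier(1)], of M x "\<lambda>m. W m c"] by simp
    then show ?thesis by (simp add: ip_def mult.commute)
  qed
  have "app M (filtered_sample_cov U M C \<omega>) x i = (\<Sum>k<M. (\<Sum>c<C. a c i * cnj (a c k)) / of_nat C * x k)"
    unfolding app_def[of M "filtered_sample_cov U M C \<omega>"]
    by (intro sum.cong refl) (use i in \<open>simp add: filtered_entry a_def\<close>)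
  also have "\<dots> = (\<Sum>k<M. \<Sum>c<C. a c i * (cnj (a c k) * x k)) / of_nat C"
    by (simp add: sum_divide_distrib sum_distrib_right mult.assoc)
  also have "(\<Sum>k<M. \<Sum>c<C. a c i * (cnj (a c k) * x k)) = (\<Sum>c<C. a c i * (\<Sum>k<M. cnj (a c k) * x k))"
    by (subst sum.swap) (simp add: sum_distrib_left)
  also have "\<dots> = app M (Xi U M) (\<lambda>j. \<Sum>c<C. (\<Sum>m<M. cnj (W m c) * b m) * W j c) i"
    unfolding app_sum app_scale a_def[symmetric] b by (simp add: mult.commute)
  also have "\<dots> / of_nat C = of_nat M * app M (Xi U M) (T (M, C) b) i"
    unfolding T_def[abs_def] fst_conv snd_conv app_divide using M by (simp add: mult.commute)
  finally show ?thesis by (simp only: b_def)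
qed

definition eig :: "nat \<Rightarrow> nat \<Rightarrow> complex" where
  "eig M C = (SOME \<mu>. eigenvector (filtered_sample_cov U M C \<omega>) (u M C) \<mu> \<and>
     (\<forall>\<nu>. eigenvalue (filtered_sample_cov U M C \<omega>) \<nu> \<longrightarrow> Re \<nu> \<le> Re \<mu>))"

lemma principal_eig:
  assumes "1 \<le> M" "1 \<le> C"
  shows "dim_vec (u M C) = M" "nrm M (vec_index (u M C)) = 1"
    "i < M \<Longrightarrow> app M (filtered_sample_cov U M C \<omega>) (vec_index (u M C)) i = eig M C * u M C $ i"
    "eigenvalue (filtered_sample_cov U M C \<omega>) \<nu> \<Longrightarrow> Re \<nu> \<le> Re (eig M C)"
proof -
  let ?A = "filtered_sample_cov U M C \<omega>"
  note D = carrier_matD[OF filtered_carrier[of M C]]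
  have p: "vnorm (u M C) = 1" and ex: "\<exists>\<mu>. eigenvector ?A (u M C) \<mu> \<and> (\<forall>\<nu>. eigenvalue ?A \<nu> \<longrightarrow> Re \<nu> \<le> Re \<mu>)"
    using principal[OF assms] by (auto simp: principal_eigenvector_def)
  have e: "eigenvector ?A (u M C) (eig M C)" "\<And>\<nu>. eigenvalue ?A \<nu> \<Longrightarrow> Re \<nu> \<le> Re (eig M C)"
    using someI_ex[OF ex] unfolding eig_def[symmetric] by blast+
  show dim: "dim_vec (u M C) = M"
    using e(1) by (simp add: eigenvector_def D)
  show "nrm M (vec_index (u M C)) = 1"
    using p vnorm_nrm[OF dim] by simp
  show "eigenvalue ?A \<nu> \<Longrightarrow> Re \<nu> \<le> Re (eig M C)" by (rule e(2))
  have "?A *\<^sub>v u M C = eig M C \<cdot>\<^sub>v u M C" using e(1) by (simp add: eigenvector_def)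
  then have "(?A *\<^sub>v u M C) $ i = eig M C * u M C $ i" if "i < M" using that dim by simp
  moreover have "(?A *\<^sub>v u M C) $ i = app M ?A (vec_index (u M C)) i" if "i < M"
    using mult_mat_vec_app[of i ?A "u M C"] that by (simp add: D dim del: index_mult_mat_vec)
  ultimately show "i < M \<Longrightarrow> app M ?A (vec_index (u M C)) i = eig M C * u M C $ i" by simp
qed

text \<open>The training noise after correlation with the pilot, in the scaling of
  \<open>h\<close>.\<close>

definition w :: "nat \<times> nat \<Rightarrow> nat \<Rightarrow> complex" where
  "w p i = (\<Sum>t<pilot_len U. cnj (pilot U $ t) * pilot_noise U i t \<omega>) / complex_of_real (real (pilot_len U) * sqrt (real (fst p)))"

lemma w_bound: "\<exists>B. 0 \<le> B \<and> (\<forall>\<^sub>F p in MC_filter. nrm (fst p) (w p) \<le> B)"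
proof -
  define f where "f M = (\<Sum>t<pilot_len U. cmod (pilot U $ t) * (sqrt ((\<Sum>i<M. (cmod (pilot_noise U i t \<omega>))\<^sup>2) / real M))) / real (pilot_len U)" for M
  define L where "L = (\<Sum>t<pilot_len U. cmod (pilot U $ t) * sqrt \<sigma>2) / real (pilot_len U)"
  have "f \<longlonglongrightarrow> L"
    unfolding f_def L_def using params(7) by (intro tendsto_intros pilot_noise_norm) auto
  then have "\<forall>\<^sub>F M in sequentially. f M < L + 1"
    by (rule order_tendstoD) simp
  from MC_filter_eventually(1)[OF this] have "\<forall>\<^sub>F p in MC_filter. nrm (fst p) (w p) \<le> L + 1"
  proof eventually_elim
    case (elim p)
    let ?M = "fst p"
    have "nrm ?M (w p) = nrm ?M (\<lambda>i. \<Sum>t<pilot_len U. cnj (pilot U $ t) * pilot_noise U i t \<omega>) / (real (pilot_len U) * sqrt (real ?M))"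
      unfolding w_def[abs_def] nrm_divide norm_of_real by simp
    also have "\<dots> \<le> (\<Sum>t<pilot_len U. cmod (pilot U $ t) * nrm ?M (\<lambda>i. pilot_noise U i t \<omega>)) / (real (pilot_len U) * sqrt (real ?M))"
    proof (rule divide_right_mono)
      show "nrm ?M (\<lambda>i. \<Sum>t<pilot_len U. cnj (pilot U $ t) * pilot_noise U i t \<omega>) \<le> (\<Sum>t<pilot_len U. cmod (pilot U $ t) * nrm ?M (\<lambda>i. pilot_noise U i t \<omega>))"
        using nrm_sum[of "{..<pilot_len U}" ?M "\<lambda>t i. cnj (pilot U $ t) * pilot_noise U i t \<omega>"] by (simp add: nrm_scale)
    qed simp
    also have "\<dots> = f ?M"
    proof -
      have "sqrt ((\<Sum>i<?M. (cmod (pilot_noise U i t \<omega>))\<^sup>2) / real ?M) = nrm ?M (\<lambda>i. pilot_noise U i t \<omega>) / sqrt (real ?M)" for t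
        unfolding nrm_sq_sum[symmetric] by (simp add: real_sqrt_divide)
      then show ?thesis
        by (simp add: f_def sum_divide_distrib mult.commute)
    qed
    finally show ?case using elim by simp
  qed
  moreover have "0 \<le> L + 1"
  proof -
    have "0 \<le> L" unfolding L_def using params(5) by (intro divide_nonneg_nonneg sum_nonneg mult_nonneg_nonneg) auto
    then show ?thesis by simp
  qed
  ultimately show ?thesis by blast
qed

text \<open>Expanding the pilot correlation and the channel leaves finitely many averages of noise
  against a steering vector, each tending to zero.\<close>

lemma w_orth: "((\<lambda>p. ip (fst p) (w p) (h tgt p)) \<longlongrightarrow> 0) MC_filter"
proof -
  define n where "n t p M = (\<Sum>i<M. pilot_noise U i t \<omega> * cnj (wave i (path_freq tgt p \<omega>))) / of_nat M" for t p M
  define f where "f M = (\<Sum>t<pilot_len U. cnj (pilot U $ t) * (\<Sum>p\<in>ps. cnj (coef tgt (tgt, p)) * n t p M)) / of_nat (pilot_len U)" for M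
  have "f \<longlonglongrightarrow> (\<Sum>t<pilot_len U. cnj (pilot U $ t) * (\<Sum>p\<in>ps. cnj (coef tgt (tgt, p)) * 0)) / of_nat (pilot_len U)"
    unfolding f_def n_def using params(7) by (intro tendsto_intros pilot_noise_wave) auto
  then have "f \<longlonglongrightarrow> 0" by simp
  from MC_filter_lim(1)[OF this] have "((\<lambda>p. f (fst p)) \<longlongrightarrow> 0) MC_filter" .
  moreover have "ip (fst p) (w p) (h tgt p) = f (fst p)" for p
  proof -
    let ?M = "fst p" and ?N = "\<lambda>t i. pilot_noise U i t \<omega>"
    have c: "chan tgt \<omega> = (\<lambda>i. \<Sum>q\<in>ps. coef tgt (tgt, q) * wave i (path_freq tgt q \<omega>))"
      by (simp add: chan_def[abs_def] coef_def)
    have n: "ip ?M (?N t) (\<lambda>i. wave i (path_freq tgt q \<omega>)) = of_nat ?M * n t q ?M" for t q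
      by (cases "?M = 0") (simp_all add: n_def ip_def)
    have "ip ?M (w p) (h tgt p) = ip ?M (\<lambda>i. \<Sum>t<pilot_len U. cnj (pilot U $ t) * ?N t i) (chan tgt \<omega>)
        / complex_of_real ((real (pilot_len U) * sqrt (real ?M)) * sqrt (real ?M))"
      unfolding w_def[abs_def] h_def by (rule ip_divide)
    also have "ip ?M (\<lambda>i. \<Sum>t<pilot_len U. cnj (pilot U $ t) * ?N t i) (chan tgt \<omega>)
      = (\<Sum>t<pilot_len U. cnj (pilot U $ t) * (\<Sum>q\<in>ps. cnj (coef tgt (tgt, q)) * (of_nat ?M * n t q ?M)))"
      unfolding c by (simp only: ip_sum_left ip_scale_left ip_sum_right ip_scale_right n)
    also have "\<dots> = of_nat ?M * (\<Sum>t<pilot_len U. cnj (pilot U $ t) * (\<Sum>q\<in>ps. cnj (coef tgt (tgt, q)) * n t q ?M))"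
      by (simp add: sum_distrib_left mult_ac)
    also have "complex_of_real ((real (pilot_len U) * sqrt (real ?M)) * sqrt (real ?M)) = of_nat (pilot_len U) * of_nat ?M"
      by (simp only: mult.assoc real_sqrt_mult_self abs_of_nat of_real_mult of_real_of_nat_eq)
    also have "of_nat ?M * (\<Sum>t<pilot_len U. cnj (pilot U $ t) * (\<Sum>q\<in>ps. cnj (coef tgt (tgt, q)) * n t q ?M)) / (of_nat (pilot_len U) * of_nat ?M) = f ?M"
      by (cases "?M = 0") (simp_all add: f_def n_def)
    finally show ?thesis .
  qed
  ultimately show ?thesis by simp
qed

text \<open>The estimate depends on the eigenvector only through the line spanned by
  \<open>t\<close>: normalisation together with the two occurrences of the direction, one of them
  conjugated, removes \<kappa>. If \<open>t\<close> has norm zero, both sides vanish by the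
  convention on division. The pilot energy cancels the factor 1 /
  \<open>pilot_len U\<close>.\<close>

lemma CA_entry:
  fixes t :: "nat \<Rightarrow> complex"
  defines "y \<equiv> \<lambda>p i. (\<Sum>l\<in>cs. h l p i) + w p i"
  assumes M: "1 \<le> M" "1 \<le> C" and i: "i < M" and \<kappa>: "\<kappa> \<noteq> 0"
    and t: "\<And>i. i < M \<Longrightarrow> app M (Xi' U M) (vec_index (u M C)) i = \<kappa> * t i"
  shows "CA_estimate U M \<omega> (u M C) $ i
    = complex_of_real (sqrt (real M)) * (ip M (y (M, C)) t / complex_of_real ((nrm M t)\<^sup>2) * t i)"
proof -
  let ?\<tau> = "pilot_len U" and ?s = "vec_index (pilot U)" and ?r = "complex_of_real (sqrt (real M))"
  define a where "a = Xi' U M *\<^sub>v u M C"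
  define z where "z = training_signal U M \<omega> *\<^sub>v conjugate (pilot U)"
  define b where "b = complex_of_real (1 / vnorm a) \<cdot>\<^sub>v a"
  have dim_a: "dim_vec a = M" using carrier_matD[OF Xi'_carrier] by (simp add: a_def)
  have dim_z: "dim_vec z = M" by (simp add: z_def training_signal_def)
  have dim_b: "dim_vec b = M" by (simp add: b_def dim_a)
  have r: "?r \<noteq> 0" using M by simp
  have a: "a $ k = \<kappa> * t k" if "k < M" for k
    using mult_mat_vec_app[of k "Xi' U M" "u M C"] that t[OF that] principal_eig(1)[OF M] carrier_matD[OF Xi'_carrier[of M]]
    by (simp add: a_def del: index_mult_mat_vec)
  have "vnorm a = nrm M (\<lambda>i. \<kappa> * t i)"
    unfolding vnorm_nrm[OF dim_a] by (rule nrm_cong) (rule a)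
  then have na: "vnorm a = cmod \<kappa> * nrm M t" by (simp only: nrm_scale)
  define q where "q = complex_of_real (1 / vnorm a) * \<kappa>"
  have b: "b $ k = q * t k" if "k < M" for k
    using that a[OF that] dim_a by (simp add: b_def q_def)
  have ss: "(\<Sum>k<?\<tau>. ?s k * cnj (?s k)) = of_nat ?\<tau>"
    using params(9) scalar_prod_ip[of "pilot U" ?\<tau> "pilot U"] carrier_vecD[OF params(8)] by (simp add: ip_def)
  have z: "z $ k = (of_nat ?\<tau> * ?r) * y (M, C) k" if k: "k < M" for k
  proof -
    have "z $ k = (\<Sum>m<?\<tau>. training_signal U M \<omega> $$ (k, m) * cnj (?s m))"
      using k carrier_vecD[OF params(8)]
      by (simp add: z_def training_signal_def scalar_prod_def atLeast0LessThan)
    also have "\<dots> = (\<Sum>m<?\<tau>. (\<Sum>l\<in>cs. chan l \<omega> k) * (?s m * cnj (?s m)) + cnj (?s m) * pilot_noise U k m \<omega>)"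
    proof (rule sum.cong[OF refl])
      fix m assume "m \<in> {..<?\<tau>}"
      then have "training_signal U M \<omega> $$ (k, m) = (\<Sum>l\<in>cs. chan l \<omega> k) * ?s m + pilot_noise U k m \<omega>"
        using k by (simp add: training_signal_def channel_chan sum_distrib_right)
      then show "training_signal U M \<omega> $$ (k, m) * cnj (?s m) = (\<Sum>l\<in>cs. chan l \<omega> k) * (?s m * cnj (?s m)) + cnj (?s m) * pilot_noise U k m \<omega>"
        by (simp only: distrib_left distrib_right mult_ac)
    qed
    also have "\<dots> = (\<Sum>l\<in>cs. chan l \<omega> k) * of_nat ?\<tau> + (\<Sum>m<?\<tau>. cnj (?s m) * pilot_noise U k m \<omega>)"
      unfolding sum.distrib sum_distrib_left[symmetric] ss ..
    also have "(\<Sum>l\<in>cs. chan l \<omega> k) = ?r * (\<Sum>l\<in>cs. h l (M, C) k)"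
      unfolding sum_distrib_left using r by (intro sum.cong refl) (simp add: h_def)
    also have "(\<Sum>m<?\<tau>. cnj (?s m) * pilot_noise U k m \<omega>) = of_nat ?\<tau> * ?r * w (M, C) k"
      using r params(7) by (simp add: w_def)
    finally show ?thesis by (simp add: y_def algebra_simps)
  qed
  have "z \<bullet>c b = ip M (vec_index z) (vec_index b)" by (rule scalar_prod_ip[OF dim_z dim_b])
  also have "\<dots> = ip M (\<lambda>k. (of_nat ?\<tau> * ?r) * y (M, C) k) (\<lambda>k. q * t k)"
    by (rule ip_cong) (simp_all only: z b)
  also have "\<dots> = of_nat ?\<tau> * ?r * (cnj q * ip M (y (M, C)) t)"
    by (simp only: ip_scale_left ip_scale_right)
  finally have zb: "z \<bullet>c b = of_nat ?\<tau> * ?r * (cnj q * ip M (y (M, C)) t)" .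
  have "CA_estimate U M \<omega> (u M C) = (1 / of_nat ?\<tau>) \<cdot>\<^sub>v ((z \<bullet>c b) \<cdot>\<^sub>v b)"
    by (simp only: CA_estimate_def Let_def a_def z_def b_def)
  then have "CA_estimate U M \<omega> (u M C) $ i = (1 / of_nat ?\<tau>) * ((z \<bullet>c b) * b $ i)"
    using i dim_b by simp
  also have "\<dots> = ?r * (ip M (y (M, C)) t * (q * cnj q) * t i)"
    using params(7) by (simp add: zb b[OF i])
  also have "q * cnj q = 1 / complex_of_real ((nrm M t)\<^sup>2)"
  proof -
    have "cmod q = 1 / nrm M t"
      using \<kappa> by (simp add: q_def na norm_mult norm_divide)
    then have "(cmod q)\<^sup>2 = 1 / (nrm M t)\<^sup>2" by (simp add: power_divide)
    then have "complex_of_real ((cmod q)\<^sup>2) = complex_of_real (1 / (nrm M t)\<^sup>2)" by (simp only:)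
    then show ?thesis by (simp only: complex_norm_square of_real_divide of_real_1)
  qed
  finally show ?thesis by simp
qed

text \<open>Channels are rescaled by 1 / sqrt M and the eigenvalue by 1 / M. From A s = \<mu> u and
  Xi' Xi = Q it follows that \<open>Xi'\<close> maps \<open>u\<close> to t / \<mu>, so the estimate
  is the projection treated in \<open>dominant_direction\<close>, and the scaling cancels in the
  relative error.\<close>

theorem CA_error_tendsto:
  "((\<lambda>(M, C). (vnorm (CA_estimate U M \<omega> (u M C) - channel U tgt M \<omega>))\<^sup>2 / (vnorm (channel U tgt M \<omega>))\<^sup>2) \<longlongrightarrow> 0) MC_filter"
proof -
  obtain \<epsilon> where \<epsilon>: "(\<epsilon> \<longlongrightarrow> 0) MC_filter" and T: "\<forall>\<^sub>F p in MC_filter. \<forall>x.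
      nrm (fst p) (\<lambda>i. T p x i - (\<Sum>l\<in>cs. ip (fst p) x (h l p) * h l p i)) \<le> \<epsilon> p * nrm (fst p) x"
    using T_approx by blast
  obtain Bw where Bw: "0 \<le> Bw" "\<forall>\<^sub>F p in MC_filter. nrm (fst p) (w p) \<le> Bw"
    using w_bound by blast
  define K where "K = (\<bar>\<zeta>\<bar> + 1) / \<sigma>2"
  \<comment> \<open>A common bound for the noise and all channels: the norm of each scaled channel
    tends to its path loss, and the added 1 leaves room for the convergence.\<close>
  define B where "B = Bw + (\<Sum>l\<in>cs. path_loss U l + 1)"
  define \<mu> where "\<mu> p = eig (fst p) (snd p) / of_nat (fst p)" for p
  define A where "A p = Xi U (fst p)" for p :: "nat \<times> nat"
  define Q where "Q p = range_proj (fst p)" for p :: "nat \<times> nat"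
  define u' where "u' p = vec_index (u (fst p) (snd p))" for p
  have loss: "0 \<le> path_loss U l" if "l \<in> cs" for l using params(6)[OF that] by simp
  have loss_sum: "path_loss U l + 1 \<le> (\<Sum>l\<in>cs. path_loss U l + 1)" if "l \<in> cs" for l
    using that loss by (intro member_le_sum[of l cs "\<lambda>l. path_loss U l + 1"]) auto
  have loss_sum0: "0 \<le> (\<Sum>l\<in>cs. path_loss U l + 1)" using loss by (intro sum_nonneg) simp
  have large: "\<forall>\<^sub>F p in MC_filter. 1 \<le> fst p" "\<forall>\<^sub>F p in MC_filter. 1 \<le> snd p"
    by (rule MC_filter_eventually; rule eventually_ge_at_top)+
  have v_def': "v = (\<lambda>l p. app (fst p) (A p) (h l p))" by (simp only: v_def A_def)
  have K0: "0 < K" unfolding K_def using params(5) by (intro divide_pos_pos) auto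
  have A_bound: "nrm (fst p) (app (fst p) (A p) x) \<le> K * nrm (fst p) x" for p x
    unfolding K_def A_def by (rule Xi_bound)
  have A_carrier: "A p \<in> carrier_mat (fst p) (fst p)" for p by (simp add: A_def)
  have Q_bound: "nrm (fst p) (app (fst p) (Q p) x) \<le> nrm (fst p) x" for p x
    unfolding Q_def by (rule range_proj_bound)
  have Q_h: "app (fst p) (Q p) (h tgt p) i = h tgt p i" if "i < fst p" for p i
    unfolding Q_def h_def app_divide using in_range[OF that] by simp
  have eig: "\<forall>\<^sub>F p in MC_filter. \<forall>i<fst p. app (fst p) (A p) (T p (app (fst p) (mat_adjoint (A p)) (u' p))) i = \<mu> p * u' p i"
    using large
  proof eventually_elim
    case (elim p)
    then show ?case
      using filtered_app[OF elim, where x = "u' p"] principal_eig(3)[OF elim] by (auto simp: A_def u'_def \<mu>_def field_simps)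
  qed
  have unit: "\<forall>\<^sub>F p in MC_filter. nrm (fst p) (u' p) = 1"
    using large by eventually_elim (simp only: u'_def principal_eig(2))
  have ray: "\<forall>\<^sub>F p in MC_filter. \<forall>x. Re (ip (fst p) (app (fst p) (A p) (T p (app (fst p) (mat_adjoint (A p)) x))) x) \<le> Re (\<mu> p) * (nrm (fst p) x)\<^sup>2"
    using large
  proof eventually_elim
    case (elim p)
    show ?case
    proof
      fix x
      let ?M = "fst p" and ?y = "app (fst p) (A p) (T p (app (fst p) (mat_adjoint (A p)) x))"
      have "ip ?M (app ?M (filtered_sample_cov U ?M (snd p) \<omega>) x) x = ip ?M (\<lambda>i. of_nat ?M * ?y i) x"
        by (rule ip_cong) (use filtered_app[OF elim] in \<open>simp_all add: A_def\<close>)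
      also have "\<dots> = complex_of_real (real ?M) * ip ?M ?y x"
        by (simp add: ip_scale_left)
      finally have "real ?M * Re (ip ?M ?y x) \<le> Re (eig ?M (snd p)) * (nrm ?M x)\<^sup>2"
        using hermitian_rayleigh[where n = ?M and A = "filtered_sample_cov U ?M (snd p) \<omega>" and x = x,
            OF filtered_carrier filtered_hermitian principal_eig(4)[OF elim]] by simp
      then show "Re (ip ?M ?y x) \<le> Re (\<mu> p) * (nrm ?M x)\<^sup>2"
        using elim(1) by (simp add: \<mu>_def field_simps)
    qed
  qed
  have orth: "((\<lambda>p. ip (fst p) (v k p) (v l p)) \<longlongrightarrow> 0) MC_filter" if "k \<in> cs" "l \<in> cs" "k \<noteq> l" for k l
    using v_gram[OF that(1,2)] that(3) by simp
  have \<alpha>: "0 < signal_power tgt / 2" using signal_power_pos by simp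
  have low: "\<forall>\<^sub>F p in MC_filter. signal_power tgt / 2 \<le> (nrm (fst p) (v tgt p))\<^sup>2"
    using order_tendstoD(1)[OF v_norm[OF params(1)], of "signal_power tgt / 2"] signal_power_pos
    by (auto elim: eventually_mono)
  have dom: "\<exists>\<delta>>0. \<forall>\<^sub>F p in MC_filter. (nrm (fst p) (v l p))\<^sup>2 + \<delta> \<le> (nrm (fst p) (v tgt p))\<^sup>2" if "l \<in> cs" "l \<noteq> tgt" for l
  proof (intro exI conjI)
    let ?\<delta> = "(signal_power tgt - signal_power l) / 2"
    show d: "0 < ?\<delta>" using signal_power_less[OF that] by simp
    have "((\<lambda>p. (nrm (fst p) (v tgt p))\<^sup>2 - (nrm (fst p) (v l p))\<^sup>2) \<longlongrightarrow> signal_power tgt - signal_power l) MC_filter"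
      by (intro tendsto_intros v_norm that params(1))
    from order_tendstoD(1)[OF this, of ?\<delta>] d
    have "\<forall>\<^sub>F p in MC_filter. ?\<delta> < (nrm (fst p) (v tgt p))\<^sup>2 - (nrm (fst p) (v l p))\<^sup>2" by simp
    then show "\<forall>\<^sub>F p in MC_filter. (nrm (fst p) (v l p))\<^sup>2 + ?\<delta> \<le> (nrm (fst p) (v tgt p))\<^sup>2"
      by eventually_elim linarith
  qed
  have h_B: "\<forall>\<^sub>F p in MC_filter. \<forall>l\<in>cs. nrm (fst p) (h l p) \<le> B"
  proof (rule eventually_ball_finite)
    show "\<forall>l\<in>cs. \<forall>\<^sub>F p in MC_filter. nrm (fst p) (h l p) \<le> B"
    proof
      fix l assume l: "l \<in> cs"
      have "(path_loss U l)\<^sup>2 < (path_loss U l + 1)\<^sup>2"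
        using loss[OF l] by (intro power_strict_mono) auto
      from order_tendstoD(2)[OF h_norm[OF l] this]
      show "\<forall>\<^sub>F p in MC_filter. nrm (fst p) (h l p) \<le> B"
      proof eventually_elim
        case (elim p)
        then have "nrm (fst p) (h l p) \<le> path_loss U l + 1"
          by (rule power2_le_imp_le[OF less_imp_le]) (use loss[OF l] in simp)
        then show ?case using loss_sum[OF l] Bw(1) unfolding B_def by linarith
      qed
    qed
  qed simp
  have B0: "0 \<le> B" unfolding B_def using Bw(1) loss_sum0 by (rule add_nonneg_nonneg)
  have orth_h: "((\<lambda>p. ip (fst p) (h l p) (h tgt p)) \<longlongrightarrow> 0) MC_filter" if "l \<in> cs" "l \<noteq> tgt" for l
    using h_gram[OF that(1) params(1)] that(2) by simp
  have w_B: "\<forall>\<^sub>F p in MC_filter. nrm (fst p) (w p) \<le> B"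
    using Bw(2) by eventually_elim (use loss_sum0 in \<open>simp add: B_def\<close>)
  have fin: "finite cs" by simp
  interpret D: dominant_direction MC_filter fst cs tgt A Q T h u' w \<mu> \<epsilon> K B "signal_power tgt / 2" v
    by unfold_locales (assumption | rule v_def'[THEN eq_reflection] fin params(1) A_carrier K0 A_bound Q_bound Q_h T \<epsilon> eig unit ray
      orth[unfolded v_def'] \<alpha> low[unfolded v_def'] dom[unfolded v_def'] h_B B0 orth_h w_B w_orth)+
  have "((\<lambda>p. (nrm (fst p) (v tgt p))\<^sup>2 - \<epsilon> p * K\<^sup>2) \<longlongrightarrow> signal_power tgt - 0 * K\<^sup>2) MC_filter"
    by (intro tendsto_intros v_norm params(1) \<epsilon>)
  then have "\<forall>\<^sub>F p in MC_filter. 0 < (nrm (fst p) (v tgt p))\<^sup>2 - \<epsilon> p * K\<^sup>2"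
    by (rule order_tendstoD) (use signal_power_pos in simp)
  \<comment> \<open>The eigenvalue is eventually nonzero, so \<open>u\<close> can be recovered from
    the filtered \<open>s\<close> by division.\<close>
  with D.mu_lower have \<mu>0: "\<forall>\<^sub>F p in MC_filter. \<mu> p \<noteq> 0"
    by eventually_elim auto
  define E where "E p = (\<lambda>i. ip (fst p) (D.y p) (D.t p) / complex_of_real ((nrm (fst p) (D.t p))\<^sup>2) * D.t p i - h tgt p i)" for p
  have "((\<lambda>p. (nrm (fst p) (E p))\<^sup>2 / (nrm (fst p) (h tgt p))\<^sup>2) \<longlongrightarrow> 0\<^sup>2 / (path_loss U tgt)\<^sup>2) MC_filter"
    unfolding E_def by (intro tendsto_intros D.estimate_tendsto h_norm params(1)) (use params(6)[OF params(1)] in simp)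
  then have lim: "((\<lambda>p. (nrm (fst p) (E p))\<^sup>2 / (nrm (fst p) (h tgt p))\<^sup>2) \<longlongrightarrow> 0) MC_filter" by simp
  show ?thesis
  proof (rule Lim_transform_eventually[OF lim])
    show "\<forall>\<^sub>F p in MC_filter. (nrm (fst p) (E p))\<^sup>2 / (nrm (fst p) (h tgt p))\<^sup>2 =
      (case p of (M, C) \<Rightarrow> (vnorm (CA_estimate U M \<omega> (u M C) - channel U tgt M \<omega>))\<^sup>2 / (vnorm (channel U tgt M \<omega>))\<^sup>2)"
      using large \<mu>0 eig
    proof eventually_elim
      case (elim p)
      obtain M C where p: "p = (M, C)" by fastforce
      have M: "1 \<le> M" "1 \<le> C" using elim p by auto
      let ?r = "complex_of_real (sqrt (real M))"
      have r: "?r \<noteq> 0" using M by simp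
      have s: "app M (Xi U M) (D.s p) i = \<mu> p * u M C $ i" if "i < M" for i
        using elim(4) that unfolding D.s_def by (simp add: p A_def u'_def)
      have t: "app M (Xi' U M) (vec_index (u M C)) i = (1 / \<mu> p) * D.t p i" if i: "i < M" for i
      proof -
        have "app M (Xi' U M) (vec_index (u M C)) i = app M (Xi' U M) (\<lambda>i. (1 / \<mu> p) * app M (Xi U M) (D.s p) i) i"
          by (rule fun_cong[OF app_cong]) (use elim(3) in \<open>simp add: s\<close>)
        also have "\<dots> = (1 / \<mu> p) * app M (Xi' U M) (app M (Xi U M) (D.s p)) i"
          by (simp only: app_scale)
        also have "app M (Xi' U M) (app M (Xi U M) (D.s p)) i = app M (range_proj M) (D.s p) i"
          using app_mult[OF Xi'_carrier Xi_carrier(1) i, of "D.s p"] by (simp only: Xi'_Xi)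
        finally show ?thesis unfolding D.t_def by (simp add: p Q_def)
      qed
      have \<kappa>: "1 / \<mu> p \<noteq> 0" using elim(3) by simp
      have ch: "chan tgt \<omega> i = ?r * h tgt p i" for i
        using r by (simp add: h_def p)
      have ca: "CA_estimate U M \<omega> (u M C) $ i = ?r * (ip M (D.y p) (D.t p) / complex_of_real ((nrm M (D.t p))\<^sup>2) * D.t p i)" if "i < M" for i
        using CA_entry[OF M that \<kappa> t] unfolding D.y_def p .
      have e1: "vnorm (CA_estimate U M \<omega> (u M C) - channel U tgt M \<omega>) = sqrt (real M) * nrm M (E p)"
      proof -
        have "vnorm (CA_estimate U M \<omega> (u M C) - channel U tgt M \<omega>) = nrm M (vec_index (CA_estimate U M \<omega> (u M C) - channel U tgt M \<omega>))"
          by (rule vnorm_nrm) simp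
        also have "\<dots> = nrm M (\<lambda>i. ?r * E p i)"
        proof (rule nrm_cong)
          fix i assume i: "i < M"
          then have "(CA_estimate U M \<omega> (u M C) - channel U tgt M \<omega>) $ i = CA_estimate U M \<omega> (u M C) $ i - chan tgt \<omega> i"
            by (simp add: channel_chan)
          then show "(CA_estimate U M \<omega> (u M C) - channel U tgt M \<omega>) $ i = ?r * E p i"
            unfolding ca[OF i] ch E_def right_diff_distrib by (simp only: p fst_conv)
        qed
        finally show ?thesis by (simp only: nrm_scale) simp
      qed
      have e2: "vnorm (channel U tgt M \<omega>) = sqrt (real M) * nrm M (h tgt p)"
      proof -
        have "vnorm (channel U tgt M \<omega>) = nrm M (vec_index (channel U tgt M \<omega>))"
          by (rule vnorm_nrm) simp
        also have "\<dots> = nrm M (\<lambda>i. ?r * h tgt p i)"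
          by (rule nrm_cong) (simp only: channel_chan ch)
        finally show ?thesis by (simp only: nrm_scale) simp
      qed
      show ?case
        using M by (simp add: p e1[unfolded p] e2[unfolded p] power_mult_distrib)
    qed
  qed
qed

end

text \<open>The exceptional null set is fixed before the residual channels are examined and before
  eigenvectors are chosen. The hypothesis on the residual channels is thus a condition on the single
  outcome, and the eigenvectors may depend on the outcome in any way, even a non-measurable
  one.\<close>

theorem theorem2:
  fixes U :: "'a uplink" and \<zeta> :: real
  assumes model: "uplink_model U"
    and no_alias: "aliasing_free U"
    and bounded: "\<And>M l. 1 \<le> M \<Longrightarrow> l \<in> {1..cells U} \<Longrightarrow> spectral_norm (channel_cov U l M) < \<zeta>"
  shows "AE \<omega> in pr U.
    (\<forall>l\<in>{1..cells U} - {target U}. \<exists>\<rho><1. \<forall>\<^sub>F M in sequentially.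
       vnorm (Xi U M *\<^sub>v residual_channel U l M \<omega>)
         \<le> \<rho> * vnorm (Xi U M *\<^sub>v channel U (target U) M \<omega>)) \<longrightarrow>
    (\<forall>u. (\<forall>M\<ge>1. \<forall>C\<ge>1. principal_eigenvector (filtered_sample_cov U M C \<omega>) (u M C)) \<longrightarrow>
       ((\<lambda>(M, C).
           (vnorm (CA_estimate U M \<omega> (u M C) - channel U (target U) M \<omega>))\<^sup>2
             / (vnorm (channel U (target U) M \<omega>))\<^sup>2)
         \<longlongrightarrow> 0) (sequentially \<times>\<^sub>F sequentially))"
proof -
  interpret uplink_system U \<zeta>
    by unfold_locales (fact model, fact no_alias, rule bounded)
  have good: "AE \<omega> in pr U. \<forall>l\<in>cs. \<forall>p\<in>ps. path_freq l p \<omega> \<in> {0<..<1} \<and> 0 < spec l (path_freq l p \<omega>) \<and> good (path_freq l p \<omega>)"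
    by (intro AE_finite_allI AE_path_freq AE_good) simp_all
  have off: "AE \<omega> in pr U. \<forall>l\<in>cs. \<forall>p\<in>ps. angle U l p \<omega> \<notin> desired_support U \<longrightarrow> spec tgt (path_freq l p \<omega>) = 0"
    by (intro AE_finite_allI AE_off_support) simp_all
  have distinct: "AE \<omega> in pr U. \<forall>s\<in>cs \<times> ps. \<forall>s'\<in>cs \<times> ps. s \<noteq> s' \<longrightarrow>
      path_freq (fst s) (snd s) \<omega> \<noteq> path_freq (fst s') (snd s') \<omega>"
  proof (intro AE_finite_allI)
    fix s s' assume s: "s \<in> cs \<times> ps" "s' \<in> cs \<times> ps"
    show "AE \<omega> in pr U. s \<noteq> s' \<longrightarrow> path_freq (fst s) (snd s) \<omega> \<noteq> path_freq (fst s') (snd s') \<omega>"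
    proof (cases "s = s'")
      case False
      with s have "AE \<omega> in pr U. path_freq (fst s) (snd s) \<omega> \<noteq> path_freq (fst s') (snd s') \<omega>"
        by (intro AE_path_freq_distinct) auto
      then show ?thesis by eventually_elim simp
    qed simp
  qed simp_all
  have pilot: "AE \<omega> in pr U. \<forall>t\<in>{..<pilot_len U}. ((\<lambda>M. (\<Sum>i<M. (cmod (pilot_noise U i t \<omega>))\<^sup>2) / real M) \<longlonglongrightarrow> noise_var U) \<and>
      (\<forall>p\<in>ps. (\<lambda>M. (\<Sum>i<M. pilot_noise U i t \<omega> * cnj (wave i (path_freq tgt p \<omega>))) / of_nat M) \<longlonglongrightarrow> 0)"
    by (intro AE_finite_allI AE_conjI AE_pilot_noise_norm AE_pilot_noise_wave) simp_all
  from good off distinct AE_range_proj_chan AE_data_noise pilot AE_symbols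
  show ?thesis
  proof eventually_elim
    case (elim \<omega>)
    show ?case
    proof (intro impI allI)
      fix u
      assume dominance: "\<forall>l\<in>cs - {tgt}. \<exists>\<rho><1. \<forall>\<^sub>F M in sequentially.
          vnorm (Xi U M *\<^sub>v residual_channel U l M \<omega>) \<le> \<rho> * vnorm (Xi U M *\<^sub>v channel U tgt M \<omega>)"
        and principal: "\<forall>M\<ge>1. \<forall>C\<ge>1. principal_eigenvector (filtered_sample_cov U M C \<omega>) (u M C)"
      interpret uplink_sample U \<zeta> \<omega> u
      proof unfold_locales
        show "inj_on (\<lambda>(l, p). path_freq l p \<omega>) (cs \<times> ps)"
          using elim(3) unfolding inj_on_def case_prod_beta by blast
        show "good (path_freq l p \<omega>)" if "l \<in> cs" "p \<in> ps" for l p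
          using elim(1) that by blast
        show "0 < spec tgt (path_freq tgt p \<omega>)" if "p \<in> ps" for p
          using elim(1) that params(1) by blast
        show "spec tgt (path_freq l p \<omega>) = 0" if "l \<in> cs" "p \<in> ps" "angle U l p \<omega> \<notin> desired_support U" for l p
          using elim(2) that by blast
        show "app M (range_proj M) (chan tgt \<omega>) i = chan tgt \<omega> i" if "i < M" for M i
          using elim(4) that by blast
        show "(\<lambda>M. (\<Sum>i<M. (cmod (pilot_noise U i t \<omega>))\<^sup>2) / real M) \<longlonglongrightarrow> noise_var U" if "t < pilot_len U" for t
          using bspec[OF elim(6), of t] that by simp
        show "(\<lambda>M. (\<Sum>i<M. pilot_noise U i t \<omega> * cnj (wave i (path_freq tgt p \<omega>))) / of_nat M) \<longlonglongrightarrow> 0"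
          if "t < pilot_len U" "p \<in> ps" for t p
          using bspec[OF elim(6), of t] that by simp
        show "(\<lambda>C. (\<Sum>c<C. symb U l c \<omega> * cnj (symb U k c \<omega>)) / of_nat C) \<longlonglongrightarrow> (if l = k then 1 else 0)"
          if "l \<in> cs" "k \<in> cs" for l k
          using bspec[OF bspec[OF elim(7) that(1)] that(2)] .
        show "\<exists>\<rho><1. \<forall>\<^sub>F M in sequentially.
            vnorm (Xi U M *\<^sub>v residual_channel U l M \<omega>) \<le> \<rho> * vnorm (Xi U M *\<^sub>v channel U tgt M \<omega>)"
          if "l \<in> cs" "l \<noteq> tgt" for l
          using bspec[OF dominance, of l] that by simp
        show "principal_eigenvector (filtered_sample_cov U M C \<omega>) (u M C)" if "1 \<le> M" "1 \<le> C" for M C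
          using principal that by blast
      qed (rule elim(5))
      show "((\<lambda>(M, C). (vnorm (CA_estimate U M \<omega> (u M C) - channel U tgt M \<omega>))\<^sup>2 / (vnorm (channel U tgt M \<omega>))\<^sup>2)
          \<longlongrightarrow> 0) (sequentially \<times>\<^sub>F sequentially)"
        by (rule CA_error_tendsto)
    qed
  qed
qed

end
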